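(* Let $\bullet$ denote any one of the four versions (regular, causal $c$, anticausal $ac$, bicausal $bc$) and let $\varepsilon>0$. Let $p\in[1,\infty)$ and let $c:\mathcal X\times\mathcal Y\to\mathbb R$ be continuous with growth of order at most $p$. Let $\mu^n\in\mathcal P_p(\mathcal X)$ and $\nu^n\in\mathcal P_p(\mathcal Y)$, $n\in\mathbb N$, be sequences converging to $\mu\in\mathcal P_p(\mathcal X)$, respectively $\nu\in\mathcal P_p(\mathcal Y)$, in $W_{p,bc}$, i.e. $W_{p,bc}(\mu^n,\mu)\to0$ and $W_{p,bc}(\nu^n,\nu)\to 0$. Then $$\lim_{n\to\infty}V_\bullet(\mu^n,\nu^n,c)=V_\bullet(\mu,\nu,c),$$ and accumulation points (with respect to weak convergence) of optimizers of $(V_\bullet(\mu^n,\nu^n,c))_{n\in\mathbb N}$ are optimizers of $V_\bullet(\mu,\nu,c)$. Further, $$\lim_{n\to\infty}E^\varepsilon_\bullet(\mu^n,\nu^n,c)=E^\varepsilon_\bullet(\mu,\nu,c),$$ and the associated optimizers (the unique minimizers of $E^\varepsilon_\bullet(\mu^n,\nu^n,c)$) converge in $W_p$ to the unique minimizer of $E^\varepsilon_\bullet(\mu,\nu,c)$.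
   Context: $N\in\mathbb N$ is the number of time steps; $\mathcal X=\mathcal X_1\times\dots\times\mathcal X_N$ and $\mathcal Y=\mathcal Y_1\times\dots\times\mathcal Y_N$ are products of Polish spaces, with metrics $d_{\mathcal X},d_{\mathcal Y}$ inducing their topologies. $\mathcal P(\cdot)$ denotes Borel probability measures, $\mathcal P_p(\mathcal X)$ those with $\int d_{\mathcal X}(\hat x,x)^p\,\mu(dx)<\infty$ for some $\hat x$. $X_t,Y_t$ are coordinate projections, $X_{1:t}=(X_1,\dots,X_t)$, etc. The function $c$ has growth of order at most $p$ if $c/(1+d_{\mathcal X}(\hat x,\cdot)^p+d_{\mathcal Y}(\hat y,\cdot)^p)$ is bounded for some $(\hat x,\hat y)\in\mathcal X\times\mathcal Y$. $\Pi(\mu,\nu)$ is the set of couplings of $\mu$ and $\nu$. A measure $\pi\in\mathcal P(\mathcal X\times\mathcal Y)$ is causal if under $\pi$, for all $t=1,\dots,N-1$, $X_{t+1}$ is conditionally independent of $Y_{1:t}$ given $X_{1:t}$; anticausal if for all such $t$, $Y_{t+1}$ is conditionally independent of $X_{1:t}$ given $Y_{1:t}$; bicausal if both. $\Pi_c(\mu,\nu),\Pi_{ac}(\mu,\nu),\Pi_{bc}(\mu,\nu)$ are the sets of causal, anticausal, bicausal elements of $\Pi(\mu,\nu)$; $\Pi_\bullet(\mu,\nu)$ stands for any of $\Pi,\Pi_c,\Pi_{ac},\Pi_{bc}$. $V_\bullet(\mu,\nu,c)=\inf_{\pi\in\Pi_\bullet(\mu,\nu)}\int c\,d\pi$ and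 $E^\varepsilon_\bullet(\mu,\nu,c)=\inf_{\pi\in\Pi_\bullet(\mu,\nu)}\int c\,d\pi+\varepsilon D_{\rm KL}(\pi,\mu\otimes\nu)$, where $D_{\rm KL}(\pi,\tilde\pi)=\int\log\frac{d\pi}{d\tilde\pi}\,d\pi$ if $\pi\ll\tilde\pi$ and $+\infty$ otherwise. $W_{p,bc}(\mu,\tilde\mu)^p=\inf_{\pi\in\Pi_{bc}(\mu,\tilde\mu)}\int d_{\mathcal X}^p\,d\pi$ for $\mu,\tilde\mu\in\mathcal P_p(\mathcal X)$ (similarly on $\mathcal Y$), and for $\pi,\tilde\pi\in\mathcal P(\mathcal X\times\mathcal Y)$, $W_p(\pi,\tilde\pi)^p=\inf_{\theta\in\Pi(\pi,\tilde\pi)}\int d_{\mathcal X}(x,\tilde x)^p+d_{\mathcal Y}(y,\tilde y)^p\,\theta(dx,dy,d\tilde x,d\tilde y)$. *)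

theory Defs
  imports "HOL-Probability.Probability"
begin

section \<open>Borel probability measures on abstract topological spaces\<close>

text \<open>
  The factors of the path spaces are possibly different Polish spaces. They are therefore modelled
  by abstract topologies on a common type (whose underlying sets may be arbitrary), and not by the
  type class of Polish spaces.
\<close>

definition polish_top :: "'a topology \<Rightarrow> bool" where
  "polish_top T \<longleftrightarrow> separable_space T \<and> completely_metrizable_space T"

definition metric_inducing :: "'a topology \<Rightarrow> ('a \<Rightarrow> 'a \<Rightarrow> real) \<Rightarrow> bool" where
  "metric_inducing T d \<longleftrightarrow>
     Metric_space (topspace T) d \<and> Metric_space.mtopology (topspace T) d = T"

definition borel_of :: "'a topology \<Rightarrow> 'a measure" where
  "borel_of T = sigma (topspace T) {U. openin T U}"

definition probs :: "'a topology \<Rightarrow> 'a measure set" where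
  "probs T = {\<mu>. prob_space \<mu> \<and> sets \<mu> = sets (borel_of T)}"

definition probs_p :: "real \<Rightarrow> 'a topology \<Rightarrow> ('a \<Rightarrow> 'a \<Rightarrow> real) \<Rightarrow> 'a measure set" where
  "probs_p p T d =
     {\<mu> \<in> probs T. \<exists>a\<in>topspace T. (\<integral>\<^sup>+x. ennreal (d a x powr p) \<partial>\<mu>) < \<infinity>}"

definition couplings ::
    "'a topology \<Rightarrow> 'b topology \<Rightarrow> 'a measure \<Rightarrow> 'b measure \<Rightarrow> ('a \<times> 'b) measure set" where
  "couplings S T \<mu> \<nu> = {\<pi> \<in> probs (prod_topology S T).
     distr \<pi> (borel_of S) fst = \<mu> \<and> distr \<pi> (borel_of T) snd = \<nu>}"

definition weakly_converges :: "'a topology \<Rightarrow> (nat \<Rightarrow> 'a measure) \<Rightarrow> 'a measure \<Rightarrow> bool" where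
  "weakly_converges T \<mu>s \<mu> \<longleftrightarrow> (\<forall>n. \<mu>s n \<in> probs T) \<and> \<mu> \<in> probs T \<and>
     (\<forall>f. continuous_map T euclideanreal f \<and> bounded (f ` topspace T) \<longrightarrow>
        (\<lambda>n. \<integral>x. f x \<partial>\<mu>s n) \<longlonglongrightarrow> (\<integral>x. f x \<partial>\<mu>))"

definition weak_accumulation_point ::
    "'a topology \<Rightarrow> (nat \<Rightarrow> 'a measure) \<Rightarrow> 'a measure \<Rightarrow> bool" where
  "weak_accumulation_point T \<mu>s \<mu> \<longleftrightarrow> (\<exists>r. strict_mono r \<and> weakly_converges T (\<mu>s \<circ> r) \<mu>)"

text \<open>
  \<open>kl_div \<pi> m\<close> is the relative entropy of \<open>\<pi>\<close> with respect to \<open>m\<close>; the arguments of the library's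
  \<open>KL_divergence\<close> are in the opposite order. The library function is real-valued and
  returns \<open>0\<close> if the logarithm of the density is not \<open>\<pi>\<close>-integrable. For probability measures the
  negative part of that logarithm is always integrable, so in this case the integral is \<open>\<infinity>\<close>.
\<close>

definition kl_div :: "'a measure \<Rightarrow> 'a measure \<Rightarrow> ereal" where
  "kl_div \<pi> m =
     (if absolutely_continuous m \<pi> \<and> integrable \<pi> (entropy_density (exp 1) m \<pi>)
      then ereal (KL_divergence (exp 1) m \<pi>) else \<infinity>)"


section \<open>Conditional independence and causality\<close>

definition cond_indep ::
    "'w measure \<Rightarrow> 'a measure \<Rightarrow> ('w \<Rightarrow> 'a) \<Rightarrow> 'b measure \<Rightarrow> ('w \<Rightarrow> 'b) \<Rightarrow>
     'c measure \<Rightarrow> ('w \<Rightarrow> 'c) \<Rightarrow> bool" where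
  "cond_indep M A U B V C W \<longleftrightarrow>
     (let F = vimage_algebra (space M) W C in
      \<forall>S\<in>sets A. \<forall>T\<in>sets B. AE w in M.
        real_cond_exp M F (indicator (U -` S \<inter> V -` T)) w =
        real_cond_exp M F (indicator (U -` S)) w * real_cond_exp M F (indicator (V -` T)) w)"

text \<open>
  The path space of \<open>X 1, \<dots>, X t\<close> consists of functions on \<open>{1..t}\<close>, extended by \<open>undefined\<close>
  outside of this set, so \<open>restrict x {1..t}\<close> is the initial segment of a path \<open>x\<close>.
\<close>

definition paths :: "nat \<Rightarrow> (nat \<Rightarrow> 'a topology) \<Rightarrow> (nat \<Rightarrow> 'a) topology" where
  "paths t X = product_topology X {1..t}"

definition causal ::
    "nat \<Rightarrow> (nat \<Rightarrow> 'a topology) \<Rightarrow> (nat \<Rightarrow> 'b topology) \<Rightarrow>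
     ((nat \<Rightarrow> 'a) \<times> (nat \<Rightarrow> 'b)) measure \<Rightarrow> bool" where
  "causal N X Y \<pi> \<longleftrightarrow> (\<forall>t\<in>{1..<N}.
     cond_indep \<pi> (borel_of (X (t + 1))) (\<lambda>(x, y). x (t + 1))
       (borel_of (paths t Y)) (\<lambda>(x, y). restrict y {1..t})
       (borel_of (paths t X)) (\<lambda>(x, y). restrict x {1..t}))"

definition anticausal ::
    "nat \<Rightarrow> (nat \<Rightarrow> 'a topology) \<Rightarrow> (nat \<Rightarrow> 'b topology) \<Rightarrow>
     ((nat \<Rightarrow> 'a) \<times> (nat \<Rightarrow> 'b)) measure \<Rightarrow> bool" where
  "anticausal N X Y \<pi> \<longleftrightarrow> (\<forall>t\<in>{1..<N}.
     cond_indep \<pi> (borel_of (Y (t + 1))) (\<lambda>(x, y). y (t + 1))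
       (borel_of (paths t X)) (\<lambda>(x, y). restrict x {1..t})
       (borel_of (paths t Y)) (\<lambda>(x, y). restrict y {1..t}))"

datatype version = Regular | Causal | Anticausal | Bicausal

fun admissible ::
    "version \<Rightarrow> nat \<Rightarrow> (nat \<Rightarrow> 'a topology) \<Rightarrow> (nat \<Rightarrow> 'b topology) \<Rightarrow>
     ((nat \<Rightarrow> 'a) \<times> (nat \<Rightarrow> 'b)) measure \<Rightarrow> bool" where
  "admissible Regular N X Y \<pi> \<longleftrightarrow> True"
| "admissible Causal N X Y \<pi> \<longleftrightarrow> causal N X Y \<pi>"
| "admissible Anticausal N X Y \<pi> \<longleftrightarrow> anticausal N X Y \<pi>"
| "admissible Bicausal N X Y \<pi> \<longleftrightarrow> causal N X Y \<pi> \<and> anticausal N X Y \<pi>"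

definition Couplings ::
    "version \<Rightarrow> nat \<Rightarrow> (nat \<Rightarrow> 'a topology) \<Rightarrow> (nat \<Rightarrow> 'b topology) \<Rightarrow>
     (nat \<Rightarrow> 'a) measure \<Rightarrow> (nat \<Rightarrow> 'b) measure \<Rightarrow>
     ((nat \<Rightarrow> 'a) \<times> (nat \<Rightarrow> 'b)) measure set" where
  "Couplings v N X Y \<mu> \<nu> =
     {\<pi> \<in> couplings (paths N X) (paths N Y) \<mu> \<nu>. admissible v N X Y \<pi>}"


section \<open>Transport problems\<close>

text \<open>
  A cost of growth of order at most \<open>p\<close> is integrable with respect to every coupling of measures
  with finite \<open>p\<close>-th moments, hence the Bochner integral is the intended one.
\<close>

definition growth_at_most ::
    "real \<Rightarrow> 'a topology \<Rightarrow> ('a \<Rightarrow> 'a \<Rightarrow> real) \<Rightarrow> 'b topology \<Rightarrow> ('b \<Rightarrow> 'b \<Rightarrow> real) \<Rightarrow>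
     ('a \<times> 'b \<Rightarrow> real) \<Rightarrow> bool" where
  "growth_at_most p S dS T dT c \<longleftrightarrow> (\<exists>a\<in>topspace S. \<exists>b\<in>topspace T.
     bounded ((\<lambda>(x, y). c (x, y) / (1 + dS a x powr p + dT b y powr p)) `
       (topspace S \<times> topspace T)))"

definition V_val ::
    "version \<Rightarrow> nat \<Rightarrow> (nat \<Rightarrow> 'a topology) \<Rightarrow> (nat \<Rightarrow> 'b topology) \<Rightarrow>
     (nat \<Rightarrow> 'a) measure \<Rightarrow> (nat \<Rightarrow> 'b) measure \<Rightarrow>
     ((nat \<Rightarrow> 'a) \<times> (nat \<Rightarrow> 'b) \<Rightarrow> real) \<Rightarrow> ereal" where
  "V_val v N X Y \<mu> \<nu> c = (INF \<pi>\<in>Couplings v N X Y \<mu> \<nu>. ereal (\<integral>z. c z \<partial>\<pi>))"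

definition V_optimizer ::
    "version \<Rightarrow> nat \<Rightarrow> (nat \<Rightarrow> 'a topology) \<Rightarrow> (nat \<Rightarrow> 'b topology) \<Rightarrow>
     (nat \<Rightarrow> 'a) measure \<Rightarrow> (nat \<Rightarrow> 'b) measure \<Rightarrow>
     ((nat \<Rightarrow> 'a) \<times> (nat \<Rightarrow> 'b) \<Rightarrow> real) \<Rightarrow>
     ((nat \<Rightarrow> 'a) \<times> (nat \<Rightarrow> 'b)) measure \<Rightarrow> bool" where
  "V_optimizer v N X Y \<mu> \<nu> c \<pi> \<longleftrightarrow>
     \<pi> \<in> Couplings v N X Y \<mu> \<nu> \<and> ereal (\<integral>z. c z \<partial>\<pi>) = V_val v N X Y \<mu> \<nu> c"

definition E_cost ::
    "real \<Rightarrow> 'a measure \<Rightarrow> 'b measure \<Rightarrow> ('a \<times> 'b \<Rightarrow> real) \<Rightarrow> ('a \<times> 'b) measure \<Rightarrow> ereal" where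
  "E_cost \<epsilon> \<mu> \<nu> c \<pi> = ereal (\<integral>z. c z \<partial>\<pi>) + ereal \<epsilon> * kl_div \<pi> (\<mu> \<Otimes>\<^sub>M \<nu>)"

definition E_val ::
    "version \<Rightarrow> real \<Rightarrow> nat \<Rightarrow> (nat \<Rightarrow> 'a topology) \<Rightarrow> (nat \<Rightarrow> 'b topology) \<Rightarrow>
     (nat \<Rightarrow> 'a) measure \<Rightarrow> (nat \<Rightarrow> 'b) measure \<Rightarrow>
     ((nat \<Rightarrow> 'a) \<times> (nat \<Rightarrow> 'b) \<Rightarrow> real) \<Rightarrow> ereal" where
  "E_val v \<epsilon> N X Y \<mu> \<nu> c = (INF \<pi>\<in>Couplings v N X Y \<mu> \<nu>. E_cost \<epsilon> \<mu> \<nu> c \<pi>)"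

definition E_optimizer ::
    "version \<Rightarrow> real \<Rightarrow> nat \<Rightarrow> (nat \<Rightarrow> 'a topology) \<Rightarrow> (nat \<Rightarrow> 'b topology) \<Rightarrow>
     (nat \<Rightarrow> 'a) measure \<Rightarrow> (nat \<Rightarrow> 'b) measure \<Rightarrow>
     ((nat \<Rightarrow> 'a) \<times> (nat \<Rightarrow> 'b) \<Rightarrow> real) \<Rightarrow>
     ((nat \<Rightarrow> 'a) \<times> (nat \<Rightarrow> 'b)) measure \<Rightarrow> bool" where
  "E_optimizer v \<epsilon> N X Y \<mu> \<nu> c \<pi> \<longleftrightarrow>
     \<pi> \<in> Couplings v N X Y \<mu> \<nu> \<and> E_cost \<epsilon> \<mu> \<nu> c \<pi> = E_val v \<epsilon> N X Y \<mu> \<nu> c"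


section \<open>Wasserstein distances\<close>

definition ennreal_root :: "real \<Rightarrow> ennreal \<Rightarrow> ennreal" where
  "ennreal_root p a = (if a = \<infinity> then \<infinity> else ennreal (enn2real a powr (1 / p)))"

definition W_bc ::
    "real \<Rightarrow> nat \<Rightarrow> (nat \<Rightarrow> 'a topology) \<Rightarrow> ((nat \<Rightarrow> 'a) \<Rightarrow> (nat \<Rightarrow> 'a) \<Rightarrow> real) \<Rightarrow>
     (nat \<Rightarrow> 'a) measure \<Rightarrow> (nat \<Rightarrow> 'a) measure \<Rightarrow> ennreal" where
  "W_bc p N X d \<mu> \<mu>' = ennreal_root p
     (INF \<pi>\<in>Couplings Bicausal N X X \<mu> \<mu>'. \<integral>\<^sup>+z. ennreal (d (fst z) (snd z) powr p) \<partial>\<pi>)"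

definition W_prod ::
    "real \<Rightarrow> 'a topology \<Rightarrow> ('a \<Rightarrow> 'a \<Rightarrow> real) \<Rightarrow> 'b topology \<Rightarrow> ('b \<Rightarrow> 'b \<Rightarrow> real) \<Rightarrow>
     ('a \<times> 'b) measure \<Rightarrow> ('a \<times> 'b) measure \<Rightarrow> ennreal" where
  "W_prod p S dS T dT \<pi> \<pi>' = ennreal_root p
     (INF \<theta>\<in>couplings (prod_topology S T) (prod_topology S T) \<pi> \<pi>'.
        \<integral>\<^sup>+((x, y), (x', y')). ennreal (dS x x' powr p + dT y y' powr p) \<partial>\<theta>)"

end

theory Submission
  imports Defs
begin

text \<open>
  Let \<open>\<gamma>\<close> and \<open>\<eta>\<close> be bicausal couplings of \<open>\<mu>, \<mu>'\<close> and of \<open>\<nu>, \<nu>'\<close> with small cost, and let \<open>\<pi>\<close> be an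
  admissible coupling of \<open>\<mu>\<close> and \<open>\<nu>\<close>. Start from \<open>(x, y) \<sim> \<pi>\<close> and sample \<open>x'\<close> and \<open>y'\<close> from the kernels of \<open>\<gamma>\<close>
  and \<open>\<eta>\<close> with independent noise. Then \<open>(x', y')\<close> is again admissible, its relative entropy does not
  exceed that of \<open>\<pi>\<close> by the data processing inequality, and its cost is close to that of \<open>\<pi>\<close> by uniform
  integrability. Gluing in both directions gives the convergence of the values.

  With fixed marginals, admissibility is a family of constraints \<open>\<integral>a(x) b(y) \<pi>(dx, dy) = 0\<close> with bounded
  measurable \<open>a, b\<close>; hence it passes to weak limits, and to mixtures.

  For the entropic problem, a midpoint inequality for \<open>t ln t\<close> shows that near-minimizers have densities
  that are close in \<open>L\<^sup>1(\<mu> \<otimes> \<nu>)\<close>. This gives existence and uniqueness; for the glued optimizers it gives total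
  variation convergence, which is turned into convergence in \<open>W\<^sub>p\<close> by a maximal coupling.
\<close>

section \<open>Polish spaces\<close>

text \<open>Causality is in general lost under weak convergence when the marginals move, because
  conditional laws can jump in the limit. Hence every coupling of \<open>\<mu>s n\<close> and
  \<open>\<nu>s n\<close> is glued to a coupling of the fixed \<open>\<mu>\<close> and
  \<open>\<nu>\<close> before a limit is taken. There the conditional laws in the constraints are
  frozen, and only integrals of products of measurable functions have to converge. Kernels are
  replaced by functions of a point and a uniform variable, so that one map acts on
  \<open>\<pi>\<close> and on \<open>\<mu> \<Otimes>\<^sub>M \<nu>\<close> alike. As the two noises
  are separate, this map sends the product of the old marginals to the product of the new ones,
  which reduces the entropy bound to data processing for a single map. Both halves of bicausality
  are used: a causal \<open>\<pi>\<close> needs anticausality of \<open>\<gamma>\<close> and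
  causality of \<open>\<eta>\<close>, an anticausal one the reverse. Uniformity over couplings
  always comes from the fixed marginals: their tightness and their tails. Entropic minimizers come
  from completeness of L1 rather than from compactness of the set of couplings.\<close>

definition polish :: "'a topology \<Rightarrow> bool" where
  "polish T \<longleftrightarrow> second_countable T \<and> completely_metrizable_space T"

lemma polish_second_countable: "polish T \<Longrightarrow> second_countable T"
  by (simp add: polish_def)

text \<open>Second countability is carried along instead of separability because it is what
  identifies the Borel sets of a product with the product sigma-algebra. The base consists of balls
  of radius \<open>inverse (Suc n)\<close> around a countable dense set.\<close>

lemma polish_top_imp_polish:
  assumes "polish_top T"
  shows "polish T"
proof -
  obtain M d where md: "Metric_space M d" "Metric_space.mcomplete M d"
    and T: "T = Metric_space.mtopology M d"
    using assms unfolding polish_top_def completely_metrizable_space_def by auto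
  interpret Metric_space M d by (fact md(1))
  obtain C where C: "countable C" "C \<subseteq> M" "mtopology closure_of C = M"
    using assms unfolding polish_top_def separable_space_def T by auto
  have "second_countable T"
    unfolding second_countable_def T
  proof (intro exI conjI strip)
    let ?B = "(\<lambda>(x, n). mball x (inverse (Suc n))) ` (C \<times> (UNIV :: nat set))"
    show "countable ?B" using C(1) by auto
    show "openin mtopology V" if "V \<in> ?B" for V using that by auto
    fix U x assume "openin mtopology U \<and> x \<in> U"
    then obtain r where r: "r > 0" "mball x r \<subseteq> U" and xU: "x \<in> U" and xM: "x \<in> M"
      using openin_mtopology by (metis (no_types, lifting) subsetD)
    obtain n where n: "inverse (Suc n) < r / 2"
      using reals_Archimedean[of "r / 2"] r(1) by auto
    have "x \<in> {x \<in> M. \<forall>r>0. \<exists>y\<in>C. y \<in> mball x r}"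
      using C(3) xM unfolding metric_closure_of by simp
    then have "\<exists>y\<in>C. y \<in> mball x (inverse (real (Suc n)))" by force
    then obtain y where y: "y \<in> C" "y \<in> mball x (inverse (Suc n))" by blast
    have "x \<in> mball y (inverse (Suc n))" using y by (auto simp: commute)
    moreover have "mball y (inverse (Suc n)) \<subseteq> U"
    proof
      fix z assume z: "z \<in> mball y (inverse (Suc n))"
      have "d x z \<le> d x y + d y z" using z y xM by (intro triangle) auto
      also have "\<dots> < r" using z y n by auto
      finally show "z \<in> U" using r(2) z xM by auto
    qed
    ultimately show "\<exists>V\<in>?B. x \<in> V \<and> V \<subseteq> U" using y(1) by force
  qed
  then show ?thesis using assms by (simp add: polish_def polish_top_def)
qed

lemma polish_prod_topology:
  assumes "polish S" "polish T"
  shows "polish (prod_topology S T)"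
proof -
  obtain A where A: "countable A" "\<And>V. V \<in> A \<Longrightarrow> openin S V"
    "\<And>U x. openin S U \<and> x \<in> U \<Longrightarrow> (\<exists>V \<in> A. x \<in> V \<and> V \<subseteq> U)"
    using polish_second_countable[OF assms(1)] unfolding second_countable_def by metis
  obtain B where B: "countable B" "\<And>V. V \<in> B \<Longrightarrow> openin T V"
    "\<And>U x. openin T U \<and> x \<in> U \<Longrightarrow> (\<exists>V \<in> B. x \<in> V \<and> V \<subseteq> U)"
    using polish_second_countable[OF assms(2)] unfolding second_countable_def by metis
  have "second_countable (prod_topology S T)"
    unfolding second_countable_def
  proof (intro exI conjI strip)
    let ?B = "(\<lambda>(a, b). a \<times> b) ` (A \<times> B)"
    show "countable ?B" using A(1) B(1) by auto
    show "openin (prod_topology S T) V" if "V \<in> ?B" for V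
      using that A(2) B(2) by (auto simp: openin_prod_Times_iff)
    fix U x assume "openin (prod_topology S T) U \<and> x \<in> U"
    then obtain V W where VW: "openin S V" "openin T W" "fst x \<in> V" "snd x \<in> W" "V \<times> W \<subseteq> U"
      unfolding openin_prod_topology_alt by (metis prod.collapse)
    obtain a b where "a \<in> A" "fst x \<in> a" "a \<subseteq> V" "b \<in> B" "snd x \<in> b" "b \<subseteq> W"
      using A(3) B(3) VW by meson
    then show "\<exists>V\<in>?B. x \<in> V \<and> V \<subseteq> U"
      using VW(5) by (intro bexI[of _ "a \<times> b"]) (auto simp: mem_Times_iff)
  qed
  then show ?thesis
    using assms by (simp add: polish_def completely_metrizable_space_prod_topology)
qed

lemma polish_homeomorphic: "S homeomorphic_space T \<Longrightarrow> polish S \<Longrightarrow> polish T"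
  by (simp add: polish_def homeomorphic_space_second_countability
      homeomorphic_completely_metrizable_space)

section \<open>Borel sigma-algebras of abstract topologies\<close>

lemma space_borel_of [simp]: "space (borel_of T) = topspace T"
  by (simp add: borel_of_def space_measure_of_conv)

lemma sets_borel_of: "sets (borel_of T) = sigma_sets (topspace T) {U. openin T U}"
  unfolding borel_of_def by (rule sets_measure_of) (auto dest: openin_subset)

lemma openin_sets_borel_of: "openin T U \<Longrightarrow> U \<in> sets (borel_of T)"
  by (simp add: sets_borel_of)

lemma closedin_sets_borel_of: "closedin T C \<Longrightarrow> C \<in> sets (borel_of T)"
proof -
  assume C: "closedin T C"
  have "topspace T - (topspace T - C) \<in> sets (borel_of T)"
    by (metis C openin_sets_borel_of openin_closedin_eq closedin_def sets.compl_sets space_borel_of)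
  then show ?thesis using C by (simp add: closedin_subset double_diff)
qed

lemma measurable_borel_of_I:
  assumes "f \<in> space M \<rightarrow> topspace T" "\<And>U. openin T U \<Longrightarrow> f -` U \<inter> space M \<in> sets M"
  shows "f \<in> M \<rightarrow>\<^sub>M borel_of T"
  unfolding borel_of_def using assms
  by (intro measurable_sigma_sets[where A="{U. openin T U}" and \<Omega>="topspace T"])
     (auto dest: openin_subset simp: sets_borel_of[unfolded borel_of_def])

lemma measurable_continuous_map:
  assumes "continuous_map S T f"
  shows "f \<in> borel_of S \<rightarrow>\<^sub>M borel_of T"
proof (rule measurable_borel_of_I)
  show "f \<in> space (borel_of S) \<rightarrow> topspace T"
    using assms by (simp add: continuous_map_def)
  fix U assume U: "openin T U"
  have "f -` U \<inter> space (borel_of S) = {x \<in> topspace S. f x \<in> U}" by auto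
  also have "\<dots> \<in> sets (borel_of S)"
    by (intro openin_sets_borel_of openin_continuous_map_preimage[OF assms U])
  finally show "f -` U \<inter> space (borel_of S) \<in> sets (borel_of S)" .
qed

lemma sets_borel_of_euclidean: "sets (borel_of euclidean) = sets borel"
  by (simp add: borel_of_def borel_def)

lemma borel_measurable_continuous_map:
  "continuous_map S euclideanreal f \<Longrightarrow> f \<in> borel_measurable (borel_of S)"
  using measurable_continuous_map[of S euclideanreal f]
  by (simp add: measurable_cong_sets[OF refl sets_borel_of_euclidean])

text \<open>An open set of the product is a union of rectangles from the two countable bases, hence
  a countable union; this is what makes it measurable for the product sigma-algebra. The other
  inclusion is continuity of the projections.\<close>

lemma sets_borel_of_prod:
  assumes S: "second_countable S" and T: "second_countable T"
  shows "sets (borel_of (prod_topology S T)) = sets (borel_of S \<Otimes>\<^sub>M borel_of T)"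
proof (rule subset_antisym)
  obtain A where A: "countable A" "\<And>V. V \<in> A \<Longrightarrow> openin S V"
    "\<And>U x. openin S U \<and> x \<in> U \<Longrightarrow> (\<exists>V \<in> A. x \<in> V \<and> V \<subseteq> U)"
    using S unfolding second_countable_def by metis
  obtain B where B: "countable B" "\<And>V. V \<in> B \<Longrightarrow> openin T V"
    "\<And>U x. openin T U \<and> x \<in> U \<Longrightarrow> (\<exists>V \<in> B. x \<in> V \<and> V \<subseteq> U)"
    using T unfolding second_countable_def by metis
  have "U \<in> sets (borel_of S \<Otimes>\<^sub>M borel_of T)" if U: "openin (prod_topology S T) U" for U
  proof -
    have "U = (\<Union>(a,b)\<in>{(a,b)\<in>A \<times> B. a \<times> b \<subseteq> U}. a \<times> b)" (is "_ = ?V")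
    proof
      show "U \<subseteq> ?V"
      proof
        fix x assume "x \<in> U"
        then obtain V W where VW: "openin S V" "openin T W" "fst x \<in> V" "snd x \<in> W" "V \<times> W \<subseteq> U"
          using U unfolding openin_prod_topology_alt by (metis prod.collapse)
        obtain a b where "a \<in> A" "fst x \<in> a" "a \<subseteq> V" "b \<in> B" "snd x \<in> b" "b \<subseteq> W"
          using A(3) B(3) VW by meson
        then show "x \<in> ?V"
          using VW(5) by (intro UN_I[of "(a, b)"]) (auto simp: mem_Times_iff)
      qed
    qed auto
    also have "\<dots> \<in> sets (borel_of S \<Otimes>\<^sub>M borel_of T)"
    proof (rule sets.countable_UN')
      show "countable {(a,b)\<in>A \<times> B. a \<times> b \<subseteq> U}"
        by (rule countable_subset[of _ "A \<times> B"]) (use A(1) B(1) in auto)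
      show "(\<lambda>(a, b). a \<times> b) ` {(a,b)\<in>A \<times> B. a \<times> b \<subseteq> U}
          \<subseteq> sets (borel_of S \<Otimes>\<^sub>M borel_of T)"
        using A(2) B(2) by (auto intro!: pair_measureI openin_sets_borel_of)
    qed
    finally show ?thesis .
  qed
  then show "sets (borel_of (prod_topology S T)) \<subseteq> sets (borel_of S \<Otimes>\<^sub>M borel_of T)"
    unfolding sets_borel_of[of "prod_topology S T"]
    using sets.top[of "borel_of S \<Otimes>\<^sub>M borel_of T"]
    by (intro sets.sigma_sets_subset') (auto simp: space_pair_measure)
  show "sets (borel_of S \<Otimes>\<^sub>M borel_of T) \<subseteq> sets (borel_of (prod_topology S T))"
  proof (rule sets_pair_in_sets)
    fix a b assume a: "a \<in> sets (borel_of S)" and b: "b \<in> sets (borel_of T)"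
    have "a \<times> b = (fst -` a \<inter> space (borel_of (prod_topology S T))) \<inter>
        (snd -` b \<inter> space (borel_of (prod_topology S T)))"
      using sets.sets_into_space[OF a] sets.sets_into_space[OF b] by auto
    also have "\<dots> \<in> sets (borel_of (prod_topology S T))"
      by (rule sets.Int[OF measurable_sets[OF measurable_continuous_map[OF continuous_map_fst] a]
            measurable_sets[OF measurable_continuous_map[OF continuous_map_snd] b]])
    finally show "a \<times> b \<in> sets (borel_of (prod_topology S T))" .
  qed
qed

section \<open>Coding of points of a Polish space by real numbers\<close>

definition encode :: "(nat \<Rightarrow> bool) \<Rightarrow> real" where
  "encode b = (\<Sum>k. of_bool (b k) * (1/4) ^ Suc k)"

text \<open>With digits 0 and 1 in base 4 the tail of the series is at most 1/3, so no carry occurs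
  and the integer part of \<open>4 ^ Suc k * r\<close> is the number formed by the first
  \<open>Suc k\<close> digits. As the base is even, its parity is the last of these digits.\<close>

definition decode :: "real \<Rightarrow> nat \<Rightarrow> bool" where
  "decode r k \<longleftrightarrow> odd \<lfloor>4 ^ Suc k * r\<rfloor>"

lemma summable_encode: "summable (\<lambda>k. of_bool (b k) * (1/4 :: real) ^ Suc k)"
  by (rule summable_comparison_test'[where g="\<lambda>k. (1/4 :: real) ^ Suc k" and N=0])
     (auto intro!: summable_geometric simp: summable_Suc_iff)

lemma encode_nonneg: "0 \<le> encode b"
  unfolding encode_def by (intro suminf_nonneg summable_encode) auto

lemma encode_le: "encode b \<le> 1/3"
proof -
  have "encode b \<le> (\<Sum>k. (1/4 :: real) ^ Suc k)"
    unfolding encode_def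
    by (intro suminf_le summable_encode) (auto intro!: summable_geometric simp: summable_Suc_iff)
  moreover have "(\<lambda>k. (1/4 :: real) ^ Suc k) sums (1/4 * (1 / (1 - 1/4)))"
    unfolding power_Suc by (intro sums_mult geometric_sums) simp
  then have "(\<Sum>k. (1/4 :: real) ^ Suc k) = 1/3" by (simp add: sums_iff)
  ultimately show ?thesis by simp
qed

lemma encode_rec: "encode b = (of_bool (b 0) + encode (\<lambda>k. b (Suc k))) / 4"
proof -
  have "encode b = (\<Sum>k. of_bool (b (Suc k)) * (1/4 :: real) ^ Suc (Suc k)) + of_bool (b 0) / 4"
    unfolding encode_def by (subst suminf_split_head[OF summable_encode]) simp
  also have "(\<Sum>k. of_bool (b (Suc k)) * (1/4 :: real) ^ Suc (Suc k))
      = (\<Sum>k. of_bool (b (Suc k)) * (1/4 :: real) ^ Suc k) / 4"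
    by (subst suminf_divide[OF summable_encode[of "\<lambda>k. b (Suc k)"], symmetric]) simp
  finally show ?thesis unfolding encode_def by simp
qed

lemma decode_encode: "decode (encode b) k = b k"
proof (induction k arbitrary: b)
  case 0
  have "4 * encode b = of_bool (b 0) + encode (\<lambda>k. b (Suc k))" by (subst encode_rec) simp
  moreover have "\<lfloor>of_bool (b 0) + encode (\<lambda>k. b (Suc k))\<rfloor> = of_bool (b 0)"
    using encode_nonneg[of "\<lambda>k. b (Suc k)"] encode_le[of "\<lambda>k. b (Suc k)"]
    by (intro floor_unique) auto
  ultimately show ?case by (simp add: decode_def)
next
  case (Suc k)
  have "4 ^ Suc (Suc k) * encode b = of_int (4 ^ Suc k * of_bool (b 0)) + 4 ^ Suc k * encode (\<lambda>k. b (Suc k))"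
    by (subst encode_rec) (simp add: field_simps)
  then have "\<lfloor>4 ^ Suc (Suc k) * encode b\<rfloor> = 4 ^ Suc k * of_bool (b 0) + \<lfloor>4 ^ Suc k * encode (\<lambda>k. b (Suc k))\<rfloor>"
    by (simp only: int_add_floor)
  then have "decode (encode b) (Suc k) = decode (encode (\<lambda>k. b (Suc k))) k"
    unfolding decode_def by (simp only: even_add) simp
  then show ?case using Suc by simp
qed

lemma decode_measurable [measurable]: "Measurable.pred borel (\<lambda>r. decode r k)"
  unfolding decode_def by measurable

text \<open>A Polish space embeds into the reals with Borel range: a point is encoded by the set of basic
  open sets containing it, and completeness makes the admissible codes a Borel condition.\<close>

lemma polish_real_coding:
  fixes T :: "'a topology"
  assumes T: "polish T" and ne: "topspace T \<noteq> {}"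
  obtains j :: "'a \<Rightarrow> real" and g :: "real \<Rightarrow> 'a"
  where "j \<in> borel_measurable (borel_of T)" "g \<in> borel \<rightarrow>\<^sub>M borel_of T"
    "\<And>x. x \<in> topspace T \<Longrightarrow> g (j x) = x" "\<And>x. 0 \<le> j x \<and> j x < 1"
proof -
  obtain M d where md: "Metric_space M d" "Metric_space.mcomplete M d"
    and Tm: "T = Metric_space.mtopology M d"
    using T unfolding polish_def completely_metrizable_space_def by auto
  interpret Metric_space M d by (fact md(1))
  obtain B0 where B0: "countable B0" "\<And>V. V \<in> B0 \<Longrightarrow> openin T V"
    "\<And>U x. openin T U \<Longrightarrow> x \<in> U \<Longrightarrow> (\<exists>V \<in> B0. x \<in> V \<and> V \<subseteq> U)"
    using polish_second_countable[OF T] unfolding second_countable_def by metis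
  \<comment> \<open>Codes refer to nonempty sets only; otherwise a code obeying the rules below
    could contain the empty set and determine no point.\<close>
  define B where "B = B0 - {{}}"
  have B: "countable B" "\<And>V. V \<in> B \<Longrightarrow> openin T V" "\<And>V. V \<in> B \<Longrightarrow> V \<noteq> {}"
    using B0(1,2) by (auto simp: B_def)
  have B4: "\<exists>V \<in> B. x \<in> V \<and> V \<subseteq> W" if "openin T W" "x \<in> W" for W x
    using B0(3)[OF that] by (auto simp: B_def)
  obtain x0 where x0: "x0 \<in> M" using ne by (auto simp: Tm)
  have "B \<noteq> {}" using B4[of "topspace T" x0] x0 by (auto simp: Tm)
  define U where "U = from_nat_into B"
  have UB: "U k \<in> B" for k using from_nat_into[OF \<open>B \<noteq> {}\<close>] by (simp add: U_def)
  have U: "openin T (U k)" "U k \<noteq> {}" "U k \<subseteq> M" for k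
    using B(2,3)[OF UB] openin_subset[of T "U k"] by (auto simp: Tm)
  have base: "\<exists>k. x \<in> U k \<and> U k \<subseteq> V" if "openin T V" "x \<in> V" for V x
  proof -
    from B4[OF that] obtain W where "W \<in> B" "x \<in> W" "W \<subseteq> V" by auto
    moreover obtain k where "from_nat_into B k = W" using from_nat_into_surj[OF B(1) \<open>W \<in> B\<close>] by auto
    ultimately show ?thesis by (auto simp: U_def)
  qed
  define j where "j x = encode (\<lambda>k. x \<in> U k)" for x
  define code where "code r x \<longleftrightarrow> x \<in> M \<and> (\<forall>k. x \<in> U k \<longleftrightarrow> decode r k)" for r x
  have code_j: "code (j x) x" if "x \<in> M" for x
    using that by (simp add: code_def j_def decode_encode)
  have code_unique: "x = y" if "code r x" "code r y" for r x y
  proof (rule ccontr)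
    assume "x \<noteq> y"
    then have "y \<notin> mball x (d x y)" "x \<in> mball x (d x y)"
      using that by (auto simp: code_def)
    then obtain k where "x \<in> U k" "U k \<subseteq> mball x (d x y)"
      using base[of "mball x (d x y)" x] by (auto simp: Tm)
    then show False using that \<open>y \<notin> mball x (d x y)\<close> unfolding code_def by auto
  qed
  \<comment> \<open>A filter base of basic sets: it has arbitrarily small members, is directed
    downwards, shrinks together with closures, and is closed under supersets. All quantifiers over
    indices are countable and the other conditions do not involve \<open>r\<close>, so the predicate
    is Borel.\<close>
  define good where "good r \<longleftrightarrow>
     (\<forall>m::nat. \<exists>k. decode r k \<and> (\<exists>y\<in>M. U k \<subseteq> mball y (inverse (Suc m)))) \<and>
     (\<forall>k l. decode r k \<and> decode r l \<longrightarrow> (\<exists>i. decode r i \<and> U i \<subseteq> U k \<inter> U l)) \<and>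
     (\<forall>k. decode r k \<longrightarrow> (\<exists>l. decode r l \<and> mtopology closure_of U l \<subseteq> U k)) \<and>
     (\<forall>i k. decode r i \<and> U i \<subseteq> U k \<longrightarrow> decode r k)" for r
  have small: "\<exists>k. x \<in> U k \<and> U k \<subseteq> mball x e" if "x \<in> M" "e > 0" for x e
    using base[of "mball x e" x] that by (auto simp: Tm)
  have good_iff: "good r \<longleftrightarrow> (\<exists>x. code r x)" for r
  proof
    assume "\<exists>x. code r x"
    then obtain x where x: "x \<in> M" "\<And>k. decode r k \<longleftrightarrow> x \<in> U k" unfolding code_def by auto
    have 1: "\<exists>l. x \<in> U l \<and> mtopology closure_of U l \<subseteq> U k" if "x \<in> U k" for k
    proof -
      from U(1)[of k] that obtain e where e: "e > 0" "mball x e \<subseteq> U k"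
        unfolding Tm openin_mtopology by blast
      obtain l where l: "x \<in> U l" "U l \<subseteq> mball x (e/2)" using small[OF x(1), of "e/2"] e by auto
      have "mtopology closure_of U l \<subseteq> mcball x (e/2)"
        by (intro closure_of_minimal) (use l mball_subset_mcball in auto)
      also have "\<dots> \<subseteq> mball x e" using e by auto
      finally show ?thesis using l e by auto
    qed
    have 2: "\<exists>i. x \<in> U i \<and> U i \<subseteq> U k \<inter> U l" if "x \<in> U k" "x \<in> U l" for k l
      using base[of "U k \<inter> U l" x] U(1) that by auto
    show "good r" unfolding good_def x(2)
    proof (intro conjI allI impI)
      show "\<exists>k. x \<in> U k \<and> (\<exists>y\<in>M. U k \<subseteq> mball y (inverse (Suc m)))" for m :: nat
        using small[OF x(1), of "inverse (Suc m)"] x(1) by auto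
    qed (use 1 2 in auto)
  next
    assume g: "good r"
    note g1 = g[unfolded good_def, THEN conjunct1, rule_format]
    note g2 = g[unfolded good_def, THEN conjunct2, THEN conjunct1, rule_format]
    note g3 = g[unfolded good_def, THEN conjunct2, THEN conjunct2, THEN conjunct1, rule_format]
    note g4 = g[unfolded good_def, THEN conjunct2, THEN conjunct2, THEN conjunct2, rule_format]
    obtain k0 where k0: "decode r k0" using g1[of 0] by auto
    have fin: "\<exists>i. decode r i \<and> U i \<subseteq> (\<Inter>k\<in>K. U k)" if "finite K" "\<forall>k\<in>K. decode r k" for K
      using that
    proof (induction K)
      case (insert k K)
      then obtain i where i: "decode r i" "U i \<subseteq> (\<Inter>k\<in>K. U k)" by auto
      moreover from i(1) g2[of i k] insert.prems obtain i' where "decode r i'" "U i' \<subseteq> U i \<inter> U k" by auto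
      ultimately show ?case by (intro exI[of _ i']) auto
    qed (use k0 in auto)
    define C where "C = (\<lambda>k. mtopology closure_of U k) ` {k. decode r k}"
    \<comment> \<open>Directedness and nonemptiness of the \<open>U k\<close> give the finite
      intersection property, the small members give sets inside arbitrarily small balls, and
      completeness yields a common point of the closures.\<close>
    have "\<Inter>C \<noteq> {}"
    proof (rule md(2)[unfolded mcomplete_fip, rule_format], intro conjI ballI allI impI)
      show "closedin mtopology A" if "A \<in> C" for A using that by (auto simp: C_def)
      show "\<exists>A a. A \<in> C \<and> A \<subseteq> mcball a e" if "e > 0" for e :: real
      proof -
        obtain m where m: "inverse (Suc m) < e" using reals_Archimedean[OF \<open>e > 0\<close>] by auto
        obtain k y where k: "decode r k" "y \<in> M" "U k \<subseteq> mball y (inverse (Suc m))"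
          using g1[of m] by auto
        have "U k \<subseteq> mcball y e" using k(3) m by fastforce
        then have "mtopology closure_of U k \<subseteq> mcball y e"
          by (intro closure_of_minimal) auto
        then show ?thesis using k(1) by (auto simp: C_def)
      qed
      fix F assume "finite F \<and> F \<subseteq> C"
      then obtain K where K: "finite K" "K \<subseteq> {k. decode r k}" "F = (\<lambda>k. mtopology closure_of U k) ` K"
        unfolding C_def by (meson finite_subset_image)
      then obtain i where i: "decode r i" "U i \<subseteq> (\<Inter>k\<in>K. U k)" using fin[of K] by auto
      obtain z where z: "z \<in> U i" using U(2) by auto
      have "z \<in> mtopology closure_of U k" if "k \<in> K" for k
        using closure_of_subset[of "U k" mtopology] U(3)[of k] i(2) z that by auto
      then show "\<Inter>F \<noteq> {}" using K(3) by auto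
    qed
    then obtain x where x: "\<And>k. decode r k \<Longrightarrow> x \<in> mtopology closure_of U k"
      unfolding C_def by auto
    \<comment> \<open>The closure condition moves the point from the closures into the sets
      themselves.\<close>
    have xU: "x \<in> U k" if k: "decode r k" for k
      using g3[OF k] x by auto
    \<comment> \<open>A member of small radius contains the point and hence lies in
      \<open>U k\<close>; closure under supersets puts \<open>k\<close> into the code.\<close>
    have "decode r k" if "x \<in> U k" for k
    proof -
      from U(1)[of k] that obtain e where e: "e > 0" "mball x e \<subseteq> U k"
        unfolding Tm openin_mtopology by blast
      obtain m where m: "inverse (Suc m) < e/2" using reals_Archimedean[of "e/2"] e(1) by auto
      obtain i y where i: "decode r i" "y \<in> M" "U i \<subseteq> mball y (inverse (Suc m))"
        using g1[of m] by auto
      have xy: "x \<in> M" "d y x < inverse (Suc m)" using xU[OF i(1)] i(3) by auto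
      have "U i \<subseteq> mball x e"
      proof
        fix z assume "z \<in> U i"
        then have z: "z \<in> M" "d y z < inverse (Suc m)" using i(3) by auto
        have "d x z \<le> d x y + d y z" using xy z i by (intro triangle) auto
        then show "z \<in> mball x e" using xy z m by (auto simp: commute)
      qed
      then show ?thesis using g4[of i k] i(1) e(2) by auto
    qed
    then show "\<exists>x. code r x"
      unfolding code_def using xU U(3) k0 by blast
  qed
  have good_measurable [measurable]: "Measurable.pred borel good"
    unfolding good_def by measurable
  define g where "g r = (if good r then (SOME x. code r x) else x0)" for r
  have g_code: "code r (g r)" if "good r" for r
    using that good_iff by (auto simp: g_def intro: someI_ex)
  have gM: "g r \<in> M" for r
    using g_code[of r] x0 by (cases "good r") (auto simp: code_def g_def)
  have "g -` V \<in> sets borel" if "openin T V" for V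
  proof -
    have "g -` V = {r. (good r \<and> (\<exists>k. decode r k \<and> U k \<subseteq> V)) \<or> (\<not> good r \<and> x0 \<in> V)}"
    proof -
      have "g r \<in> V \<longleftrightarrow> (\<exists>k. decode r k \<and> U k \<subseteq> V)" if "good r" for r
        using g_code[OF that] base[OF \<open>openin T V\<close>, of "g r"] unfolding code_def by auto
      moreover have "g r = x0" if "\<not> good r" for r using that by (simp add: g_def)
      ultimately have "g r \<in> V \<longleftrightarrow> (good r \<and> (\<exists>k. decode r k \<and> U k \<subseteq> V)) \<or> (\<not> good r \<and> x0 \<in> V)" for r
        by (cases "good r") auto
      then show ?thesis by auto
    qed
    also have "\<dots> \<in> sets borel"
    proof -
      have "{r \<in> space borel. (good r \<and> (\<exists>k. decode r k \<and> U k \<subseteq> V)) \<or> (\<not> good r \<and> x0 \<in> V)} \<in> sets borel"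
        by measurable
      then show ?thesis by simp
    qed
    finally show ?thesis .
  qed
  then have g_meas: "g \<in> borel \<rightarrow>\<^sub>M borel_of T"
    using gM by (intro measurable_borel_of_I) (auto simp: Tm)
  have j_meas: "j \<in> borel_measurable (borel_of T)"
    unfolding j_def encode_def
  proof (intro borel_measurable_suminf borel_measurable_times)
    fix k
    have "(\<lambda>x. indicator (U k) x :: real) \<in> borel_measurable (borel_of T)"
      using openin_sets_borel_of[OF U(1)] by measurable
    moreover have "(\<lambda>x. indicator (U k) x :: real) = (\<lambda>x. of_bool (x \<in> U k))"
      by (auto simp: indicator_def)
    ultimately show "(\<lambda>x. of_bool (x \<in> U k) :: real) \<in> borel_measurable (borel_of T)" by simp
  qed auto
  show thesis
  proof (rule that[OF j_meas g_meas])
    show "g (j x) = x" if "x \<in> topspace T" for x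
      using code_j[of x] g_code[of "j x"] code_unique good_iff that by (auto simp: Tm)
    show "0 \<le> j x \<and> j x < 1" for x
      using encode_nonneg encode_le[of "\<lambda>k. x \<in> U k"] by (auto simp: j_def)
  qed
qed

text \<open>Ulam's theorem. For each radius finitely many closed balls carry all but a summably
  small part of the mass; the intersection of these finite unions is closed and totally bounded,
  hence compact by completeness.\<close>

lemma polish_tight:
  assumes T: "polish T" and \<mu>: "\<mu> \<in> probs T" and e: "e > 0"
  obtains K where "compactin T K" "K \<in> sets (borel_of T)" "measure \<mu> (topspace T - K) < e"
proof -
  interpret prob_space \<mu> using \<mu> by (simp add: probs_def)
  have sets [simp]: "sets \<mu> = sets (borel_of T)" using \<mu> by (simp add: probs_def)
  have space [simp]: "space \<mu> = topspace T" using sets_eq_imp_space_eq[OF sets] by simp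
  obtain M d where md: "Metric_space M d" "Metric_space.mcomplete M d"
    and Tm: "T = Metric_space.mtopology M d"
    using T unfolding polish_def completely_metrizable_space_def by auto
  interpret Metric_space M d by (fact md(1))
  obtain C where C: "countable C" "C \<subseteq> M" "mtopology closure_of C = M"
    using second_countable_imp_separable_space[OF polish_second_countable[OF T]]
    unfolding separable_space_def Tm by auto
  have "C \<noteq> {}" using C(3) not_empty by (auto simp: Tm)
  define q where "q = from_nat_into C"
  have qM: "q k \<in> M" for k using from_nat_into[OF \<open>C \<noteq> {}\<close>] C(2) by (auto simp: q_def)
  have cover: "\<exists>k. x \<in> mcball (q k) r" if "x \<in> M" "r > 0" for x r
  proof -
    have "\<exists>y\<in>C. y \<in> mcball x r" using that C(3) unfolding metric_closure_of_alt by blast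
    then obtain k where "q k \<in> mcball x r" unfolding q_def using from_nat_into_surj[OF C(1)] by metis
    then show ?thesis using that by (auto simp: commute)
  qed
  define A where "A m n = M - (\<Union>k\<le>n. mcball (q k) (inverse (Suc m)))" for m n :: nat
  have clos: "closedin T (\<Union>k\<le>n. mcball (q k) (inverse (Suc m)))" for n m :: nat
    by (auto simp: Tm intro!: closedin_Union)
  have A_sets: "A m n \<in> sets (borel_of T)" for m n
    using closedin_sets_borel_of[OF clos] sets.top[of "borel_of T"] by (auto simp: A_def Tm)
  have "\<exists>n. measure \<mu> (A m n) < e / 2 * (1/2) ^ Suc m" for m
  proof -
    have "(\<lambda>n. measure \<mu> (A m n)) \<longlonglongrightarrow> measure \<mu> (\<Inter>n. A m n)"
      by (rule finite_Lim_measure_decseq) (use A_sets in \<open>auto simp: decseq_def A_def\<close>)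
    moreover have "(\<Inter>n. A m n) = {}"
      using cover[of _ "inverse (Suc m)"] by (fastforce simp: A_def)
    ultimately have "(\<lambda>n. measure \<mu> (A m n)) \<longlonglongrightarrow> 0" by simp
    then show ?thesis using e
      by (intro eventually_happens'[OF sequentially_bot] order_tendstoD(2)) auto
  qed
  then obtain N where N: "\<And>m. measure \<mu> (A m (N m)) < e / 2 * (1/2) ^ Suc m" by metis
  define K where "K = M \<inter> (\<Inter>m. \<Union>k\<le>N m. mcball (q k) (inverse (Suc m)))"
  have Kclosed: "closedin T K"
  proof -
    have "closedin T (topspace T \<inter> (\<Inter>m. \<Union>k\<le>N m. mcball (q k) (inverse (Suc m))))"
      by (intro closedin_Int closedin_topspace closedin_Inter) (use clos in auto)
    then show ?thesis by (simp add: K_def Tm)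
  qed
  have "mtotally_bounded K"
    unfolding mtotally_bounded_def
  proof (intro allI impI)
    fix r :: real assume "r > 0"
    obtain m where m: "inverse (Suc m) < r / 2" using reals_Archimedean[of "r/2"] \<open>r > 0\<close> by auto
    \<comment> \<open>The net has to consist of points of \<open>K\<close>, whereas the centres
      \<open>q k\<close> need not lie in \<open>K\<close>. Choosing a point of \<open>K\<close> in
      each ball that meets \<open>K\<close> doubles the radius, hence \<open>r / 2\<close>.\<close>
    define I where "I = {k. k \<le> N m \<and> K \<inter> mcball (q k) (inverse (Suc m)) \<noteq> {}}"
    have "\<forall>k\<in>I. \<exists>z. z \<in> K \<inter> mcball (q k) (inverse (Suc m))" unfolding I_def by blast
    then obtain z where z: "\<And>k. k \<in> I \<Longrightarrow> z k \<in> K \<inter> mcball (q k) (inverse (Suc m))"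
      by (drule_tac bchoice) blast
    show "\<exists>L. finite L \<and> L \<subseteq> K \<and> K \<subseteq> (\<Union>x\<in>L. mball x r)"
    proof (intro exI[of _ "z ` I"] conjI)
      show "finite (z ` I)" by (auto simp: I_def)
      show "z ` I \<subseteq> K" using z by auto
      show "K \<subseteq> (\<Union>x\<in>z ` I. mball x r)"
      proof
        fix x assume x: "x \<in> K"
        then obtain k where k: "k \<le> N m" "x \<in> mcball (q k) (inverse (Suc m))"
          unfolding K_def by blast
        then have kI: "k \<in> I" using x by (auto simp: I_def)
        have "d (z k) x \<le> d (z k) (q k) + d (q k) x"
          using z[OF kI] k qM by (intro triangle) auto
        also have "\<dots> < r" using z[OF kI] k m by (auto simp: commute)
        finally have "x \<in> mball (z k) r" using z[OF kI] k by auto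
        then show "x \<in> (\<Union>x\<in>z ` I. mball x r)" using kI by auto
      qed
    qed
  qed
  then have "compactin T (T closure_of K)"
    using mtotally_bounded_eq_compact_closure_of[OF md(2)] by (simp add: Tm)
  then have "compactin T K" using Kclosed by (simp add: closure_of_closedin)
  moreover have "measure \<mu> (topspace T - K) < e"
  proof -
    have sm1: "summable (\<lambda>m. e / 2 * (1/2) ^ Suc m)"
      using sums_mult[OF power_half_series, of "e / 2"] by (simp add: sums_iff)
    have sm2: "summable (\<lambda>m. measure \<mu> (A m (N m)))"
      by (rule summable_comparison_test'[OF sm1, of 0]) (use N in \<open>auto intro: less_imp_le simp del: power_Suc\<close>)
    have "topspace T - K = (\<Union>m. A m (N m))" by (auto simp: K_def A_def Tm)
    also have "measure \<mu> \<dots> \<le> (\<Sum>m. measure \<mu> (A m (N m)))"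
      by (rule finite_measure_subadditive_countably[OF _ sm2]) (use A_sets in auto)
    also have "\<dots> \<le> (\<Sum>m. e / 2 * (1/2) ^ Suc m)"
      by (rule suminf_le[OF _ sm2 sm1]) (use N less_imp_le in blast)
    also have "\<dots> = e / 2" using sums_mult[OF power_half_series, of "e / 2"] by (simp add: sums_iff)
    finally show ?thesis using e by simp
  qed
  ultimately show thesis using that closedin_sets_borel_of[OF Kclosed] by blast
qed

section \<open>Path spaces as iterated binary products\<close>

lemma homeomorphic_paths_Suc:
  "prod_topology (paths t X) (X (Suc t)) homeomorphic_space paths (Suc t) X"
proof -
  have "homeomorphic_maps (prod_topology (paths t X) (X (Suc t))) (paths (Suc t) X)
     (\<lambda>(x, a). x(Suc t := a)) (\<lambda>x. (restrict x {1..t}, x (Suc t)))"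
    unfolding homeomorphic_maps_def
  proof (intro conjI ballI)
    show "continuous_map (prod_topology (paths t X) (X (Suc t))) (paths (Suc t) X) (\<lambda>(x, a). x(Suc t := a))"
      unfolding paths_def continuous_map_componentwise
    proof (intro conjI ballI)
      show "(\<lambda>(x, a). x(Suc t := a)) ` topspace (prod_topology (product_topology X {1..t}) (X (Suc t)))
        \<subseteq> extensional {1..Suc t}"
        by (auto simp: extensional_def PiE_def)
      fix k assume k: "k \<in> {1..Suc t}"
      show "continuous_map (prod_topology (product_topology X {1..t}) (X (Suc t))) (X k)
         (\<lambda>x. (case x of (x, a) \<Rightarrow> x(Suc t := a)) k)"
      proof (cases "k = Suc t")
        case True
        show ?thesis unfolding True
          by (rule continuous_map_eq[OF continuous_map_snd]) auto
      next
        case False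
        then have "continuous_map (prod_topology (product_topology X {1..t}) (X (Suc t))) (X k)
            ((\<lambda>x. x k) \<circ> fst)"
          using k by (intro continuous_map_compose[OF continuous_map_fst]
              continuous_map_product_projection) auto
        then show ?thesis using False by (simp add: case_prod_unfold o_def)
      qed
    qed
    show "continuous_map (paths (Suc t) X) (prod_topology (paths t X) (X (Suc t)))
       (\<lambda>x. (restrict x {1..t}, x (Suc t)))"
      unfolding continuous_map_pairwise o_def paths_def fst_conv snd_conv
      by (auto simp: continuous_map_componentwise intro!: continuous_map_product_projection)
    fix z assume "z \<in> topspace (prod_topology (paths t X) (X (Suc t)))"
    then show "(\<lambda>x. (restrict x {1..t}, x (Suc t))) ((\<lambda>(x, a). x(Suc t := a)) z) = z"
      by (auto simp: paths_def PiE_def extensional_def restrict_def)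
  next
    fix y assume "y \<in> topspace (paths (Suc t) X)"
    then show "(\<lambda>(x, a). x(Suc t := a)) ((\<lambda>x. (restrict x {1..t}, x (Suc t))) y) = y"
      by (auto simp: paths_def PiE_def extensional_def restrict_def fun_eq_iff le_Suc_eq)
  qed
  then show ?thesis by (auto simp: homeomorphic_space_def)
qed

lemma polish_paths:
  assumes "\<And>s. s \<in> {1..t} \<Longrightarrow> polish (X s)"
  shows "polish (paths t X)"
  using assms
proof (induction t)
  case 0
  have "paths 0 X = discrete_topology {\<lambda>x. undefined}"
    by (simp add: paths_def product_topology_empty_discrete)
  then show ?case
    by (simp add: polish_def second_countable_discrete_topology
        completely_metrizable_space_discrete_topology)
next
  case (Suc t)
  then show ?case
    by (intro polish_homeomorphic[OF homeomorphic_paths_Suc] polish_prod_topology) auto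
qed

lemma continuous_map_paths_restrict:
  "t \<le> N \<Longrightarrow> continuous_map (paths N X) (paths t X) (\<lambda>x. restrict x {1..t})"
  by (auto simp: paths_def continuous_map_componentwise intro!: continuous_map_product_projection)

lemma continuous_map_paths_component:
  "t \<in> {1..N} \<Longrightarrow> continuous_map (paths N X) (X t) (\<lambda>x. x t)"
  unfolding paths_def by (intro continuous_map_product_projection)

section \<open>Randomization\<close>

lemma measure_eqI_rectangles:
  assumes "finite_measure M" and M: "sets M = sets (A \<Otimes>\<^sub>M B)" and N: "sets N = sets (A \<Otimes>\<^sub>M B)"
    and eq: "\<And>a b. a \<in> sets A \<Longrightarrow> b \<in> sets B \<Longrightarrow> emeasure M (a \<times> b) = emeasure N (a \<times> b)"
  shows "M = N"
proof (rule measure_eqI_generator_eq[where E="{a \<times> b |a b. a \<in> sets A \<and> b \<in> sets B}"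
      and \<Omega>="space A \<times> space B" and A="\<lambda>_. space A \<times> space B"])
  interpret finite_measure M by fact
  show "Int_stable {a \<times> b |a b. a \<in> sets A \<and> b \<in> sets B}"
    by (rule Int_stable_pair_measure_generator)
  show "{a \<times> b |a b. a \<in> sets A \<and> b \<in> sets B} \<subseteq> Pow (space A \<times> space B)"
    by (rule pair_measure_closed)
  show "sets M = sigma_sets (space A \<times> space B) {a \<times> b |a b. a \<in> sets A \<and> b \<in> sets B}"
    "sets N = sigma_sets (space A \<times> space B) {a \<times> b |a b. a \<in> sets A \<and> b \<in> sets B}"
    using M N by (simp_all add: sets_pair_measure)
  show "emeasure M (space A \<times> space B) \<noteq> \<infinity>" for i :: nat by (simp add: emeasure_eq_measure)
qed (use eq in auto)

lemma borel_measure_eqI_lessThan: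
  fixes M N :: "real measure"
  assumes "finite_measure M" "sets M = sets borel" "sets N = sets borel"
    and eq: "\<And>r. emeasure M {..<r} = emeasure N {..<r}"
  shows "M = N"
proof (rule measure_eqI_generator_eq[where E="range lessThan" and \<Omega>=UNIV and A="\<lambda>n. {..<real n}"])
  interpret finite_measure M by fact
  show "Int_stable (range lessThan :: real set set)"
  proof (rule Int_stableI)
    fix a b :: "real set" assume "a \<in> range lessThan" "b \<in> range lessThan"
    then obtain x y where "a = {..<x}" "b = {..<y}" by auto
    then have "a \<inter> b = {..<min x y}" by auto
    then show "a \<inter> b \<in> range lessThan" by auto
  qed
  show "(\<Union>n. {..<real n}) = UNIV" by (auto intro: reals_Archimedean2)
  show "emeasure M {..<real i} \<noteq> \<infinity>" for i by (simp add: emeasure_eq_measure)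
qed (use assms in \<open>auto simp: borel_Iio\<close>)

definition unif :: "real measure" where
  "unif = uniform_measure lborel {0..1}"

lemma sets_unif [simp, measurable_cong]: "sets unif = sets borel"
  by (simp add: unif_def)

lemma space_unif [simp]: "space unif = UNIV"
  by (simp add: unif_def)

lemma prob_space_unif: "prob_space unif"
  unfolding unif_def by (rule prob_space_uniform_measure) auto

text \<open>Clipping \<open>u\<close> to the unit interval makes the comparison with an extended
  nonnegative number meaningful for every real \<open>u\<close> and changes nothing where
  \<open>unif\<close> lives. A value \<open>a\<close> of a conditional distribution function thus
  becomes the probability of an event in \<open>u\<close>.\<close>

lemma emeasure_unif_le:
  fixes a :: ennreal
  shows "emeasure unif {u. ennreal (max 0 (min 1 u)) \<le> a} = min 1 a"
proof -
  have "emeasure unif {u. ennreal (max 0 (min 1 u)) \<le> a} =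
      emeasure lborel ({0..1} \<inter> {u. ennreal (max 0 (min 1 u)) \<le> a})"
    unfolding unif_def by (subst emeasure_uniform_measure) (auto simp: divide_ennreal_def)
  also have "\<dots> = min 1 a"
  proof (cases "a \<ge> 1")
    case True
    then have "{0..1} \<inter> {u. ennreal (max 0 (min 1 u)) \<le> a} = {0..1}"
      by (auto intro!: order_trans[OF _ True] simp: ennreal_le_1)
    with True show ?thesis by (simp add: min_def)
  next
    case False
    then obtain r where r: "a = ennreal r" "0 \<le> r" "r < 1"
      by (cases a) (auto simp: not_le)
    then have "{0..1} \<inter> {u. ennreal (max 0 (min 1 u)) \<le> a} = {0..r}"
      by (auto simp: ennreal_le_iff)
    with r show ?thesis by (simp add: min_def)
  qed
  finally show ?thesis .
qed

text \<open>On the set where \<open>g < f\<close> the hypothesis forces the difference to have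
  integral zero; the finite integral of \<open>g\<close> is what permits the subtraction.\<close>

lemma AE_le_of_nn_set_integral_le:
  assumes [measurable]: "f \<in> borel_measurable M" "g \<in> borel_measurable M"
    and fin: "(\<integral>\<^sup>+x. g x \<partial>M) \<noteq> \<infinity>"
    and le: "\<And>A. A \<in> sets M \<Longrightarrow> (\<integral>\<^sup>+x. f x * indicator A x \<partial>M) \<le> (\<integral>\<^sup>+x. g x * indicator A x \<partial>M)"
  shows "AE x in M. (f x :: ennreal) \<le> g x"
proof -
  define A where "A = {x \<in> space M. g x < f x}"
  have A [measurable]: "A \<in> sets M" unfolding A_def by measurable
  have ge: "g x * indicator A x \<le> f x * indicator A x" for x
    by (auto simp: A_def indicator_def)
  have gfin: "(\<integral>\<^sup>+x. g x * indicator A x \<partial>M) \<noteq> \<infinity>"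
  proof -
    have "(\<integral>\<^sup>+x. g x * indicator A x \<partial>M) \<le> (\<integral>\<^sup>+x. g x \<partial>M)"
      by (intro nn_integral_mono) (auto simp: indicator_def)
    then show ?thesis using fin by (auto simp: top_unique)
  qed
  have "(\<integral>\<^sup>+x. f x * indicator A x - g x * indicator A x \<partial>M)
      = (\<integral>\<^sup>+x. f x * indicator A x \<partial>M) - (\<integral>\<^sup>+x. g x * indicator A x \<partial>M)"
    using gfin ge by (intro nn_integral_diff) auto
  also have "\<dots> = 0"
    using le[OF A] gfin by (intro diff_eq_0_ennreal) (auto simp: less_top)
  finally have "AE x in M. f x * indicator A x - g x * indicator A x = 0"
    by (subst (asm) nn_integral_0_iff_AE) auto
  then show ?thesis using AE_space
  proof eventually_elim
    case (elim x)
    show ?case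
    proof (rule ccontr)
      assume "\<not> f x \<le> g x"
      then have "g x < f x" by simp
      then have "f x - g x > 0" by (simp add: diff_gr0_ennreal)
      moreover have "f x - g x = 0"
        using elim \<open>g x < f x\<close> by (cases "x \<in> A") (auto simp: A_def indicator_def)
      ultimately show False by simp
    qed
  qed
qed

text \<open>Noise outsourcing on the line: the second coordinate is a function of the first coordinate and
  an independent uniform variable, namely the conditional quantile function.\<close>

lemma real_randomization:
  fixes \<gamma> :: "('b \<times> real) measure" and E :: "'b measure"
  assumes "prob_space \<gamma>" and sets_\<gamma>: "sets \<gamma> = sets (E \<Otimes>\<^sub>M borel)"
    and bounds: "AE z in \<gamma>. 0 \<le> snd z \<and> snd z < 1"
  obtains f where "f \<in> borel_measurable (E \<Otimes>\<^sub>M borel)"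
    "distr (distr \<gamma> E fst \<Otimes>\<^sub>M unif) (E \<Otimes>\<^sub>M borel) (\<lambda>(x, u). (x, f (x, u))) = \<gamma>"
proof -
  interpret \<gamma>: prob_space \<gamma> by fact
  note [measurable_cong] = sets_\<gamma>
  have fst_m [measurable]: "fst \<in> \<gamma> \<rightarrow>\<^sub>M E" and snd_m [measurable]: "snd \<in> \<gamma> \<rightarrow>\<^sub>M borel"
    by measurable
  have space_\<gamma>: "space \<gamma> = space E \<times> UNIV"
    using sets_eq_imp_space_eq[OF sets_\<gamma>] by (simp add: space_pair_measure)
  define \<mu> where "\<mu> = distr \<gamma> E fst"
  interpret \<mu>: prob_space \<mu> unfolding \<mu>_def by (rule \<gamma>.prob_space_distr) simp
  have sets_\<mu> [measurable_cong]: "sets \<mu> = sets E" by (simp add: \<mu>_def)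
  have space_\<mu>: "space \<mu> = space E" by (simp add: \<mu>_def)
  interpret U: prob_space unif by (rule prob_space_unif)
  interpret \<mu>U: pair_prob_space \<mu> unif ..
  \<comment> \<open>This is the measure sending \<open>A\<close> to
    \<open>\<gamma> (A \<times> {..q})\<close>. Its density \<open>D q\<close> with respect to
    \<open>\<mu>\<close> is the conditional distribution function at \<open>q\<close>.\<close>
  define \<nu> where "\<nu> q = distr (density \<gamma> (indicator (space E \<times> {..q}))) E fst" for q :: real
  have sets_\<nu>: "sets (\<nu> q) = sets \<mu>" for q by (simp add: \<nu>_def sets_\<mu>)
  have em_\<nu>: "emeasure (\<nu> q) A = emeasure \<gamma> (A \<times> {..q})" if [measurable]: "A \<in> sets E" for A q
  proof -
    have sub: "A \<subseteq> space E" using sets.sets_into_space[OF that] .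
    have "emeasure (\<nu> q) A = emeasure (density \<gamma> (indicator (space E \<times> {..q}))) (A \<times> (UNIV :: real set))"
      unfolding \<nu>_def using sub by (subst emeasure_distr) (auto simp: space_\<gamma> intro!: arg_cong2[where f=emeasure])
    also have "\<dots> = (\<integral>\<^sup>+z. indicator (space E \<times> {..q}) z * indicator (A \<times> UNIV) z \<partial>\<gamma>)"
      by (rule emeasure_density) measurable
    also have "\<dots> = (\<integral>\<^sup>+z. indicator (A \<times> {..q}) z \<partial>\<gamma>)"
      using sub by (intro nn_integral_cong) (auto split: split_indicator)
    also have "\<dots> = emeasure \<gamma> (A \<times> {..q})" by (rule nn_integral_indicator) (simp add: sets_\<gamma>)
    finally show ?thesis .
  qed
  have em_\<mu>: "emeasure \<mu> A = emeasure \<gamma> (A \<times> UNIV)" if "A \<in> sets E" for A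
    using sets.sets_into_space[OF that] that unfolding \<mu>_def
    by (subst emeasure_distr) (auto simp: space_\<gamma> intro!: arg_cong2[where f=emeasure])
  have \<nu>_le: "emeasure (\<nu> q) A \<le> emeasure \<mu> A" if "A \<in> sets E" for A q
    using that by (simp add: em_\<nu> em_\<mu> sets_\<gamma> emeasure_mono Times_subset_cancel2 pair_measureI Sigma_mono)
  have ac: "absolutely_continuous \<mu> (\<nu> q)" for q
    unfolding absolutely_continuous_def
  proof
    fix A assume "A \<in> null_sets \<mu>"
    then have "A \<in> sets E" "emeasure \<mu> A = 0" by (auto simp: sets_\<mu>)
    then show "A \<in> null_sets (\<nu> q)" using \<nu>_le[of A q] by (auto simp: sets_\<nu> sets_\<mu>)
  qed
  define D where "D q = RN_deriv \<mu> (\<nu> q)" for q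
  have D_m [measurable]: "D q \<in> borel_measurable E" for q
    using borel_measurable_RN_deriv[of \<mu> "\<nu> q"] by (simp add: D_def measurable_cong_sets[OF sets_\<mu> refl])
  have D_int: "(\<integral>\<^sup>+x. D q x * indicator A x \<partial>\<mu>) = emeasure \<gamma> (A \<times> {..q})" if A: "A \<in> sets E" for A q
  proof -
    have "emeasure (density \<mu> (D q)) A = emeasure (\<nu> q) A"
      unfolding D_def by (subst \<mu>.density_RN_deriv[OF ac sets_\<nu>]) simp
    then show ?thesis using A by (simp add: em_\<nu> emeasure_density sets_\<mu>)
  qed
  have D_fin: "(\<integral>\<^sup>+x. D q x \<partial>\<mu>) \<noteq> \<infinity>" for q
  proof -
    have "(\<integral>\<^sup>+x. D q x \<partial>\<mu>) = (\<integral>\<^sup>+x. D q x * indicator (space E) x \<partial>\<mu>)"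
      by (intro nn_integral_cong) (simp add: space_\<mu>)
    then show ?thesis using D_int[of "space E" q] by (simp add: \<gamma>.emeasure_eq_measure)
  qed
  have D_mono: "AE x in \<mu>. D q x \<le> D q' x" if "q \<le> q'" for q q'
  proof (rule AE_le_of_nn_set_integral_le)
    fix A assume "A \<in> sets \<mu>"
    then have "A \<in> sets E" by (simp add: sets_\<mu>)
    then show "(\<integral>\<^sup>+x. D q x * indicator A x \<partial>\<mu>) \<le> (\<integral>\<^sup>+x. D q' x * indicator A x \<partial>\<mu>)"
      using that by (simp add: D_int, intro emeasure_mono) (auto simp: sets_\<gamma>)
  qed (use D_fin in auto)
  have D_le1: "AE x in \<mu>. D q x \<le> 1" for q
  proof (rule AE_le_of_nn_set_integral_le)
    fix A assume "A \<in> sets \<mu>"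
    then have A: "A \<in> sets E" by (simp add: sets_\<mu>)
    then show "(\<integral>\<^sup>+x. D q x * indicator A x \<partial>\<mu>) \<le> (\<integral>\<^sup>+x. 1 * indicator A x \<partial>\<mu>)"
      using \<nu>_le[OF A, of q] by (simp add: D_int em_\<nu> sets_\<mu>)
  qed (auto simp: \<mu>.emeasure_space_1)
  \<comment> \<open>Each \<open>D q\<close> is determined almost everywhere only, so monotonicity in
    \<open>q\<close> may fail at a given \<open>x\<close>. The supremum over rationals restores it
    everywhere and agrees almost everywhere with \<open>D\<close> at rational
    \<open>q\<close>.\<close>
  define G where "G q x = (SUP q'\<in>{q'. of_rat q' \<le> q}. D (of_rat q') x)" for q :: real and x
  have G_m [measurable]: "G q \<in> borel_measurable E" for q
    unfolding G_def by (rule borel_measurable_SUP) (auto simp: countable_Collect)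
  have G_mono: "G q x \<le> G q' x" if "q \<le> q'" for q q' x
    unfolding G_def using that by (intro SUP_subset_mono) auto
  have G_eq: "AE x in \<mu>. G (of_rat q) x = D (of_rat q) x" for q
  proof -
    have "AE x in \<mu>. \<forall>q'\<in>{q'. of_rat q' \<le> (of_rat q :: real)}. D (of_rat q') x \<le> D (of_rat q) x"
      by (subst AE_ball_countable) (auto simp: countable_Collect intro: D_mono)
    then show ?thesis
    proof eventually_elim
      case (elim x)
      then show ?case unfolding G_def by (intro antisym SUP_least) (auto intro!: SUP_upper2[of q])
    qed
  qed
  \<comment> \<open>For \<open>q\<close> between 0 and 1 this says that \<open>u\<close>, clipped to
    the unit interval, is at most the conditional distribution function at \<open>q\<close>. The
    forced values for \<open>q < 0\<close> and \<open>q \<ge> 1\<close> agree with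
    \<open>bounds\<close> and make the infimum defining \<open>f\<close> range over a nonempty set
    that is bounded below.\<close>
  define P where "P q x u \<longleftrightarrow> 0 \<le> q \<and> (1 \<le> q \<or> ennreal (max 0 (min 1 u)) \<le> G q x)" for q :: real and x and u :: real
  have P_mono: "P q x u \<Longrightarrow> q \<le> q' \<Longrightarrow> P q' x u" for q q' x u
    using G_mono[of q q' x] by (auto simp: P_def intro: order_trans)
  have P_m [measurable]: "Measurable.pred (E \<Otimes>\<^sub>M borel) (\<lambda>z. P q (fst z) (snd z))" for q
    unfolding P_def by measurable
  define f where "f = (\<lambda>z. Inf {of_rat q | q :: rat. P (of_rat q) (fst z) (snd z)} :: real)"
  \<comment> \<open>The infimum is below \<open>r\<close> exactly if some rational candidate is, so
    measurability of \<open>f\<close> reduces to a countable union.\<close>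
  have f_less: "f z < r \<longleftrightarrow> (\<exists>q. of_rat q < r \<and> P (of_rat q) (fst z) (snd z))" for z r
  proof -
    have "(1::real) \<in> {of_rat q | q :: rat. P (of_rat q) (fst z) (snd z)}"
      by (auto simp: P_def intro!: exI[of _ 1])
    moreover have "bdd_below {of_rat q :: real | q :: rat. P (of_rat q) (fst z) (snd z)}"
      by (rule bdd_belowI[of _ 0]) (auto simp: P_def)
    ultimately have "f z < r \<longleftrightarrow> (\<exists>y\<in>{of_rat q | q :: rat. P (of_rat q) (fst z) (snd z)}. y < r)"
      unfolding f_def by (intro cInf_less_iff) blast+
    then show ?thesis by auto
  qed
  have f_m [measurable]: "f \<in> borel_measurable (E \<Otimes>\<^sub>M borel)"
  proof (rule borel_measurableI_less)
    fix r show "{z \<in> space (E \<Otimes>\<^sub>M borel). f z < r} \<in> sets (E \<Otimes>\<^sub>M borel)"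
      unfolding f_less by measurable
  qed
  have P_int: "emeasure (\<mu> \<Otimes>\<^sub>M unif) {z \<in> A \<times> UNIV. P (of_rat q) (fst z) (snd z)} = emeasure \<gamma> (A \<times> {..of_rat q})"
    if A [measurable]: "A \<in> sets E" for A q
  proof -
    have AU [measurable]: "A \<times> UNIV \<in> sets (E \<Otimes>\<^sub>M borel)" by auto
    have *: "{z \<in> A \<times> UNIV. P (of_rat q) (fst z) (snd z)} \<in> sets (\<mu> \<Otimes>\<^sub>M unif)"
    proof -
      have "{z \<in> A \<times> UNIV. P (of_rat q) (fst z) (snd z)}
        = {z \<in> space (E \<Otimes>\<^sub>M borel). z \<in> A \<times> UNIV \<and> P (of_rat q) (fst z) (snd z)}"
        using sets.sets_into_space[OF A] by (auto simp: space_pair_measure)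
      also have "\<dots> \<in> sets (E \<Otimes>\<^sub>M borel)" by measurable
      finally show ?thesis by (simp cong: sets_pair_measure_cong add: sets_\<mu>)
    qed
    have "emeasure (\<mu> \<Otimes>\<^sub>M unif) {z \<in> A \<times> UNIV. P (of_rat q) (fst z) (snd z)}
      = (\<integral>\<^sup>+x. emeasure unif (Pair x -` {z \<in> A \<times> UNIV. P (of_rat q) (fst z) (snd z)}) \<partial>\<mu>)"
      by (rule U.emeasure_pair_measure_alt[OF *])
    also have "\<dots> = (\<integral>\<^sup>+x. emeasure unif {u. P (of_rat q) x u} * indicator A x \<partial>\<mu>)"
      by (intro nn_integral_cong) (auto simp: indicator_def vimage_def)
    also have "\<dots> = emeasure \<gamma> (A \<times> {..of_rat q})"
    proof -
      consider "of_rat q < (0::real)" | "0 \<le> (of_rat q :: real)" "of_rat q < (1::real)" | "1 \<le> (of_rat q :: real)"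
        by linarith
      then show ?thesis
      proof cases
        case 1
        have "emeasure \<gamma> (A \<times> {..of_rat q}) = 0"
        proof -
          have "emeasure \<gamma> (A \<times> {..of_rat q}) = emeasure \<gamma> {}"
          proof (rule emeasure_eq_AE)
            show "AE z in \<gamma>. z \<in> A \<times> {..of_rat q} \<longleftrightarrow> z \<in> {}"
              using bounds
            proof eventually_elim
              case (elim z)
              then have "of_rat q < snd z" using 1 by linarith
              then show ?case by (simp add: mem_Times_iff)
            qed
          qed (simp_all add: sets_\<gamma>)
          then show ?thesis by simp
        qed
        then show ?thesis using 1 by (simp add: P_def)
      next
        case 2
        then have "{u. P (of_rat q) x u} = {u. ennreal (max 0 (min 1 u)) \<le> G (of_rat q) x}" for x
          unfolding P_def by auto
        then have "(\<integral>\<^sup>+x. emeasure unif {u. P (of_rat q) x u} * indicator A x \<partial>\<mu>)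
          = (\<integral>\<^sup>+x. min 1 (G (of_rat q) x) * indicator A x \<partial>\<mu>)"
          by (simp only: emeasure_unif_le)
        also have "\<dots> = (\<integral>\<^sup>+x. D (of_rat q) x * indicator A x \<partial>\<mu>)"
          using G_eq[of q] D_le1[of "of_rat q"] by (intro nn_integral_cong_AE) (auto elim: AE_mp simp: min_def)
        finally show ?thesis using D_int[OF A] by simp
      next
        case 3
        then have "(\<integral>\<^sup>+x. emeasure unif {u. P (of_rat q) x u} * indicator A x \<partial>\<mu>) = emeasure \<mu> A"
          using U.emeasure_space_1 by (simp add: P_def sets_\<mu>)
        also have "\<dots> = emeasure \<gamma> (A \<times> {..of_rat q})"
          unfolding em_\<mu>[OF A]
        proof (rule emeasure_eq_AE)
          show "AE z in \<gamma>. z \<in> A \<times> UNIV \<longleftrightarrow> z \<in> A \<times> {..of_rat q}"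
            using bounds
          proof eventually_elim
            case (elim z)
            then have "snd z \<le> of_rat q" using 3 by linarith
            then show ?case by (simp add: mem_Times_iff)
          qed
        qed (simp_all add: sets_\<gamma>)
        finally show ?thesis .
      qed
    qed
    finally show ?thesis .
  qed
  let ?h = "\<lambda>(x, u). (x, f (x, u))"
  have h_m [measurable]: "?h \<in> \<mu> \<Otimes>\<^sub>M unif \<rightarrow>\<^sub>M E \<Otimes>\<^sub>M borel" by measurable
  have key: "emeasure (distr (\<mu> \<Otimes>\<^sub>M unif) (E \<Otimes>\<^sub>M borel) ?h) (A \<times> {..<r}) = emeasure \<gamma> (A \<times> {..<r})"
    if A [measurable]: "A \<in> sets E" for A r
  proof -
    have "\<exists>q. r - inverse (Suc n) < of_rat q \<and> of_rat q < r" for n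
      by (rule of_rat_dense) auto
    then obtain s where s: "\<And>n. r - inverse (real (Suc n)) < of_rat (s n)" "\<And>n. (of_rat (s n) :: real) < r"
      by metis
    \<comment> \<open>The running maximum turns rationals approaching \<open>r\<close> from below
      into an increasing sequence, as continuity of measures along unions requires.\<close>
    define q where "q n = Max (s ` {..n})" for n
    have q_inc: "q n \<le> q m" if "n \<le> m" for n m
      unfolding q_def using that by (intro Max_mono) auto
    have q_less: "(of_rat (q n) :: real) < r" for n
    proof -
      have "q n \<in> s ` {..n}" unfolding q_def by (rule Max_in) auto
      then show ?thesis using s(2) by auto
    qed
    have q_gr: "r - inverse (real (Suc n)) < of_rat (q n)" for n
    proof -
      have "s n \<le> q n" unfolding q_def by (rule Max_ge) auto
      then have "(of_rat (s n) :: real) \<le> of_rat (q n)" by (simp add: of_rat_less_eq)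
      then show ?thesis using s(1)[of n] by linarith
    qed
    have q_sup: "\<exists>n. x \<le> of_rat (q n)" if "x < r" for x :: real
    proof -
      from reals_Archimedean[of "r - x"] that obtain n where "inverse (real (Suc n)) < r - x" by auto
      then show ?thesis using q_gr[of n] by (intro exI[of _ n]) linarith
    qed
    have "emeasure (distr (\<mu> \<Otimes>\<^sub>M unif) (E \<Otimes>\<^sub>M borel) ?h) (A \<times> {..<r})
        = emeasure (\<mu> \<Otimes>\<^sub>M unif) (\<Union>n. {z \<in> A \<times> UNIV. P (of_rat (q n)) (fst z) (snd z)})"
    proof (subst emeasure_distr)
      have "?h -` (A \<times> {..<r}) \<inter> space (\<mu> \<Otimes>\<^sub>M unif) = {z \<in> A \<times> UNIV. f z < r}"
        using sets.sets_into_space[OF A] by (auto simp: space_pair_measure space_\<mu>)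
      also have "\<dots> = (\<Union>n. {z \<in> A \<times> UNIV. P (of_rat (q n)) (fst z) (snd z)})"
      proof (intro equalityI subsetI)
        fix z assume "z \<in> {z \<in> A \<times> UNIV. f z < r}"
        then obtain q' where q': "of_rat q' < r" "P (of_rat q') (fst z) (snd z)" "z \<in> A \<times> UNIV"
          unfolding f_less by auto
        then show "z \<in> (\<Union>n. {z \<in> A \<times> UNIV. P (of_rat (q n)) (fst z) (snd z)})"
          using q_sup[OF q'(1)] P_mono by blast
      next
        fix z assume "z \<in> (\<Union>n. {z \<in> A \<times> UNIV. P (of_rat (q n)) (fst z) (snd z)})"
        then show "z \<in> {z \<in> A \<times> UNIV. f z < r}" unfolding f_less using q_less by blast
      qed
      finally show "emeasure (\<mu> \<Otimes>\<^sub>M unif) (?h -` (A \<times> {..<r}) \<inter> space (\<mu> \<Otimes>\<^sub>M unif))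
        = emeasure (\<mu> \<Otimes>\<^sub>M unif) (\<Union>n. {z \<in> A \<times> UNIV. P (of_rat (q n)) (fst z) (snd z)})" by simp
    qed auto
    also have "\<dots> = (SUP n. emeasure (\<mu> \<Otimes>\<^sub>M unif) {z \<in> A \<times> UNIV. P (of_rat (q n)) (fst z) (snd z)})"
    proof (rule SUP_emeasure_incseq[symmetric])
      show "range (\<lambda>n. {z \<in> A \<times> UNIV. P (of_rat (q n)) (fst z) (snd z)}) \<subseteq> sets (\<mu> \<Otimes>\<^sub>M unif)"
      proof (rule image_subsetI)
        fix n
        have "A \<times> UNIV \<in> sets (E \<Otimes>\<^sub>M (borel :: real measure))" by auto
        note [measurable] = this
        have "{z \<in> A \<times> UNIV. P (of_rat (q n)) (fst z) (snd z)}
          = {z \<in> space (E \<Otimes>\<^sub>M borel). z \<in> A \<times> UNIV \<and> P (of_rat (q n)) (fst z) (snd z)}"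
          using sets.sets_into_space[OF A] by (auto simp: space_pair_measure)
        also have "\<dots> \<in> sets (E \<Otimes>\<^sub>M borel)" by measurable
        finally show "{z \<in> A \<times> UNIV. P (of_rat (q n)) (fst z) (snd z)} \<in> sets (\<mu> \<Otimes>\<^sub>M unif)"
          by (simp cong: sets_pair_measure_cong add: sets_\<mu>)
      qed
      show "incseq (\<lambda>n. {z \<in> A \<times> UNIV. P (of_rat (q n)) (fst z) (snd z)})"
        using P_mono q_inc by (auto simp: incseq_def of_rat_less_eq)
    qed
    also have "\<dots> = (SUP n. emeasure \<gamma> (A \<times> {..of_rat (q n)}))" by (simp add: P_int[OF A])
    also have "\<dots> = emeasure \<gamma> (\<Union>n. A \<times> {..of_rat (q n)})"
      by (rule SUP_emeasure_incseq)
         (use q_inc in \<open>auto simp: incseq_def sets_\<gamma> of_rat_less_eq intro: order_trans\<close>)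
    also have "(\<Union>n. A \<times> {..of_rat (q n) :: real}) = A \<times> {..<r}"
      using q_less q_sup by (auto intro: le_less_trans)
    finally show ?thesis .
  qed
  have "distr (\<mu> \<Otimes>\<^sub>M unif) (E \<Otimes>\<^sub>M borel) ?h = \<gamma>" (is "?D = _")
  proof (rule measure_eqI_rectangles[where A=E and B=borel])
    show "finite_measure ?D"
      by (intro prob_space.finite_measure \<mu>U.prob_space_distr) simp
    fix A and B :: "real set" assume A [measurable]: "A \<in> sets E" and B [measurable]: "B \<in> sets borel"
    \<comment> \<open>For fixed \<open>A\<close> both sides are finite measures in the second
      coordinate, so agreement on half-lines extends to all Borel sets \<open>B\<close>.\<close>
    define M where "M \<theta> = distr (density \<theta> (indicator (A \<times> UNIV))) borel snd" for \<theta> :: "('b \<times> real) measure"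
    have em: "emeasure (M \<theta>) B = emeasure \<theta> (A \<times> B)"
      if B [measurable]: "B \<in> sets borel" and [measurable_cong]: "sets \<theta> = sets (E \<Otimes>\<^sub>M borel)" for \<theta> B
    proof -
      have sp: "space \<theta> = space E \<times> UNIV"
        using sets_eq_imp_space_eq[OF that(2)] by (simp add: space_pair_measure)
      have "emeasure (M \<theta>) B = emeasure (density \<theta> (indicator (A \<times> UNIV))) (space E \<times> B)"
        unfolding M_def by (subst emeasure_distr) (auto simp: sp intro!: arg_cong2[where f=emeasure])
      also have "\<dots> = (\<integral>\<^sup>+z. indicator (A \<times> UNIV) z * indicator (space E \<times> B) z \<partial>\<theta>)"
        by (rule emeasure_density) measurable
      also have "\<dots> = (\<integral>\<^sup>+z. indicator (A \<times> B) z \<partial>\<theta>)"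
        using sets.sets_into_space[OF A] by (intro nn_integral_cong) (auto split: split_indicator)
      also have "\<dots> = emeasure \<theta> (A \<times> B)" by (rule nn_integral_indicator) (simp add: that)
      finally show ?thesis .
    qed
    have "M ?D = M \<gamma>"
    proof (rule borel_measure_eqI_lessThan)
      have "emeasure (M ?D) (space (M ?D)) \<le> emeasure ?D (A \<times> UNIV)"
        using em[of UNIV ?D] by (simp add: M_def)
      then show "finite_measure (M ?D)"
        using \<mu>U.prob_space_distr[OF h_m, THEN prob_space.finite_measure]
        by (intro finite_measureI) (auto simp: top_unique finite_measure.emeasure_eq_measure)
      show "emeasure (M ?D) {..<r} = emeasure (M \<gamma>) {..<r}" for r
        using key[OF A, of r] by (simp add: em sets_\<gamma>)
    qed (simp_all add: M_def)
    then show "emeasure ?D (A \<times> B) = emeasure \<gamma> (A \<times> B)"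
      using em[of B ?D] em[of B \<gamma>] by (simp add: sets_\<gamma>)
  qed (simp_all add: sets_\<gamma>)
  then show thesis using that[OF f_m] by (simp add: \<mu>_def)
qed

text \<open>The second coordinate is coded by a number in the unit interval, randomized there and
  decoded. The map \<open>f\<close> plays the role of the conditional kernel of
  \<open>\<gamma>\<close>: evaluating it at independent noise replaces disintegration.\<close>

lemma polish_randomization:
  fixes \<gamma> :: "('b \<times> 'a) measure" and E :: "'b measure"
  assumes T: "polish T" and "prob_space \<gamma>" and sets_\<gamma>: "sets \<gamma> = sets (E \<Otimes>\<^sub>M borel_of T)"
  obtains f where "f \<in> E \<Otimes>\<^sub>M borel \<rightarrow>\<^sub>M borel_of T"
    "distr (distr \<gamma> E fst \<Otimes>\<^sub>M unif) (E \<Otimes>\<^sub>M borel_of T) (\<lambda>(x, u). (x, f (x, u))) = \<gamma>"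
proof -
  interpret \<gamma>: prob_space \<gamma> by fact
  note [measurable_cong] = sets_\<gamma>
  have sp: "space \<gamma> = space E \<times> topspace T"
    using sets_eq_imp_space_eq[OF sets_\<gamma>] by (simp add: space_pair_measure)
  then have ne: "topspace T \<noteq> {}" using \<gamma>.not_empty by auto
  obtain j :: "'a \<Rightarrow> real" and g where j [measurable]: "j \<in> borel_measurable (borel_of T)"
    and g [measurable]: "g \<in> borel \<rightarrow>\<^sub>M borel_of T"
    and gj: "\<And>x. x \<in> topspace T \<Longrightarrow> g (j x) = x" and j01: "\<And>x. 0 \<le> j x \<and> j x < 1"
    by (rule polish_real_coding[OF T ne]) (rule that)
  define \<gamma>' where "\<gamma>' = distr \<gamma> (E \<Otimes>\<^sub>M borel) (\<lambda>(x, y). (x, j y))"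
  have p: "prob_space \<gamma>'" unfolding \<gamma>'_def by (rule \<gamma>.prob_space_distr) measurable
  have s: "sets \<gamma>' = sets (E \<Otimes>\<^sub>M borel)" by (simp add: \<gamma>'_def)
  have b: "AE z in \<gamma>'. 0 \<le> snd z \<and> snd z < 1"
    unfolding \<gamma>'_def by (subst AE_distr_iff) (auto simp: j01)
  obtain f where f [measurable]: "f \<in> borel_measurable (E \<Otimes>\<^sub>M borel)"
    and fd: "distr (distr \<gamma>' E fst \<Otimes>\<^sub>M unif) (E \<Otimes>\<^sub>M borel) (\<lambda>(x, u). (x, f (x, u))) = \<gamma>'"
    using real_randomization[OF p s b] .
  have eq: "distr \<gamma>' E fst = distr \<gamma> E fst"
    unfolding \<gamma>'_def by (subst distr_distr) (auto simp: comp_def case_prod_unfold)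
  have "distr (distr \<gamma> E fst \<Otimes>\<^sub>M unif) (E \<Otimes>\<^sub>M borel_of T) (\<lambda>(x, u). (x, g (f (x, u))))
     = distr (distr (distr \<gamma>' E fst \<Otimes>\<^sub>M unif) (E \<Otimes>\<^sub>M borel) (\<lambda>(x, u). (x, f (x, u))))
        (E \<Otimes>\<^sub>M borel_of T) (\<lambda>(x, r). (x, g r))"
    unfolding eq by (subst distr_distr) (auto simp: comp_def case_prod_unfold)
  also have "\<dots> = distr \<gamma> (E \<Otimes>\<^sub>M borel_of T) (\<lambda>(x, y). (x, g (j y)))"
    unfolding fd unfolding \<gamma>'_def by (subst distr_distr) (auto simp: comp_def case_prod_unfold)
  also have "\<dots> = distr \<gamma> \<gamma> (\<lambda>z. z)"
    by (rule distr_cong) (auto simp: sets_\<gamma> sp gj)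
  also have "\<dots> = \<gamma>" by simp
  finally show thesis by (intro that[of "\<lambda>z. g (f z)"]) simp_all
qed

section \<open>Conditional independence\<close>

text \<open>The bound holds on the whole type and not just on \<open>space M\<close>, which makes
  the class stable under products and measurable substitutions without side conditions. For the same
  reason averaged functions are later set to 0 outside the space.\<close>

definition bmeas :: "'a measure \<Rightarrow> ('a \<Rightarrow> real) set" where
  "bmeas M = {h. h \<in> borel_measurable M \<and> (\<exists>C. \<forall>x. \<bar>h x\<bar> \<le> C)}"

lemma bmeas_measurable: "h \<in> bmeas M \<Longrightarrow> h \<in> borel_measurable M"
  by (simp add: bmeas_def)

lemma bmeasI: "h \<in> borel_measurable M \<Longrightarrow> (\<And>x. \<bar>h x\<bar> \<le> C) \<Longrightarrow> h \<in> bmeas M"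
  by (auto simp: bmeas_def)

lemma bmeas_bound: assumes "h \<in> bmeas M" obtains C where "\<And>x. \<bar>h x\<bar> \<le> C" "C \<ge> 0"
proof -
  obtain C where C: "\<And>x. \<bar>h x\<bar> \<le> C" using assms by (auto simp: bmeas_def)
  moreover have "C \<ge> 0" using C[of undefined] by (meson abs_ge_zero order_trans)
  ultimately show thesis using that by blast
qed

lemma bmeas_indicator: "A \<in> sets M \<Longrightarrow> indicator A \<in> bmeas M"
  by (rule bmeasI[where C=1]) (auto simp: indicator_def)

lemma bmeas_mult: assumes "f \<in> bmeas M" "g \<in> bmeas M" shows "(\<lambda>x. f x * g x) \<in> bmeas M"
proof -
  obtain C D where "\<And>x. \<bar>f x\<bar> \<le> C" "C \<ge> 0" "\<And>x. \<bar>g x\<bar> \<le> D"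
    using bmeas_bound[OF assms(1)] bmeas_bound[OF assms(2)] by metis
  then show ?thesis using assms
    by (intro bmeasI[where C="C * D"]) (auto simp: bmeas_def abs_mult intro!: mult_mono)
qed

lemma bmeas_diff: assumes "f \<in> bmeas M" "g \<in> bmeas M" shows "(\<lambda>x. f x - g x) \<in> bmeas M"
proof -
  obtain C D where CD: "\<And>x. \<bar>f x\<bar> \<le> C" "\<And>x. \<bar>g x\<bar> \<le> D"
    using bmeas_bound[OF assms(1)] bmeas_bound[OF assms(2)] by metis
  have "\<bar>f x - g x\<bar> \<le> C + D" for x
    using CD[of x] CD(2)[of x] by linarith
  then show ?thesis using assms
    by (intro bmeasI[where C="C + D"]) (auto simp: bmeas_def)
qed

lemma bmeas_comp: "h \<in> bmeas B \<Longrightarrow> V \<in> M \<rightarrow>\<^sub>M B \<Longrightarrow> (\<lambda>w. h (V w)) \<in> bmeas M"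
  by (auto simp: bmeas_def)

lemma (in finite_measure) bmeas_integrable: "h \<in> bmeas M \<Longrightarrow> integrable M h"
  using bmeas_bound[of h M] by (metis AE_I2 bmeas_measurable integrable_const_bound real_norm_def)

lemma integrable_mult_bmeas:
  assumes "integrable M \<psi>" "h \<in> bmeas M"
  shows "integrable M (\<lambda>w. \<psi> w * h w :: real)" "integrable M (\<lambda>w. h w * \<psi> w :: real)"
proof -
  obtain C where C: "\<And>x. \<bar>h x\<bar> \<le> C" using bmeas_bound[OF assms(2)] by blast
  show "integrable M (\<lambda>w. h w * \<psi> w)"
  proof (rule Bochner_Integration.integrable_bound[where f="\<lambda>w. C * \<psi> w"])
    show "AE w in M. norm (h w * \<psi> w) \<le> norm (C * \<psi> w)"
      using C by (auto simp: abs_mult intro!: AE_I2 mult_right_mono intro: order_trans[OF _ abs_ge_self])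
  qed (use assms in \<open>auto simp: bmeas_def\<close>)
  then show "integrable M (\<lambda>w. \<psi> w * h w)" by (simp add: mult.commute)
qed

lemma (in finite_measure) subalgebra_vimage:
  assumes "V \<in> M \<rightarrow>\<^sub>M B"
  shows "sigma_finite_subalgebra M (vimage_algebra (space M) V B)"
proof (rule finite_measure_subalgebra_is_sigma_finite)
  have "V \<in> space M \<rightarrow> space B" using assms by (auto simp: measurable_def)
  then have "subalgebra M (vimage_algebra (space M) V B)"
    using assms by (auto simp: subalgebra_def sets_vimage_algebra2 measurable_sets)
  then show "finite_measure_subalgebra M (vimage_algebra (space M) V B)"
    by unfold_locales
qed

text \<open>The hypothesis says that \<open>E[\<psi> | V] = 0\<close>.\<close>

lemma (in finite_measure) integral_zero_extend:
  assumes \<psi>: "integrable M \<psi>" and V [measurable]: "V \<in> M \<rightarrow>\<^sub>M B"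
    and zero: "\<And>T. T \<in> sets B \<Longrightarrow> (\<integral>w. \<psi> w * indicator T (V w) \<partial>M) = 0"
    and h: "h \<in> bmeas B"
  shows "(\<integral>w. \<psi> w * h (V w) \<partial>M) = (0 :: real)"
proof -
  define F where "F = vimage_algebra (space M) V B"
  interpret F: sigma_finite_subalgebra M F unfolding F_def by (rule subalgebra_vimage[OF V])
  have VF: "V \<in> F \<rightarrow>\<^sub>M B" unfolding F_def
    using V by (intro measurable_vimage_algebra1) (auto simp: measurable_def)
  have "AE w in M. real_cond_exp M F \<psi> w = 0"
  proof (rule F.real_cond_exp_charact)
    fix A assume "A \<in> sets F"
    then obtain T where T: "T \<in> sets B" "A = V -` T \<inter> space M"
      using V by (auto simp: F_def sets_vimage_algebra2 measurable_def)
    have "(\<integral>w\<in>A. \<psi> w \<partial>M) = (\<integral>w. \<psi> w * indicator T (V w) \<partial>M)"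
      unfolding set_lebesgue_integral_def T(2)
      by (intro Bochner_Integration.integral_cong) (auto simp: indicator_def)
    then show "(\<integral>w\<in>A. \<psi> w \<partial>M) = (\<integral>w\<in>A. 0 \<partial>M)" using zero[OF T(1)] by simp
  qed (use \<psi> in auto)
  have hV: "(\<lambda>w. h (V w)) \<in> borel_measurable F"
    using measurable_compose[OF VF bmeas_measurable[OF h]] .
  have "(\<integral>w. \<psi> w * h (V w) \<partial>M) = (\<integral>w. h (V w) * \<psi> w \<partial>M)" by (simp add: mult.commute)
  also have "\<dots> = (\<integral>w. h (V w) * real_cond_exp M F \<psi> w \<partial>M)"
    using integrable_mult_bmeas(2)[OF \<psi> bmeas_comp[OF h V]] hV \<psi>
    by (intro F.real_cond_exp_intg(2)[symmetric]) auto
  also have "\<dots> = (\<integral>w. 0 \<partial>M)"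
    by (rule integral_cong_AE) (use \<open>AE w in M. real_cond_exp M F \<psi> w = 0\<close> bmeas_comp[OF h V] in \<open>auto simp: bmeas_def\<close>)
  finally show ?thesis by simp
qed

text \<open>The weight \<open>\<psi>\<close> is signed, so uniqueness of measures does not apply to
  it directly. A constant \<open>K\<close> repairs this: the image measures with weights
  \<open>K - \<psi>\<close> and \<open>K\<close> agree on rectangles, hence everywhere.\<close>

lemma (in finite_measure) integral_zero_rectangles:
  assumes \<psi>: "\<psi> \<in> bmeas M" and V [measurable]: "V \<in> M \<rightarrow>\<^sub>M B" and W [measurable]: "W \<in> M \<rightarrow>\<^sub>M C"
    and zero: "\<And>S T. S \<in> sets B \<Longrightarrow> T \<in> sets C \<Longrightarrow>
      (\<integral>w. \<psi> w * (indicator S (V w) * indicator T (W w)) \<partial>M) = 0"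
    and A: "A \<in> sets (B \<Otimes>\<^sub>M C)"
  shows "(\<integral>w. \<psi> w * indicator A (V w, W w) \<partial>M) = (0 :: real)"
proof -
  obtain K where K: "\<And>w. \<bar>\<psi> w\<bar> \<le> K" "K \<ge> 0" using bmeas_bound[OF \<psi>] by blast
  have \<psi>m [measurable]: "\<psi> \<in> borel_measurable M" using \<psi> by (rule bmeas_measurable)
  define D where "D f = distr (density M (\<lambda>w. ennreal (f w))) (B \<Otimes>\<^sub>M C) (\<lambda>w. (V w, W w))" for f
  have D: "emeasure (D f) A = ennreal (\<integral>w. f w * indicator A (V w, W w) \<partial>M)"
    if f: "f \<in> bmeas M" "\<And>w. f w \<ge> 0" and A [measurable]: "A \<in> sets (B \<Otimes>\<^sub>M C)" for f A
  proof -
    have [measurable]: "f \<in> borel_measurable M" using f by (simp add: bmeas_def)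
    have "emeasure (D f) A = emeasure (density M (\<lambda>w. ennreal (f w))) ((\<lambda>w. (V w, W w)) -` A \<inter> space M)"
      unfolding D_def by (subst emeasure_distr) auto
    also have "\<dots> = (\<integral>\<^sup>+w. ennreal (f w) * indicator ((\<lambda>w. (V w, W w)) -` A \<inter> space M) w \<partial>M)"
      by (rule emeasure_density) measurable
    also have "\<dots> = (\<integral>\<^sup>+w. ennreal (f w * indicator A (V w, W w)) \<partial>M)"
      by (intro nn_integral_cong) (auto split: split_indicator)
    also have "\<dots> = ennreal (\<integral>w. f w * indicator A (V w, W w) \<partial>M)"
      using f by (intro nn_integral_eq_integral integrable_mult_bmeas bmeas_integrable
          bmeas_comp[OF bmeas_indicator[OF A]]) auto
    finally show ?thesis .
  qed
  have b1: "(\<lambda>w. K - \<psi> w) \<in> bmeas M" "(\<lambda>w. K) \<in> bmeas M"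
  proof -
    show "(\<lambda>w. K) \<in> bmeas M" using K(2) by (intro bmeasI[where C=K]) auto
    from bmeas_diff[OF this \<psi>] show "(\<lambda>w. K - \<psi> w) \<in> bmeas M" .
  qed
  have nn: "K - \<psi> w \<ge> 0" for w using K(1)[of w] by linarith
  have eq_int: "(\<integral>w. (K - \<psi> w) * g w \<partial>M) = (\<integral>w. K * g w \<partial>M) - (\<integral>w. \<psi> w * g w \<partial>M)" if "g \<in> bmeas M" for g
    unfolding left_diff_distrib
    by (intro Bochner_Integration.integral_diff integrable_mult_bmeas bmeas_integrable b1 that \<psi>)
  have "D (\<lambda>w. K - \<psi> w) = D (\<lambda>w. K)"
  proof (rule measure_eqI_rectangles)
    show "finite_measure (D (\<lambda>w. K - \<psi> w))"
    proof (rule finite_measureI)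
      have "space (D (\<lambda>w. K - \<psi> w)) = space (B \<Otimes>\<^sub>M C)" by (simp add: D_def)
      then show "emeasure (D (\<lambda>w. K - \<psi> w)) (space (D (\<lambda>w. K - \<psi> w))) \<noteq> \<infinity>"
        using D[OF b1(1) nn] by simp
    qed
    fix S T assume S [measurable]: "S \<in> sets B" and T [measurable]: "T \<in> sets C"
    let ?g = "\<lambda>w. indicator S (V w) * indicator T (W w) :: real"
    have g: "?g \<in> bmeas M"
      by (rule bmeas_mult[OF bmeas_comp[OF bmeas_indicator[OF S] V] bmeas_comp[OF bmeas_indicator[OF T] W]])
    have ind: "indicator (S \<times> T) (V w, W w) = ?g w" for w by (simp add: indicator_def)
    show "emeasure (D (\<lambda>w. K - \<psi> w)) (S \<times> T) = emeasure (D (\<lambda>w. K)) (S \<times> T)"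
      using D[OF b1(1) nn, of "S \<times> T"] D[OF b1(2), of "S \<times> T"] eq_int[OF g] zero[OF S T] K(2)
      by (simp add: ind del: indicator_simps)
  qed (simp_all add: D_def)
  then have "ennreal (\<integral>w. (K - \<psi> w) * indicator A (V w, W w) \<partial>M) = ennreal (\<integral>w. K * indicator A (V w, W w) \<partial>M)"
    using D[OF b1(1) nn A] D[OF b1(2) _ A] K(2) by simp
  moreover have "(\<integral>w. (K - \<psi> w) * indicator A (V w, W w) \<partial>M) \<ge> 0"
    using nn by (intro integral_nonneg_AE) auto
  ultimately have "(\<integral>w. (K - \<psi> w) * indicator A (V w, W w) \<partial>M) = (\<integral>w. K * indicator A (V w, W w) \<partial>M)"
    using K(2) by (subst (asm) ennreal_inj) (auto intro!: integral_nonneg_AE)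
  then show ?thesis
    using eq_int[of "\<lambda>w. indicator A (V w, W w)"] bmeas_comp[OF bmeas_indicator[OF A], of "\<lambda>w. (V w, W w)" M]
    by simp
qed

text \<open>\<open>k S (W w)\<close> is a version of the conditional probability of
  \<open>U \<in> S\<close> given \<open>W\<close>. Since it can be pulled into the conditional
  expectation, independence means that the indicator of \<open>U \<in> S\<close> and
  \<open>k S (W w)\<close>, each multiplied by the indicator of \<open>V \<in> T\<close>, have the
  same conditional expectation. Integration over \<open>W \<in> G\<close> gives a condition that is
  linear in the joint law once \<open>k\<close> is fixed.\<close>

lemma (in prob_space) cond_indep_iff_integral:
  assumes U [measurable]: "U \<in> M \<rightarrow>\<^sub>M A" and V [measurable]: "V \<in> M \<rightarrow>\<^sub>M B" and W [measurable]: "W \<in> M \<rightarrow>\<^sub>M C"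
    and k: "\<And>S. S \<in> sets A \<Longrightarrow> k S \<in> bmeas C"
    and k_int: "\<And>S G. S \<in> sets A \<Longrightarrow> G \<in> sets C \<Longrightarrow>
      (\<integral>w. (indicator S (U w) - k S (W w)) * indicator G (W w) \<partial>M) = 0"
  shows "cond_indep M A U B V C W \<longleftrightarrow> (\<forall>S\<in>sets A. \<forall>T\<in>sets B. \<forall>G\<in>sets C.
      (\<integral>w. (indicator S (U w) - k S (W w)) * indicator G (W w) * indicator T (V w) \<partial>M) = 0)"
proof -
  define F where "F = vimage_algebra (space M) W C"
  interpret F: sigma_finite_subalgebra M F unfolding F_def by (rule subalgebra_vimage[OF W])
  have WF: "W \<in> F \<rightarrow>\<^sub>M C" unfolding F_def
    using W by (intro measurable_vimage_algebra1) (auto simp: measurable_def)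
  have setF: "\<exists>G\<in>sets C. D = W -` G \<inter> space M" if "D \<in> sets F" for D
    using that W by (auto simp: F_def sets_vimage_algebra2 measurable_def)
  have setF': "W -` G \<inter> space M \<in> sets F" if "G \<in> sets C" for G
    using that W unfolding F_def by (subst sets_vimage_algebra2) (auto simp: measurable_def)
  have set_int: "(\<integral>w\<in>W -` G \<inter> space M. f w \<partial>M) = (\<integral>w. f w * indicator G (W w) \<partial>M)" for f :: "_ \<Rightarrow> real" and G
    unfolding set_lebesgue_integral_def
    by (intro Bochner_Integration.integral_cong) (auto simp: indicator_def)
  have kW: "(\<lambda>w. k S (W w)) \<in> bmeas M" "(\<lambda>w. k S (W w)) \<in> borel_measurable F" if "S \<in> sets A" for S
    using bmeas_comp[OF k[OF that] W] measurable_compose[OF WF bmeas_measurable[OF k[OF that]]] by auto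
  have indU: "(\<lambda>w. indicator S (U w) :: real) \<in> bmeas M" if "S \<in> sets A" for S
    by (rule bmeas_comp[OF bmeas_indicator[OF that] U])
  have indV: "(\<lambda>w. indicator T (V w) :: real) \<in> bmeas M" if "T \<in> sets B" for T
    by (rule bmeas_comp[OF bmeas_indicator[OF that] V])
  have indW: "(\<lambda>w. indicator G (W w) :: real) \<in> bmeas M" if "G \<in> sets C" for G
    by (rule bmeas_comp[OF bmeas_indicator[OF that] W])
  have ceU: "AE w in M. real_cond_exp M F (\<lambda>w. indicator S (U w)) w = k S (W w)" if S: "S \<in> sets A" for S
  proof (rule F.real_cond_exp_charact)
    fix D assume "D \<in> sets F"
    then obtain G where G: "G \<in> sets C" "D = W -` G \<inter> space M" using setF by auto
    have "(\<integral>w. indicator S (U w) * indicator G (W w) \<partial>M) - (\<integral>w. k S (W w) * indicator G (W w) \<partial>M)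
      = (\<integral>w. (indicator S (U w) - k S (W w)) * indicator G (W w) \<partial>M)"
      unfolding left_diff_distrib
      by (intro Bochner_Integration.integral_diff[symmetric] bmeas_integrable bmeas_mult indU kW indW S G)
    then show "(\<integral>w\<in>D. indicator S (U w) \<partial>M) = (\<integral>w\<in>D. k S (W w) \<partial>M)"
      using k_int[OF S G(1)] by (simp add: G(2) set_int)
  qed (use kW[OF S] indU[OF S] bmeas_integrable in auto)
  have ind_eq: "indicator (U -` S) = (\<lambda>w. indicator S (U w) :: real)"
    "indicator (V -` T) = (\<lambda>w. indicator T (V w) :: real)"
    "indicator (U -` S \<inter> V -` T) = (\<lambda>w. indicator S (U w) * indicator T (V w) :: real)" for S T
    by (auto simp: indicator_def)
  have key: "(AE w in M. real_cond_exp M F (\<lambda>w. indicator S (U w) * indicator T (V w)) w =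
        real_cond_exp M F (\<lambda>w. indicator S (U w)) w * real_cond_exp M F (\<lambda>w. indicator T (V w)) w)
      \<longleftrightarrow> (\<forall>G\<in>sets C. (\<integral>w. (indicator S (U w) - k S (W w)) * indicator G (W w) * indicator T (V w) \<partial>M) = 0)"
    (is "?L \<longleftrightarrow> ?R")
    if S [measurable]: "S \<in> sets A" and T [measurable]: "T \<in> sets B" for S T
  proof -
    let ?ce = "real_cond_exp M F (\<lambda>w. indicator S (U w) * indicator T (V w))"
    let ?kT = "real_cond_exp M F (\<lambda>w. k S (W w) * indicator T (V w))"
    have i1: "integrable M (\<lambda>w. indicator S (U w) * indicator T (V w) :: real)"
      "integrable M (\<lambda>w. k S (W w) * indicator T (V w))"
      by (intro bmeas_integrable bmeas_mult indU indV kW S T)+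
    have mult: "AE w in M. ?kT w = k S (W w) * real_cond_exp M F (\<lambda>w. indicator T (V w)) w"
      using kW[OF S] indV[OF T] i1(2) by (intro F.real_cond_exp_mult) (auto simp: bmeas_def)
    have L_iff: "?L \<longleftrightarrow> (AE w in M. ?ce w = ?kT w)"
    proof
      assume ?L then show "AE w in M. ?ce w = ?kT w" using mult ceU[OF S] by eventually_elim auto
    next
      assume "AE w in M. ?ce w = ?kT w"
      then show ?L using mult ceU[OF S] by eventually_elim auto
    qed
    have int_eq: "(\<integral>w. (indicator S (U w) - k S (W w)) * indicator G (W w) * indicator T (V w) \<partial>M)
       = (\<integral>w\<in>W -` G \<inter> space M. indicator S (U w) * indicator T (V w) \<partial>M) - (\<integral>w\<in>W -` G \<inter> space M. k S (W w) * indicator T (V w) \<partial>M)"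
      if G: "G \<in> sets C" for G
    proof -
      have "(\<integral>w. (indicator S (U w) - k S (W w)) * indicator G (W w) * indicator T (V w) \<partial>M)
        = (\<integral>w. indicator S (U w) * indicator T (V w) * indicator G (W w) - k S (W w) * indicator T (V w) * indicator G (W w) \<partial>M)"
        by (intro Bochner_Integration.integral_cong) (auto simp: algebra_simps)
      also have "\<dots> = (\<integral>w. indicator S (U w) * indicator T (V w) * indicator G (W w) \<partial>M) - (\<integral>w. k S (W w) * indicator T (V w) * indicator G (W w) \<partial>M)"
        by (intro Bochner_Integration.integral_diff bmeas_integrable bmeas_mult indU indV indW kW S T G)
      finally show ?thesis by (simp add: set_int)
    qed
    show ?thesis
    proof
      assume ?L
      then have ae: "AE w in M. ?ce w = ?kT w" using L_iff by simp
      show ?R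
      proof
        fix G assume G: "G \<in> sets C"
        have "(\<integral>w\<in>W -` G \<inter> space M. indicator S (U w) * indicator T (V w) \<partial>M) = (\<integral>w\<in>W -` G \<inter> space M. ?ce w \<partial>M)"
          by (rule F.real_cond_exp_intA[OF i1(1) setF'[OF G]])
        also have "\<dots> = (\<integral>w\<in>W -` G \<inter> space M. ?kT w \<partial>M)"
          unfolding set_lebesgue_integral_def
          by (rule integral_cong_AE) (use ae G in \<open>auto intro!: borel_measurable_indicator measurable_sets[OF W]\<close>)
        also have "\<dots> = (\<integral>w\<in>W -` G \<inter> space M. k S (W w) * indicator T (V w) \<partial>M)"
          by (rule F.real_cond_exp_intA[OF i1(2) setF'[OF G], symmetric])
        finally show "(\<integral>w. (indicator S (U w) - k S (W w)) * indicator G (W w) * indicator T (V w) \<partial>M) = 0"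
          using int_eq[OF G] by simp
      qed
    next
      assume R: ?R
      have "AE w in M. ?ce w = ?kT w"
      proof (rule F.real_cond_exp_charact)
        fix D assume "D \<in> sets F"
        then obtain G where G: "G \<in> sets C" "D = W -` G \<inter> space M" using setF by auto
        have "(\<integral>w\<in>D. indicator S (U w) * indicator T (V w) \<partial>M) = (\<integral>w\<in>D. k S (W w) * indicator T (V w) \<partial>M)"
          using int_eq[OF G(1)] R G by simp
        also have "\<dots> = (\<integral>w\<in>D. ?kT w \<partial>M)"
          using \<open>D \<in> sets F\<close> by (rule F.real_cond_exp_intA[OF i1(2)])
        finally show "(\<integral>w\<in>D. indicator S (U w) * indicator T (V w) \<partial>M) = (\<integral>w\<in>D. ?kT w \<partial>M)" .
      qed (use i1 F.real_cond_exp_int(1) in auto)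
      then show ?L using L_iff by simp
    qed
  qed
  show ?thesis
    unfolding cond_indep_def Let_def F_def[symmetric] ind_eq using key by blast
qed

text \<open>Here \<open>k(W)\<close> is a version of \<open>E[h(V) | W]\<close>, bounded everywhere.\<close>

lemma (in prob_space) cond_exp_function:
  assumes B: "polish T" and V [measurable]: "V \<in> M \<rightarrow>\<^sub>M borel_of T" and W [measurable]: "W \<in> M \<rightarrow>\<^sub>M C"
    and h: "h \<in> bmeas (borel_of T)"
  obtains k where "k \<in> bmeas C"
    "\<And>g. g \<in> bmeas C \<Longrightarrow> (\<integral>w. (h (V w) - k (W w)) * g (W w) \<partial>M) = 0"
proof -
  define \<gamma> where "\<gamma> = distr M (C \<Otimes>\<^sub>M borel_of T) (\<lambda>w. (W w, V w))"
  have \<gamma>p: "prob_space \<gamma>" unfolding \<gamma>_def by (rule prob_space_distr) measurable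
  have \<gamma>s: "sets \<gamma> = sets (C \<Otimes>\<^sub>M borel_of T)" by (simp add: \<gamma>_def)
  obtain f where f [measurable]: "f \<in> C \<Otimes>\<^sub>M borel \<rightarrow>\<^sub>M borel_of T"
    and fd: "distr (distr \<gamma> C fst \<Otimes>\<^sub>M unif) (C \<Otimes>\<^sub>M borel_of T) (\<lambda>(x, u). (x, f (x, u))) = \<gamma>"
    by (rule polish_randomization[OF B \<gamma>p \<gamma>s]) (rule that)
  have \<mu>: "distr \<gamma> C fst = distr M C W" unfolding \<gamma>_def by (subst distr_distr) (auto simp: comp_def)
  interpret \<mu>: prob_space "distr M C W" by (rule prob_space_distr) measurable
  interpret U: prob_space unif by (rule prob_space_unif)
  interpret P: pair_prob_space "distr M C W" unif ..
  obtain K where K: "\<And>x. \<bar>h x\<bar> \<le> K" "K \<ge> 0" using bmeas_bound[OF h] by blast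
  have hm [measurable]: "h \<in> borel_measurable (borel_of T)" using h by (rule bmeas_measurable)
  define k where "k x = (if x \<in> space C then \<integral>u. h (f (x, u)) \<partial>unif else 0)" for x
  have km: "k \<in> borel_measurable C"
  proof -
    have "(\<lambda>x. \<integral>u. h (f (x, u)) \<partial>unif) \<in> borel_measurable C"
      by (rule U.borel_measurable_lebesgue_integral) simp
    then show ?thesis by (subst measurable_cong[where g="\<lambda>x. \<integral>u. h (f (x, u)) \<partial>unif"]) (auto simp: k_def)
  qed
  have kb: "\<bar>k x\<bar> \<le> K" for x
  proof (cases "x \<in> space C")
    case True
    have "integrable unif (\<lambda>u. h (f (x, u)))"
      using K True by (intro U.integrable_const_bound[where B=K]) auto
    then have "\<bar>\<integral>u. h (f (x, u)) \<partial>unif\<bar> \<le> (\<integral>u. K \<partial>unif)"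
      using K by (intro order_trans[OF integral_abs_bound] integral_mono) auto
    then show ?thesis using True U.prob_space by (simp add: k_def)
  qed (use K(2) in \<open>simp add: k_def\<close>)
  have kbm: "k \<in> bmeas C" using km kb by (rule bmeasI)
  show thesis
  proof (rule that[OF kbm])
    fix g assume g: "g \<in> bmeas C"
    then have gm [measurable]: "g \<in> borel_measurable C" by (rule bmeas_measurable)
    have i: "integrable M (\<lambda>w. h (V w) * g (W w))" "integrable M (\<lambda>w. k (W w) * g (W w))"
      by (intro bmeas_integrable bmeas_mult bmeas_comp[OF h V] bmeas_comp[OF g W] bmeas_comp[OF kbm W])+
    have "(\<integral>w. h (V w) * g (W w) \<partial>M) = (\<integral>z. h (snd z) * g (fst z) \<partial>\<gamma>)"
      unfolding \<gamma>_def by (subst integral_distr) auto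
    also have "\<dots> = (\<integral>z. h (f z) * g (fst z) \<partial>(distr M C W \<Otimes>\<^sub>M unif))"
      by (subst fd[symmetric], unfold \<mu>, subst integral_distr) (auto simp: case_prod_unfold)
    also have "\<dots> = (\<integral>x. (\<integral>u. h (f (x, u)) * g x \<partial>unif) \<partial>distr M C W)"
    proof -
      have "(\<lambda>z. h (f z) * g (fst z)) \<in> bmeas (distr M C W \<Otimes>\<^sub>M unif)"
        by (intro bmeas_mult bmeas_comp[OF h] bmeas_comp[OF g]) (auto simp: measurable_cong_sets[OF sets_pair_measure_cong[OF sets_distr sets_unif] refl])
      then have "integrable (distr M C W \<Otimes>\<^sub>M unif) (\<lambda>z. h (f z) * g (fst z))"
        by (rule P.bmeas_integrable)
      from P.integral_fst'[OF this] show ?thesis by simp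
    qed
    also have "\<dots> = (\<integral>x. k x * g x \<partial>distr M C W)"
      by (intro Bochner_Integration.integral_cong) (auto simp: k_def)
    also have "\<dots> = (\<integral>w. k (W w) * g (W w) \<partial>M)"
      using km by (subst integral_distr) auto
    finally show "(\<integral>w. (h (V w) - k (W w)) * g (W w) \<partial>M) = 0"
      unfolding left_diff_distrib using i by (subst Bochner_Integration.integral_diff) auto
  qed
qed

section \<open>Causality as a family of linear constraints\<close>

lemma continuous_map_paths_update:
  "continuous_map (prod_topology (paths t X) (X (Suc t))) (paths (Suc t) X) (\<lambda>(x, a). x(Suc t := a))"
  unfolding paths_def continuous_map_componentwise
proof (intro conjI ballI)
  show "(\<lambda>(x, a). x(Suc t := a)) ` topspace (prod_topology (product_topology X {1..t}) (X (Suc t)))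
    \<subseteq> extensional {1..Suc t}"
    by (auto simp: extensional_def PiE_def)
  fix k assume k: "k \<in> {1..Suc t}"
  show "continuous_map (prod_topology (product_topology X {1..t}) (X (Suc t))) (X k)
     (\<lambda>x. (case x of (x, a) \<Rightarrow> x(Suc t := a)) k)"
  proof (cases "k = Suc t")
    case True
    show ?thesis unfolding True
      by (rule continuous_map_eq[OF continuous_map_snd]) auto
  next
    case False
    then have "continuous_map (prod_topology (product_topology X {1..t}) (X (Suc t))) (X k)
        ((\<lambda>x. x k) \<circ> fst)"
      using k by (intro continuous_map_compose[OF continuous_map_fst]
          continuous_map_product_projection) auto
    then show ?thesis using False by (simp add: case_prod_unfold o_def)
  qed
qed

text \<open>Stated for random variables on an arbitrary space because gluing puts four paths on one
  space and needs causality of several pairs among them. Anticausality is the same notion with the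
  two paths exchanged.\<close>

definition causal_rv ::
    "nat \<Rightarrow> (nat \<Rightarrow> 'a topology) \<Rightarrow> (nat \<Rightarrow> 'b topology) \<Rightarrow> 'w measure \<Rightarrow>
     ('w \<Rightarrow> nat \<Rightarrow> 'a) \<Rightarrow> ('w \<Rightarrow> nat \<Rightarrow> 'b) \<Rightarrow> bool" where
  "causal_rv N X Y M \<xi> \<zeta> \<longleftrightarrow> (\<forall>t\<in>{1..<N}.
     cond_indep M (borel_of (X (t + 1))) (\<lambda>w. \<xi> w (t + 1))
       (borel_of (paths t Y)) (\<lambda>w. restrict (\<zeta> w) {1..t})
       (borel_of (paths t X)) (\<lambda>w. restrict (\<xi> w) {1..t}))"

lemma causal_eq_causal_rv: "causal N X Y \<pi> \<longleftrightarrow> causal_rv N X Y \<pi> fst snd"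
  by (simp add: causal_def causal_rv_def case_prod_unfold)

lemma anticausal_eq_causal_rv: "anticausal N X Y \<pi> \<longleftrightarrow> causal_rv N Y X \<pi> snd fst"
  by (simp add: anticausal_def causal_rv_def case_prod_unfold)

lemma measurable_paths_restrict:
  "t \<le> N \<Longrightarrow> (\<lambda>x. restrict x {1..t}) \<in> borel_of (paths N X) \<rightarrow>\<^sub>M borel_of (paths t X)"
  by (intro measurable_continuous_map continuous_map_paths_restrict)

lemma measurable_paths_component:
  "t \<in> {1..N} \<Longrightarrow> (\<lambda>x. x t) \<in> borel_of (paths N X) \<rightarrow>\<^sub>M borel_of (X t)"
  by (intro measurable_continuous_map continuous_map_paths_component)

lemma restrict_paths: "x \<in> topspace (paths N X) \<Longrightarrow> restrict x {1..N} = x"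
  by (auto simp: paths_def PiE_def extensional_restrict)

lemma restrict_restrict_initial: "t \<le> s \<Longrightarrow> restrict (restrict x {1..s}) {1..t} = restrict x {1..(t::nat)}"
  by (auto simp: restrict_def fun_eq_iff)

text \<open>Causality with respect to a fixed first marginal \<open>\<mu>\<close> is a family of linear constraints
  \<open>\<integral>\<phi>(x) h(y) \<pi>(dx, dy) = 0\<close>; here \<open>k\<close> is a version of \<open>\<mu>(X (t + 1) \<in> S | X 1, \<dots>, X t)\<close>.\<close>

definition causal_test ::
    "nat \<Rightarrow> (nat \<Rightarrow> 'a topology) \<Rightarrow> (nat \<Rightarrow> 'b topology) \<Rightarrow> (nat \<Rightarrow> 'a) measure \<Rightarrow>
     ((nat \<Rightarrow> 'a) \<Rightarrow> real) \<Rightarrow> ((nat \<Rightarrow> 'b) \<Rightarrow> real) \<Rightarrow> bool" where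
  "causal_test N X Y \<mu> \<phi> h \<longleftrightarrow> (\<exists>t\<in>{1..<N}. \<exists>S\<in>sets (borel_of (X (t + 1))).
     \<exists>G\<in>sets (borel_of (paths t X)). \<exists>T\<in>sets (borel_of (paths t Y)). \<exists>k\<in>bmeas (borel_of (paths t X)).
     (\<forall>G\<in>sets (borel_of (paths t X)).
        (\<integral>x. (indicator S (x (t + 1)) - k (restrict x {1..t})) * indicator G (restrict x {1..t}) \<partial>\<mu>) = 0) \<and>
     \<phi> = (\<lambda>x. (indicator S (x (t + 1)) - k (restrict x {1..t})) * indicator G (restrict x {1..t})) \<and>
     h = (\<lambda>y. indicator T (restrict y {1..t})))"

lemma causal_test_bmeas:
  assumes "causal_test N X Y \<mu> \<phi> h"
  shows "\<phi> \<in> bmeas (borel_of (paths N X))" "h \<in> bmeas (borel_of (paths N Y))"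
proof -
  obtain t S G T k where t: "t \<in> {1..<N}" and S: "S \<in> sets (borel_of (X (t + 1)))"
    and G: "G \<in> sets (borel_of (paths t X))" and T: "T \<in> sets (borel_of (paths t Y))"
    and k: "k \<in> bmeas (borel_of (paths t X))"
    and \<phi>: "\<phi> = (\<lambda>x. (indicator S (x (t + 1)) - k (restrict x {1..t})) * indicator G (restrict x {1..t}))"
    and h: "h = (\<lambda>y. indicator T (restrict y {1..t}))"
    using assms unfolding causal_test_def by blast
  have r: "t \<le> N" "t + 1 \<in> {1..N}" using t by auto
  show "\<phi> \<in> bmeas (borel_of (paths N X))" unfolding \<phi>
    by (intro bmeas_mult bmeas_diff bmeas_comp[OF bmeas_indicator[OF S] measurable_paths_component[where X=X, OF r(2)]]
        bmeas_comp[OF bmeas_indicator[OF G] measurable_paths_restrict[OF r(1)]]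
        bmeas_comp[OF k measurable_paths_restrict[OF r(1)]])
  show "h \<in> bmeas (borel_of (paths N Y))" unfolding h
    by (rule bmeas_comp[OF bmeas_indicator[OF T] measurable_paths_restrict[OF r(1)]])
qed

lemma causal_test_integral:
  assumes "causal_test N X Y \<mu> \<phi> h"
  shows "(\<integral>x. \<phi> x \<partial>\<mu>) = 0"
  using assms unfolding causal_test_def by blast

text \<open>Versions of the conditional probability may be exchanged, so the test can be demanded of
  all versions \<open>k\<close> at once. The resulting family involves no choice, and its side
  condition sees only the law of \<open>(U, W)\<close>. Polishness of \<open>TA\<close> supplies at
  least one version for the converse.\<close>

lemma (in prob_space) cond_indep_iff_all:
  assumes A: "polish TA" and U: "U \<in> M \<rightarrow>\<^sub>M borel_of TA" and V: "V \<in> M \<rightarrow>\<^sub>M B" and W: "W \<in> M \<rightarrow>\<^sub>M C"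
  shows "cond_indep M (borel_of TA) U B V C W \<longleftrightarrow> (\<forall>S\<in>sets (borel_of TA). \<forall>T\<in>sets B. \<forall>G\<in>sets C. \<forall>k\<in>bmeas C.
      (\<forall>G\<in>sets C. (\<integral>w. (indicator S (U w) - k (W w)) * indicator G (W w) \<partial>M) = 0) \<longrightarrow>
      (\<integral>w. (indicator S (U w) - k (W w)) * indicator G (W w) * indicator T (V w) \<partial>M) = 0)"
    (is "?L \<longleftrightarrow> ?R")
proof -
  have "\<exists>k\<in>bmeas C. \<forall>G\<in>sets C. (\<integral>w. (indicator S (U w) - k (W w)) * indicator G (W w) \<partial>M) = 0"
    if S: "S \<in> sets (borel_of TA)" for S
    by (rule cond_exp_function[OF A U W bmeas_indicator[OF S]]) (use bmeas_indicator in blast)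
  then have "\<forall>S\<in>sets (borel_of TA). \<exists>k. k \<in> bmeas C \<and>
      (\<forall>G\<in>sets C. (\<integral>w. (indicator S (U w) - k (W w)) * indicator G (W w) \<partial>M) = 0)" by blast
  from bchoice[OF this] obtain \<kappa> where \<kappa>: "\<And>S. S \<in> sets (borel_of TA) \<Longrightarrow> \<kappa> S \<in> bmeas C"
    "\<And>S G. S \<in> sets (borel_of TA) \<Longrightarrow> G \<in> sets C \<Longrightarrow>
      (\<integral>w. (indicator S (U w) - \<kappa> S (W w)) * indicator G (W w) \<partial>M) = 0" by blast
  note iff = cond_indep_iff_integral[OF U V W]
  show ?thesis
  proof
    assume L: ?L
    show ?R
    proof (intro ballI impI)
      fix S T G k assume S: "S \<in> sets (borel_of TA)" and T: "T \<in> sets B" and G: "G \<in> sets C" and k: "k \<in> bmeas C"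
        and z: "\<forall>G\<in>sets C. (\<integral>w. (indicator S (U w) - k (W w)) * indicator G (W w) \<partial>M) = 0"
      \<comment> \<open>The characterization asks for one version per set; replacing the chosen one
        at the single set \<open>S\<close> brings in the given \<open>k\<close>.\<close>
      define \<kappa>' where "\<kappa>' = \<kappa>(S := k)"
      have "\<And>S. S \<in> sets (borel_of TA) \<Longrightarrow> \<kappa>' S \<in> bmeas C"
        "\<And>S G. S \<in> sets (borel_of TA) \<Longrightarrow> G \<in> sets C \<Longrightarrow>
          (\<integral>w. (indicator S (U w) - \<kappa>' S (W w)) * indicator G (W w) \<partial>M) = 0"
        using \<kappa> z k by (auto simp: \<kappa>'_def)
      from iff[of \<kappa>', OF this] L
      have "(\<integral>w. (indicator S (U w) - \<kappa>' S (W w)) * indicator G (W w) * indicator T (V w) \<partial>M) = 0"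
        using S T G by blast
      then show "(\<integral>w. (indicator S (U w) - k (W w)) * indicator G (W w) * indicator T (V w) \<partial>M) = 0"
        by (simp add: \<kappa>'_def)
    qed
  next
    assume R: ?R
    show ?L using iff[of \<kappa>, OF \<kappa>] R \<kappa> by blast
  qed
qed

text \<open>The side condition on \<open>k\<close> is an integral against the first marginal alone.
  All couplings with the same first marginal therefore face the same tests, which is the source of
  stability under limits and mixtures.\<close>

lemma causal_rv_iff_test:
  assumes "prob_space M" and X: "\<And>t. t \<in> {1..N} \<Longrightarrow> polish (X t)"
    and \<xi> [measurable]: "\<xi> \<in> M \<rightarrow>\<^sub>M borel_of (paths N X)" and \<zeta> [measurable]: "\<zeta> \<in> M \<rightarrow>\<^sub>M borel_of (paths N Y)"
    and \<mu>: "distr M (borel_of (paths N X)) \<xi> = \<mu>"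
  shows "causal_rv N X Y M \<xi> \<zeta> \<longleftrightarrow> (\<forall>\<phi> h. causal_test N X Y \<mu> \<phi> h \<longrightarrow> (\<integral>w. \<phi> (\<xi> w) * h (\<zeta> w) \<partial>M) = 0)"
proof -
  interpret prob_space M by fact
  have iff: "cond_indep M (borel_of (X (t + 1))) (\<lambda>w. \<xi> w (t + 1))
       (borel_of (paths t Y)) (\<lambda>w. restrict (\<zeta> w) {1..t})
       (borel_of (paths t X)) (\<lambda>w. restrict (\<xi> w) {1..t}) \<longleftrightarrow>
     (\<forall>S\<in>sets (borel_of (X (t + 1))). \<forall>T\<in>sets (borel_of (paths t Y)). \<forall>G\<in>sets (borel_of (paths t X)).
       \<forall>k\<in>bmeas (borel_of (paths t X)).
      (\<forall>G\<in>sets (borel_of (paths t X)). (\<integral>x. (indicator S (x (t + 1)) - k (restrict x {1..t})) * indicator G (restrict x {1..t}) \<partial>\<mu>) = 0) \<longrightarrow>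
      (\<integral>w. (indicator S (\<xi> w (t + 1)) - k (restrict (\<xi> w) {1..t})) * indicator G (restrict (\<xi> w) {1..t})
        * indicator T (restrict (\<zeta> w) {1..t}) \<partial>M) = 0)"
    if t: "t \<in> {1..<N}" for t
  proof -
    have r: "t \<le> N" "t + 1 \<in> {1..N}" using t by auto
    note mr = measurable_paths_restrict[OF r(1)] and mc = measurable_paths_component[where X=X, OF r(2)]
    have eq: "(\<integral>x. (indicator S (x (t + 1)) - k (restrict x {1..t})) * indicator G (restrict x {1..t}) \<partial>\<mu>)
      = (\<integral>w. (indicator S (\<xi> w (t + 1)) - k (restrict (\<xi> w) {1..t})) * indicator G (restrict (\<xi> w) {1..t}) \<partial>M)"
      if S: "S \<in> sets (borel_of (X (t + 1)))" and G: "G \<in> sets (borel_of (paths t X))" and k: "k \<in> bmeas (borel_of (paths t X))" for S G k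
    proof -
      have "(\<lambda>x. (indicator S (x (t + 1)) - k (restrict x {1..t})) * indicator G (restrict x {1..t})) \<in> bmeas (borel_of (paths N X))"
        by (intro bmeas_mult bmeas_diff bmeas_comp[OF bmeas_indicator[OF S] mc]
          bmeas_comp[OF bmeas_indicator[OF G] mr] bmeas_comp[OF k mr])
      then show ?thesis unfolding \<mu>[symmetric] by (subst integral_distr) (auto simp: bmeas_def)
    qed
    show ?thesis
      by (subst cond_indep_iff_all[OF X[OF r(2)] measurable_compose[OF \<xi> mc] measurable_compose[OF \<zeta> mr] measurable_compose[OF \<xi> mr]])
         (intro ball_cong refl arg_cong2[where f="(\<longrightarrow>)"]; simp only: eq)
  qed
  show ?thesis
  proof
    assume L: "causal_rv N X Y M \<xi> \<zeta>"
    show "\<forall>\<phi> h. causal_test N X Y \<mu> \<phi> h \<longrightarrow> (\<integral>w. \<phi> (\<xi> w) * h (\<zeta> w) \<partial>M) = 0"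
    proof (intro allI impI)
      fix \<phi> h assume "causal_test N X Y \<mu> \<phi> h"
      then show "(\<integral>w. \<phi> (\<xi> w) * h (\<zeta> w) \<partial>M) = 0"
        using L iff unfolding causal_test_def causal_rv_def by blast
    qed
  next
    assume R: "\<forall>\<phi> h. causal_test N X Y \<mu> \<phi> h \<longrightarrow> (\<integral>w. \<phi> (\<xi> w) * h (\<zeta> w) \<partial>M) = 0"
    show "causal_rv N X Y M \<xi> \<zeta>"
      unfolding causal_rv_def
    proof (intro ballI, subst iff, assumption, intro ballI impI)
      fix t S T G k
      assume *: "t \<in> {1..<N}" "S \<in> sets (borel_of (X (t + 1)))" "T \<in> sets (borel_of (paths t Y))"
        "G \<in> sets (borel_of (paths t X))" "k \<in> bmeas (borel_of (paths t X))"
        "\<forall>G\<in>sets (borel_of (paths t X)). (\<integral>x. (indicator S (x (t + 1)) - k (restrict x {1..t})) * indicator G (restrict x {1..t}) \<partial>\<mu>) = 0"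
      then have "causal_test N X Y \<mu> (\<lambda>x. (indicator S (x (t + 1)) - k (restrict x {1..t})) * indicator G (restrict x {1..t}))
         (\<lambda>y. indicator T (restrict y {1..t}))"
        unfolding causal_test_def by blast
      from R[rule_format, OF this]
      show "(\<integral>w. (indicator S (\<xi> w (t + 1)) - k (restrict (\<xi> w) {1..t})) * indicator G (restrict (\<xi> w) {1..t})
        * indicator T (restrict (\<zeta> w) {1..t}) \<partial>M) = 0" .
    qed
  qed
qed

text \<open>Under causality the conditional law of \<open>Y 1, \<dots>, Y t\<close> given the whole path \<open>X\<close> depends
  on \<open>X 1, \<dots>, X t\<close> only.\<close>

lemma causal_rv_projection:
  assumes "prob_space M" and X: "\<And>t. t \<in> {1..N} \<Longrightarrow> polish (X t)" and Y: "\<And>t. t \<in> {1..N} \<Longrightarrow> polish (Y t)"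
    and \<xi>: "\<xi> \<in> M \<rightarrow>\<^sub>M borel_of (paths N X)" and \<zeta>: "\<zeta> \<in> M \<rightarrow>\<^sub>M borel_of (paths N Y)"
    and causal: "causal_rv N X Y M \<xi> \<zeta>" and t: "t \<in> {1..<N}" and h: "h \<in> bmeas (borel_of (paths t Y))"
  obtains K where "K \<in> bmeas (borel_of (paths t X))"
    "\<And>\<phi>. \<phi> \<in> bmeas (borel_of (paths N X)) \<Longrightarrow>
      (\<integral>w. (h (restrict (\<zeta> w) {1..t}) - K (restrict (\<xi> w) {1..t})) * \<phi> (\<xi> w) \<partial>M) = 0"
proof -
  interpret prob_space M by fact
  have PY: "polish (paths t Y)" using Y t by (intro polish_paths) auto
  have m\<xi>: "(\<lambda>w. restrict (\<xi> w) {1..s}) \<in> M \<rightarrow>\<^sub>M borel_of (paths s X)" if "s \<le> N" for s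
    by (rule measurable_compose[OF \<xi> measurable_paths_restrict[OF that]])
  have m\<zeta>: "(\<lambda>w. restrict (\<zeta> w) {1..s}) \<in> M \<rightarrow>\<^sub>M borel_of (paths s Y)" if "s \<le> N" for s
    by (rule measurable_compose[OF \<zeta> measurable_paths_restrict[OF that]])
  have tN: "t \<le> N" using t by auto
  obtain K where K: "K \<in> bmeas (borel_of (paths t X))"
    and Kz: "\<And>g. g \<in> bmeas (borel_of (paths t X)) \<Longrightarrow>
      (\<integral>w. (h (restrict (\<zeta> w) {1..t}) - K (restrict (\<xi> w) {1..t})) * g (restrict (\<xi> w) {1..t}) \<partial>M) = 0"
    by (rule cond_exp_function[OF PY m\<zeta>[OF tN] m\<xi>[OF tN] h]) blast
  define \<psi> where "\<psi> w = h (restrict (\<zeta> w) {1..t}) - K (restrict (\<xi> w) {1..t})" for w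
  have \<psi>: "\<psi> \<in> bmeas M" unfolding \<psi>_def
    by (rule bmeas_diff[OF bmeas_comp[OF h m\<zeta>[OF tN]] bmeas_comp[OF K m\<xi>[OF tN]]])
  \<comment> \<open>Induction on the horizon \<open>s\<close>: the residual \<open>\<psi>\<close> is
    orthogonal to all events of the first \<open>s\<close> coordinates of
    \<open>\<xi>\<close>.\<close>
  have main: "s \<le> N \<longrightarrow> (\<forall>A\<in>sets (borel_of (paths s X)). (\<integral>w. \<psi> w * indicator A (restrict (\<xi> w) {1..s}) \<partial>M) = 0)"
    if "t \<le> s" for s
    using that
  proof (induction s rule: dec_induct)
    case base
    show ?case unfolding \<psi>_def using Kz bmeas_indicator by blast
  next
    case (step s)
    show ?case
    proof (intro impI ballI)
      assume sN: "Suc s \<le> N"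
      fix A assume A: "A \<in> sets (borel_of (paths (Suc s) X))"
      have s: "s \<in> {1..<N}" "s \<le> N" "s + 1 \<in> {1..N}" using sN step t by auto
      have IH: "\<And>A. A \<in> sets (borel_of (paths s X)) \<Longrightarrow> (\<integral>w. \<psi> w * indicator A (restrict (\<xi> w) {1..s}) \<partial>M) = 0"
        using step.IH sN Suc_leD by blast
      note mU = measurable_compose[OF \<xi> measurable_paths_component[where X=X, OF s(3)]]
      define u where "u = (\<lambda>z. (fst z)(Suc s := snd z) :: nat \<Rightarrow> 'b)"
      have pr: "polish (paths s X)" "polish (X (s + 1))" using X s by (auto intro!: polish_paths)
      have u: "u \<in> borel_of (paths s X) \<Otimes>\<^sub>M borel_of (X (s + 1)) \<rightarrow>\<^sub>M borel_of (paths (Suc s) X)"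
      proof -
        have "continuous_map (prod_topology (paths s X) (X (Suc s))) (paths (Suc s) X) u"
          using continuous_map_paths_update[of s X] by (simp add: u_def case_prod_unfold)
        from measurable_continuous_map[OF this] show ?thesis
          using pr by (simp add: measurable_cong_sets[OF sets_borel_of_prod refl] polish_second_countable)
      qed
      define A' where "A' = u -` A \<inter> space (borel_of (paths s X) \<Otimes>\<^sub>M borel_of (X (s + 1)))"
      have A': "A' \<in> sets (borel_of (paths s X) \<Otimes>\<^sub>M borel_of (X (s + 1)))"
        unfolding A'_def using u A by (rule measurable_sets)
      have "(\<integral>w. \<psi> w * indicator A' (restrict (\<xi> w) {1..s}, \<xi> w (s + 1)) \<partial>M) = 0"
      proof (rule integral_zero_rectangles[OF \<psi> m\<xi>[OF s(2)] mU _ A'])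
        fix G S assume G: "G \<in> sets (borel_of (paths s X))" and S: "S \<in> sets (borel_of (X (s + 1)))"
        obtain k where k: "k \<in> bmeas (borel_of (paths s X))"
          and kz: "\<And>g. g \<in> bmeas (borel_of (paths s X)) \<Longrightarrow>
            (\<integral>w. (indicator S (\<xi> w (s + 1)) - k (restrict (\<xi> w) {1..s})) * g (restrict (\<xi> w) {1..s}) \<partial>M) = 0"
          by (rule cond_exp_function[OF pr(2) mU m\<xi>[OF s(2)] bmeas_indicator[OF S]]) blast
        define d where "d w = (indicator S (\<xi> w (s + 1)) - k (restrict (\<xi> w) {1..s})) * indicator G (restrict (\<xi> w) {1..s})" for w
        have ind_s: "(\<lambda>w. indicator G (restrict (\<xi> w) {1..s})) \<in> bmeas M"
          by (rule bmeas_comp[OF bmeas_indicator[OF G] m\<xi>[OF s(2)]])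
        have d: "d \<in> bmeas M" unfolding d_def
          by (intro bmeas_mult bmeas_diff bmeas_comp[OF bmeas_indicator[OF S] mU] bmeas_comp[OF k m\<xi>[OF s(2)]] ind_s)
        have dT: "(\<integral>w. d w * indicator T (restrict (\<zeta> w) {1..s}) \<partial>M) = 0" if T: "T \<in> sets (borel_of (paths s Y))" for T
        proof -
          have ci: "cond_indep M (borel_of (X (s + 1))) (\<lambda>w. \<xi> w (s + 1))
             (borel_of (paths s Y)) (\<lambda>w. restrict (\<zeta> w) {1..s})
             (borel_of (paths s X)) (\<lambda>w. restrict (\<xi> w) {1..s})"
            using causal s(1) unfolding causal_rv_def by blast
          have "\<forall>G\<in>sets (borel_of (paths s X)).
            (\<integral>w. (indicator S (\<xi> w (s + 1)) - k (restrict (\<xi> w) {1..s})) * indicator G (restrict (\<xi> w) {1..s}) \<partial>M) = 0"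
            using kz bmeas_indicator by blast
          then show ?thesis
            using cond_indep_iff_all[OF pr(2) mU m\<zeta>[OF s(2)] m\<xi>[OF s(2)], THEN iffD1, OF ci] S T G k
            unfolding d_def by blast
        qed
        \<comment> \<open>The indicator of \<open>S\<close> is split into its conditional
          expectation \<open>k\<close> and a residual, whose product with the indicator of
          \<open>G\<close> is \<open>d\<close>. Against \<open>d\<close>, the part \<open>h\<close>
          vanishes by causality at time \<open>s\<close> and the part \<open>K\<close> because it is
          a function of the conditioning path; the remaining term carries \<open>k\<close> and
          vanishes by induction.\<close>
        have 1: "(\<integral>w. d w * h (restrict (\<zeta> w) {1..t}) \<partial>M) = 0"
          using integral_zero_extend[OF bmeas_integrable[OF d] m\<zeta>[OF s(2)] dT
            bmeas_comp[OF h measurable_paths_restrict[OF \<open>t \<le> s\<close>]]]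
          by (simp only: restrict_restrict_initial[OF \<open>t \<le> s\<close>])
        have 2: "(\<integral>w. d w * K (restrict (\<xi> w) {1..t}) \<partial>M) = 0"
          using kz[OF bmeas_mult[OF bmeas_indicator[OF G] bmeas_comp[OF K measurable_paths_restrict[OF \<open>t \<le> s\<close>]]]]
          unfolding d_def restrict_restrict_initial[OF \<open>t \<le> s\<close>] by (simp only: mult.assoc)
        have 3: "(\<integral>w. \<psi> w * (k (restrict (\<xi> w) {1..s}) * indicator G (restrict (\<xi> w) {1..s})) \<partial>M) = 0"
          by (rule integral_zero_extend[OF bmeas_integrable[OF \<psi>] m\<xi>[OF s(2)] IH bmeas_mult[OF k bmeas_indicator[OF G]]])
        have i: "integrable M (\<lambda>w. d w * h (restrict (\<zeta> w) {1..t}))" "integrable M (\<lambda>w. d w * K (restrict (\<xi> w) {1..t}))"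
          "integrable M (\<lambda>w. \<psi> w * (k (restrict (\<xi> w) {1..s}) * indicator G (restrict (\<xi> w) {1..s})))"
          by (rule bmeas_integrable, intro bmeas_mult d \<psi> ind_s bmeas_comp[OF h m\<zeta>[OF tN]] bmeas_comp[OF K m\<xi>[OF tN]]
            bmeas_comp[OF k m\<xi>[OF s(2)]])+
        have "(\<integral>w. \<psi> w * (indicator G (restrict (\<xi> w) {1..s}) * indicator S (\<xi> w (s + 1))) \<partial>M)
          = (\<integral>w. d w * h (restrict (\<zeta> w) {1..t}) - d w * K (restrict (\<xi> w) {1..t})
             + \<psi> w * (k (restrict (\<xi> w) {1..s}) * indicator G (restrict (\<xi> w) {1..s})) \<partial>M)"
          by (rule Bochner_Integration.integral_cong) (auto simp: d_def \<psi>_def algebra_simps)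
        also have "\<dots> = 0" using i 1 2 3 by simp
        finally show "(\<integral>w. \<psi> w * (indicator G (restrict (\<xi> w) {1..s}) * indicator S (\<xi> w (s + 1))) \<partial>M) = 0" .
      qed
      also have "(\<integral>w. \<psi> w * indicator A' (restrict (\<xi> w) {1..s}, \<xi> w (s + 1)) \<partial>M)
        = (\<integral>w. \<psi> w * indicator A (restrict (\<xi> w) {1..Suc s}) \<partial>M)"
      proof (rule Bochner_Integration.integral_cong)
        fix w assume w: "w \<in> space M"
        have "u (restrict (\<xi> w) {1..s}, \<xi> w (s + 1)) = restrict (\<xi> w) {1..Suc s}"
          by (auto simp: u_def restrict_def fun_eq_iff)
        moreover have "(restrict (\<xi> w) {1..s}, \<xi> w (s + 1)) \<in> space (borel_of (paths s X) \<Otimes>\<^sub>M borel_of (X (s + 1)))"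
          using measurable_space[OF m\<xi>[OF s(2)] w] measurable_space[OF mU w] by (simp add: space_pair_measure)
        ultimately show "\<psi> w * indicator A' (restrict (\<xi> w) {1..s}, \<xi> w (s + 1)) = \<psi> w * indicator A (restrict (\<xi> w) {1..Suc s})"
          unfolding A'_def by (simp add: indicator_def)
      qed simp
      finally show "(\<integral>w. \<psi> w * indicator A (restrict (\<xi> w) {1..Suc s}) \<partial>M) = 0" by simp
    qed
  qed
  have z: "(\<integral>w. \<psi> w * \<phi> (\<xi> w) \<partial>M) = 0" if \<phi>: "\<phi> \<in> bmeas (borel_of (paths N X))" for \<phi>
  proof -
    have "(\<integral>w. \<psi> w * \<phi> (restrict (\<xi> w) {1..N}) \<partial>M) = 0"
      by (rule integral_zero_extend[OF bmeas_integrable[OF \<psi>] m\<xi>[OF order_refl] _ \<phi>]) (use main[OF tN] in blast)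
    also have "(\<integral>w. \<psi> w * \<phi> (restrict (\<xi> w) {1..N}) \<partial>M) = (\<integral>w. \<psi> w * \<phi> (\<xi> w) \<partial>M)"
    proof (rule Bochner_Integration.integral_cong)
      fix w assume "w \<in> space M"
      then have "restrict (\<xi> w) {1..N} = \<xi> w"
        using measurable_space[OF \<xi>] by (intro restrict_paths) simp
      then show "\<psi> w * \<phi> (restrict (\<xi> w) {1..N}) = \<psi> w * \<phi> (\<xi> w)" by (simp only:)
    qed simp
    finally show ?thesis .
  qed
  show thesis using that[OF K] z unfolding \<psi>_def by blast
qed

text \<open>In the next lemma \<open>TX\<close> and \<open>TY\<close> are the conditional expectation operators given \<open>x1\<close> and \<open>y1\<close>;
  \<open>x2\<close> and \<open>y2\<close> are conditionally independent given \<open>(x1, y1)\<close>.\<close>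

lemma causal_rv_glue:
  assumes "prob_space M" and X: "\<And>t. t \<in> {1..N} \<Longrightarrow> polish (X t)" and Y: "\<And>t. t \<in> {1..N} \<Longrightarrow> polish (Y t)"
    and x1: "x1 \<in> M \<rightarrow>\<^sub>M borel_of (paths N X)" and x2: "x2 \<in> M \<rightarrow>\<^sub>M borel_of (paths N X)"
    and y1: "y1 \<in> M \<rightarrow>\<^sub>M borel_of (paths N Y)" and y2: "y2 \<in> M \<rightarrow>\<^sub>M borel_of (paths N Y)"
    and TX: "\<And>\<phi>. \<phi> \<in> bmeas (borel_of (paths N X)) \<Longrightarrow> TX \<phi> \<in> bmeas (borel_of (paths N X))"
    and TY: "\<And>h. h \<in> bmeas (borel_of (paths N Y)) \<Longrightarrow> TY h \<in> bmeas (borel_of (paths N Y))"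
    and I1: "\<And>\<phi> h. \<phi> \<in> bmeas (borel_of (paths N X)) \<Longrightarrow> h \<in> bmeas (borel_of (paths N Y)) \<Longrightarrow>
      (\<integral>w. \<phi> (x2 w) * h (y2 w) \<partial>M) = (\<integral>w. TX \<phi> (x1 w) * TY h (y1 w) \<partial>M)"
    and I2: "\<And>\<phi> \<psi>. \<phi> \<in> bmeas (borel_of (paths N X)) \<Longrightarrow> \<psi> \<in> bmeas (borel_of (paths N X)) \<Longrightarrow>
      (\<integral>w. \<phi> (x2 w) * \<psi> (x1 w) \<partial>M) = (\<integral>w. TX \<phi> (x1 w) * \<psi> (x1 w) \<partial>M)"
    and I3: "\<And>h \<psi>. h \<in> bmeas (borel_of (paths N Y)) \<Longrightarrow> \<psi> \<in> bmeas (borel_of (paths N Y)) \<Longrightarrow>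
      (\<integral>w. h (y2 w) * \<psi> (y1 w) \<partial>M) = (\<integral>w. TY h (y1 w) * \<psi> (y1 w) \<partial>M)"
    and c1: "causal_rv N X X M x2 x1" and c2: "causal_rv N Y Y M y1 y2" and c3: "causal_rv N X Y M x1 y1"
  shows "causal_rv N X Y M x2 y2"
proof -
  interpret prob_space M by fact
  let ?\<mu> = "distr M (borel_of (paths N X)) x2"
  have "(\<integral>w. \<phi> (x2 w) * h (y2 w) \<partial>M) = 0" if test: "causal_test N X Y ?\<mu> \<phi> h" for \<phi> h
  proof -
    obtain t S G T k where t: "t \<in> {1..<N}" and S: "S \<in> sets (borel_of (X (t + 1)))"
      and G: "G \<in> sets (borel_of (paths t X))" and T: "T \<in> sets (borel_of (paths t Y))"
      and k: "k \<in> bmeas (borel_of (paths t X))"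
      and kz: "\<forall>G\<in>sets (borel_of (paths t X)).
        (\<integral>x. (indicator S (x (t + 1)) - k (restrict x {1..t})) * indicator G (restrict x {1..t}) \<partial>?\<mu>) = 0"
      and \<phi>_eq: "\<phi> = (\<lambda>x. (indicator S (x (t + 1)) - k (restrict x {1..t})) * indicator G (restrict x {1..t}))"
      and h_eq: "h = (\<lambda>y. indicator T (restrict y {1..t}))"
      using test unfolding causal_test_def by blast
    have tN: "t \<le> N" using t by auto
    note \<phi> = causal_test_bmeas(1)[OF test] and h = causal_test_bmeas(2)[OF test]
    \<comment> \<open>The chain runs through the pairs \<open>(y1, y2)\<close>,
      \<open>(x1, y1)\<close> and \<open>(x2, x1)\<close>: \<open>H\<close> projects the test event
      on \<open>y1\<close>, \<open>K\<close> projects \<open>H\<close> on \<open>x1\<close>, and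
      both still depend on times up to \<open>t\<close> only. Causality from \<open>x2\<close> to
      \<open>x1\<close> finally makes the integral against \<open>K\<close> vanish.\<close>
    obtain H where H: "H \<in> bmeas (borel_of (paths t Y))"
      and Hz: "\<And>\<psi>. \<psi> \<in> bmeas (borel_of (paths N Y)) \<Longrightarrow>
        (\<integral>w. (indicator T (restrict (y2 w) {1..t}) - H (restrict (y1 w) {1..t})) * \<psi> (y1 w) \<partial>M) = 0"
      by (rule causal_rv_projection[OF \<open>prob_space M\<close> Y Y y1 y2 c2 t bmeas_indicator[OF T]]) blast+
    obtain K where K: "K \<in> bmeas (borel_of (paths t X))"
      and Kz: "\<And>\<psi>. \<psi> \<in> bmeas (borel_of (paths N X)) \<Longrightarrow>
        (\<integral>w. (H (restrict (y1 w) {1..t}) - K (restrict (x1 w) {1..t})) * \<psi> (x1 w) \<partial>M) = 0"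
      by (rule causal_rv_projection[OF \<open>prob_space M\<close> X Y x1 y1 c3 t H]) blast+
    have HN: "(\<lambda>y. H (restrict y {1..t})) \<in> bmeas (borel_of (paths N Y))"
      by (rule bmeas_comp[OF H measurable_paths_restrict[OF tN]])
    have KN: "(\<lambda>x. K (restrict x {1..t})) \<in> bmeas (borel_of (paths N X))"
      by (rule bmeas_comp[OF K measurable_paths_restrict[OF tN]])
    define \<psi> where "\<psi> y = TY h y - H (restrict y {1..t})" for y
    have \<psi>: "\<psi> \<in> bmeas (borel_of (paths N Y))" unfolding \<psi>_def by (rule bmeas_diff[OF TY[OF h] HN])
    note b = bmeas_integrable[OF bmeas_mult]
    note by1 = bmeas_comp[OF _ y1] and by2 = bmeas_comp[OF _ y2] and bx1 = bmeas_comp[OF _ x1]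
    \<comment> \<open>\<open>TY h\<close> and \<open>H\<close> are both versions of the conditional
      expectation of \<open>h (y2 w)\<close> given \<open>y1\<close>. Testing their difference
      against itself gives almost sure equality, so \<open>TY h\<close> inherits the dependence on
      times up to \<open>t\<close>.\<close>
    have "(\<integral>w. \<psi> (y1 w) * \<psi> (y1 w) \<partial>M)
        = (\<integral>w. TY h (y1 w) * \<psi> (y1 w) \<partial>M) - (\<integral>w. H (restrict (y1 w) {1..t}) * \<psi> (y1 w) \<partial>M)"
      using b[OF by1[OF TY[OF h]] by1[OF \<psi>]] b[OF by1[OF HN] by1[OF \<psi>]]
      by (subst Bochner_Integration.integral_diff[symmetric]) (auto simp: \<psi>_def left_diff_distrib)
    also have "(\<integral>w. TY h (y1 w) * \<psi> (y1 w) \<partial>M) = (\<integral>w. h (y2 w) * \<psi> (y1 w) \<partial>M)"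
      using I3[OF h \<psi>] by simp
    also have "\<dots> - (\<integral>w. H (restrict (y1 w) {1..t}) * \<psi> (y1 w) \<partial>M) = 0"
      using Hz[OF \<psi>] b[OF by2[OF h] by1[OF \<psi>]] b[OF by1[OF HN] by1[OF \<psi>]]
      by (subst Bochner_Integration.integral_diff[symmetric]) (auto simp: h_eq left_diff_distrib)
    finally have "AE w in M. \<psi> (y1 w) * \<psi> (y1 w) = 0"
      using b[OF by1[OF \<psi>] by1[OF \<psi>]] by (subst (asm) integral_nonneg_eq_0_iff_AE) auto
    then have ae: "AE w in M. TY h (y1 w) = H (restrict (y1 w) {1..t})"
      by eventually_elim (simp add: \<psi>_def)
    have "(\<integral>w. \<phi> (x2 w) * h (y2 w) \<partial>M) = (\<integral>w. TX \<phi> (x1 w) * TY h (y1 w) \<partial>M)" by (rule I1[OF \<phi> h])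
    also have "\<dots> = (\<integral>w. H (restrict (y1 w) {1..t}) * TX \<phi> (x1 w) \<partial>M)"
      using ae by1[OF HN] by1[OF TY[OF h]] bx1[OF TX[OF \<phi>]]
      by (intro integral_cong_AE) (auto simp: bmeas_def)
    also have "\<dots> = (\<integral>w. K (restrict (x1 w) {1..t}) * TX \<phi> (x1 w) \<partial>M)"
      using Kz[OF TX[OF \<phi>]] b[OF by1[OF HN] bx1[OF TX[OF \<phi>]]] b[OF bx1[OF KN] bx1[OF TX[OF \<phi>]]]
      by (simp add: left_diff_distrib)
    also have "\<dots> = (\<integral>w. \<phi> (x2 w) * K (restrict (x1 w) {1..t}) \<partial>M)"
      using I2[OF \<phi> KN] by (simp add: mult.commute)
    also have "\<dots> = 0"
    proof (rule integral_zero_extend[OF _ measurable_compose[OF x1 measurable_paths_restrict[OF tN]] _ K])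
      show "integrable M (\<lambda>w. \<phi> (x2 w))" by (rule bmeas_integrable[OF bmeas_comp[OF \<phi> x2]])
      fix T assume "T \<in> sets (borel_of (paths t X))"
      then have "causal_test N X X ?\<mu> \<phi> (\<lambda>y. indicator T (restrict y {1..t}))"
        unfolding causal_test_def using t S G k kz \<phi>_eq by blast
      then show "(\<integral>w. \<phi> (x2 w) * indicator T (restrict (x1 w) {1..t}) \<partial>M) = 0"
        using causal_rv_iff_test[OF \<open>prob_space M\<close> X x2 x1 refl] c1 by blast
    qed
    finally show ?thesis .
  qed
  then show ?thesis
    by (subst causal_rv_iff_test[OF \<open>prob_space M\<close> X x2 y2 refl]) auto
qed

section \<open>Relative entropy\<close>

text \<open>The tangent inequality \<open>ln x \<le> x - 1\<close> at \<open>x = r / a\<close>,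
  multiplied by \<open>a\<close>. It yields the lower bound for \<open>t * ln t\<close>,
  nonnegativity of relative entropy, and data processing.\<close>

lemma mult_ln_le: "0 \<le> a \<Longrightarrow> 0 < r \<Longrightarrow> a * ln r \<le> a * ln a + r - (a :: real)"
proof (cases "a = 0")
  case False
  assume a: "0 \<le> a" and r: "0 < r"
  with False have a0: "0 < a" by simp
  have "a * ln (r / a) \<le> a * (r / a - 1)"
    using a0 r by (intro mult_left_mono ln_le_minus_one) auto
  also have "\<dots> = r - a" using a0 by (simp add: field_simps)
  finally show ?thesis using a0 r by (simp add: ln_div right_diff_distrib)
qed simp

lemma minus_mult_ln_le: "0 \<le> a \<Longrightarrow> - (a * ln a) \<le> (1 :: real)"
  using mult_ln_le[of a 1] by simp

text \<open>Brings the relative entropy into the form in which it is computed from here on. At zeros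
  of \<open>\<rho>\<close> the default value of \<open>ln\<close> is multiplied by 0, which matches
  the usual convention.\<close>

lemma (in prob_space) kl_div_density:
  fixes \<rho> :: "'a \<Rightarrow> real"
  assumes \<rho> [measurable]: "\<rho> \<in> borel_measurable M" and nn: "\<And>x. 0 \<le> \<rho> x"
  shows "kl_div (density M \<rho>) M =
    (if integrable M (\<lambda>x. \<rho> x * ln (\<rho> x)) then ereal (\<integral>x. \<rho> x * ln (\<rho> x) \<partial>M) else \<infinity>)"
proof -
  have eq: "AE x in M. RN_deriv M (density M \<rho>) x = \<rho> x"
    using RN_deriv_unique[of "\<lambda>x. ennreal (\<rho> x)" "density M \<rho>"] by auto
  have "integrable (density M \<rho>) (entropy_density (exp 1) M (density M \<rho>)) \<longleftrightarrow>
      integrable M (\<lambda>x. \<rho> x *\<^sub>R entropy_density (exp 1) M (density M \<rho>) x)"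
    by (rule integrable_density) (auto simp: nn)
  also have "\<dots> \<longleftrightarrow> integrable M (\<lambda>x. \<rho> x * ln (\<rho> x))"
  proof (rule integrable_cong_AE)
    show "AE x in M. \<rho> x *\<^sub>R entropy_density (exp 1) M (density M \<rho>) x = \<rho> x * ln (\<rho> x)"
      using eq by eventually_elim (simp add: entropy_density_def nn flip: log_ln)
  qed auto
  moreover have "KL_divergence (exp 1) M (density M \<rho>) = (\<integral>x. \<rho> x * ln (\<rho> x) \<partial>M)"
    by (subst KL_density) (auto simp: nn simp flip: log_ln)
  moreover have "absolutely_continuous M (density M \<rho>)"
    by (rule absolutely_continuousI_density) measurable
  ultimately show ?thesis by (simp add: kl_div_def)
qed

lemma (in prob_space) integral_density_one:
  fixes \<rho> :: "'a \<Rightarrow> real"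
  assumes \<rho> [measurable]: "\<rho> \<in> borel_measurable M" and nn: "\<And>x. 0 \<le> \<rho> x"
    and p: "prob_space (density M \<rho>)"
  shows "integrable M \<rho>" "(\<integral>x. \<rho> x \<partial>M) = 1"
proof -
  have "(\<integral>\<^sup>+x. ennreal (\<rho> x) \<partial>M) = emeasure (density M \<rho>) (space M)"
    by (subst emeasure_density) (auto intro!: nn_integral_cong)
  also have "\<dots> = 1" using prob_space.emeasure_space_1[OF p] by simp
  finally have *: "(\<integral>\<^sup>+x. ennreal (\<rho> x) \<partial>M) = 1" .
  show "integrable M \<rho>"
    by (rule integrableI_nn_integral_finite[where x=1]) (use * nn in auto)
  show "(\<integral>x. \<rho> x \<partial>M) = 1"
    by (rule integral_eq_nn_integral[THEN trans]) (use * nn in auto)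
qed

lemma (in prob_space) density_of_absolutely_continuous:
  assumes p: "prob_space \<pi>" and sets: "sets \<pi> = sets M" and ac: "absolutely_continuous M \<pi>"
  obtains \<rho> :: "'a \<Rightarrow> real" where "\<rho> \<in> borel_measurable M" "\<And>x. 0 \<le> \<rho> x" "\<pi> = density M \<rho>"
    "AE x in \<pi>. 0 < \<rho> x"
proof -
  interpret \<pi>: prob_space \<pi> by fact
  obtain D where D: "D \<in> borel_measurable M" "AE x in M. RN_deriv M \<pi> x = ennreal (D x)"
    "AE x in \<pi>. 0 < D x" "\<And>x. 0 \<le> D x"
    by (rule real_RN_deriv[OF \<pi>.finite_measure_axioms ac sets]) blast
  have "density M D = density M (RN_deriv M \<pi>)"
    using D by (intro density_cong) auto
  also have "\<dots> = \<pi>" by (rule density_RN_deriv[OF ac sets])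
  finally show thesis using that D by metis
qed

lemma (in prob_space) kl_div_finite_density:
  assumes p: "prob_space \<pi>" and sets: "sets \<pi> = sets M" and fin: "kl_div \<pi> M \<noteq> \<infinity>"
  obtains \<rho> :: "'a \<Rightarrow> real" where "\<rho> \<in> borel_measurable M" "\<And>x. 0 \<le> \<rho> x" "\<pi> = density M \<rho>"
    "integrable M (\<lambda>x. \<rho> x * ln (\<rho> x))" "kl_div \<pi> M = ereal (\<integral>x. \<rho> x * ln (\<rho> x) \<partial>M)"
proof -
  have "absolutely_continuous M \<pi>" using fin by (auto simp: kl_div_def split: if_splits)
  then obtain \<rho> :: "'a \<Rightarrow> real" where \<rho>: "\<rho> \<in> borel_measurable M" "\<And>x. 0 \<le> \<rho> x" "\<pi> = density M \<rho>"
    by (rule density_of_absolutely_continuous[OF p sets]) blast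
  then show thesis using that[OF \<rho>] fin kl_div_density[OF \<rho>(1,2)] by (auto split: if_splits)
qed

lemma (in prob_space) kl_div_nonneg:
  assumes p: "prob_space \<pi>" and sets: "sets \<pi> = sets M"
  shows "0 \<le> kl_div \<pi> M"
proof (cases "kl_div \<pi> M = \<infinity>")
  case False
  then obtain \<rho> :: "'a \<Rightarrow> real" where \<rho>: "\<rho> \<in> borel_measurable M" "\<And>x. 0 \<le> \<rho> x" "\<pi> = density M \<rho>"
    "integrable M (\<lambda>x. \<rho> x * ln (\<rho> x))" "kl_div \<pi> M = ereal (\<integral>x. \<rho> x * ln (\<rho> x) \<partial>M)"
    by (rule kl_div_finite_density[OF p sets]) blast
  note one = integral_density_one[OF \<rho>(1,2) p[unfolded \<rho>(3)]]
  have "0 = (\<integral>x. \<rho> x - 1 \<partial>M)" using one by (simp add: prob_space)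
  also have "\<dots> \<le> (\<integral>x. \<rho> x * ln (\<rho> x) \<partial>M)"
    using mult_ln_le[OF \<rho>(2), of 1] \<rho>(4) one by (intro integral_mono) (auto simp: algebra_simps)
  finally show ?thesis using \<rho>(5) by simp
qed simp

text \<open>Data processing. Pointwise, \<open>ln (D \<circ> T)\<close> is compared with \<open>ln \<rho>\<close> by \<open>ln x \<le> x - 1\<close>.\<close>

lemma (in prob_space) kl_div_distr_le:
  fixes \<rho> :: "'a \<Rightarrow> real"
  assumes \<rho> [measurable]: "\<rho> \<in> borel_measurable M" and nn: "\<And>x. 0 \<le> \<rho> x"
    and p: "prob_space (density M \<rho>)" and int: "integrable M (\<lambda>x. \<rho> x * ln (\<rho> x))"
    and T [measurable]: "T \<in> M \<rightarrow>\<^sub>M Z"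
  shows "kl_div (distr (density M \<rho>) Z T) (distr M Z T) \<le> ereal (\<integral>x. \<rho> x * ln (\<rho> x) \<partial>M)"
proof -
  define P where "P = density M \<rho>"
  have P_sets [measurable_cong]: "sets P = sets M" by (simp add: P_def)
  define Q where "Q = distr P Z T"
  define Q0 where "Q0 = distr M Z T"
  interpret P: prob_space P using p by (simp add: P_def)
  interpret Q: prob_space Q unfolding Q_def by (rule P.prob_space_distr) measurable
  interpret Q0: prob_space Q0 unfolding Q0_def by (rule prob_space_distr) measurable
  note one = integral_density_one[OF \<rho> nn p]
  have QQ0: "sets Q = sets Q0" by (simp add: Q_def Q0_def)
  have "absolutely_continuous M P" unfolding P_def by (rule absolutely_continuousI_density) measurable
  then have ac: "absolutely_continuous Q0 Q"
    unfolding absolutely_continuous_def Q_def Q0_def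
    by (auto simp: null_sets_distr_iff P_sets sets_eq_imp_space_eq[OF P_sets])
  obtain D :: "_ \<Rightarrow> real" where D [measurable]: "D \<in> borel_measurable Q0" and Dnn: "\<And>x. 0 \<le> D x" and Qd: "Q = density Q0 D"
    and Dpos: "AE x in Q. 0 < D x"
    by (rule Q0.density_of_absolutely_continuous[OF Q.prob_space_axioms QQ0 ac]) blast
  have DZ [measurable]: "D \<in> borel_measurable Z" using D by (simp add: Q0_def)
  have D_one: "integrable Q0 D" "(\<integral>x. D x \<partial>Q0) = 1"
    using Q0.integral_density_one[OF D Dnn] Q.prob_space_axioms Qd by auto
  have DT: "integrable M (\<lambda>x. D (T x))" "(\<integral>x. D (T x) \<partial>M) = 1"
    using D_one unfolding Q0_def by (auto simp: integrable_distr_eq integral_distr)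
  have "AE x in P. 0 < D (T x)" using Dpos unfolding Q_def by (subst (asm) AE_distr_iff) auto
  \<comment> \<open>Where \<open>\<rho>\<close> is positive the image density is positive too;
    elsewhere the factor \<open>\<rho>\<close> is 0. So the default value of \<open>ln\<close> at 0
    never enters the comparison.\<close>
  then have pos: "AE x in M. 0 < \<rho> x \<longrightarrow> 0 < D (T x)"
    unfolding P_def by (subst (asm) AE_density) (auto simp: nn)
  have le: "AE x in M. \<rho> x * ln (D (T x)) \<le> \<rho> x * ln (\<rho> x) + D (T x) - \<rho> x"
    using pos
  proof eventually_elim
    case (elim x)
    then show ?case using mult_ln_le[OF nn[of x], of "D (T x)"] Dnn[of "T x"] nn[of x]
      by (cases "\<rho> x = 0") auto
  qed
  \<comment> \<open>Integrability of \<open>D * ln D\<close> is shown separately for the two parts: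
    the positive part through the pointwise comparison, the negative part because
    \<open>- (t * ln t)\<close> is at most 1.\<close>
  have "integrable M (\<lambda>x. \<rho> x *\<^sub>R max 0 (ln (D (T x))))"
  proof (rule Bochner_Integration.integrable_bound)
    show "integrable M (\<lambda>x. \<bar>\<rho> x * ln (\<rho> x)\<bar> + D (T x))" using int DT by auto
    show "AE x in M. norm (\<rho> x *\<^sub>R max 0 (ln (D (T x)))) \<le> norm (\<bar>\<rho> x * ln (\<rho> x)\<bar> + D (T x))"
      using le
    proof eventually_elim
      case (elim x)
      have "\<rho> x * max 0 (ln (D (T x))) \<le> \<bar>\<rho> x * ln (\<rho> x)\<bar> + D (T x)"
        using elim nn[of x] Dnn[of "T x"] by (cases "ln (D (T x)) \<ge> 0") (auto simp: max_def)
      moreover have "0 \<le> \<rho> x * max 0 (ln (D (T x)))" using nn[of x] by simp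
      ultimately show ?case by (simp only: real_norm_def real_scaleR_def abs_of_nonneg)
    qed
  qed auto
  then have "integrable P (\<lambda>x. max 0 (ln (D (T x))))"
    unfolding P_def by (subst integrable_density) (auto simp: nn)
  then have "integrable Q (\<lambda>x. max 0 (ln (D x)))"
    unfolding Q_def by (subst integrable_distr_eq) auto
  then have i1: "integrable Q0 (\<lambda>x. D x * max 0 (ln (D x)))"
    unfolding Qd by (subst (asm) integrable_density) (auto simp: Dnn)
  have i2: "integrable Q0 (\<lambda>x. D x * max 0 (- ln (D x)))"
  proof (rule Q0.integrable_const_bound[where B=1])
    show "AE x in Q0. norm (D x * max 0 (- ln (D x))) \<le> 1"
      using minus_mult_ln_le[OF Dnn] Dnn by (intro AE_I2) (auto simp: max_def)
  qed auto
  have "integrable Q0 (\<lambda>x. D x * max 0 (ln (D x)) - D x * max 0 (- ln (D x)))"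
    by (rule Bochner_Integration.integrable_diff[OF i1 i2])
  also have "(\<lambda>x. D x * max 0 (ln (D x)) - D x * max 0 (- ln (D x))) = (\<lambda>x. D x * ln (D x))"
    by (auto simp: fun_eq_iff max_def)
  finally have iD: "integrable Q0 (\<lambda>x. D x * ln (D x))" .
  then have iQ: "integrable Q (\<lambda>x. ln (D x))"
    unfolding Qd by (subst integrable_density) (auto simp: Dnn)
  then have iP: "integrable P (\<lambda>x. ln (D (T x)))"
    unfolding Q_def by (subst (asm) integrable_distr_eq) auto
  then have iM: "integrable M (\<lambda>x. \<rho> x * ln (D (T x)))"
    unfolding P_def by (subst (asm) integrable_density) (auto simp: nn)
  have "(\<integral>x. D x * ln (D x) \<partial>Q0) = (\<integral>x. ln (D x) \<partial>Q)"
    unfolding Qd by (subst integral_density) (auto simp: Dnn)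
  also have "\<dots> = (\<integral>x. ln (D (T x)) \<partial>P)"
    unfolding Q_def by (subst integral_distr) auto
  also have "\<dots> = (\<integral>x. \<rho> x * ln (D (T x)) \<partial>M)"
    unfolding P_def by (subst integral_density) (auto simp: nn)
  \<comment> \<open>The composition of \<open>D\<close> with \<open>T\<close> and the density
    \<open>\<rho>\<close> both integrate to 1, so the correction terms cancel.\<close>
  also have "\<dots> \<le> (\<integral>x. \<rho> x * ln (\<rho> x) + D (T x) - \<rho> x \<partial>M)"
    using le iM int DT one by (intro integral_mono_AE) auto
  also have "\<dots> = (\<integral>x. \<rho> x * ln (\<rho> x) \<partial>M)"
    using int DT one by simp
  finally have "ereal (\<integral>x. D x * ln (D x) \<partial>Q0) \<le> ereal (\<integral>x. \<rho> x * ln (\<rho> x) \<partial>M)" by simp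
  moreover have "kl_div Q Q0 = ereal (\<integral>x. D x * ln (D x) \<partial>Q0)"
    using Q0.kl_div_density[OF D Dnn] iD Qd by simp
  ultimately show ?thesis by (simp add: Q_def Q0_def P_def)
qed

lemma bmeas_unif_average:
  assumes f: "f \<in> E \<Otimes>\<^sub>M borel \<rightarrow>\<^sub>M B" and \<phi>: "\<phi> \<in> bmeas B"
  shows "(\<lambda>x. if x \<in> space E then \<integral>u. \<phi> (f (x, u)) \<partial>unif else 0) \<in> bmeas E"
proof -
  interpret U: prob_space unif by (rule prob_space_unif)
  note [measurable] = f bmeas_measurable[OF \<phi>]
  obtain K where K: "\<And>x. \<bar>\<phi> x\<bar> \<le> K" "K \<ge> 0" using bmeas_bound[OF \<phi>] by blast
  show ?thesis
  proof (rule bmeasI)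
    have "(\<lambda>x. \<integral>u. \<phi> (f (x, u)) \<partial>unif) \<in> borel_measurable E"
      by (rule U.borel_measurable_lebesgue_integral) simp
    then show "(\<lambda>x. if x \<in> space E then \<integral>u. \<phi> (f (x, u)) \<partial>unif else 0) \<in> borel_measurable E"
      by (subst measurable_cong[where g="\<lambda>x. \<integral>u. \<phi> (f (x, u)) \<partial>unif"]) auto
    fix x
    show "\<bar>if x \<in> space E then \<integral>u. \<phi> (f (x, u)) \<partial>unif else 0\<bar> \<le> K"
    proof (cases "x \<in> space E")
      case True
      have "integrable unif (\<lambda>u. \<phi> (f (x, u)))"
        using K True by (intro U.integrable_const_bound[where B=K]) auto
      then have "\<bar>\<integral>u. \<phi> (f (x, u)) \<partial>unif\<bar> \<le> (\<integral>u. K \<partial>unif)"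
        using K by (intro order_trans[OF integral_abs_bound] integral_mono) auto
      then show ?thesis using True U.prob_space by simp
    qed (use K(2) in simp)
  qed
qed

lemma integral_pair_mult:
  assumes "prob_space A" "prob_space B" and a: "a \<in> bmeas A" and b: "b \<in> bmeas B"
  shows "(\<integral>z. a (fst z) * b (snd z) \<partial>(A \<Otimes>\<^sub>M B)) = (\<integral>x. a x \<partial>A) * (\<integral>y. b y \<partial>B)"
proof -
  interpret A: prob_space A by fact
  interpret B: prob_space B by fact
  interpret P: pair_prob_space A B ..
  have "(\<lambda>z. a (fst z) * b (snd z)) \<in> bmeas (A \<Otimes>\<^sub>M B)"
    by (intro bmeas_mult bmeas_comp[OF a] bmeas_comp[OF b]) auto
  from P.integral_fst'[OF P.bmeas_integrable[OF this]] show ?thesis by simp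
qed

text \<open>Causality depends on the joint law only. Through the test integrals this is a change of
  variables instead of a comparison of conditional expectations on two spaces.\<close>

lemma causal_rv_distr:
  assumes "prob_space M" and X: "\<And>t. t \<in> {1..N} \<Longrightarrow> polish (X t)" and q: "q \<in> M \<rightarrow>\<^sub>M D"
    and \<xi>: "\<xi> \<in> D \<rightarrow>\<^sub>M borel_of (paths N X)" and \<zeta>: "\<zeta> \<in> D \<rightarrow>\<^sub>M borel_of (paths N Y)"
  shows "causal_rv N X Y (distr M D q) \<xi> \<zeta> \<longleftrightarrow> causal_rv N X Y M (\<lambda>w. \<xi> (q w)) (\<lambda>w. \<zeta> (q w))"
proof -
  interpret prob_space M by fact
  have 1: "distr (distr M D q) (borel_of (paths N X)) \<xi> = distr M (borel_of (paths N X)) (\<lambda>w. \<xi> (q w))"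
    using q \<xi> by (subst distr_distr) (auto simp: comp_def)
  have 2: "(\<integral>w. \<phi> (\<xi> w) * h (\<zeta> w) \<partial>distr M D q) = (\<integral>w. \<phi> (\<xi> (q w)) * h (\<zeta> (q w)) \<partial>M)"
    if "causal_test N X Y \<mu> \<phi> h" for \<mu> \<phi> h
    using bmeas_mult[OF bmeas_comp[OF causal_test_bmeas(1)[OF that] \<xi>] bmeas_comp[OF causal_test_bmeas(2)[OF that] \<zeta>]]
    by (subst integral_distr[OF q]) (auto simp: bmeas_def)
  have p: "prob_space (distr M D q)" by (rule prob_space_distr[OF q])
  have m: "\<xi> \<in> distr M D q \<rightarrow>\<^sub>M borel_of (paths N X)" "\<zeta> \<in> distr M D q \<rightarrow>\<^sub>M borel_of (paths N Y)"
    using \<xi> \<zeta> by (auto simp: measurable_distr_eq1)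
  let ?\<mu> = "distr M (borel_of (paths N X)) (\<lambda>w. \<xi> (q w))"
  have "causal_rv N X Y (distr M D q) \<xi> \<zeta> \<longleftrightarrow>
      (\<forall>\<phi> h. causal_test N X Y ?\<mu> \<phi> h \<longrightarrow> (\<integral>w. \<phi> (\<xi> w) * h (\<zeta> w) \<partial>distr M D q) = 0)"
    by (rule causal_rv_iff_test[OF p _ m 1]) (rule X)
  also have "\<dots> \<longleftrightarrow> (\<forall>\<phi> h. causal_test N X Y ?\<mu> \<phi> h \<longrightarrow> (\<integral>w. \<phi> (\<xi> (q w)) * h (\<zeta> (q w)) \<partial>M) = 0)"
    using 2 by (intro arg_cong[where f=All] ext) auto
  also have "\<dots> \<longleftrightarrow> causal_rv N X Y M (\<lambda>w. \<xi> (q w)) (\<lambda>w. \<zeta> (q w))"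
    by (rule causal_rv_iff_test[OF \<open>prob_space M\<close> _ measurable_compose[OF q \<xi>] measurable_compose[OF q \<zeta>] refl, symmetric])
       (rule X)
  finally show ?thesis .
qed

section \<open>Gluing of couplings\<close>

lemma couplingsD:
  assumes "\<pi> \<in> couplings S T \<mu> \<nu>"
  shows "prob_space \<pi>" "sets \<pi> = sets (borel_of (prod_topology S T))"
    "distr \<pi> (borel_of S) fst = \<mu>" "distr \<pi> (borel_of T) snd = \<nu>"
  using assms by (auto simp: couplings_def probs_def)

lemma couplings_sets:
  assumes "polish S" "polish T" "\<pi> \<in> couplings S T \<mu> \<nu>"
  shows "sets \<pi> = sets (borel_of S \<Otimes>\<^sub>M borel_of T)"
  using couplingsD(2)[OF assms(3)] sets_borel_of_prod[of S T] assms(1,2)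
  by (simp add: polish_second_countable)

lemma couplings_marginals:
  assumes "polish S" "polish T" "\<pi> \<in> couplings S T \<mu> \<nu>"
  shows "\<mu> \<in> probs S" "\<nu> \<in> probs T"
proof -
  interpret prob_space \<pi> using couplingsD(1)[OF assms(3)] .
  note [measurable_cong] = couplings_sets[OF assms]
  show "\<mu> \<in> probs S" "\<nu> \<in> probs T"
    using prob_space_distr[of fst "borel_of S"] prob_space_distr[of snd "borel_of T"] couplingsD(3,4)[OF assms(3)]
    by (auto simp: probs_def)
qed

lemma distr_unif_pair: "distr (unif \<Otimes>\<^sub>M unif) borel fst = unif" "distr (unif \<Otimes>\<^sub>M unif) borel snd = unif"
proof -
  interpret U: prob_space unif by (rule prob_space_unif)
  interpret P: pair_prob_space unif unif ..
  have "distr (unif \<Otimes>\<^sub>M unif) unif fst = unif" by (rule U.distr_pair_fst)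
  then show 1: "distr (unif \<Otimes>\<^sub>M unif) borel fst = unif" by (simp cong: distr_cong)
  have "distr (unif \<Otimes>\<^sub>M unif) borel snd = distr (distr (unif \<Otimes>\<^sub>M unif) (unif \<Otimes>\<^sub>M unif) (\<lambda>(x, y). (y, x))) borel snd"
    by (rule arg_cong[OF P.distr_pair_swap, of "\<lambda>M. distr M borel snd"])
  also have "\<dots> = distr (unif \<Otimes>\<^sub>M unif) borel fst"
    by (subst distr_distr) (auto simp: comp_def case_prod_unfold)
  finally show "distr (unif \<Otimes>\<^sub>M unif) borel snd = unif" using 1 by simp
qed

text \<open>The maps \<open>f\<close> and \<open>g\<close> are fixed while the measure on pairs
  varies, because the same construction is applied both to the coupling \<open>\<pi>\<close> and to
  the product of its marginals.\<close>

locale noise =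
  fixes A :: "'a measure" and A' :: "'c measure" and B :: "'b measure" and B' :: "'d measure"
    and f :: "'a \<times> real \<Rightarrow> 'c" and g :: "'b \<times> real \<Rightarrow> 'd"
  assumes f [measurable]: "f \<in> A \<Otimes>\<^sub>M borel \<rightarrow>\<^sub>M A'" and g [measurable]: "g \<in> B \<Otimes>\<^sub>M borel \<rightarrow>\<^sub>M B'"
begin

definition ext :: "('a \<times> 'b) measure \<Rightarrow> (('a \<times> 'b) \<times> real \<times> real) measure" where
  "ext \<pi> = \<pi> \<Otimes>\<^sub>M (unif \<Otimes>\<^sub>M unif)"

definition x2 :: "('a \<times> 'b) \<times> real \<times> real \<Rightarrow> 'c" where
  "x2 w = f (fst (fst w), fst (snd w))"

definition y2 :: "('a \<times> 'b) \<times> real \<times> real \<Rightarrow> 'd" where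
  "y2 w = g (snd (fst w), snd (snd w))"

definition TX :: "('c \<Rightarrow> real) \<Rightarrow> 'a \<Rightarrow> real" where
  "TX \<phi> x = (if x \<in> space A then \<integral>u. \<phi> (f (x, u)) \<partial>unif else 0)"

definition TY :: "('d \<Rightarrow> real) \<Rightarrow> 'b \<Rightarrow> real" where
  "TY h y = (if y \<in> space B then \<integral>u. h (g (y, u)) \<partial>unif else 0)"

lemma TX_bmeas: "\<phi> \<in> bmeas A' \<Longrightarrow> TX \<phi> \<in> bmeas A"
  unfolding TX_def by (rule bmeas_unif_average[OF f])

lemma TY_bmeas: "h \<in> bmeas B' \<Longrightarrow> TY h \<in> bmeas B"
  unfolding TY_def by (rule bmeas_unif_average[OF g])

context
  fixes \<pi> :: "('a \<times> 'b) measure"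
  assumes \<pi>: "prob_space \<pi>" and sets_\<pi> [measurable_cong]: "sets \<pi> = sets (A \<Otimes>\<^sub>M B)"
begin

lemma prob_space_unif2: "prob_space (unif \<Otimes>\<^sub>M unif)"
proof -
  interpret U: prob_space unif by (rule prob_space_unif)
  interpret P: pair_prob_space unif unif ..
  show ?thesis by (rule P.prob_space_axioms)
qed

lemma prob_space_ext: "prob_space (ext \<pi>)"
proof -
  interpret \<pi>: prob_space \<pi> by (rule \<pi>)
  interpret U: prob_space "unif \<Otimes>\<^sub>M unif" by (rule prob_space_unif2)
  interpret P: pair_prob_space \<pi> "unif \<Otimes>\<^sub>M unif" ..
  show ?thesis unfolding ext_def by (rule P.prob_space_axioms)
qed

lemma sets_ext [measurable_cong]: "sets (ext \<pi>) = sets ((A \<Otimes>\<^sub>M B) \<Otimes>\<^sub>M (borel \<Otimes>\<^sub>M borel))"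
  unfolding ext_def by (rule sets_pair_measure_cong[OF sets_\<pi> sets_pair_measure_cong[OF sets_unif sets_unif]])

lemma ext_measurable [measurable]:
  "(\<lambda>w. fst (fst w)) \<in> ext \<pi> \<rightarrow>\<^sub>M A" "(\<lambda>w. snd (fst w)) \<in> ext \<pi> \<rightarrow>\<^sub>M B"
  "fst \<in> ext \<pi> \<rightarrow>\<^sub>M A \<Otimes>\<^sub>M B"
  "x2 \<in> ext \<pi> \<rightarrow>\<^sub>M A'" "y2 \<in> ext \<pi> \<rightarrow>\<^sub>M B'"
  unfolding x2_def y2_def measurable_cong_sets[OF sets_ext refl]
proof -
  let ?E = "(A \<Otimes>\<^sub>M B) \<Otimes>\<^sub>M (borel :: real measure) \<Otimes>\<^sub>M (borel :: real measure)"
  have 1: "fst \<in> ?E \<rightarrow>\<^sub>M A \<Otimes>\<^sub>M B" "snd \<in> ?E \<rightarrow>\<^sub>M borel \<Otimes>\<^sub>M borel"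
    by (rule measurable_fst, rule measurable_snd)
  note 2 = measurable_compose[OF 1(1) measurable_fst] measurable_compose[OF 1(1) measurable_snd]
    measurable_compose[OF 1(2) measurable_fst] measurable_compose[OF 1(2) measurable_snd]
  show "fst \<in> ?E \<rightarrow>\<^sub>M A \<Otimes>\<^sub>M B" "(\<lambda>w. fst (fst w)) \<in> ?E \<rightarrow>\<^sub>M A" "(\<lambda>w. snd (fst w)) \<in> ?E \<rightarrow>\<^sub>M B"
    by (rule 1 2)+
  show "(\<lambda>w. f (fst (fst w), fst (snd w))) \<in> ?E \<rightarrow>\<^sub>M A'"
    by (rule measurable_compose[OF measurable_Pair[OF 2(1) 2(3)] f])
  show "(\<lambda>w. g (snd (fst w), snd (snd w))) \<in> ?E \<rightarrow>\<^sub>M B'"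
    by (rule measurable_compose[OF measurable_Pair[OF 2(2) 2(4)] g])
qed

lemma distr_ext_fst: "distr (ext \<pi>) \<pi> fst = \<pi>"
proof -
  interpret U: prob_space "unif \<Otimes>\<^sub>M unif" by (rule prob_space_unif2)
  show ?thesis unfolding ext_def by (rule U.distr_pair_fst)
qed

text \<open>Given \<open>fst w\<close> the two factors depend on different, independent noises, so
  the inner integral factorizes. This is the conditional independence of the two new paths given the
  old pair.\<close>

lemma integral_ext:
  assumes a: "a \<in> bmeas (A \<Otimes>\<^sub>M borel)" and b: "b \<in> bmeas (B \<Otimes>\<^sub>M borel)"
  shows "(\<integral>w. a (fst (fst w), fst (snd w)) * b (snd (fst w), snd (snd w)) \<partial>ext \<pi>)
    = (\<integral>w. (\<integral>u. a (fst (fst w), u) \<partial>unif) * (\<integral>u. b (snd (fst w), u) \<partial>unif) \<partial>ext \<pi>)"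
proof -
  interpret \<pi>: prob_space \<pi> by (rule \<pi>)
  interpret U: prob_space unif by (rule prob_space_unif)
  interpret UU: prob_space "unif \<Otimes>\<^sub>M unif" by (rule prob_space_unif2)
  interpret P: pair_prob_space \<pi> "unif \<Otimes>\<^sub>M unif" ..
  note [measurable] = bmeas_measurable[OF a] bmeas_measurable[OF b]
  have sp: "z \<in> space \<pi> \<longleftrightarrow> fst z \<in> space A \<and> snd z \<in> space B" for z
    unfolding sets_eq_imp_space_eq[OF sets_\<pi>] by (cases z) (simp add: space_pair_measure)
  define F where "F w = a (fst (fst w), fst (snd w)) * b (snd (fst w), snd (snd w))" for w :: "('a \<times> 'b) \<times> real \<times> real"
  define H where "H z = (\<integral>u. a (fst z, u) \<partial>unif) * (\<integral>u. b (snd z, u) \<partial>unif)" for z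
  have "F \<in> bmeas (\<pi> \<Otimes>\<^sub>M (unif \<Otimes>\<^sub>M unif))" unfolding F_def
    by (intro bmeas_mult bmeas_comp[OF a] bmeas_comp[OF b]) measurable
  from P.integral_fst'[OF P.bmeas_integrable[OF this]]
  have "(\<integral>w. F w \<partial>ext \<pi>) = (\<integral>z. (\<integral>v. F (z, v) \<partial>(unif \<Otimes>\<^sub>M unif)) \<partial>\<pi>)"
    unfolding ext_def by simp
  also have "\<dots> = (\<integral>z. H z \<partial>\<pi>)"
  proof (rule Bochner_Integration.integral_cong)
    fix z assume z: "z \<in> space \<pi>"
    have "(\<lambda>u. a (fst z, u)) \<in> bmeas unif" "(\<lambda>u. b (snd z, u)) \<in> bmeas unif"
      using z by (auto intro!: bmeas_comp[OF a] bmeas_comp[OF b] simp: sp)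
    from integral_pair_mult[OF prob_space_unif prob_space_unif this]
    show "(\<integral>v. F (z, v) \<partial>(unif \<Otimes>\<^sub>M unif)) = H z" by (simp add: F_def H_def)
  qed simp
  also have "\<dots> = (\<integral>z. H z \<partial>distr (ext \<pi>) \<pi> fst)" by (simp add: distr_ext_fst)
  also have "\<dots> = (\<integral>w. H (fst w) \<partial>ext \<pi>)"
  proof (rule integral_distr)
    show "fst \<in> ext \<pi> \<rightarrow>\<^sub>M \<pi>" by measurable
    have 1: "(\<lambda>x. \<integral>u. a (x, u) \<partial>unif) \<in> borel_measurable A"
      by (rule U.borel_measurable_lebesgue_integral) simp
    have 2: "(\<lambda>x. \<integral>u. b (x, u) \<partial>unif) \<in> borel_measurable B"
      by (rule U.borel_measurable_lebesgue_integral) simp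
    show "H \<in> borel_measurable \<pi>" unfolding H_def
      by (intro borel_measurable_times measurable_compose[OF _ 1] measurable_compose[OF _ 2]) measurable
  qed
  finally show ?thesis unfolding F_def H_def .
qed

lemma ext_space: "w \<in> space (ext \<pi>) \<Longrightarrow> fst (fst w) \<in> space A \<and> snd (fst w) \<in> space B"
  unfolding sets_eq_imp_space_eq[OF sets_ext] by (cases w) (auto simp: space_pair_measure)

lemma integral_x2_y2:
  assumes \<phi>: "\<phi> \<in> bmeas A'" and h: "h \<in> bmeas B'"
  shows "(\<integral>w. \<phi> (x2 w) * h (y2 w) \<partial>ext \<pi>) = (\<integral>w. TX \<phi> (fst (fst w)) * TY h (snd (fst w)) \<partial>ext \<pi>)"
proof -
  have "(\<integral>w. \<phi> (x2 w) * h (y2 w) \<partial>ext \<pi>)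
    = (\<integral>w. (\<integral>u. \<phi> (f (fst (fst w), u)) \<partial>unif) * (\<integral>u. h (g (snd (fst w), u)) \<partial>unif) \<partial>ext \<pi>)"
    unfolding x2_def y2_def by (rule integral_ext[OF bmeas_comp[OF \<phi> f] bmeas_comp[OF h g]])
  also have "\<dots> = (\<integral>w. TX \<phi> (fst (fst w)) * TY h (snd (fst w)) \<partial>ext \<pi>)"
    by (rule Bochner_Integration.integral_cong) (simp_all add: TX_def TY_def ext_space)
  finally show ?thesis .
qed

lemma integral_x2_x1:
  assumes \<phi>: "\<phi> \<in> bmeas A'" and \<psi>: "\<psi> \<in> bmeas A"
  shows "(\<integral>w. \<phi> (x2 w) * \<psi> (fst (fst w)) \<partial>ext \<pi>) = (\<integral>w. TX \<phi> (fst (fst w)) * \<psi> (fst (fst w)) \<partial>ext \<pi>)"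
proof -
  interpret U: prob_space unif by (rule prob_space_unif)
  have "(\<lambda>z. \<phi> (f z) * \<psi> (fst z)) \<in> bmeas (A \<Otimes>\<^sub>M borel)"
    by (intro bmeas_mult bmeas_comp[OF \<phi> f] bmeas_comp[OF \<psi>]) measurable
  from integral_ext[OF this, of "\<lambda>_. 1"] have "(\<integral>w. \<phi> (x2 w) * \<psi> (fst (fst w)) \<partial>ext \<pi>)
    = (\<integral>w. (\<integral>u. \<phi> (f (fst (fst w), u)) * \<psi> (fst (fst w)) \<partial>unif) \<partial>ext \<pi>)"
    using U.prob_space by (simp add: x2_def bmeasI[where C=1])
  also have "\<dots> = (\<integral>w. TX \<phi> (fst (fst w)) * \<psi> (fst (fst w)) \<partial>ext \<pi>)"
    by (rule Bochner_Integration.integral_cong) (simp_all add: TX_def ext_space)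
  finally show ?thesis .
qed

lemma integral_y2_y1:
  assumes h: "h \<in> bmeas B'" and \<psi>: "\<psi> \<in> bmeas B"
  shows "(\<integral>w. h (y2 w) * \<psi> (snd (fst w)) \<partial>ext \<pi>) = (\<integral>w. TY h (snd (fst w)) * \<psi> (snd (fst w)) \<partial>ext \<pi>)"
proof -
  interpret U: prob_space unif by (rule prob_space_unif)
  have "(\<lambda>z. h (g z) * \<psi> (fst z)) \<in> bmeas (B \<Otimes>\<^sub>M borel)"
    by (intro bmeas_mult bmeas_comp[OF h g] bmeas_comp[OF \<psi>]) measurable
  from integral_ext[OF _ this, of "\<lambda>_. 1"] have "(\<integral>w. h (y2 w) * \<psi> (snd (fst w)) \<partial>ext \<pi>)
    = (\<integral>w. (\<integral>u. h (g (snd (fst w), u)) * \<psi> (snd (fst w)) \<partial>unif) \<partial>ext \<pi>)"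
    using U.prob_space by (simp add: y2_def bmeasI[where C=1])
  also have "\<dots> = (\<integral>w. TY h (snd (fst w)) * \<psi> (snd (fst w)) \<partial>ext \<pi>)"
    by (rule Bochner_Integration.integral_cong) (simp_all add: TY_def ext_space)
  finally show ?thesis .
qed

text \<open>The joint law of old and new path depends on \<open>\<pi>\<close> through its first
  marginal only. Hence the \<open>f\<close> built from \<open>\<gamma>\<close> reproduces
  \<open>\<gamma>\<close> under every coupling with that marginal.\<close>

lemma law_x1_x2:
  "distr (ext \<pi>) (A \<Otimes>\<^sub>M A') (\<lambda>w. (fst (fst w), x2 w))
    = distr (distr \<pi> A fst \<Otimes>\<^sub>M unif) (A \<Otimes>\<^sub>M A') (\<lambda>(x, u). (x, f (x, u)))"
proof -
  interpret U: prob_space unif by (rule prob_space_unif)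
  have "distr \<pi> A fst \<Otimes>\<^sub>M distr (unif \<Otimes>\<^sub>M unif) borel fst
      = distr (\<pi> \<Otimes>\<^sub>M (unif \<Otimes>\<^sub>M unif)) (A \<Otimes>\<^sub>M borel) (\<lambda>(x, y). (fst x, fst y))"
    by (rule pair_measure_distr) (auto simp: distr_unif_pair U.sigma_finite_measure_axioms)
  then have "distr \<pi> A fst \<Otimes>\<^sub>M unif = distr (ext \<pi>) (A \<Otimes>\<^sub>M borel) (\<lambda>(x, y). (fst x, fst y))"
    by (simp add: distr_unif_pair ext_def)
  then have "distr (distr \<pi> A fst \<Otimes>\<^sub>M unif) (A \<Otimes>\<^sub>M A') (\<lambda>(x, u). (x, f (x, u)))
     = distr (distr (ext \<pi>) (A \<Otimes>\<^sub>M borel) (\<lambda>(x, y). (fst x, fst y))) (A \<Otimes>\<^sub>M A') (\<lambda>(x, u). (x, f (x, u)))" by simp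
  also have "\<dots> = distr (ext \<pi>) (A \<Otimes>\<^sub>M A') (\<lambda>w. (fst (fst w), x2 w))"
    by (subst distr_distr) (auto simp: comp_def case_prod_unfold x2_def)
  finally show ?thesis by simp
qed

lemma law_y1_y2:
  "distr (ext \<pi>) (B \<Otimes>\<^sub>M B') (\<lambda>w. (snd (fst w), y2 w))
    = distr (distr \<pi> B snd \<Otimes>\<^sub>M unif) (B \<Otimes>\<^sub>M B') (\<lambda>(x, u). (x, g (x, u)))"
proof -
  interpret U: prob_space unif by (rule prob_space_unif)
  have "distr \<pi> B snd \<Otimes>\<^sub>M distr (unif \<Otimes>\<^sub>M unif) borel snd
      = distr (\<pi> \<Otimes>\<^sub>M (unif \<Otimes>\<^sub>M unif)) (B \<Otimes>\<^sub>M borel) (\<lambda>(x, y). (snd x, snd y))"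
    by (rule pair_measure_distr) (auto simp: distr_unif_pair U.sigma_finite_measure_axioms)
  then have "distr \<pi> B snd \<Otimes>\<^sub>M unif = distr (ext \<pi>) (B \<Otimes>\<^sub>M borel) (\<lambda>(x, y). (snd x, snd y))"
    by (simp add: distr_unif_pair ext_def)
  then have "distr (distr \<pi> B snd \<Otimes>\<^sub>M unif) (B \<Otimes>\<^sub>M B') (\<lambda>(x, u). (x, g (x, u)))
     = distr (distr (ext \<pi>) (B \<Otimes>\<^sub>M borel) (\<lambda>(x, y). (snd x, snd y))) (B \<Otimes>\<^sub>M B') (\<lambda>(x, u). (x, g (x, u)))" by simp
  also have "\<dots> = distr (ext \<pi>) (B \<Otimes>\<^sub>M B') (\<lambda>w. (snd (fst w), y2 w))"
    by (subst distr_distr) (auto simp: comp_def case_prod_unfold y2_def)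
  finally show ?thesis by simp
qed

end

text \<open>Independent paths moved with independent noises stay independent. This identifies the
  reference measure in the data processing inequality with the product of the new marginals.\<close>

lemma law_x2_y2_product:
  assumes \<mu>: "prob_space \<mu>" and s\<mu> [measurable_cong]: "sets \<mu> = sets A"
    and \<nu>: "prob_space \<nu>" and s\<nu> [measurable_cong]: "sets \<nu> = sets B"
  shows "distr (ext (\<mu> \<Otimes>\<^sub>M \<nu>)) (A' \<Otimes>\<^sub>M B') (\<lambda>w. (x2 w, y2 w))
    = distr (ext (\<mu> \<Otimes>\<^sub>M \<nu>)) A' x2 \<Otimes>\<^sub>M distr (ext (\<mu> \<Otimes>\<^sub>M \<nu>)) B' y2"
proof -
  interpret \<mu>: prob_space \<mu> by (rule \<mu>)
  interpret \<nu>: prob_space \<nu> by (rule \<nu>)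
  interpret P: pair_prob_space \<mu> \<nu> ..
  let ?\<pi> = "\<mu> \<Otimes>\<^sub>M \<nu>"
  have s: "sets ?\<pi> = sets (A \<Otimes>\<^sub>M B)" by (rule sets_pair_measure_cong[OF s\<mu> s\<nu>])
  note p = P.prob_space_axioms
  note [measurable] = ext_measurable[OF p s]
  interpret E: prob_space "ext ?\<pi>" by (rule prob_space_ext[OF p s])
  interpret X: prob_space "distr (ext ?\<pi>) A' x2" by (rule E.prob_space_distr) measurable
  interpret Y: prob_space "distr (ext ?\<pi>) B' y2" by (rule E.prob_space_distr) measurable
  have int: "(\<integral>w. indicator a (x2 w) * indicator b (y2 w) \<partial>ext ?\<pi>)
     = (\<integral>x. TX (indicator a) x \<partial>\<mu>) * (\<integral>y. TY (indicator b) y \<partial>\<nu>)"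
    if a: "a \<in> sets A'" and b: "b \<in> sets B'" for a b
  proof -
    have ta: "TX (indicator a) \<in> bmeas \<mu>" and tb: "TY (indicator b) \<in> bmeas \<nu>"
      using TX_bmeas[OF bmeas_indicator[OF a]] TY_bmeas[OF bmeas_indicator[OF b]]
      by (auto simp: bmeas_def measurable_cong_sets[OF s\<mu> refl] measurable_cong_sets[OF s\<nu> refl])
    have "(\<integral>w. indicator a (x2 w) * indicator b (y2 w) \<partial>ext ?\<pi>)
      = (\<integral>w. TX (indicator a) (fst (fst w)) * TY (indicator b) (snd (fst w)) \<partial>ext ?\<pi>)"
      by (rule integral_x2_y2[OF p s bmeas_indicator[OF a] bmeas_indicator[OF b]])
    also have "\<dots> = (\<integral>z. TX (indicator a) (fst z) * TY (indicator b) (snd z) \<partial>distr (ext ?\<pi>) ?\<pi> fst)"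
    proof (rule integral_distr[symmetric])
      show "fst \<in> ext ?\<pi> \<rightarrow>\<^sub>M ?\<pi>"
        using ext_measurable(3)[OF p s] by (simp only: measurable_cong_sets[OF refl s])
      show "(\<lambda>z. TX (indicator a) (fst z) * TY (indicator b) (snd z)) \<in> borel_measurable ?\<pi>"
        using bmeas_measurable[OF ta] bmeas_measurable[OF tb] by measurable
    qed
    also have "\<dots> = (\<integral>x. TX (indicator a) x \<partial>\<mu>) * (\<integral>y. TY (indicator b) y \<partial>\<nu>)"
      unfolding distr_ext_fst[OF p s] by (rule integral_pair_mult[OF \<mu> \<nu> ta tb])
    finally show ?thesis .
  qed
  have em: "emeasure (ext ?\<pi>) {w \<in> space (ext ?\<pi>). x2 w \<in> a \<and> y2 w \<in> b}
     = ennreal (\<integral>w. indicator a (x2 w) * indicator b (y2 w) \<partial>ext ?\<pi>)"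
    if [measurable]: "a \<in> sets A'" "b \<in> sets B'" for a b
  proof -
    have "(\<integral>w. indicator a (x2 w) * indicator b (y2 w) \<partial>ext ?\<pi>)
      = (\<integral>w. (indicator {w \<in> space (ext ?\<pi>). x2 w \<in> a \<and> y2 w \<in> b} w :: real) \<partial>ext ?\<pi>)"
      by (rule Bochner_Integration.integral_cong) (auto simp: indicator_def)
    also have "\<dots> = measure (ext ?\<pi>) {w \<in> space (ext ?\<pi>). x2 w \<in> a \<and> y2 w \<in> b}" by simp
    finally show ?thesis by (simp add: E.emeasure_eq_measure)
  qed
  \<comment> \<open>Taking the whole space for one of the two sets isolates each factor as a
    marginal probability.\<close>
  have marg: "(\<integral>w. indicator a (x2 w) * indicator (space B') (y2 w) \<partial>ext ?\<pi>) = (\<integral>x. TX (indicator a) x \<partial>\<mu>) * 1"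
    "(\<integral>w. indicator (space A') (x2 w) * indicator b (y2 w) \<partial>ext ?\<pi>) = 1 * (\<integral>y. TY (indicator b) y \<partial>\<nu>)"
    if ab: "a \<in> sets A'" "b \<in> sets B'" for a b
  proof -
    have 1: "(\<integral>w. indicator (space A') (x2 w) * indicator (space B') (y2 w) \<partial>ext ?\<pi>) = (1 :: real)"
    proof -
      have "(\<integral>w. indicator (space A') (x2 w) * indicator (space B') (y2 w) \<partial>ext ?\<pi>) = (\<integral>w. (1::real) \<partial>ext ?\<pi>)"
        using measurable_space[OF ext_measurable(4)[OF p s]] measurable_space[OF ext_measurable(5)[OF p s]]
        by (intro Bochner_Integration.integral_cong) auto
      then show ?thesis using E.prob_space by simp
    qed
    have "(\<integral>y. TY (indicator (space B')) y \<partial>\<nu>) = 1" "(\<integral>y. TX (indicator (space A')) y \<partial>\<mu>) = 1"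
    proof -
      interpret U: prob_space unif by (rule prob_space_unif)
      have "(\<integral>u. indicator (space B') (g (y, u)) \<partial>unif) = (1::real)" if "y \<in> space B" for y
      proof -
        have "(\<integral>u. indicator (space B') (g (y, u)) \<partial>unif) = (\<integral>u. (1::real) \<partial>unif)"
          using measurable_space[OF g] that by (intro Bochner_Integration.integral_cong) (auto simp: space_pair_measure)
        then show ?thesis using U.prob_space by simp
      qed
      then have "(\<integral>y. TY (indicator (space B')) y \<partial>\<nu>) = (\<integral>y. 1 \<partial>\<nu>)"
        using sets_eq_imp_space_eq[OF s\<nu>] by (intro Bochner_Integration.integral_cong) (auto simp: TY_def)
      then show "(\<integral>y. TY (indicator (space B')) y \<partial>\<nu>) = 1" using \<nu>.prob_space by simp
      have "(\<integral>u. indicator (space A') (f (y, u)) \<partial>unif) = (1::real)" if "y \<in> space A" for y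
      proof -
        have "(\<integral>u. indicator (space A') (f (y, u)) \<partial>unif) = (\<integral>u. (1::real) \<partial>unif)"
          using measurable_space[OF f] that by (intro Bochner_Integration.integral_cong) (auto simp: space_pair_measure)
        then show ?thesis using U.prob_space by simp
      qed
      then have "(\<integral>y. TX (indicator (space A')) y \<partial>\<mu>) = (\<integral>y. 1 \<partial>\<mu>)"
        using sets_eq_imp_space_eq[OF s\<mu>] by (intro Bochner_Integration.integral_cong) (auto simp: TX_def)
      then show "(\<integral>y. TX (indicator (space A')) y \<partial>\<mu>) = 1" using \<mu>.prob_space by simp
    qed
    then show "(\<integral>w. indicator a (x2 w) * indicator (space B') (y2 w) \<partial>ext ?\<pi>) = (\<integral>x. TX (indicator a) x \<partial>\<mu>) * 1"
      "(\<integral>w. indicator (space A') (x2 w) * indicator b (y2 w) \<partial>ext ?\<pi>) = 1 * (\<integral>y. TY (indicator b) y \<partial>\<nu>)"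
      using int[OF ab(1) sets.top] int[OF sets.top ab(2)] by auto
  qed
  show ?thesis
  proof (rule measure_eqI_rectangles[where A=A' and B=B'])
    show "finite_measure (distr (ext ?\<pi>) (A' \<Otimes>\<^sub>M B') (\<lambda>w. (x2 w, y2 w)))"
      by (intro prob_space.finite_measure E.prob_space_distr) measurable
    fix a b assume ab [measurable]: "a \<in> sets A'" "b \<in> sets B'"
    have nn: "(\<integral>x. TX (indicator a) x \<partial>\<mu>) \<ge> 0" "(\<integral>y. TY (indicator b) y \<partial>\<nu>) \<ge> 0"
      by (auto intro!: integral_nonneg_AE simp: TX_def TY_def)
    have "emeasure (distr (ext ?\<pi>) (A' \<Otimes>\<^sub>M B') (\<lambda>w. (x2 w, y2 w))) (a \<times> b)
      = emeasure (ext ?\<pi>) {w \<in> space (ext ?\<pi>). x2 w \<in> a \<and> y2 w \<in> b}"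
      by (subst emeasure_distr) (auto intro!: arg_cong2[where f=emeasure])
    also have "\<dots> = ennreal (\<integral>x. TX (indicator a) x \<partial>\<mu>) * ennreal (\<integral>y. TY (indicator b) y \<partial>\<nu>)"
      using nn by (simp add: em ab int ennreal_mult)
    also have "ennreal (\<integral>x. TX (indicator a) x \<partial>\<mu>) = emeasure (distr (ext ?\<pi>) A' x2) a"
    proof -
      have "emeasure (distr (ext ?\<pi>) A' x2) a = emeasure (ext ?\<pi>) {w \<in> space (ext ?\<pi>). x2 w \<in> a \<and> y2 w \<in> space B'}"
        using measurable_space[OF ext_measurable(5)[OF p s]]
        by (subst emeasure_distr) (auto intro!: arg_cong2[where f=emeasure])
      then show ?thesis using marg(1)[OF ab] by (simp add: em)
    qed
    also have "ennreal (\<integral>y. TY (indicator b) y \<partial>\<nu>) = emeasure (distr (ext ?\<pi>) B' y2) b"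
    proof -
      have "emeasure (distr (ext ?\<pi>) B' y2) b = emeasure (ext ?\<pi>) {w \<in> space (ext ?\<pi>). x2 w \<in> space A' \<and> y2 w \<in> b}"
        using measurable_space[OF ext_measurable(4)[OF p s]]
        by (subst emeasure_distr) (auto intro!: arg_cong2[where f=emeasure])
      then show ?thesis using marg(2)[OF ab] by (simp add: em)
    qed
    also have "emeasure (distr (ext ?\<pi>) A' x2) a * emeasure (distr (ext ?\<pi>) B' y2) b
      = emeasure (distr (ext ?\<pi>) A' x2 \<Otimes>\<^sub>M distr (ext ?\<pi>) B' y2) (a \<times> b)"
      by (subst Y.emeasure_pair_measure_Times) auto
    finally show "emeasure (distr (ext ?\<pi>) (A' \<Otimes>\<^sub>M B') (\<lambda>w. (x2 w, y2 w))) (a \<times> b)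
      = emeasure (distr (ext ?\<pi>) A' x2 \<Otimes>\<^sub>M distr (ext ?\<pi>) B' y2) (a \<times> b)" .
  qed auto
qed

end

lemma CouplingsD:
  assumes "\<pi> \<in> Couplings v N X Y \<mu> \<nu>"
  shows "\<pi> \<in> couplings (paths N X) (paths N Y) \<mu> \<nu>" "admissible v N X Y \<pi>"
  using assms by (auto simp: Couplings_def)

lemma distr_pair_snd_prob:
  assumes "prob_space A" "prob_space B"
  shows "distr (A \<Otimes>\<^sub>M B) B snd = B"
proof -
  interpret A: prob_space A by fact
  interpret B: prob_space B by fact
  show ?thesis
  proof (rule measure_eqI)
    fix b assume "b \<in> sets (distr (A \<Otimes>\<^sub>M B) B snd)"
    then have b: "b \<in> sets B" by simp
    have "emeasure (distr (A \<Otimes>\<^sub>M B) B snd) b = emeasure (A \<Otimes>\<^sub>M B) (space A \<times> b)"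
      using b sets.sets_into_space[OF b]
      by (subst emeasure_distr) (auto simp: space_pair_measure intro!: arg_cong2[where f=emeasure])
    also have "\<dots> = emeasure B b"
      using b A.emeasure_space_1 by (subst B.emeasure_pair_measure_Times) auto
    finally show "emeasure (distr (A \<Otimes>\<^sub>M B) B snd) b = emeasure B b" .
  qed simp
qed

text \<open>Adjoining independent noise leaves the density unchanged, so a coupling and its
  extension have the same relative entropy with respect to the product and its extension.\<close>

lemma (in noise) ext_density:
  fixes \<rho> :: "'a \<times> 'b \<Rightarrow> real"
  assumes m: "prob_space m" and s [measurable_cong]: "sets m = sets (A \<Otimes>\<^sub>M B)"
    and \<rho> [measurable]: "\<rho> \<in> borel_measurable m"
  shows "ext (density m \<rho>) = density (ext m) (\<lambda>w. \<rho> (fst w))"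
proof -
  interpret U: prob_space "unif \<Otimes>\<^sub>M unif" by (rule prob_space_unif2[OF m s])
  interpret m: prob_space m by (rule m)
  have "density m (\<lambda>z. ennreal (\<rho> z)) \<Otimes>\<^sub>M density (unif \<Otimes>\<^sub>M unif) (\<lambda>_. 1)
      = density (m \<Otimes>\<^sub>M (unif \<Otimes>\<^sub>M unif)) (\<lambda>(x, y). ennreal (\<rho> x) * 1)"
    by (rule pair_measure_density) (auto simp: density_1 U.sigma_finite_measure_axioms)
  then show ?thesis by (simp add: ext_def density_1 case_prod_unfold)
qed

text \<open>All four paths live on the extended space \<open>ext \<pi>\<close>. The coupling
  \<open>\<Theta>\<close> records the old and the new pair jointly, and its projections
  \<open>\<gamma>\<close> and \<open>\<eta>\<close> measure how far either component has been
  moved.\<close>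

lemma glue_couplings:
  fixes \<pi> :: "((nat \<Rightarrow> 'a) \<times> (nat \<Rightarrow> 'b)) measure"
  assumes X: "\<And>t. t \<in> {1..N} \<Longrightarrow> polish (X t)" and Y: "\<And>t. t \<in> {1..N} \<Longrightarrow> polish (Y t)"
    and \<gamma>: "\<gamma> \<in> Couplings Bicausal N X X \<mu> \<mu>2" and \<eta>: "\<eta> \<in> Couplings Bicausal N Y Y \<nu> \<nu>2"
    and \<pi>: "\<pi> \<in> Couplings v N X Y \<mu> \<nu>"
  defines "P \<equiv> prod_topology (paths N X) (paths N Y)"
  obtains \<Theta> \<pi>2 where "\<Theta> \<in> couplings P P \<pi> \<pi>2" "\<pi>2 \<in> Couplings v N X Y \<mu>2 \<nu>2"
    "distr \<Theta> (borel_of (prod_topology (paths N X) (paths N X))) (\<lambda>z. (fst (fst z), fst (snd z))) = \<gamma>"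
    "distr \<Theta> (borel_of (prod_topology (paths N Y) (paths N Y))) (\<lambda>z. (snd (fst z), snd (snd z))) = \<eta>"
    "kl_div \<pi>2 (\<mu>2 \<Otimes>\<^sub>M \<nu>2) \<le> kl_div \<pi> (\<mu> \<Otimes>\<^sub>M \<nu>)"
proof -
  define Bx where "Bx = borel_of (paths N X)"
  define By where "By = borel_of (paths N Y)"
  have pX: "polish (paths N X)" and pY: "polish (paths N Y)" using X Y by (auto intro!: polish_paths)
  have pP: "polish P" unfolding P_def by (rule polish_prod_topology[OF pX pY])
  note \<gamma>c = CouplingsD(1)[OF \<gamma>] and \<eta>c = CouplingsD(1)[OF \<eta>] and \<pi>c = CouplingsD(1)[OF \<pi>]
  have s\<gamma>: "sets \<gamma> = sets (Bx \<Otimes>\<^sub>M Bx)" unfolding Bx_def by (rule couplings_sets[OF pX pX \<gamma>c])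
  have s\<eta>: "sets \<eta> = sets (By \<Otimes>\<^sub>M By)" unfolding By_def by (rule couplings_sets[OF pY pY \<eta>c])
  have s\<pi>: "sets \<pi> = sets (Bx \<Otimes>\<^sub>M By)" unfolding Bx_def By_def by (rule couplings_sets[OF pX pY \<pi>c])
  have sP: "sets (borel_of P) = sets (Bx \<Otimes>\<^sub>M By)" "sets (borel_of (prod_topology P P)) = sets ((Bx \<Otimes>\<^sub>M By) \<Otimes>\<^sub>M (Bx \<Otimes>\<^sub>M By))"
    "sets (borel_of (prod_topology (paths N X) (paths N X))) = sets (Bx \<Otimes>\<^sub>M Bx)"
    "sets (borel_of (prod_topology (paths N Y) (paths N Y))) = sets (By \<Otimes>\<^sub>M By)"
  proof -
    show 1: "sets (borel_of P) = sets (Bx \<Otimes>\<^sub>M By)"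
      "sets (borel_of (prod_topology (paths N X) (paths N X))) = sets (Bx \<Otimes>\<^sub>M Bx)"
      "sets (borel_of (prod_topology (paths N Y) (paths N Y))) = sets (By \<Otimes>\<^sub>M By)"
      unfolding P_def Bx_def By_def by (intro sets_borel_of_prod polish_second_countable pX pY)+
    show "sets (borel_of (prod_topology P P)) = sets ((Bx \<Otimes>\<^sub>M By) \<Otimes>\<^sub>M (Bx \<Otimes>\<^sub>M By))"
      using sets_borel_of_prod[of P P] polish_second_countable[OF pP]
      by (simp add: sets_pair_measure_cong[OF 1(1) 1(1)])
  qed
  have p\<gamma>: "prob_space \<gamma>" and p\<eta>: "prob_space \<eta>" and p\<pi>: "prob_space \<pi>"
    using couplingsD(1)[OF \<gamma>c] couplingsD(1)[OF \<eta>c] couplingsD(1)[OF \<pi>c] by auto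
  have marg: "distr \<gamma> Bx fst = \<mu>" "distr \<gamma> Bx snd = \<mu>2" "distr \<eta> By fst = \<nu>" "distr \<eta> By snd = \<nu>2"
    "distr \<pi> Bx fst = \<mu>" "distr \<pi> By snd = \<nu>"
    unfolding Bx_def By_def using couplingsD(3,4)[OF \<gamma>c] couplingsD(3,4)[OF \<eta>c] couplingsD(3,4)[OF \<pi>c] by auto
  obtain f where f: "f \<in> Bx \<Otimes>\<^sub>M borel \<rightarrow>\<^sub>M Bx"
    and fl: "distr (distr \<gamma> Bx fst \<Otimes>\<^sub>M unif) (Bx \<Otimes>\<^sub>M Bx) (\<lambda>(x, u). (x, f (x, u))) = \<gamma>"
    using polish_randomization[OF pX p\<gamma> s\<gamma>[unfolded Bx_def]] unfolding Bx_def by blast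
  obtain g where g: "g \<in> By \<Otimes>\<^sub>M borel \<rightarrow>\<^sub>M By"
    and gl: "distr (distr \<eta> By fst \<Otimes>\<^sub>M unif) (By \<Otimes>\<^sub>M By) (\<lambda>(x, u). (x, g (x, u))) = \<eta>"
    using polish_randomization[OF pY p\<eta> s\<eta>[unfolded By_def]] unfolding By_def by blast
  interpret noise Bx Bx By By f g by unfold_locales (fact f, fact g)
  define M where "M = ext \<pi>"
  interpret M: prob_space M unfolding M_def by (rule prob_space_ext[OF p\<pi> s\<pi>])
  note meas = ext_measurable[OF p\<pi> s\<pi>, folded M_def]
  note [measurable] = meas
  define x1 where "x1 = (\<lambda>w :: ((nat \<Rightarrow> 'a) \<times> (nat \<Rightarrow> 'b)) \<times> real \<times> real. fst (fst w))"
  define y1 where "y1 = (\<lambda>w :: ((nat \<Rightarrow> 'a) \<times> (nat \<Rightarrow> 'b)) \<times> real \<times> real. snd (fst w))"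
  have m1 [measurable]: "x1 \<in> M \<rightarrow>\<^sub>M Bx" "y1 \<in> M \<rightarrow>\<^sub>M By" unfolding x1_def y1_def by (rule meas)+
  have law\<gamma>: "distr M (Bx \<Otimes>\<^sub>M Bx) (\<lambda>w. (x1 w, x2 w)) = \<gamma>"
    using law_x1_x2[OF p\<pi> s\<pi>] fl marg by (simp add: M_def x1_def)
  have law\<eta>: "distr M (By \<Otimes>\<^sub>M By) (\<lambda>w. (y1 w, y2 w)) = \<eta>"
    using law_y1_y2[OF p\<pi> s\<pi>] gl marg by (simp add: M_def y1_def)
  have law\<pi>: "distr M (Bx \<Otimes>\<^sub>M By) fst = \<pi>"
  proof -
    have "distr M \<pi> fst = \<pi>" unfolding M_def by (rule distr_ext_fst[OF p\<pi> s\<pi>])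
    then show ?thesis by (simp add: s\<pi> cong: distr_cong)
  qed
  have law2: "distr M Bx x2 = \<mu>2" "distr M By y2 = \<nu>2"
  proof -
    have "\<mu>2 = distr (distr M (Bx \<Otimes>\<^sub>M Bx) (\<lambda>w. (x1 w, x2 w))) Bx snd" unfolding law\<gamma> by (simp add: marg)
    also have "\<dots> = distr M Bx x2" by (subst distr_distr) (auto simp: comp_def)
    finally show "distr M Bx x2 = \<mu>2" by simp
    have "\<nu>2 = distr (distr M (By \<Otimes>\<^sub>M By) (\<lambda>w. (y1 w, y2 w))) By snd" unfolding law\<eta> by (simp add: marg)
    also have "\<dots> = distr M By y2" by (subst distr_distr) (auto simp: comp_def)
    finally show "distr M By y2 = \<nu>2" by simp
  qed
  have p12: "(\<lambda>w. (x1 w, x2 w)) \<in> M \<rightarrow>\<^sub>M Bx \<Otimes>\<^sub>M Bx" "(\<lambda>w. (y1 w, y2 w)) \<in> M \<rightarrow>\<^sub>M By \<Otimes>\<^sub>M By"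
    "(\<lambda>w. (x2 w, y2 w)) \<in> M \<rightarrow>\<^sub>M Bx \<Otimes>\<^sub>M By"
    by measurable
  \<comment> \<open>Both directions are recorded: the causal case of \<open>causal_rv_glue\<close>
    uses the pairs \<open>(x2, x1)\<close> and \<open>(y1, y2)\<close>, the anticausal case the
    reversed ones.\<close>
  have c\<gamma>: "causal_rv N X X M x1 x2" "causal_rv N X X M x2 x1"
  proof -
    have "causal_rv N X X (distr M (Bx \<Otimes>\<^sub>M Bx) (\<lambda>w. (x1 w, x2 w))) fst snd"
      "causal_rv N X X (distr M (Bx \<Otimes>\<^sub>M Bx) (\<lambda>w. (x1 w, x2 w))) snd fst"
      using CouplingsD(2)[OF \<gamma>] by (auto simp: law\<gamma> causal_eq_causal_rv anticausal_eq_causal_rv)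
    then show "causal_rv N X X M x1 x2" "causal_rv N X X M x2 x1"
      using causal_rv_distr[OF M.prob_space_axioms X p12(1), where \<xi>=fst and \<zeta>=snd and Y=X]
        causal_rv_distr[OF M.prob_space_axioms X p12(1), where \<xi>=snd and \<zeta>=fst and Y=X]
      by (auto simp: Bx_def)
  qed
  have c\<eta>: "causal_rv N Y Y M y1 y2" "causal_rv N Y Y M y2 y1"
  proof -
    have "causal_rv N Y Y (distr M (By \<Otimes>\<^sub>M By) (\<lambda>w. (y1 w, y2 w))) fst snd"
      "causal_rv N Y Y (distr M (By \<Otimes>\<^sub>M By) (\<lambda>w. (y1 w, y2 w))) snd fst"
      using CouplingsD(2)[OF \<eta>] by (auto simp: law\<eta> causal_eq_causal_rv anticausal_eq_causal_rv)
    then show "causal_rv N Y Y M y1 y2" "causal_rv N Y Y M y2 y1"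
      using causal_rv_distr[OF M.prob_space_axioms Y p12(2), where \<xi>=fst and \<zeta>=snd and Y=Y]
        causal_rv_distr[OF M.prob_space_axioms Y p12(2), where \<xi>=snd and \<zeta>=fst and Y=Y]
      by (auto simp: By_def)
  qed
  define \<pi>2 where "\<pi>2 = distr M (borel_of P) (\<lambda>w. (x2 w, y2 w))"
  have \<pi>2_eq: "\<pi>2 = distr M (Bx \<Otimes>\<^sub>M By) (\<lambda>w. (x2 w, y2 w))"
    unfolding \<pi>2_def by (rule distr_cong) (simp_all add: sP)
  note m2 = meas(4,5)[unfolded Bx_def By_def] and m1' = m1[unfolded Bx_def By_def]
  have causal2: "causal N X Y \<pi>2" if "causal N X Y \<pi>"
  proof -
    have "causal_rv N X Y (distr M (Bx \<Otimes>\<^sub>M By) fst) fst snd"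
      using that by (simp add: law\<pi> causal_eq_causal_rv)
    then have c3: "causal_rv N X Y M x1 y1"
      using causal_rv_distr[OF M.prob_space_axioms X meas(3), where \<xi>=fst and \<zeta>=snd and Y=Y]
      by (auto simp: Bx_def By_def x1_def y1_def)
    have "causal_rv N X Y M x2 y2"
    proof (rule causal_rv_glue[OF M.prob_space_axioms X Y m1'(1) m2(1) m1'(2) m2(2), of TX TY])
    qed (use c\<gamma> c\<eta> c3 TX_bmeas TY_bmeas integral_x2_y2[OF p\<pi> s\<pi>] integral_x2_x1[OF p\<pi> s\<pi>] integral_y2_y1[OF p\<pi> s\<pi>]
       in \<open>simp_all add: Bx_def By_def M_def x1_def y1_def\<close>)
    then show ?thesis
      using causal_rv_distr[OF M.prob_space_axioms X p12(3), where \<xi>=fst and \<zeta>=snd and Y=Y]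
      by (auto simp: Bx_def By_def causal_eq_causal_rv \<pi>2_eq)
  qed
  have anticausal2: "anticausal N X Y \<pi>2" if "anticausal N X Y \<pi>"
  proof -
    have "causal_rv N Y X (distr M (Bx \<Otimes>\<^sub>M By) fst) snd fst"
      using that by (simp add: law\<pi> anticausal_eq_causal_rv)
    then have c3: "causal_rv N Y X M y1 x1"
      using causal_rv_distr[OF M.prob_space_axioms Y meas(3), where \<xi>=snd and \<zeta>=fst and Y=X]
      by (auto simp: Bx_def By_def x1_def y1_def)
    have swap: "(\<integral>w. h (y2 w) * \<phi> (x2 w) \<partial>ext \<pi>) = (\<integral>w. TY h (snd (fst w)) * TX \<phi> (fst (fst w)) \<partial>ext \<pi>)"
      if "\<phi> \<in> bmeas Bx" "h \<in> bmeas By" for \<phi> h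
      using integral_x2_y2[OF p\<pi> s\<pi> that]
      by (simp only: mult.commute[of "h _"] mult.commute[of "TY h _"])
    have "causal_rv N Y X M y2 x2"
    proof (rule causal_rv_glue[OF M.prob_space_axioms Y X m1'(2) m2(2) m1'(1) m2(1), of TY TX])
    qed (use c\<gamma> c\<eta> c3 TX_bmeas TY_bmeas swap integral_x2_x1[OF p\<pi> s\<pi>] integral_y2_y1[OF p\<pi> s\<pi>]
       in \<open>simp_all add: Bx_def By_def M_def x1_def y1_def\<close>)
    then show ?thesis
      using causal_rv_distr[OF M.prob_space_axioms Y p12(3), where \<xi>=snd and \<zeta>=fst and Y=X]
      by (auto simp: Bx_def By_def anticausal_eq_causal_rv \<pi>2_eq)
  qed
  have adm: "admissible v N X Y \<pi>2"
    using CouplingsD(2)[OF \<pi>] causal2 anticausal2 by (cases v) auto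
  have "\<pi>2 \<in> couplings (paths N X) (paths N Y) \<mu>2 \<nu>2"
  proof -
    have "prob_space \<pi>2" unfolding \<pi>2_eq by (rule M.prob_space_distr[OF p12(3)])
    moreover have "distr \<pi>2 Bx fst = \<mu>2" "distr \<pi>2 By snd = \<nu>2"
      unfolding \<pi>2_eq law2[symmetric] by (subst distr_distr; auto simp: comp_def)+
    ultimately show ?thesis
      by (simp add: couplings_def probs_def \<pi>2_def P_def Bx_def By_def)
  qed
  then have \<pi>2C: "\<pi>2 \<in> Couplings v N X Y \<mu>2 \<nu>2" using adm by (simp add: Couplings_def)
  define \<Theta> where "\<Theta> = distr M (borel_of (prod_topology P P)) (\<lambda>w. (fst w, (x2 w, y2 w)))"
  have m\<Theta>: "(\<lambda>w. (fst w, (x2 w, y2 w))) \<in> M \<rightarrow>\<^sub>M borel_of (prod_topology P P)"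
    using meas p12(3) by (simp add: measurable_cong_sets[OF refl sP(2)])
  have \<Theta>d: "distr \<Theta> L k = distr M L (\<lambda>w. k (fst w, (x2 w, y2 w)))"
    if "k \<in> (Bx \<Otimes>\<^sub>M By) \<Otimes>\<^sub>M (Bx \<Otimes>\<^sub>M By) \<rightarrow>\<^sub>M L" for k and L :: "'z measure"
    unfolding \<Theta>_def using that m\<Theta>
    by (subst distr_distr) (auto simp: comp_def measurable_cong_sets[OF sP(2) refl])
  have \<Theta>C: "\<Theta> \<in> couplings P P \<pi> \<pi>2"
  proof -
    have "prob_space \<Theta>" unfolding \<Theta>_def by (rule M.prob_space_distr[OF m\<Theta>])
    moreover have "distr \<Theta> (borel_of P) fst = \<pi>"
      using \<Theta>d[of fst "borel_of P"] law\<pi>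
      by (simp add: measurable_cong_sets[OF refl sP(1)] sP(1) cong: distr_cong)
    moreover have "distr \<Theta> (borel_of P) snd = \<pi>2"
      using \<Theta>d[of snd "borel_of P"]
      by (simp add: measurable_cong_sets[OF refl sP(1)] \<pi>2_def)
    ultimately show ?thesis by (simp add: couplings_def probs_def \<Theta>_def)
  qed
  have \<Theta>\<gamma>: "distr \<Theta> (borel_of (prod_topology (paths N X) (paths N X))) (\<lambda>z. (fst (fst z), fst (snd z))) = \<gamma>"
  proof -
    have "distr \<Theta> (Bx \<Otimes>\<^sub>M Bx) (\<lambda>z. (fst (fst z), fst (snd z))) = \<gamma>"
      using \<Theta>d[of "\<lambda>z. (fst (fst z), fst (snd z))" "Bx \<Otimes>\<^sub>M Bx"] law\<gamma> by (simp add: x1_def)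
    then show ?thesis by (simp add: sP(3) cong: distr_cong)
  qed
  have \<Theta>\<eta>: "distr \<Theta> (borel_of (prod_topology (paths N Y) (paths N Y))) (\<lambda>z. (snd (fst z), snd (snd z))) = \<eta>"
  proof -
    have "distr \<Theta> (By \<Otimes>\<^sub>M By) (\<lambda>z. (snd (fst z), snd (snd z))) = \<eta>"
      using \<Theta>d[of "\<lambda>z. (snd (fst z), snd (snd z))" "By \<Otimes>\<^sub>M By"] law\<eta> by (simp add: y1_def)
    then show ?thesis by (simp add: sP(4) cong: distr_cong)
  qed
  \<comment> \<open>The map \<open>(x2, y2)\<close> sends \<open>ext \<pi>\<close> to
    \<open>\<pi>2\<close> and the extension of \<open>\<mu> \<Otimes>\<^sub>M \<nu>\<close> to the
    product of the new marginals, so data processing compares exactly the two required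
    entropies.\<close>
  have "kl_div \<pi>2 (\<mu>2 \<Otimes>\<^sub>M \<nu>2) \<le> kl_div \<pi> (\<mu> \<Otimes>\<^sub>M \<nu>)"
  proof (cases "kl_div \<pi> (\<mu> \<Otimes>\<^sub>M \<nu>) = \<infinity>")
    case False
    have \<mu>: "prob_space \<mu>" "sets \<mu> = sets Bx" and \<nu>: "prob_space \<nu>" "sets \<nu> = sets By"
      using couplings_marginals[OF pX pY \<pi>c] by (auto simp: probs_def Bx_def By_def)
    interpret \<mu>: prob_space \<mu> by (rule \<mu>(1))
    interpret \<nu>: prob_space \<nu> by (rule \<nu>(1))
    interpret m: pair_prob_space \<mu> \<nu> ..
    let ?m = "\<mu> \<Otimes>\<^sub>M \<nu>"
    note pm = m.prob_space_axioms
    have sm: "sets ?m = sets (Bx \<Otimes>\<^sub>M By)" by (rule sets_pair_measure_cong[OF \<mu>(2) \<nu>(2)])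
    interpret E: prob_space "ext ?m" by (rule prob_space_ext[OF pm sm])
    obtain \<rho> where \<rho>: "\<rho> \<in> borel_measurable ?m" "\<And>z. 0 \<le> \<rho> z" "\<pi> = density ?m (\<lambda>z. ennreal (\<rho> z))"
      "integrable ?m (\<lambda>z. \<rho> z * ln (\<rho> z))" "kl_div \<pi> ?m = ereal (\<integral>z. \<rho> z * ln (\<rho> z) \<partial>?m)"
      by (rule m.kl_div_finite_density[OF p\<pi> _ False]) (auto simp: s\<pi> sm)
    have fm: "fst \<in> ext ?m \<rightarrow>\<^sub>M ?m"
      using ext_measurable(3)[OF pm sm] by (simp only: measurable_cong_sets[OF refl sm])
    have Md: "M = density (ext ?m) (\<lambda>w. ennreal (\<rho> (fst w)))"
      unfolding M_def \<rho>(3) by (rule ext_density[OF pm sm \<rho>(1)])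
    have dm: "distr (ext ?m) ?m fst = ?m" by (rule distr_ext_fst[OF pm sm])
    have 1: "integrable (ext ?m) (\<lambda>w. \<rho> (fst w) * ln (\<rho> (fst w)))"
      "(\<integral>w. \<rho> (fst w) * ln (\<rho> (fst w)) \<partial>ext ?m) = (\<integral>z. \<rho> z * ln (\<rho> z) \<partial>?m)"
    proof -
      have "integrable (distr (ext ?m) ?m fst) (\<lambda>z. \<rho> z * ln (\<rho> z))" using \<rho>(4) by (simp add: dm)
      then show "integrable (ext ?m) (\<lambda>w. \<rho> (fst w) * ln (\<rho> (fst w)))"
        using \<rho>(1) by (subst (asm) integrable_distr_eq[OF fm]) auto
      have "(\<integral>z. \<rho> z * ln (\<rho> z) \<partial>distr (ext ?m) ?m fst) = (\<integral>w. \<rho> (fst w) * ln (\<rho> (fst w)) \<partial>ext ?m)"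
        using \<rho>(1) by (intro integral_distr[OF fm]) auto
      then show "(\<integral>w. \<rho> (fst w) * ln (\<rho> (fst w)) \<partial>ext ?m) = (\<integral>z. \<rho> z * ln (\<rho> z) \<partial>?m)" by (simp add: dm)
    qed
    have "distr ?m Bx fst = \<mu>" "distr ?m By snd = \<nu>"
      using \<nu>.distr_pair_fst[of \<mu>] distr_pair_snd_prob[OF \<mu>(1) \<nu>(1)] \<mu>(2) \<nu>(2) by (auto cong: distr_cong)
    then have l1: "distr (ext ?m) (Bx \<Otimes>\<^sub>M Bx) (\<lambda>w. (fst (fst w), x2 w)) = \<gamma>"
      and l2: "distr (ext ?m) (By \<Otimes>\<^sub>M By) (\<lambda>w. (snd (fst w), y2 w)) = \<eta>"
      using law_x1_x2[OF pm sm] law_y1_y2[OF pm sm] fl gl marg by simp_all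
    note me = ext_measurable[OF pm sm]
    have e2: "distr (ext ?m) Bx x2 = \<mu>2" "distr (ext ?m) By y2 = \<nu>2"
    proof -
      have "\<mu>2 = distr (distr (ext ?m) (Bx \<Otimes>\<^sub>M Bx) (\<lambda>w. (fst (fst w), x2 w))) Bx snd" unfolding l1 by (simp add: marg)
      also have "\<dots> = distr (ext ?m) Bx x2" using me by (subst distr_distr) (auto simp: comp_def)
      finally show "distr (ext ?m) Bx x2 = \<mu>2" by simp
      have "\<nu>2 = distr (distr (ext ?m) (By \<Otimes>\<^sub>M By) (\<lambda>w. (snd (fst w), y2 w))) By snd" unfolding l2 by (simp add: marg)
      also have "\<dots> = distr (ext ?m) By y2" using me by (subst distr_distr) (auto simp: comp_def)
      finally show "distr (ext ?m) By y2 = \<nu>2" by simp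
    qed
    have "\<mu>2 \<Otimes>\<^sub>M \<nu>2 = distr (ext ?m) (Bx \<Otimes>\<^sub>M By) (\<lambda>w. (x2 w, y2 w))"
      using law_x2_y2_product[OF \<mu> \<nu>] by (simp add: e2)
    moreover have "kl_div (distr (density (ext ?m) (\<lambda>w. ennreal (\<rho> (fst w)))) (Bx \<Otimes>\<^sub>M By) (\<lambda>w. (x2 w, y2 w)))
        (distr (ext ?m) (Bx \<Otimes>\<^sub>M By) (\<lambda>w. (x2 w, y2 w))) \<le> ereal (\<integral>w. \<rho> (fst w) * ln (\<rho> (fst w)) \<partial>ext ?m)"
      using \<rho>(2) M.prob_space_axioms[unfolded Md] 1(1) me
      by (intro E.kl_div_distr_le measurable_compose[OF fm \<rho>(1)]) auto
    ultimately show ?thesis unfolding 1 \<rho>(5) \<pi>2_eq Md by simp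
  qed simp
  then show thesis using that[OF \<Theta>C \<pi>2C \<Theta>\<gamma> \<Theta>\<eta>] by blast
qed

section \<open>Costs of growth of order at most p\<close>

lemma metric_inducing_metric_space: "metric_inducing T d \<Longrightarrow> Metric_space (topspace T) d"
  by (simp add: metric_inducing_def)

lemma metric_inducing_openin_ball:
  assumes T: "metric_inducing T d"
  shows "openin T U \<longleftrightarrow> U \<subseteq> topspace T \<and> (\<forall>x\<in>U. \<exists>r>0. \<forall>y\<in>topspace T. d x y < r \<longrightarrow> y \<in> U)"
proof -
  interpret Metric_space "topspace T" d by (rule metric_inducing_metric_space[OF T])
  have "mtopology = T" using T by (simp add: metric_inducing_def)
  then have 1: "openin T U \<longleftrightarrow> U \<subseteq> topspace T \<and> (\<forall>x\<in>U. \<exists>r>0. mball x r \<subseteq> U)"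
    using openin_mtopology[of U] by auto
  have 2: "mball x r \<subseteq> U \<longleftrightarrow> (\<forall>y\<in>topspace T. d x y < r \<longrightarrow> y \<in> U)" if "x \<in> topspace T" for x r
    using that by (auto simp: subset_iff)
  show ?thesis unfolding 1
  proof (rule conj_cong[OF refl], rule ball_cong[OF refl])
    fix x assume "U \<subseteq> topspace T" "x \<in> U"
    then have "x \<in> topspace T" by blast
    then show "(\<exists>r>0. mball x r \<subseteq> U) \<longleftrightarrow> (\<exists>r>0. \<forall>y\<in>topspace T. d x y < r \<longrightarrow> y \<in> U)"
      by (simp only: 2)
  qed
qed

lemma continuous_map_metric_inducing:
  assumes T: "metric_inducing T d"
  shows "continuous_map (prod_topology T T) euclideanreal (\<lambda>z. d (fst z) (snd z))"
proof -
  interpret Metric_space "topspace T" d by (rule metric_inducing_metric_space[OF T])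
  have m: "mtopology = T" using T by (simp add: metric_inducing_def)
  have "continuous_map (prod_topology mtopology mtopology) euclideanreal
      (\<lambda>z. mdist (metric (topspace T, d)) (fst z) (snd z))"
    by (rule continuous_map_mdist) (simp_all add: continuous_map_fst continuous_map_snd)
  then show ?thesis by (simp add: m)
qed

lemma measurable_metric:
  assumes T: "metric_inducing T d" and p: "polish T"
  shows "(\<lambda>z. d (fst z) (snd z)) \<in> borel_measurable (borel_of T \<Otimes>\<^sub>M borel_of T)"
  using borel_measurable_continuous_map[OF continuous_map_metric_inducing[OF T]]
  unfolding measurable_cong_sets[OF sets_borel_of_prod[OF polish_second_countable[OF p] polish_second_countable[OF p]] refl] .

lemma powr_add_le:
  fixes s t p :: real
  assumes "0 \<le> s" "0 \<le> t" "0 \<le> p"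
  shows "(s + t) powr p \<le> 2 powr p * (s powr p + t powr p)"
proof -
  have "(s + t) powr p \<le> (2 * max s t) powr p" using assms by (intro powr_mono2) auto
  also have "\<dots> = 2 powr p * max s t powr p" using assms by (simp add: powr_mult)
  also have "\<dots> \<le> 2 powr p * (s powr p + t powr p)" by (intro mult_left_mono) (auto simp: max_def)
  finally show ?thesis .
qed

locale metric_polish =
  fixes T :: "'a topology" and d :: "'a \<Rightarrow> 'a \<Rightarrow> real" and p :: real
  assumes polish: "polish T" and metric: "metric_inducing T d" and p: "1 \<le> p"
begin

sublocale Metric_space "topspace T" d
  by (rule metric_inducing_metric_space[OF metric])

lemma dist_powr_measurable: "(\<lambda>z. d (fst z) (snd z) powr p) \<in> borel_measurable (borel_of T \<Otimes>\<^sub>M borel_of T)"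
  by (rule measurable_compose[OF measurable_metric[OF metric polish], of "\<lambda>t. t powr p"]) simp

lemma dist_powr_measurable1: "a \<in> topspace T \<Longrightarrow> (\<lambda>x. d a x powr p) \<in> borel_measurable (borel_of T)"
proof -
  assume "a \<in> topspace T"
  then have "Pair a \<in> borel_of T \<rightarrow>\<^sub>M borel_of T \<Otimes>\<^sub>M borel_of T" by (intro measurable_Pair1') simp
  from measurable_compose[OF this dist_powr_measurable] show ?thesis by simp
qed

lemma dist_powr_triangle:
  assumes "x \<in> topspace T" "y \<in> topspace T" "z \<in> topspace T"
  shows "d x z powr p \<le> 2 powr p * (d x y powr p + d y z powr p)"
proof -
  have "d x z powr p \<le> (d x y + d y z) powr p"
    using triangle[OF assms] p by (intro powr_mono2) auto
  also have "\<dots> \<le> 2 powr p * (d x y powr p + d y z powr p)"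
    using p by (intro powr_add_le) auto
  finally show ?thesis .
qed

text \<open>\<open>probs_p\<close> provides some centre with a finite moment, whereas the growth
  bound of the cost comes with its own; the triangle inequality up to the factor
  \<open>2 powr p\<close> lets the centre be changed.\<close>

lemma moment_integrable:
  assumes \<mu>: "\<mu> \<in> probs_p p T d" and a: "a \<in> topspace T"
  shows "integrable \<mu> (\<lambda>x. d a x powr p)"
proof -
  obtain b where b: "b \<in> topspace T" "(\<integral>\<^sup>+x. ennreal (d b x powr p) \<partial>\<mu>) < \<infinity>"
    using \<mu> by (auto simp: probs_p_def)
  have s: "sets \<mu> = sets (borel_of T)" "prob_space \<mu>" using \<mu> by (auto simp: probs_p_def probs_def)
  interpret \<mu>: prob_space \<mu> by (rule s)
  have m: "(\<lambda>x. d c x powr p) \<in> borel_measurable \<mu>" if "c \<in> topspace T" for c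
    using dist_powr_measurable1[OF that] by (simp add: measurable_cong_sets[OF s(1) refl])
  have sp: "space \<mu> = topspace T" using sets_eq_imp_space_eq[OF s(1)] by simp
  have ib: "integrable \<mu> (\<lambda>x. d b x powr p)"
    using b m[OF b(1)] by (intro integrableI_bounded) auto
  show ?thesis
  proof (rule Bochner_Integration.integrable_bound)
    show "integrable \<mu> (\<lambda>x. 2 powr p * (d a b powr p + d b x powr p))" using ib by auto
    show "AE x in \<mu>. norm (d a x powr p) \<le> norm (2 powr p * (d a b powr p + d b x powr p))"
      using dist_powr_triangle[OF a b(1)] by (intro AE_I2) (auto simp: sp)
  qed (rule m[OF a])
qed

end

text \<open>Tails are measured by the positive part of \<open>G - R\<close> because positive parts
  are subadditive, so that the tails of two marginals can simply be added.\<close>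

lemma integrable_tail:
  assumes "integrable M G" and e: "e > (0 :: real)"
  obtains R where "R > 0" "(\<integral>x. max 0 (G x - R) \<partial>M) \<le> e"
proof -
  have [measurable]: "G \<in> borel_measurable M" using assms by auto
  have "(\<lambda>n. \<integral>x. max 0 (G x - real n) \<partial>M) \<longlonglongrightarrow> (\<integral>x. 0 \<partial>M)"
  proof (rule integral_dominated_convergence)
    show "integrable M (\<lambda>x. \<bar>G x\<bar>)" using assms by auto
    show "AE x in M. (\<lambda>n. max 0 (G x - real n)) \<longlonglongrightarrow> 0"
    proof (rule AE_I2)
      fix x
      obtain n0 where "G x \<le> real n0" using real_arch_simple by blast
      then have "\<forall>n\<ge>n0. max 0 (G x - real n) = 0" by auto
      then show "(\<lambda>n. max 0 (G x - real n)) \<longlonglongrightarrow> 0"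
        by (intro tendsto_eventually) (auto simp: eventually_sequentially)
    qed
  qed (auto simp: max_def)
  then have "eventually (\<lambda>n. (\<integral>x. max 0 (G x - real n) \<partial>M) < e) sequentially"
    using e by (intro order_tendstoD(2)) auto
  then have "eventually (\<lambda>n. (\<integral>x. max 0 (G x - real n) \<partial>M) < e \<and> n > 0) sequentially"
    using eventually_gt_at_top[of 0] by eventually_elim auto
  then obtain n where "(\<integral>x. max 0 (G x - real n) \<partial>M) < e" "n > 0"
    using eventually_happens'[OF sequentially_bot] by blast
  then show thesis using that[of "real n"] by auto
qed

lemma integrable_bounded_by_marginals:
  fixes g :: "'w \<Rightarrow> real"
  assumes "prob_space M" and x: "x \<in> M \<rightarrow>\<^sub>M A" and y: "y \<in> M \<rightarrow>\<^sub>M B"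
    and G: "integrable (distr M A x) G1" "integrable (distr M B y) G2"
    and g: "g \<in> borel_measurable M" and le: "\<And>w. w \<in> space M \<Longrightarrow> \<bar>g w\<bar> \<le> C * (1 + G1 (x w) + G2 (y w))"
  shows "integrable M g"
proof (rule Bochner_Integration.integrable_bound[where f="\<lambda>w. C * (1 + G1 (x w) + G2 (y w))"])
  interpret prob_space M by fact
  have "integrable M (\<lambda>w. G1 (x w))" "integrable M (\<lambda>w. G2 (y w))"
    using G x y by (auto intro: integrable_distr)
  then show "integrable M (\<lambda>w. C * (1 + G1 (x w) + G2 (y w)))" by auto
  show "AE w in M. norm (g w) \<le> norm (C * (1 + G1 (x w) + G2 (y w)))"
    using le by (intro AE_I2) (auto intro: order_trans[OF _ abs_ge_self])
qed (rule g)

text \<open>Uniform integrability over all joint laws with given marginals, from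
  \<open>(s + t - 2 R)\<^sup>+ \<le> (s - R)\<^sup>+ + (t - R)\<^sup>+\<close>.\<close>

lemma uniform_tail:
  assumes G1: "integrable \<mu> G1" and G2: "integrable \<nu> G2" and C: "C \<ge> (0 :: real)" and e: "e > 0"
  obtains R where "R > 0"
    "\<And>(M :: 'w measure) x y g. prob_space M \<Longrightarrow> x \<in> M \<rightarrow>\<^sub>M A \<Longrightarrow> y \<in> M \<rightarrow>\<^sub>M B \<Longrightarrow>
      distr M A x = \<mu> \<Longrightarrow> distr M B y = \<nu> \<Longrightarrow> g \<in> borel_measurable M \<Longrightarrow>
      (\<And>w. w \<in> space M \<Longrightarrow> \<bar>g w\<bar> \<le> C * (1 + G1 (x w) + G2 (y w))) \<Longrightarrow>
      integrable M (\<lambda>w. max 0 (\<bar>g w\<bar> - R)) \<and> (\<integral>w. max 0 (\<bar>g w\<bar> - R) \<partial>M) \<le> e"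
proof -
  \<comment> \<open>The \<open>+ 1\<close> keeps the division legitimate when \<open>C = 0\<close>;
    likewise the summand 1 in the level \<open>R\<close> below keeps that level positive.\<close>
  define e' where "e' = e / 2 / (C + 1)"
  have e': "e' > 0" using e C by (simp add: e'_def)
  obtain R1 where R1: "R1 > 0" "(\<integral>x. max 0 (G1 x - R1) \<partial>\<mu>) \<le> e'" by (rule integrable_tail[OF G1 e'])
  obtain R2 where R2: "R2 > 0" "(\<integral>x. max 0 (G2 x - R2) \<partial>\<nu>) \<le> e'" by (rule integrable_tail[OF G2 e'])
  define R where "R = C * (1 + R1 + R2) + 1"
  have R: "R > 0" using C R1 R2 by (auto simp: R_def intro!: add_nonneg_pos mult_nonneg_nonneg)
  show thesis
  proof (rule that[OF R])
    fix M :: "'w measure" and x y and g :: "'w \<Rightarrow> real"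
    assume M: "prob_space M" and x [measurable]: "x \<in> M \<rightarrow>\<^sub>M A" and y [measurable]: "y \<in> M \<rightarrow>\<^sub>M B"
      and lx: "distr M A x = \<mu>" and ly: "distr M B y = \<nu>" and g [measurable]: "g \<in> borel_measurable M"
      and le: "\<And>w. w \<in> space M \<Longrightarrow> \<bar>g w\<bar> \<le> C * (1 + G1 (x w) + G2 (y w))"
    interpret prob_space M by (rule M)
    have gi: "integrable M g"
      by (rule integrable_bounded_by_marginals[OF M x y _ _ g le]) (simp_all add: lx ly G1 G2)
    have G1': "integrable \<mu> (\<lambda>x. max 0 (G1 x - R1))" and G2': "integrable \<nu> (\<lambda>x. max 0 (G2 x - R2))"
    proof -
      have "prob_space \<mu>" "prob_space \<nu>" using prob_space_distr[OF x] prob_space_distr[OF y] lx ly by auto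
      then interpret \<mu>: prob_space \<mu> + \<nu>: prob_space \<nu> by auto
      show "integrable \<mu> (\<lambda>x. max 0 (G1 x - R1))" "integrable \<nu> (\<lambda>x. max 0 (G2 x - R2))" using G1 G2 by auto
    qed
    have m1: "G1 \<in> borel_measurable A" "G2 \<in> borel_measurable B"
      using borel_measurable_integrable[OF G1] borel_measurable_integrable[OF G2] by (simp_all add: lx[symmetric] ly[symmetric])
    note [measurable] = m1
    have i1: "integrable M (\<lambda>w. max 0 (G1 (x w) - R1))" "(\<integral>w. max 0 (G1 (x w) - R1) \<partial>M) \<le> e'"
      using G1' R1(2) unfolding lx[symmetric] by (auto simp: integrable_distr_eq integral_distr)
    have i2: "integrable M (\<lambda>w. max 0 (G2 (y w) - R2))" "(\<integral>w. max 0 (G2 (y w) - R2) \<partial>M) \<le> e'"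
      using G2' R2(2) unfolding ly[symmetric] by (auto simp: integrable_distr_eq integral_distr)
    have i: "integrable M (\<lambda>w. max 0 (\<bar>g w\<bar> - R))" using gi by auto
    have pw: "max 0 (\<bar>g w\<bar> - R) \<le> C * (max 0 (G1 (x w) - R1) + max 0 (G2 (y w) - R2))" if "w \<in> space M" for w
    proof -
      have "\<bar>g w\<bar> - R \<le> C * (1 + G1 (x w) + G2 (y w)) - C * (1 + R1 + R2)"
        using le[OF that] by (simp add: R_def)
      also have "\<dots> = C * ((G1 (x w) - R1) + (G2 (y w) - R2))" by (simp add: algebra_simps)
      also have "\<dots> \<le> C * (max 0 (G1 (x w) - R1) + max 0 (G2 (y w) - R2))"
        using C by (intro mult_left_mono add_mono) auto
      finally show ?thesis using C by (auto simp: max_def intro!: mult_nonneg_nonneg)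
    qed
    have "(\<integral>w. max 0 (\<bar>g w\<bar> - R) \<partial>M) \<le> (\<integral>w. C * (max 0 (G1 (x w) - R1) + max 0 (G2 (y w) - R2)) \<partial>M)"
      using i i1 i2 pw by (intro integral_mono) auto
    also have "\<dots> \<le> C * (e' + e')" using i1 i2 C by (auto intro!: mult_left_mono)
    also have "\<dots> \<le> (C + 1) * (e' + e')" using e' by (intro mult_right_mono) auto
    also have "\<dots> = e"
    proof -
      have "C + 1 \<noteq> 0" using C by linarith
      then have "(C + 1) * e' = e / 2" unfolding e'_def by (metis nonzero_mult_div_cancel_left times_divide_eq_right)
      then show ?thesis by (simp only: distrib_left)
    qed
    finally show "integrable M (\<lambda>w. max 0 (\<bar>g w\<bar> - R)) \<and> (\<integral>w. max 0 (\<bar>g w\<bar> - R) \<partial>M) \<le> e" using i by simp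
  qed
qed

text \<open>Only \<open>(x, y)\<close> is confined to compact sets, while \<open>(x', y')\<close> is
  any nearby point. This one-sided form is the right one because tightness is available for the
  fixed marginals alone.\<close>

lemma compact_uniform_continuity:
  fixes c :: "'a \<times> 'b \<Rightarrow> real"
  assumes S: "metric_inducing S dS" and T: "metric_inducing T dT"
    and c: "continuous_map (prod_topology S T) euclideanreal c"
    and K: "compactin S K" and L: "compactin T L" and e: "e > 0"
  obtains r where "r > 0"
    "\<And>x y x' y'. x \<in> K \<Longrightarrow> y \<in> L \<Longrightarrow> x' \<in> topspace S \<Longrightarrow> y' \<in> topspace T \<Longrightarrow>
      dS x x' < r \<Longrightarrow> dT y y' < r \<Longrightarrow> \<bar>c (x, y) - c (x', y')\<bar> \<le> e"
proof -
  interpret S: Metric_space "topspace S" dS by (rule metric_inducing_metric_space[OF S])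
  interpret T: Metric_space "topspace T" dT by (rule metric_inducing_metric_space[OF T])
  have Ks: "K \<subseteq> topspace S" and Ls: "L \<subseteq> topspace T" using K L by (auto dest: compactin_subset_topspace)
  have loc: "\<exists>r>0. \<forall>x'\<in>topspace S. \<forall>y'\<in>topspace T. dS x x' < r \<longrightarrow> dT y y' < r \<longrightarrow> \<bar>c (x, y) - c (x', y')\<bar> < e / 2"
    if "x \<in> topspace S" "y \<in> topspace T" for x y
  proof -
    let ?U = "{z \<in> topspace (prod_topology S T). c z \<in> ball (c (x, y)) (e / 2)}"
    have "openin (prod_topology S T) ?U"
      by (rule openin_continuous_map_preimage[OF c]) auto
    moreover have "(x, y) \<in> ?U" using that e by auto
    ultimately have "\<exists>V W. openin S V \<and> openin T W \<and> x \<in> V \<and> y \<in> W \<and> V \<times> W \<subseteq> ?U"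
      unfolding openin_prod_topology_alt by blast
    then obtain V W where VW: "openin S V" "openin T W" "x \<in> V" "y \<in> W" "V \<times> W \<subseteq> ?U" by blast
    obtain r1 where r1: "r1 > 0" "\<forall>x'\<in>topspace S. dS x x' < r1 \<longrightarrow> x' \<in> V"
      using VW(1,3) metric_inducing_openin_ball[OF S] by blast
    obtain r2 where r2: "r2 > 0" "\<forall>y'\<in>topspace T. dT y y' < r2 \<longrightarrow> y' \<in> W"
      using VW(2,4) metric_inducing_openin_ball[OF T] by blast
    show ?thesis
    proof (intro exI[of _ "min r1 r2"] conjI ballI impI)
      fix x' y' assume "x' \<in> topspace S" "y' \<in> topspace T" "dS x x' < min r1 r2" "dT y y' < min r1 r2"
      then have "(x', y') \<in> ?U" using r1 r2 VW(5) by auto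
      then show "\<bar>c (x, y) - c (x', y')\<bar> < e / 2" by (simp add: dist_real_def)
    qed (use r1 r2 in auto)
  qed
  then have "\<forall>z\<in>topspace S \<times> topspace T. \<exists>r>0. \<forall>x'\<in>topspace S. \<forall>y'\<in>topspace T.
      dS (fst z) x' < r \<longrightarrow> dT (snd z) y' < r \<longrightarrow> \<bar>c z - c (x', y')\<bar> < e / 2" by auto
  from bchoice[OF this] obtain \<rho> where \<rho>0: "\<forall>z\<in>topspace S \<times> topspace T. \<rho> z > 0 \<and> (\<forall>x'\<in>topspace S. \<forall>y'\<in>topspace T.
      dS (fst z) x' < \<rho> z \<longrightarrow> dT (snd z) y' < \<rho> z \<longrightarrow> \<bar>c z - c (x', y')\<bar> < e / 2)" by blast
  have \<rho>: "\<And>z. z \<in> topspace S \<times> topspace T \<Longrightarrow> \<rho> z > 0"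
    "\<And>z x' y'. z \<in> topspace S \<times> topspace T \<Longrightarrow> x' \<in> topspace S \<Longrightarrow> y' \<in> topspace T \<Longrightarrow>
      dS (fst z) x' < \<rho> z \<Longrightarrow> dT (snd z) y' < \<rho> z \<Longrightarrow> \<bar>c z - c (x', y')\<bar> < e / 2"
    using \<rho>0 by blast+
  define U where "U z = S.mball (fst z) (\<rho> z / 2) \<times> T.mball (snd z) (\<rho> z / 2)" for z
  have mS: "S.mtopology = S" and mT: "T.mtopology = T" using S T by (simp_all add: metric_inducing_def)
  have cpt: "K = {} \<or> L = {} \<or> compactin (prod_topology S T) (K \<times> L)"
    using K L by (simp add: compactin_Times)
  have "\<exists>F. finite F \<and> F \<subseteq> K \<times> L \<and> K \<times> L \<subseteq> (\<Union>z\<in>F. U z)"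
  proof (cases "K = {} \<or> L = {}")
    case False
    have "openin (prod_topology S T) (U z)" for z
      using S.openin_mball[of "fst z" "\<rho> z / 2"] T.openin_mball[of "snd z" "\<rho> z / 2"]
      by (simp add: U_def openin_prod_Times_iff mS mT)
    moreover have "K \<times> L \<subseteq> \<Union> (U ` (K \<times> L))"
      using \<rho>(1) Ks Ls by (fastforce simp: U_def)
    ultimately obtain \<F> where "finite \<F>" "\<F> \<subseteq> U ` (K \<times> L)" "K \<times> L \<subseteq> \<Union>\<F>"
      using cpt False compactinD[of "prod_topology S T" "K \<times> L" "U ` (K \<times> L)"] by blast
    then show ?thesis by (metis finite_subset_image)
  qed auto
  then obtain F where F: "finite F" "F \<subseteq> K \<times> L" "K \<times> L \<subseteq> (\<Union>z\<in>F. U z)" by blast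
  \<comment> \<open>The inserted 1 covers an empty cover. Half radii leave room for the triangle
    inequality from the centre of the ball to \<open>(x', y')\<close>.\<close>
  define r where "r = Min (insert 1 ((\<lambda>z. \<rho> z / 2) ` F))"
  have fin: "finite (insert 1 ((\<lambda>z. \<rho> z / 2) ` F))" using F(1) by simp
  have r: "r > 0" "\<And>z. z \<in> F \<Longrightarrow> r \<le> \<rho> z / 2"
  proof -
    have "0 < \<rho> z" if "z \<in> F" for z
      using \<rho>(1)[of z] F(2) Ks Ls that by blast
    then show "r > 0" unfolding r_def using fin by (subst Min_gr_iff) auto
    show "r \<le> \<rho> z / 2" if "z \<in> F" for z
      unfolding r_def using fin that by (intro Min_le) auto
  qed
  show thesis
  proof (rule that[OF r(1)])
    fix x y x' y' assume xy: "x \<in> K" "y \<in> L" "x' \<in> topspace S" "y' \<in> topspace T" "dS x x' < r" "dT y y' < r"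
    then obtain z where z: "z \<in> F" "(x, y) \<in> U z" using F(3) by blast
    then have "z \<in> topspace S \<times> topspace T" using F(2) Ks Ls by blast
    then have zs: "z \<in> topspace S \<times> topspace T" "fst z \<in> topspace S" "snd z \<in> topspace T"
      by (auto simp: mem_Times_iff)
    have xs: "x \<in> topspace S" "y \<in> topspace T" using xy Ks Ls by auto
    have d: "dS (fst z) x < \<rho> z / 2" "dT (snd z) y < \<rho> z / 2" using z(2) by (auto simp: U_def)
    have "dS (fst z) x' < \<rho> z" using S.triangle[OF zs(2) xs(1) xy(3)] d r(2)[OF z(1)] xy(5) by linarith
    moreover have "dT (snd z) y' < \<rho> z" using T.triangle[OF zs(3) xs(2) xy(4)] d r(2)[OF z(1)] xy(6) by linarith
    ultimately have 1: "\<bar>c z - c (x', y')\<bar> < e / 2" using \<rho>(2)[OF zs(1) xy(3,4)] by auto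
    have "dS (fst z) x < \<rho> z" "dT (snd z) y < \<rho> z" using d \<rho>(1)[OF zs(1)] by linarith+
    then have "\<bar>c z - c (x, y)\<bar> < e / 2" using \<rho>(2)[OF zs(1) xs] by auto
    then show "\<bar>c (x, y) - c (x', y')\<bar> \<le> e" using 1 by linarith
  qed
qed

locale cost_setting = S: metric_polish S dS p + T: metric_polish T dT p
  for S :: "'a topology" and dS and T :: "'b topology" and dT and p :: real +
  fixes c :: "'a \<times> 'b \<Rightarrow> real"
  assumes c_cont: "continuous_map (prod_topology S T) euclideanreal c"
    and c_growth: "growth_at_most p S dS T dT c"
begin

lemma c_measurable: "c \<in> borel_measurable (borel_of S \<Otimes>\<^sub>M borel_of T)"
  using borel_measurable_continuous_map[OF c_cont]
  unfolding measurable_cong_sets[OF sets_borel_of_prod[OF polish_second_countable[OF S.polish] polish_second_countable[OF T.polish]] refl] .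

lemma growth_bound:
  obtains a b C where "a \<in> topspace S" "b \<in> topspace T" "C \<ge> 0"
    "\<And>x y. x \<in> topspace S \<Longrightarrow> y \<in> topspace T \<Longrightarrow> \<bar>c (x, y)\<bar> \<le> C * (1 + dS a x powr p + dT b y powr p)"
proof -
  obtain a b where ab: "a \<in> topspace S" "b \<in> topspace T"
    "bounded ((\<lambda>(x, y). c (x, y) / (1 + dS a x powr p + dT b y powr p)) ` (topspace S \<times> topspace T))"
    using c_growth by (auto simp: growth_at_most_def)
  then obtain C where C: "\<forall>z\<in>topspace S \<times> topspace T. \<bar>(\<lambda>(x, y). c (x, y) / (1 + dS a x powr p + dT b y powr p)) z\<bar> \<le> C"
    unfolding bounded_iff by auto
  show thesis
  proof (rule that[OF ab(1,2), of "max 0 C"])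
    fix x y assume "x \<in> topspace S" "y \<in> topspace T"
    then have "\<bar>c (x, y) / (1 + dS a x powr p + dT b y powr p)\<bar> \<le> C" using C by force
    moreover have pos: "1 + dS a x powr p + dT b y powr p > 0" by (simp add: add_pos_nonneg)
    ultimately have "\<bar>c (x, y)\<bar> \<le> C * (1 + dS a x powr p + dT b y powr p)"
      by (simp add: abs_divide pos_divide_le_eq)
    also have "\<dots> \<le> max 0 C * (1 + dS a x powr p + dT b y powr p)"
      using pos by (intro mult_right_mono) auto
    finally show "\<bar>c (x, y)\<bar> \<le> max 0 C * (1 + dS a x powr p + dT b y powr p)" .
  qed simp
qed

text \<open>Only \<open>(x, y)\<close> has prescribed marginals; \<open>(x', y')\<close> is known to
  be close in mean and nothing else, and \<open>\<delta>\<close> is uniform over all such pairs. If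
  \<open>(x, y)\<close> lies in compact sets and moves little, the cost changes little. The
  complementary event is small by tightness and Markov's inequality, and there the growth bound and
  the tails of the marginals take over.\<close>

lemma c_stable:
  assumes \<mu>: "\<mu> \<in> probs_p p S dS" and \<nu>: "\<nu> \<in> probs_p p T dT" and e: "e > 0"
  obtains \<delta> where "\<delta> > 0"
    "\<And>(M :: 'w measure) x y x' y'. prob_space M \<Longrightarrow> x \<in> M \<rightarrow>\<^sub>M borel_of S \<Longrightarrow> x' \<in> M \<rightarrow>\<^sub>M borel_of S \<Longrightarrow>
      y \<in> M \<rightarrow>\<^sub>M borel_of T \<Longrightarrow> y' \<in> M \<rightarrow>\<^sub>M borel_of T \<Longrightarrow>
      distr M (borel_of S) x = \<mu> \<Longrightarrow> distr M (borel_of T) y = \<nu> \<Longrightarrow>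
      (\<integral>\<^sup>+w. ennreal (dS (x w) (x' w) powr p) \<partial>M) \<le> ennreal \<delta> \<Longrightarrow>
      (\<integral>\<^sup>+w. ennreal (dT (y w) (y' w) powr p) \<partial>M) \<le> ennreal \<delta> \<Longrightarrow>
      integrable M (\<lambda>w. c (x w, y w)) \<and> integrable M (\<lambda>w. c (x' w, y' w)) \<and>
      (\<integral>w. \<bar>c (x w, y w) - c (x' w, y' w)\<bar> \<partial>M) \<le> e"
proof -
  obtain a b C0 where ab: "a \<in> topspace S" "b \<in> topspace T" and C0: "C0 \<ge> 0"
    "\<And>x y. x \<in> topspace S \<Longrightarrow> y \<in> topspace T \<Longrightarrow> \<bar>c (x, y)\<bar> \<le> C0 * (1 + dS a x powr p + dT b y powr p)"
    by (rule growth_bound) (rule that)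
  define G1 where "G1 x = dS a x powr p" for x
  define G2 where "G2 y = dT b y powr p" for y
  define K where "K = (2 :: real) powr p"
  have K: "K \<ge> 1" unfolding K_def using S.p by (simp add: ge_one_powr_ge_zero)
  \<comment> \<open>Twice \<open>C0 * K\<close> bounds the growth factors of both costs together;
    the added 1 makes \<open>C1\<close> a legitimate divisor.\<close>
  define C1 where "C1 = 2 * C0 * K + 1"
  have C1: "C1 > 0" using C0 K by (simp add: C1_def add_nonneg_pos)
  have G1: "integrable \<mu> G1" and G2: "integrable \<nu> G2"
    unfolding G1_def G2_def using S.moment_integrable[OF \<mu> ab(1)] T.moment_integrable[OF \<nu> ab(2)] by auto
  have Gm [measurable]: "G1 \<in> borel_measurable (borel_of S)" "G2 \<in> borel_measurable (borel_of T)"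
    unfolding G1_def G2_def using S.dist_powr_measurable1[OF ab(1)] T.dist_powr_measurable1[OF ab(2)] by auto
  have Gnn: "G1 x \<ge> 0" "G2 y \<ge> 0" for x y by (auto simp: G1_def G2_def)
  \<comment> \<open>Each of four contributions receives \<open>e / 4\<close>: uniform continuity,
    four small probabilities \<open>\<beta>\<close> weighted by \<open>B\<close>, two tails
    \<open>e1\<close> weighted by \<open>C1\<close>, and two mean displacements, at most
    \<open>e1\<close> each, weighted by \<open>C1\<close>.\<close>
  define e1 where "e1 = e / (8 * C1)"
  have e1: "e1 > 0" using e C1 by (simp add: e1_def)
  obtain R1 where R1: "R1 > 0" "(\<integral>x. max 0 (G1 x - R1) \<partial>\<mu>) \<le> e1" by (rule integrable_tail[OF G1 e1])
  obtain R2 where R2: "R2 > 0" "(\<integral>x. max 0 (G2 x - R2) \<partial>\<nu>) \<le> e1" by (rule integrable_tail[OF G2 e1])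
  define B where "B = C1 * (1 + R1 + R2)"
  have B: "B > 0" unfolding B_def using C1 R1 R2 by simp
  define \<beta> where "\<beta> = e / (16 * B)"
  have \<beta>: "\<beta> > 0" using e B by (simp add: \<beta>_def)
  have p\<mu>: "\<mu> \<in> probs S" and p\<nu>: "\<nu> \<in> probs T" using \<mu> \<nu> by (auto simp: probs_p_def)
  obtain KS where KS: "compactin S KS" "KS \<in> sets (borel_of S)" "measure \<mu> (topspace S - KS) < \<beta>"
    by (rule polish_tight[OF S.polish p\<mu> \<beta>])
  obtain KT where KT: "compactin T KT" "KT \<in> sets (borel_of T)" "measure \<nu> (topspace T - KT) < \<beta>"
    by (rule polish_tight[OF T.polish p\<nu> \<beta>])
  have "e / 4 > 0" using e by simp
  obtain r where r: "r > 0"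
    "\<And>x y x' y'. x \<in> KS \<Longrightarrow> y \<in> KT \<Longrightarrow> x' \<in> topspace S \<Longrightarrow> y' \<in> topspace T \<Longrightarrow>
      dS x x' < r \<Longrightarrow> dT y y' < r \<Longrightarrow> \<bar>c (x, y) - c (x', y')\<bar> \<le> e / 4"
    by (rule compact_uniform_continuity[OF S.metric T.metric c_cont KS(1) KT(1) \<open>e / 4 > 0\<close>]) blast
  define q where "q = r powr p"
  have q: "q > 0" using r by (simp add: q_def)
  \<comment> \<open>The bound \<open>\<beta> * q\<close> makes the Markov ratio at threshold
    \<open>r\<close> at most \<open>\<beta>\<close>; the bound \<open>e1\<close> controls the mean
    displacement itself.\<close>
  define \<delta> where "\<delta> = min (\<beta> * q) e1"
  have \<delta>: "\<delta> > 0" using \<beta> q e1 by (simp add: \<delta>_def)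
  show thesis
  proof (rule that[OF \<delta>])
    fix M :: "'w measure" and x x' y y'
    assume M: "prob_space M" and m [measurable]: "x \<in> M \<rightarrow>\<^sub>M borel_of S" "x' \<in> M \<rightarrow>\<^sub>M borel_of S"
      "y \<in> M \<rightarrow>\<^sub>M borel_of T" "y' \<in> M \<rightarrow>\<^sub>M borel_of T"
      and lx: "distr M (borel_of S) x = \<mu>" and ly: "distr M (borel_of T) y = \<nu>"
      and dx: "(\<integral>\<^sup>+w. ennreal (dS (x w) (x' w) powr p) \<partial>M) \<le> ennreal \<delta>"
      and dy: "(\<integral>\<^sup>+w. ennreal (dT (y w) (y' w) powr p) \<partial>M) \<le> ennreal \<delta>"
    interpret prob_space M by (rule M)
    define D1 where "D1 w = dS (x w) (x' w) powr p" for w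
    define D2 where "D2 w = dT (y w) (y' w) powr p" for w
    have D1m [measurable]: "D1 \<in> borel_measurable M" unfolding D1_def
      using measurable_compose[OF measurable_Pair[OF m(1,2)] S.dist_powr_measurable] by simp
    have D2m [measurable]: "D2 \<in> borel_measurable M" unfolding D2_def
      using measurable_compose[OF measurable_Pair[OF m(3,4)] T.dist_powr_measurable] by simp
    have Dnn: "D1 w \<ge> 0" "D2 w \<ge> 0" for w by (auto simp: D1_def D2_def)
    have D1: "integrable M D1" "(\<integral>w. D1 w \<partial>M) \<le> \<delta>"
    proof -
      have "(\<integral>\<^sup>+w. ennreal (D1 w) \<partial>M) \<le> ennreal \<delta>" using dx by (simp add: D1_def)
      then show i: "integrable M D1" using Dnn by (intro integrableI_nonneg) (auto simp: less_top[symmetric] top_unique)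
      have "ennreal (\<integral>w. D1 w \<partial>M) \<le> ennreal \<delta>"
        using \<open>(\<integral>\<^sup>+w. ennreal (D1 w) \<partial>M) \<le> ennreal \<delta>\<close> nn_integral_eq_integral[OF i] Dnn by simp
      then show "(\<integral>w. D1 w \<partial>M) \<le> \<delta>" using \<delta> by (simp add: ennreal_le_iff)
    qed
    have D2: "integrable M D2" "(\<integral>w. D2 w \<partial>M) \<le> \<delta>"
    proof -
      have "(\<integral>\<^sup>+w. ennreal (D2 w) \<partial>M) \<le> ennreal \<delta>" using dy by (simp add: D2_def)
      then show i: "integrable M D2" using Dnn by (intro integrableI_nonneg) (auto simp: less_top[symmetric] top_unique)
      have "ennreal (\<integral>w. D2 w \<partial>M) \<le> ennreal \<delta>"
        using \<open>(\<integral>\<^sup>+w. ennreal (D2 w) \<partial>M) \<le> ennreal \<delta>\<close> nn_integral_eq_integral[OF i] Dnn by simp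
      then show "(\<integral>w. D2 w \<partial>M) \<le> \<delta>" using \<delta> by (simp add: ennreal_le_iff)
    qed
    have sp: "x w \<in> topspace S" "x' w \<in> topspace S" "y w \<in> topspace T" "y' w \<in> topspace T" if "w \<in> space M" for w
      using measurable_space[OF m(1) that] measurable_space[OF m(2) that] measurable_space[OF m(3) that] measurable_space[OF m(4) that] by auto
    define z where "z w = c (x w, y w)" for w
    define z' where "z' w = c (x' w, y' w)" for w
    have zm [measurable]: "z \<in> borel_measurable M" "z' \<in> borel_measurable M"
      unfolding z_def z'_def using measurable_compose[OF measurable_Pair[OF m(1,3)] c_measurable]
        measurable_compose[OF measurable_Pair[OF m(2,4)] c_measurable] by auto
    have iG1: "integrable M (\<lambda>w. G1 (x w))" and iG2: "integrable M (\<lambda>w. G2 (y w))"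
      using G1 G2 unfolding lx[symmetric] ly[symmetric] by (auto simp: integrable_distr_eq)
    have \<mu>s: "sets \<mu> = sets (borel_of S)" "sets \<nu> = sets (borel_of T)" using p\<mu> p\<nu> by (auto simp: probs_def)
    have iT1: "integrable M (\<lambda>w. max 0 (G1 (x w) - R1))" "(\<integral>w. max 0 (G1 (x w) - R1) \<partial>M) \<le> e1"
    proof -
      show "integrable M (\<lambda>w. max 0 (G1 (x w) - R1))" using iG1 by auto
      show "(\<integral>w. max 0 (G1 (x w) - R1) \<partial>M) \<le> e1" using R1(2) unfolding lx[symmetric] by (subst (asm) integral_distr) auto
    qed
    have iT2: "integrable M (\<lambda>w. max 0 (G2 (y w) - R2))" "(\<integral>w. max 0 (G2 (y w) - R2) \<partial>M) \<le> e1"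
    proof -
      show "integrable M (\<lambda>w. max 0 (G2 (y w) - R2))" using iG2 by auto
      show "(\<integral>w. max 0 (G2 (y w) - R2) \<partial>M) \<le> e1" using R2(2) unfolding ly[symmetric] by (subst (asm) integral_distr) auto
    qed
    have bz: "\<bar>z w\<bar> \<le> C0 * (1 + G1 (x w) + G2 (y w))" if "w \<in> space M" for w
      using C0(2) sp[OF that] by (simp add: z_def G1_def G2_def)
    have bz': "\<bar>z' w\<bar> \<le> C0 * K * (1 + G1 (x w) + G2 (y w) + D1 w + D2 w)" if w: "w \<in> space M" for w
    proof -
      have 1: "G1 (x' w) \<le> K * (G1 (x w) + D1 w)"
        unfolding G1_def D1_def K_def using sp[OF w] by (intro S.dist_powr_triangle ab)
      have 2: "G2 (y' w) \<le> K * (G2 (y w) + D2 w)"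
        unfolding G2_def D2_def K_def using sp[OF w] by (intro T.dist_powr_triangle ab)
      have "\<bar>z' w\<bar> \<le> C0 * (1 + G1 (x' w) + G2 (y' w))"
        using C0(2) sp[OF w] by (simp add: z'_def G1_def G2_def)
      also have "\<dots> \<le> C0 * (K + K * (G1 (x w) + D1 w) + K * (G2 (y w) + D2 w))"
        using 1 2 K C0(1) by (intro mult_left_mono add_mono) auto
      finally show ?thesis by (simp add: algebra_simps)
    qed
    have iz: "integrable M z"
    proof (rule Bochner_Integration.integrable_bound)
      show "integrable M (\<lambda>w. C0 * (1 + G1 (x w) + G2 (y w)))" using iG1 iG2 by auto
      show "AE w in M. norm (z w) \<le> norm (C0 * (1 + G1 (x w) + G2 (y w)))"
        using bz by (intro AE_I2) (auto intro: order_trans[OF _ abs_ge_self])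
    qed auto
    have iz': "integrable M z'"
    proof (rule Bochner_Integration.integrable_bound)
      show "integrable M (\<lambda>w. C0 * K * (1 + G1 (x w) + G2 (y w) + D1 w + D2 w))" using iG1 iG2 D1 D2 by auto
      show "AE w in M. norm (z' w) \<le> norm (C0 * K * (1 + G1 (x w) + G2 (y w) + D1 w + D2 w))"
        using bz' by (intro AE_I2) (auto intro: order_trans[OF _ abs_ge_self])
    qed auto
    define I1 where "I1 w = (indicator (topspace S - KS) (x w) :: real)" for w
    define I2 where "I2 w = (indicator (topspace T - KT) (y w) :: real)" for w
    have KSc: "topspace S - KS \<in> sets (borel_of S)" "topspace T - KT \<in> sets (borel_of T)"
      using KS(2) KT(2) sets.compl_sets[of KS "borel_of S"] sets.compl_sets[of KT "borel_of T"] by auto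
    note [measurable] = KSc
    have I1: "integrable M I1" "(\<integral>w. I1 w \<partial>M) \<le> \<beta>"
    proof -
      show "integrable M I1" unfolding I1_def by (rule bmeas_integrable[OF bmeas_comp[OF bmeas_indicator[OF KSc(1)] m(1)]])
      have "(\<integral>w. I1 w \<partial>M) = (\<integral>u. indicator (topspace S - KS) u \<partial>\<mu>)"
        unfolding lx[symmetric] I1_def by (subst integral_distr) auto
      also have "\<dots> = measure \<mu> (topspace S - KS)"
        using KSc(1) by (simp add: \<mu>s Int_absorb2 sets_eq_imp_space_eq[OF \<mu>s(1)])
      finally show "(\<integral>w. I1 w \<partial>M) \<le> \<beta>" using KS(3) by simp
    qed
    have I2: "integrable M I2" "(\<integral>w. I2 w \<partial>M) \<le> \<beta>"
    proof -
      show "integrable M I2" unfolding I2_def by (rule bmeas_integrable[OF bmeas_comp[OF bmeas_indicator[OF KSc(2)] m(3)]])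
      have "(\<integral>w. I2 w \<partial>M) = (\<integral>u. indicator (topspace T - KT) u \<partial>\<nu>)"
        unfolding ly[symmetric] I2_def by (subst integral_distr) auto
      also have "\<dots> = measure \<nu> (topspace T - KT)"
        using KSc(2) by (simp add: \<mu>s Int_absorb2 sets_eq_imp_space_eq[OF \<mu>s(2)])
      finally show "(\<integral>w. I2 w \<partial>M) \<le> \<beta>" using KT(3) by simp
    qed
    define bnd where "bnd w = e / 4 + B * (I1 w + I2 w + D1 w / q + D2 w / q)
        + C1 * (max 0 (G1 (x w) - R1) + max 0 (G2 (y w) - R2)) + C1 * (D1 w + D2 w)" for w
    have pw: "\<bar>z w - z' w\<bar> \<le> bnd w" if w: "w \<in> space M" for w
    proof (cases "x w \<in> KS \<and> y w \<in> KT \<and> dS (x w) (x' w) < r \<and> dT (y w) (y' w) < r")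
      case True
      then have "\<bar>z w - z' w\<bar> \<le> e / 4" unfolding z_def z'_def using r(2) sp[OF w] by blast
      also have "\<dots> \<le> bnd w" unfolding bnd_def using B C1 Dnn q by (auto simp: I1_def I2_def intro!: add_nonneg_nonneg mult_nonneg_nonneg)
      finally show ?thesis .
    next
      case False
      \<comment> \<open>Off the good event at least one indicator or Markov ratio reaches 1, so the
        level \<open>B\<close> is paid only there.\<close>
      have "1 \<le> I1 w + I2 w + D1 w / q + D2 w / q"
      proof -
        have "1 \<le> D1 w / q" if "\<not> dS (x w) (x' w) < r"
          using that r(1) S.p q by (simp add: D1_def q_def powr_mono2)
        moreover have "1 \<le> D2 w / q" if "\<not> dT (y w) (y' w) < r"
          using that r(1) S.p q by (simp add: D2_def q_def powr_mono2)
        moreover have "I1 w \<ge> 0" "I2 w \<ge> 0" "D1 w / q \<ge> 0" "D2 w / q \<ge> 0" using Dnn q by (auto simp: I1_def I2_def)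
        moreover have "x w \<notin> KS \<Longrightarrow> I1 w = 1" "y w \<notin> KT \<Longrightarrow> I2 w = 1"
          using sp[OF w] by (auto simp: I1_def I2_def)
        ultimately show ?thesis using False by (smt (verit))
      qed
      then have B1: "B \<le> B * (I1 w + I2 w + D1 w / q + D2 w / q)" using B by simp
      define g where "g = 1 + G1 (x w) + G2 (y w)"
      have g: "g \<ge> 0" using Gnn by (simp add: g_def add_nonneg_nonneg)
      have "\<bar>z w - z' w\<bar> \<le> C0 * g + C0 * K * (g + D1 w + D2 w)"
        using bz[OF w] bz'[OF w] by (simp add: g_def)
      also have "\<dots> \<le> C0 * K * g + C0 * K * (g + D1 w + D2 w)"
        using K C0(1) g by (intro add_right_mono mult_right_mono) (auto simp: mult_le_cancel_left1)
      also have "\<dots> \<le> C1 * g + C1 * (D1 w + D2 w)"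
      proof -
        have "C0 * K * (D1 w + D2 w) \<le> C1 * (D1 w + D2 w)"
          using C0(1) K Dnn by (intro mult_right_mono) (auto simp: C1_def)
        moreover have "2 * C0 * K * g \<le> C1 * g" using g by (intro mult_right_mono) (auto simp: C1_def)
        ultimately show ?thesis by (simp add: algebra_simps)
      qed
      also have "C1 * g \<le> B + C1 * (max 0 (G1 (x w) - R1) + max 0 (G2 (y w) - R2))"
      proof -
        have "g \<le> (1 + R1 + R2) + (max 0 (G1 (x w) - R1) + max 0 (G2 (y w) - R2))" by (auto simp: g_def)
        then have "C1 * g \<le> C1 * ((1 + R1 + R2) + (max 0 (G1 (x w) - R1) + max 0 (G2 (y w) - R2)))"
          using C1 by (intro mult_left_mono) auto
        then show ?thesis by (simp add: B_def distrib_left)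
      qed
      finally show ?thesis using B1 e unfolding bnd_def by simp
    qed
    have ib: "integrable M bnd" unfolding bnd_def using I1 I2 D1 D2 iT1 iT2 by auto
    have "(\<integral>w. \<bar>z w - z' w\<bar> \<partial>M) \<le> (\<integral>w. bnd w \<partial>M)"
      using iz iz' ib pw by (intro integral_mono) auto
    also have "\<dots> = e / 4 + B * ((\<integral>w. I1 w \<partial>M) + (\<integral>w. I2 w \<partial>M) + (\<integral>w. D1 w \<partial>M) / q + (\<integral>w. D2 w \<partial>M) / q)
        + C1 * ((\<integral>w. max 0 (G1 (x w) - R1) \<partial>M) + (\<integral>w. max 0 (G2 (y w) - R2) \<partial>M)) + C1 * ((\<integral>w. D1 w \<partial>M) + (\<integral>w. D2 w \<partial>M))"
      unfolding bnd_def using I1 I2 D1 D2 iT1 iT2 prob_space by simp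
    also have "\<dots> \<le> e / 4 + B * (\<beta> + \<beta> + \<beta> + \<beta>) + C1 * (e1 + e1) + C1 * (e1 + e1)"
    proof -
      have "(\<integral>w. D1 w \<partial>M) / q \<le> \<beta>" "(\<integral>w. D2 w \<partial>M) / q \<le> \<beta>" "(\<integral>w. D1 w \<partial>M) \<le> e1" "(\<integral>w. D2 w \<partial>M) \<le> e1"
        using D1 D2 q by (auto simp: \<delta>_def pos_divide_le_eq)
      then show ?thesis using I1 I2 iT1 iT2 B C1 by (intro add_mono mult_left_mono order_refl) auto
    qed
    also have "\<dots> = e" using B C1 by (simp add: \<beta>_def e1_def)
    finally show "integrable M (\<lambda>w. c (x w, y w)) \<and> integrable M (\<lambda>w. c (x' w, y' w)) \<and>
      (\<integral>w. \<bar>c (x w, y w) - c (x' w, y' w)\<bar> \<partial>M) \<le> e"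
      using iz iz' by (simp add: z_def[abs_def] z'_def[abs_def])
  qed
qed

end

section \<open>Closedness of the admissible sets\<close>

lemma bmeas_cong_sets: "sets M = sets N \<Longrightarrow> bmeas M = bmeas N"
  unfolding bmeas_def by (subst measurable_cong_sets[of M N borel borel]) auto

section \<open>Bounded continuous functions and their density in L1\<close>

definition bcont :: "'a topology \<Rightarrow> ('a \<Rightarrow> real) set" where
  "bcont T = {f. continuous_map T euclideanreal f \<and> (\<exists>C. \<forall>x. \<bar>f x\<bar> \<le> C)}"

lemma bcont_bmeas: "f \<in> bcont T \<Longrightarrow> f \<in> bmeas (borel_of T)"
  by (auto simp: bcont_def bmeas_def intro: borel_measurable_continuous_map)

lemma bcont_const: "(\<lambda>_. c) \<in> bcont T"
  by (auto simp: bcont_def)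

lemma bcont_add: assumes "f \<in> bcont T" "g \<in> bcont T" shows "(\<lambda>x. f x + g x) \<in> bcont T"
proof -
  obtain C D where "\<forall>x. \<bar>f x\<bar> \<le> C" "\<forall>x. \<bar>g x\<bar> \<le> D" using assms by (auto simp: bcont_def)
  then have "\<forall>x. \<bar>f x + g x\<bar> \<le> C + D" by (meson abs_triangle_ineq add_mono order_trans)
  then show ?thesis using assms by (auto simp: bcont_def intro: continuous_map_add)
qed

lemma bcont_mult: assumes "f \<in> bcont T" "g \<in> bcont T" shows "(\<lambda>x. f x * g x) \<in> bcont T"
proof -
  obtain C D where CD: "\<forall>x. \<bar>f x\<bar> \<le> C" "\<forall>x. \<bar>g x\<bar> \<le> D" using assms by (auto simp: bcont_def)
  have "\<bar>f x * g x\<bar> \<le> C * D" for x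
    unfolding abs_mult using CD by (intro mult_mono) (auto intro: order_trans[OF abs_ge_zero])
  then show ?thesis using assms by (auto simp: bcont_def intro: continuous_map_real_mult)
qed

lemma bcont_compose: "f \<in> bcont T \<Longrightarrow> continuous_map S T q \<Longrightarrow> (\<lambda>x. f (q x)) \<in> bcont S"
  using continuous_map_compose[of S T q euclideanreal f] by (auto simp: bcont_def o_def)

text \<open>A closed set of a metrizable space is the intersection of decreasing open sets. Urysohn
  functions that vanish off these sets are eventually 0 at each point outside
  \<open>C\<close>.\<close>

lemma closed_indicator_limit:
  assumes T: "metrizable_space T" and C: "closedin T C"
  obtains f :: "nat \<Rightarrow> 'a \<Rightarrow> real" where "\<And>n. f n \<in> bcont T" "\<And>n x. 0 \<le> f n x \<and> f n x \<le> 1"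
    "\<And>x. x \<in> topspace T \<Longrightarrow> (\<lambda>n. f n x) \<longlonglongrightarrow> indicator C x"
proof -
  obtain U where U: "\<And>n. openin T (U n)" "\<And>n. U (Suc n) \<subseteq> U n" "\<Inter>(range U) = C"
    using closed_imp_gdelta_in[OF T C] unfolding gdelta_in_descending by blast
  have anti: "U m \<subseteq> U n" if "n \<le> m" for n m
    using that by (induction rule: dec_induct) (use U(2) in auto)
  have "\<exists>g. continuous_map T (top_of_set {0..1::real}) g \<and> g ` (topspace T - U n) \<subseteq> {0} \<and> g ` C \<subseteq> {1}" for n
  proof -
    have "closedin T (topspace T - U n)" using U(1) by blast
    moreover have "disjnt (topspace T - U n) C" using U(3) by (auto simp: disjnt_def)
    ultimately show ?thesis
      using Urysohn_lemma[OF metrizable_imp_normal_space[OF T] _ C, of "topspace T - U n" 0 1]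
      by (metis zero_le_one)
  qed
  then obtain g where g: "\<And>n. continuous_map T (top_of_set {0..1::real}) (g n)"
    "\<And>n. g n ` (topspace T - U n) \<subseteq> {0}" "\<And>n. g n ` C \<subseteq> {1}" by metis
  \<comment> \<open>Continuity says nothing outside \<open>topspace T\<close>, where the Urysohn
    function could be unbounded, whereas \<open>bcont\<close> demands a bound everywhere.\<close>
  define f where "f n x = (if x \<in> topspace T then g n x else 0)" for n x
  have f01: "0 \<le> f n x \<and> f n x \<le> 1" for n x
    using g(1)[of n] by (auto simp: f_def continuous_map_in_subtopology image_subset_iff)
  show thesis
  proof (rule that)
    show "f n \<in> bcont T" for n
    proof -
      have "continuous_map T euclideanreal (g n)" using g(1) by (simp add: continuous_map_in_subtopology)
      then have "continuous_map T euclideanreal (f n)" by (rule continuous_map_eq) (simp add: f_def)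
      then show ?thesis using f01 by (auto simp: bcont_def intro!: exI[of _ 1])
    qed
    show "0 \<le> f n x \<and> f n x \<le> 1" for n x by (rule f01)
    fix x assume x: "x \<in> topspace T"
    show "(\<lambda>n. f n x) \<longlonglongrightarrow> indicator C x"
    proof (cases "x \<in> C")
      case True
      then have "f n x = 1" for n using g(3)[of n] x by (auto simp: f_def)
      then show ?thesis using True by simp
    next
      case False
      then obtain n where "x \<notin> U n" using U(3) by auto
      then have "f m x = 0" if "m \<ge> n" for m
        using g(2)[of m] x anti[OF that] by (auto simp: f_def)
      then show ?thesis using False
        by (intro tendsto_eventually) (auto simp: eventually_sequentially)
    qed
  qed
qed

lemma polish_metrizable: "polish T \<Longrightarrow> metrizable_space T"
  by (simp add: polish_def completely_metrizable_imp_metrizable_space)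

lemma Int_stable_closedin: "Int_stable {C. closedin T C}"
  by (auto simp: Int_stable_def)

lemma sets_borel_of_closed: "sets (borel_of T) = sigma_sets (topspace T) {C. closedin T C}"
proof
  interpret sigma_algebra "topspace T" "sigma_sets (topspace T) {C. closedin T C}"
    by (rule sigma_algebra_sigma_sets) (auto dest: closedin_subset)
  have "U \<in> sigma_sets (topspace T) {C. closedin T C}" if "openin T U" for U
  proof -
    have "topspace T - (topspace T - U) \<in> sigma_sets (topspace T) {C. closedin T C}"
      using that by (intro compl_sets sigma_sets.Basic) auto
    then show ?thesis using openin_subset[OF that] by (simp add: double_diff)
  qed
  then show "sets (borel_of T) \<subseteq> sigma_sets (topspace T) {C. closedin T C}"
    unfolding sets_borel_of by (intro sigma_sets_subset) auto
  show "sigma_sets (topspace T) {C. closedin T C} \<subseteq> sets (borel_of T)"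
    using sets.sigma_sets_subset[of "{C. closedin T C}" "borel_of T"] closedin_sets_borel_of by auto
qed

lemma probs_eqI:
  assumes T: "polish T" and \<mu>: "\<mu> \<in> probs T" and \<nu>: "\<nu> \<in> probs T"
    and eq: "\<And>f. f \<in> bcont T \<Longrightarrow> (\<integral>x. f x \<partial>\<mu>) = (\<integral>x. f x \<partial>\<nu>)"
  shows "\<mu> = \<nu>"
proof (rule measure_eqI_generator_eq[where E="{C. closedin T C}" and \<Omega>="topspace T" and A="\<lambda>_. topspace T"])
  interpret \<mu>: prob_space \<mu> using \<mu> by (simp add: probs_def)
  interpret \<nu>: prob_space \<nu> using \<nu> by (simp add: probs_def)
  have s: "sets \<mu> = sets (borel_of T)" "sets \<nu> = sets (borel_of T)" using \<mu> \<nu> by (auto simp: probs_def)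
  have sp: "space \<mu> = topspace T" "space \<nu> = topspace T"
    using sets_eq_imp_space_eq[OF s(1)] sets_eq_imp_space_eq[OF s(2)] by auto
  show "sets \<mu> = sigma_sets (topspace T) {C. closedin T C}" "sets \<nu> = sigma_sets (topspace T) {C. closedin T C}"
    using s by (simp_all add: sets_borel_of_closed)
  fix C assume "C \<in> {C. closedin T C}"
  then have C: "closedin T C" by simp
  obtain f :: "nat \<Rightarrow> 'a \<Rightarrow> real" where f: "\<And>n. f n \<in> bcont T" "\<And>n x. 0 \<le> f n x \<and> f n x \<le> 1"
    "\<And>x. x \<in> topspace T \<Longrightarrow> (\<lambda>n. f n x) \<longlonglongrightarrow> indicator C x"
    by (rule closed_indicator_limit[OF polish_metrizable[OF T] C]) (rule that)
  have lim: "(\<lambda>n. \<integral>x. f n x \<partial>M) \<longlonglongrightarrow> measure M C" if "prob_space M" "sets M = sets (borel_of T)" for M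
  proof -
    interpret prob_space M by fact
    have [simp]: "space M = topspace T" using sets_eq_imp_space_eq[OF that(2)] by simp
    have Cs: "C \<in> sets M" using closedin_sets_borel_of[OF C] that(2) by simp
    have "(\<lambda>n. \<integral>x. f n x \<partial>M) \<longlonglongrightarrow> (\<integral>x. indicator C x \<partial>M)"
    proof (rule integral_dominated_convergence[where w="\<lambda>_. 1"])
      show "f n \<in> borel_measurable M" for n
        using bmeas_measurable[OF bcont_bmeas[OF f(1)[of n]]] by (simp add: measurable_cong_sets[OF that(2) refl])
    qed (use f Cs in auto)
    then show ?thesis using Cs closedin_subset[OF C] by (simp add: Int_absorb2)
  qed
  have "measure \<mu> C = measure \<nu> C"
    using LIMSEQ_unique[OF lim[OF \<mu>.prob_space_axioms s(1)]] lim[OF \<nu>.prob_space_axioms s(2)] eq[OF f(1)] by simp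
  then show "emeasure \<mu> C = emeasure \<nu> C" by (simp add: \<mu>.emeasure_eq_measure \<nu>.emeasure_eq_measure)
next
  interpret \<mu>: prob_space \<mu> using \<mu> by (simp add: probs_def)
  show "emeasure \<mu> (topspace T) \<noteq> \<infinity>" for i :: nat by (simp add: \<mu>.emeasure_eq_measure)
qed (use Int_stable_closedin closedin_subset in auto)

definition approximable :: "'a topology \<Rightarrow> 'a measure \<Rightarrow> ('a \<Rightarrow> real) \<Rightarrow> bool" where
  "approximable T \<mu> f \<longleftrightarrow> integrable \<mu> f \<and> (\<forall>e>0. \<exists>g\<in>bcont T. (\<integral>x. \<bar>f x - g x\<bar> \<partial>\<mu>) < e)"

context
  fixes T :: "'a topology" and \<mu> :: "'a measure"
  assumes T: "polish T" and \<mu>: "\<mu> \<in> probs T"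
begin

interpretation \<mu>: prob_space \<mu> using \<mu> by (simp add: probs_def)

lemma approx_sets: "sets \<mu> = sets (borel_of T)" "space \<mu> = topspace T"
proof -
  show "sets \<mu> = sets (borel_of T)" using \<mu> by (simp add: probs_def)
  from sets_eq_imp_space_eq[OF this] show "space \<mu> = topspace T" by simp
qed

lemma bcont_integrable:
  assumes "g \<in> bcont T"
  shows "integrable \<mu> g"
proof (rule \<mu>.bmeas_integrable)
  show "g \<in> bmeas \<mu>"
    using bcont_bmeas[OF assms] unfolding bmeas_def measurable_cong_sets[OF approx_sets(1) refl] .
qed

lemma approximable_bcont:
  assumes "g \<in> bcont T"
  shows "approximable T \<mu> g"
  unfolding approximable_def
proof (intro conjI allI impI bexI)
  show "integrable \<mu> g" by (rule bcont_integrable[OF assms])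
  show "g \<in> bcont T" by (rule assms)
  show "(\<integral>x. \<bar>g x - g x\<bar> \<partial>\<mu>) < e" if "e > 0" for e using that by simp
qed

lemma approximable_limit:
  assumes s: "\<And>i. approximable T \<mu> (s i)" and f: "integrable \<mu> f"
    and lim: "(\<lambda>i. \<integral>x. \<bar>f x - s i x\<bar> \<partial>\<mu>) \<longlonglongrightarrow> 0"
  shows "approximable T \<mu> f"
  unfolding approximable_def
proof (intro conjI allI impI f)
  fix e :: real assume "e > 0"
  then have "eventually (\<lambda>i. (\<integral>x. \<bar>f x - s i x\<bar> \<partial>\<mu>) < e / 2) sequentially"
    using lim by (intro order_tendstoD(2)) auto
  then obtain i where i: "(\<integral>x. \<bar>f x - s i x\<bar> \<partial>\<mu>) < e / 2"
    using eventually_happens'[OF sequentially_bot] by blast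
  obtain g where g: "g \<in> bcont T" "(\<integral>x. \<bar>s i x - g x\<bar> \<partial>\<mu>) < e / 2"
    using s[of i] \<open>e > 0\<close> unfolding approximable_def by (meson half_gt_zero)
  have si: "integrable \<mu> (s i)" using s by (simp add: approximable_def)
  have "(\<integral>x. \<bar>f x - g x\<bar> \<partial>\<mu>) \<le> (\<integral>x. \<bar>f x - s i x\<bar> + \<bar>s i x - g x\<bar> \<partial>\<mu>)"
    using f si bcont_integrable[OF g(1)] by (intro integral_mono) auto
  also have "\<dots> < e" using f si bcont_integrable[OF g(1)] i g(2) by simp
  finally show "\<exists>g\<in>bcont T. (\<integral>x. \<bar>f x - g x\<bar> \<partial>\<mu>) < e" using g(1) by blast
qed

lemma approximable_dominated:
  assumes s: "\<And>i. approximable T \<mu> (s i)" and f: "integrable \<mu> f" and w: "integrable \<mu> w"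
    and lim: "\<And>x. x \<in> topspace T \<Longrightarrow> (\<lambda>i. s i x) \<longlonglongrightarrow> f x"
    and bnd: "\<And>i x. x \<in> topspace T \<Longrightarrow> \<bar>s i x\<bar> \<le> w x"
  shows "approximable T \<mu> f"
proof (rule approximable_limit[OF s f])
  have si: "integrable \<mu> (s i)" for i using s by (simp add: approximable_def)
  have "(\<lambda>i. \<integral>x. \<bar>f x - s i x\<bar> \<partial>\<mu>) \<longlonglongrightarrow> (\<integral>x. 0 \<partial>\<mu>)"
  proof (rule integral_dominated_convergence[where w="\<lambda>x. \<bar>f x\<bar> + w x"])
    show "AE x in \<mu>. (\<lambda>i. \<bar>f x - s i x\<bar>) \<longlonglongrightarrow> 0"
    proof (rule AE_I2)
      fix x assume "x \<in> space \<mu>"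
      then have "(\<lambda>i. f x - s i x) \<longlonglongrightarrow> f x - f x"
        using lim approx_sets by (intro tendsto_diff) auto
      then show "(\<lambda>i. \<bar>f x - s i x\<bar>) \<longlonglongrightarrow> 0" by (intro tendsto_rabs_zero) simp
    qed
    show "AE x in \<mu>. norm \<bar>f x - s i x\<bar> \<le> \<bar>f x\<bar> + w x" for i
      using bnd approx_sets by (intro AE_I2) (fastforce intro: order_trans[OF abs_triangle_ineq4])
  qed (use f w si in auto)
  then show "(\<lambda>i. \<integral>x. \<bar>f x - s i x\<bar> \<partial>\<mu>) \<longlonglongrightarrow> 0" by simp
qed

lemma approximable_add:
  assumes f: "approximable T \<mu> f" and g: "approximable T \<mu> g"
  shows "approximable T \<mu> (\<lambda>x. f x + g x)"
  unfolding approximable_def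
proof (intro conjI allI impI)
  have i: "integrable \<mu> f" "integrable \<mu> g" using f g by (auto simp: approximable_def)
  then show "integrable \<mu> (\<lambda>x. f x + g x)" by simp
  fix e :: real assume "e > 0"
  then obtain f' g' where fg: "f' \<in> bcont T" "g' \<in> bcont T" "(\<integral>x. \<bar>f x - f' x\<bar> \<partial>\<mu>) < e / 2" "(\<integral>x. \<bar>g x - g' x\<bar> \<partial>\<mu>) < e / 2"
    using f g unfolding approximable_def by (meson half_gt_zero)
  have "(\<integral>x. \<bar>f x + g x - (f' x + g' x)\<bar> \<partial>\<mu>) \<le> (\<integral>x. \<bar>f x - f' x\<bar> + \<bar>g x - g' x\<bar> \<partial>\<mu>)"
    using i bcont_integrable fg by (intro integral_mono) auto
  also have "\<dots> < e" using i fg bcont_integrable by simp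
  finally show "\<exists>h\<in>bcont T. (\<integral>x. \<bar>f x + g x - h x\<bar> \<partial>\<mu>) < e"
    using bcont_add[OF fg(1,2)] by (intro bexI[of _ "\<lambda>x. f' x + g' x"])
qed

lemma approximable_scale:
  assumes f: "approximable T \<mu> f"
  shows "approximable T \<mu> (\<lambda>x. c * f x)"
  unfolding approximable_def
proof (intro conjI allI impI)
  have i: "integrable \<mu> f" using f by (auto simp: approximable_def)
  then show "integrable \<mu> (\<lambda>x. c * f x)" by simp
  fix e :: real assume e: "e > 0"
  have "e / (\<bar>c\<bar> + 1) > 0" using e by (simp add: add_nonneg_pos)
  then obtain g where g: "g \<in> bcont T" "(\<integral>x. \<bar>f x - g x\<bar> \<partial>\<mu>) < e / (\<bar>c\<bar> + 1)"
    using f unfolding approximable_def by meson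
  have "(\<integral>x. \<bar>c * f x - c * g x\<bar> \<partial>\<mu>) = \<bar>c\<bar> * (\<integral>x. \<bar>f x - g x\<bar> \<partial>\<mu>)"
    by (simp add: abs_mult flip: right_diff_distrib)
  also have "\<dots> \<le> (\<bar>c\<bar> + 1) * (\<integral>x. \<bar>f x - g x\<bar> \<partial>\<mu>)" by (intro mult_right_mono) auto
  also have "\<dots> < e" using g(2) by (simp add: pos_less_divide_eq add_nonneg_pos mult.commute)
  finally show "\<exists>h\<in>bcont T. (\<integral>x. \<bar>c * f x - h x\<bar> \<partial>\<mu>) < e"
    using bcont_mult[OF bcont_const g(1)] by (intro bexI[of _ "\<lambda>x. c * g x"])
qed

text \<open>A Dynkin argument: closed sets form an intersection-stable generator, and
  approximability passes to complements by linearity and to disjoint unions by dominated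
  convergence.\<close>

lemma approximable_indicator:
  assumes "A \<in> sets (borel_of T)"
  shows "approximable T \<mu> (indicator A)"
proof -
  have int: "integrable \<mu> (indicator A :: _ \<Rightarrow> real)" if "A \<in> sets (borel_of T)" for A
    using that approx_sets(1) by (simp add: less_top[symmetric])
  have sub: "{C. closedin T C} \<subseteq> Pow (topspace T)" by (auto dest: closedin_subset)
  show ?thesis
    using Int_stable_closedin sub assms[unfolded sets_borel_of_closed]
  proof (induction rule: sigma_sets_induct_disjoint)
    case (basic C)
    then have C: "closedin T C" by simp
    obtain f :: "nat \<Rightarrow> 'a \<Rightarrow> real" where f: "\<And>n. f n \<in> bcont T" "\<And>n x. 0 \<le> f n x \<and> f n x \<le> 1"
      "\<And>x. x \<in> topspace T \<Longrightarrow> (\<lambda>n. f n x) \<longlonglongrightarrow> indicator C x"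
      by (rule closed_indicator_limit[OF polish_metrizable[OF T] C]) (rule that)
    show ?case
      by (rule approximable_dominated[where s=f and w="\<lambda>_. 1"])
         (use f approximable_bcont int closedin_sets_borel_of[OF C] in \<open>auto simp: abs_le_iff intro: order_trans\<close>)
  next
    case empty
    show ?case using approximable_bcont[OF bcont_const[of 0]] by (simp add: indicator_def)
  next
    case (compl A)
    have 1: "approximable T \<mu> (\<lambda>x. 1 + (-1) * indicator A x)"
      by (intro approximable_add approximable_scale approximable_bcont bcont_const compl)
    \<comment> \<open>The two functions agree on \<open>topspace T\<close> only, so the indicator of
      the complement is obtained as the limit of a constant sequence.\<close>
    show ?case
    proof (rule approximable_dominated[where w="\<lambda>_. 1", OF 1])
      show "integrable \<mu> (indicator (topspace T - A) :: _ \<Rightarrow> real)"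
        using compl(1) sets.compl_sets[of A "borel_of T"] by (intro int) (auto simp: sets_borel_of_closed)
    qed (auto simp: indicator_def)
  next
    case (union A)
    have As: "A i \<in> sets (borel_of T)" for i using union(2) by (auto simp: sets_borel_of_closed)
    have 1: "approximable T \<mu> (\<lambda>x. \<Sum>i<n. indicator (A i) x)" for n
    proof (induction n)
      case 0
      show ?case using approximable_bcont[OF bcont_const[of 0]] by simp
    next
      case (Suc n)
      then show ?case using approximable_add[OF _ union(3)] by simp
    qed
    have eq: "(\<Sum>i<n. indicator (A i) x) = (indicator (\<Union>i<n. A i) x :: real)" for n x
      using union(1) by (intro indicator_UN_disjoint[symmetric]) (auto intro: disjoint_family_on_mono)
    show ?case
    proof (rule approximable_dominated[where w="\<lambda>_. 1", OF 1])
      show "integrable \<mu> (indicator (\<Union>i. A i) :: _ \<Rightarrow> real)" using As by (intro int) auto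
      show "(\<lambda>n. \<Sum>i<n. indicator (A i) x) \<longlonglongrightarrow> (indicator (\<Union>i. A i) x :: real)" for x
        unfolding eq
      proof (cases "x \<in> (\<Union>i. A i)")
        case True
        then obtain k where "x \<in> A k" by auto
        then have "\<forall>n\<ge>Suc k. (indicator (\<Union>i<n. A i) x :: real) = indicator (\<Union>i. A i) x"
          by (auto simp: indicator_def intro!: bexI[of _ k])
        then show "(\<lambda>n. indicator (\<Union>i<n. A i) x) \<longlonglongrightarrow> (indicator (\<Union>i. A i) x :: real)"
          by (intro tendsto_eventually) (auto simp: eventually_sequentially)
      qed (auto simp: indicator_def)
    qed (auto simp: eq)
  qed
qed

lemma integrable_approximable:
  assumes "integrable \<mu> f"
  shows "approximable T \<mu> f"
  using assms
proof (induction rule: integrable_induct)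
  case (base A c)
  then show ?case using approximable_scale[OF approximable_indicator[of A], of c] approx_sets(1)
    by (simp add: mult.commute)
next
  case (add f g)
  then show ?case by (intro approximable_add)
next
  case (lim f s)
  show ?case
    by (rule approximable_dominated[where s=s and w="\<lambda>x. 2 * \<bar>f x\<bar>"]) (use lim approx_sets in auto)
qed

end

text \<open>The marginals are fixed, so \<open>a\<close> and \<open>b\<close> can be approximated by continuous functions in
  \<open>L\<^sup>1(\<mu>)\<close> and \<open>L\<^sup>1(\<nu>)\<close>, uniformly in the coupling.\<close>

lemma couplings_product_convergence:
  assumes S: "polish S" and T: "polish T" and \<pi>s: "\<And>n. \<pi>s n \<in> couplings S T \<mu> \<nu>" and \<pi>: "\<pi> \<in> couplings S T \<mu> \<nu>"
    and weak: "\<And>f. f \<in> bcont (prod_topology S T) \<Longrightarrow> (\<lambda>n. \<integral>z. f z \<partial>\<pi>s n) \<longlonglongrightarrow> (\<integral>z. f z \<partial>\<pi>)"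
    and a: "a \<in> bmeas (borel_of S)" and b: "b \<in> bmeas (borel_of T)"
  shows "(\<lambda>n. \<integral>z. a (fst z) * b (snd z) \<partial>\<pi>s n) \<longlonglongrightarrow> (\<integral>z. a (fst z) * b (snd z) \<partial>\<pi>)"
proof (rule LIMSEQ_I)
  fix e :: real assume e: "e > 0"
  have \<mu>: "\<mu> \<in> probs S" and \<nu>: "\<nu> \<in> probs T" using couplings_marginals[OF S T \<pi>] by auto
  interpret \<mu>: prob_space \<mu> using \<mu> by (simp add: probs_def)
  interpret \<nu>: prob_space \<nu> using \<nu> by (simp add: probs_def)
  have s\<mu>: "sets \<mu> = sets (borel_of S)" "sets \<nu> = sets (borel_of T)" using \<mu> \<nu> by (auto simp: probs_def)
  have ia: "integrable \<mu> a" "integrable \<nu> b"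
    using \<mu>.bmeas_integrable[of a] \<nu>.bmeas_integrable[of b] a b
    unfolding bmeas_cong_sets[OF s\<mu>(1)] bmeas_cong_sets[OF s\<mu>(2)] by blast+
  obtain Cb where Cb: "\<And>y. \<bar>b y\<bar> \<le> Cb" "Cb \<ge> 0" using bmeas_bound[OF b] by blast
  have e1: "e / (6 * (Cb + 1)) > 0" using e Cb by simp
  \<comment> \<open>The order of the choices matters: the tolerance for \<open>g\<close> uses the
    bound of \<open>b\<close>, and the tolerance for \<open>h\<close> uses the bound of
    \<open>g\<close>. Together they cost \<open>e / 3\<close> under every coupling, which leaves a
    third each for \<open>\<pi>s n\<close>, for \<open>\<pi>\<close> and for the weak
    convergence.\<close>
  obtain g where g: "g \<in> bcont S" "(\<integral>x. \<bar>a x - g x\<bar> \<partial>\<mu>) < e / (6 * (Cb + 1))"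
    using integrable_approximable[OF S \<mu> ia(1)] e1 unfolding approximable_def by blast
  obtain Cg where Cg: "\<And>y. \<bar>g y\<bar> \<le> Cg" "Cg \<ge> 0" using bmeas_bound[OF bcont_bmeas[OF g(1)]] by blast
  have e2: "e / (6 * (Cg + 1)) > 0" using e Cg by simp
  obtain h where h: "h \<in> bcont T" "(\<integral>x. \<bar>b x - h x\<bar> \<partial>\<nu>) < e / (6 * (Cg + 1))"
    using integrable_approximable[OF T \<nu> ia(2)] e2 unfolding approximable_def by blast
  define F where "F z = a (fst z) * b (snd z)" for z
  define H where "H z = g (fst z) * h (snd z)" for z
  have H: "H \<in> bcont (prod_topology S T)" unfolding H_def
    by (intro bcont_mult bcont_compose[OF g(1)] bcont_compose[OF h(1)] continuous_map_fst continuous_map_snd)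
  have close: "\<bar>(\<integral>z. F z \<partial>\<theta>) - (\<integral>z. H z \<partial>\<theta>)\<bar> \<le> e / 3" if \<theta>: "\<theta> \<in> couplings S T \<mu> \<nu>" for \<theta>
  proof -
    interpret \<theta>: prob_space \<theta> using couplingsD(1)[OF \<theta>] .
    note s\<theta> = couplings_sets[OF S T \<theta>]
    have m: "fst \<in> \<theta> \<rightarrow>\<^sub>M borel_of S" "snd \<in> \<theta> \<rightarrow>\<^sub>M borel_of T"
      by (simp_all add: measurable_cong_sets[OF s\<theta> refl])
    note bm = a b bcont_bmeas[OF g(1)] bcont_bmeas[OF h(1)]
    have ba: "(\<lambda>z. a (fst z)) \<in> bmeas \<theta>" "(\<lambda>z. g (fst z)) \<in> bmeas \<theta>" "(\<lambda>z. b (snd z)) \<in> bmeas \<theta>" "(\<lambda>z. h (snd z)) \<in> bmeas \<theta>"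
      by (intro bmeas_comp[OF _ m(1)] bmeas_comp[OF _ m(2)] bm)+
    have i: "integrable \<theta> F" "integrable \<theta> H" unfolding F_def H_def
      by (intro \<theta>.bmeas_integrable bmeas_mult ba)+
    have d: "integrable \<theta> (\<lambda>z. \<bar>a (fst z) - g (fst z)\<bar>)" "integrable \<theta> (\<lambda>z. \<bar>b (snd z) - h (snd z)\<bar>)"
      by (intro integrable_abs \<theta>.bmeas_integrable bmeas_diff ba)+
    have "\<bar>(\<integral>z. F z \<partial>\<theta>) - (\<integral>z. H z \<partial>\<theta>)\<bar> = \<bar>\<integral>z. F z - H z \<partial>\<theta>\<bar>" using i by simp
    also have "\<dots> \<le> (\<integral>z. \<bar>F z - H z\<bar> \<partial>\<theta>)" by (rule integral_abs_bound)
    also have "\<dots> \<le> (\<integral>z. Cb * \<bar>a (fst z) - g (fst z)\<bar> + Cg * \<bar>b (snd z) - h (snd z)\<bar> \<partial>\<theta>)"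
    proof (rule integral_mono)
      fix z
      have "F z - H z = (a (fst z) - g (fst z)) * b (snd z) + g (fst z) * (b (snd z) - h (snd z))"
        by (simp add: F_def H_def algebra_simps)
      then have "\<bar>F z - H z\<bar> \<le> \<bar>a (fst z) - g (fst z)\<bar> * \<bar>b (snd z)\<bar> + \<bar>g (fst z)\<bar> * \<bar>b (snd z) - h (snd z)\<bar>"
        by (metis abs_mult abs_triangle_ineq)
      also have "\<dots> \<le> \<bar>a (fst z) - g (fst z)\<bar> * Cb + Cg * \<bar>b (snd z) - h (snd z)\<bar>"
        using Cb Cg by (intro add_mono mult_left_mono mult_right_mono) auto
      finally show "\<bar>F z - H z\<bar> \<le> Cb * \<bar>a (fst z) - g (fst z)\<bar> + Cg * \<bar>b (snd z) - h (snd z)\<bar>"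
        by (simp add: mult.commute)
    qed (use i d in auto)
    also have "\<dots> = Cb * (\<integral>z. \<bar>a (fst z) - g (fst z)\<bar> \<partial>\<theta>) + Cg * (\<integral>z. \<bar>b (snd z) - h (snd z)\<bar> \<partial>\<theta>)"
      using d by simp
    also have "(\<integral>z. \<bar>a (fst z) - g (fst z)\<bar> \<partial>\<theta>) = (\<integral>x. \<bar>a x - g x\<bar> \<partial>\<mu>)"
      unfolding couplingsD(3)[OF \<theta>, symmetric] using bm m by (subst integral_distr) (auto simp: bmeas_def)
    also have "(\<integral>z. \<bar>b (snd z) - h (snd z)\<bar> \<partial>\<theta>) = (\<integral>x. \<bar>b x - h x\<bar> \<partial>\<nu>)"
      unfolding couplingsD(4)[OF \<theta>, symmetric] using bm m by (subst integral_distr) (auto simp: bmeas_def)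
    also have "Cb * (\<integral>x. \<bar>a x - g x\<bar> \<partial>\<mu>) + Cg * (\<integral>x. \<bar>b x - h x\<bar> \<partial>\<nu>)
      \<le> (Cb + 1) * (e / (6 * (Cb + 1))) + (Cg + 1) * (e / (6 * (Cg + 1)))"
      using g(2) h(2) Cb Cg by (intro add_mono mult_mono) auto
    also have "\<dots> = e / 6 + e / 6"
    proof -
      have "(C + 1) * (e / (6 * (C + 1))) = e / 6" if "C \<ge> 0" for C :: real
      proof -
        have "C + 1 \<noteq> 0" using that by linarith
        then show ?thesis by (simp add: divide_simps)
      qed
      from this[OF Cb(2)] this[OF Cg(2)] show ?thesis by (simp only:)
    qed
    finally show ?thesis by simp
  qed
  obtain n0 where n0: "\<forall>n\<ge>n0. norm ((\<integral>z. H z \<partial>\<pi>s n) - (\<integral>z. H z \<partial>\<pi>)) < e / 3"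
    using LIMSEQ_D[OF weak[OF H], of "e / 3"] e by auto
  show "\<exists>n0. \<forall>n\<ge>n0. norm ((\<integral>z. a (fst z) * b (snd z) \<partial>\<pi>s n) - (\<integral>z. a (fst z) * b (snd z) \<partial>\<pi>)) < e"
  proof (intro exI[of _ n0] allI impI)
    fix n assume "n \<ge> n0"
    then have "\<bar>(\<integral>z. H z \<partial>\<pi>s n) - (\<integral>z. H z \<partial>\<pi>)\<bar> < e / 3" using n0 by simp
    then have "\<bar>(\<integral>z. F z \<partial>\<pi>s n) - (\<integral>z. F z \<partial>\<pi>)\<bar> < e"
      using close[OF \<pi>s[of n]] close[OF \<pi>] by linarith
    then show "norm ((\<integral>z. a (fst z) * b (snd z) \<partial>\<pi>s n) - (\<integral>z. a (fst z) * b (snd z) \<partial>\<pi>)) < e"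
      by (simp add: F_def)
  qed
qed

text \<open>Puts the constraints of all four versions into one form, a function of the first path
  times a function of the second; the regular version has no constraint. Limits, mixtures and
  products are then treated once for all versions.\<close>

definition version_test ::
    "version \<Rightarrow> nat \<Rightarrow> (nat \<Rightarrow> 'a topology) \<Rightarrow> (nat \<Rightarrow> 'b topology) \<Rightarrow>
     (nat \<Rightarrow> 'a) measure \<Rightarrow> (nat \<Rightarrow> 'b) measure \<Rightarrow> ((nat \<Rightarrow> 'a) \<Rightarrow> real) \<Rightarrow> ((nat \<Rightarrow> 'b) \<Rightarrow> real) \<Rightarrow> bool" where
  "version_test v N X Y \<mu> \<nu> a b \<longleftrightarrow>
     (v = Causal \<or> v = Bicausal) \<and> causal_test N X Y \<mu> a b \<or>
     (v = Anticausal \<or> v = Bicausal) \<and> causal_test N Y X \<nu> b a"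

lemma version_test_bmeas:
  assumes "version_test v N X Y \<mu> \<nu> a b"
  shows "a \<in> bmeas (borel_of (paths N X))" "b \<in> bmeas (borel_of (paths N Y))"
  using assms by (auto simp: version_test_def dest: causal_test_bmeas)

lemma admissible_iff_version_test:
  assumes X: "\<And>t. t \<in> {1..N} \<Longrightarrow> polish (X t)" and Y: "\<And>t. t \<in> {1..N} \<Longrightarrow> polish (Y t)"
    and \<pi>: "\<pi> \<in> couplings (paths N X) (paths N Y) \<mu> \<nu>"
  shows "admissible v N X Y \<pi> \<longleftrightarrow>
    (\<forall>a b. version_test v N X Y \<mu> \<nu> a b \<longrightarrow> (\<integral>z. a (fst z) * b (snd z) \<partial>\<pi>) = 0)"
proof -
  have pX: "polish (paths N X)" and pY: "polish (paths N Y)" using X Y by (auto intro!: polish_paths)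
  note s = couplings_sets[OF pX pY \<pi>]
  have m: "fst \<in> \<pi> \<rightarrow>\<^sub>M borel_of (paths N X)" "snd \<in> \<pi> \<rightarrow>\<^sub>M borel_of (paths N Y)"
    by (simp_all add: measurable_cong_sets[OF s refl])
  have c: "causal N X Y \<pi> \<longleftrightarrow> (\<forall>a b. causal_test N X Y \<mu> a b \<longrightarrow> (\<integral>z. a (fst z) * b (snd z) \<partial>\<pi>) = 0)"
    unfolding causal_eq_causal_rv
    by (rule causal_rv_iff_test[OF couplingsD(1)[OF \<pi>] _ m couplingsD(3)[OF \<pi>]]) (rule X)
  have ac: "anticausal N X Y \<pi> \<longleftrightarrow> (\<forall>b a. causal_test N Y X \<nu> b a \<longrightarrow> (\<integral>z. b (snd z) * a (fst z) \<partial>\<pi>) = 0)"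
    unfolding anticausal_eq_causal_rv
    by (rule causal_rv_iff_test[OF couplingsD(1)[OF \<pi>] _ m(2,1) couplingsD(4)[OF \<pi>]]) (rule Y)
  then have ac': "anticausal N X Y \<pi> \<longleftrightarrow> (\<forall>a b. causal_test N Y X \<nu> b a \<longrightarrow> (\<integral>z. a (fst z) * b (snd z) \<partial>\<pi>) = 0)"
    by (subst (asm) mult.commute) blast
  show ?thesis
  proof (cases v)
    case Bicausal
    then show ?thesis unfolding version_test_def using c ac' by auto
  qed (use c ac' in \<open>simp_all add: version_test_def\<close>)
qed

text \<open>Every test contains a factor with mean zero under its own marginal, so the product
  measure passes all tests. Consequently no infimum ranges over the empty set, and the entropic
  value is finite from above because the relative entropy of the product is 0.\<close>

lemma product_Couplings:
  assumes X: "\<And>t. t \<in> {1..N} \<Longrightarrow> polish (X t)" and Y: "\<And>t. t \<in> {1..N} \<Longrightarrow> polish (Y t)"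
    and \<mu>: "\<mu> \<in> probs (paths N X)" and \<nu>: "\<nu> \<in> probs (paths N Y)"
  shows "\<mu> \<Otimes>\<^sub>M \<nu> \<in> Couplings v N X Y \<mu> \<nu>"
proof -
  have pX: "polish (paths N X)" and pY: "polish (paths N Y)" using X Y by (auto intro!: polish_paths)
  interpret \<mu>: prob_space \<mu> using \<mu> by (simp add: probs_def)
  interpret \<nu>: prob_space \<nu> using \<nu> by (simp add: probs_def)
  interpret P: pair_prob_space \<mu> \<nu> ..
  have s: "sets \<mu> = sets (borel_of (paths N X))" "sets \<nu> = sets (borel_of (paths N Y))"
    using \<mu> \<nu> by (auto simp: probs_def)
  have "sets (\<mu> \<Otimes>\<^sub>M \<nu>) = sets (borel_of (prod_topology (paths N X) (paths N Y)))"
    using sets_pair_measure_cong[OF s] sets_borel_of_prod[of "paths N X" "paths N Y"] pX pY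
    by (simp add: polish_second_countable)
  moreover have "distr (\<mu> \<Otimes>\<^sub>M \<nu>) (borel_of (paths N X)) fst = \<mu>" "distr (\<mu> \<Otimes>\<^sub>M \<nu>) (borel_of (paths N Y)) snd = \<nu>"
    using \<nu>.distr_pair_fst[of \<mu>] distr_pair_snd_prob[OF \<mu>.prob_space_axioms \<nu>.prob_space_axioms] s
    by (auto cong: distr_cong)
  ultimately have C: "\<mu> \<Otimes>\<^sub>M \<nu> \<in> couplings (paths N X) (paths N Y) \<mu> \<nu>"
    using P.prob_space_axioms by (simp add: couplings_def probs_def)
  have "(\<integral>z. a (fst z) * b (snd z) \<partial>(\<mu> \<Otimes>\<^sub>M \<nu>)) = 0" if t: "version_test v N X Y \<mu> \<nu> a b" for a b
  proof -
    have "a \<in> bmeas \<mu>" "b \<in> bmeas \<nu>" using version_test_bmeas[OF t]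
      by (auto simp: bmeas_def measurable_cong_sets[OF s(1) refl] measurable_cong_sets[OF s(2) refl])
    then have "(\<integral>z. a (fst z) * b (snd z) \<partial>(\<mu> \<Otimes>\<^sub>M \<nu>)) = (\<integral>x. a x \<partial>\<mu>) * (\<integral>y. b y \<partial>\<nu>)"
      by (rule integral_pair_mult[OF \<mu>.prob_space_axioms \<nu>.prob_space_axioms])
    also have "\<dots> = 0" using t by (auto simp: version_test_def dest: causal_test_integral)
    finally show ?thesis .
  qed
  then show ?thesis using C admissible_iff_version_test[OF X Y C, of v] by (simp add: Couplings_def)
qed

text \<open>Used with constant sequences for convexity and with \<open>\<pi>s = \<pi>s'\<close> for closedness.\<close>

lemma Couplings_average_limitI:
  assumes X: "\<And>t. t \<in> {1..N} \<Longrightarrow> polish (X t)" and Y: "\<And>t. t \<in> {1..N} \<Longrightarrow> polish (Y t)"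
    and \<pi>s: "\<And>n. \<pi>s n \<in> Couplings v N X Y \<mu> \<nu>" and \<pi>s': "\<And>n. \<pi>s' n \<in> Couplings v N X Y \<mu> \<nu>"
    and \<pi>: "prob_space \<pi>" "sets \<pi> = sets (borel_of (paths N X) \<Otimes>\<^sub>M borel_of (paths N Y))"
    and lim: "\<And>a b. a \<in> bmeas (borel_of (paths N X)) \<Longrightarrow> b \<in> bmeas (borel_of (paths N Y)) \<Longrightarrow>
      (\<lambda>n. ((\<integral>z. a (fst z) * b (snd z) \<partial>\<pi>s n) + (\<integral>z. a (fst z) * b (snd z) \<partial>\<pi>s' n)) / 2)
        \<longlonglongrightarrow> (\<integral>z. a (fst z) * b (snd z) \<partial>\<pi>)"
  shows "\<pi> \<in> Couplings v N X Y \<mu> \<nu>"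
proof -
  have pX: "polish (paths N X)" and pY: "polish (paths N Y)" using X Y by (auto intro!: polish_paths)
  interpret \<pi>: prob_space \<pi> by fact
  note c = CouplingsD(1)[OF \<pi>s] and c' = CouplingsD(1)[OF \<pi>s']
  have \<mu>\<nu>: "\<mu> \<in> probs (paths N X)" "\<nu> \<in> probs (paths N Y)" using couplings_marginals[OF pX pY c] by auto
  have m: "fst \<in> \<theta> \<rightarrow>\<^sub>M borel_of (paths N X)" "snd \<in> \<theta> \<rightarrow>\<^sub>M borel_of (paths N Y)"
    if "sets \<theta> = sets (borel_of (paths N X) \<Otimes>\<^sub>M borel_of (paths N Y))" for \<theta>
    by (simp_all add: measurable_cong_sets[OF that refl])
  \<comment> \<open>Testing with the constant 1 in one argument recovers the marginals of the
    limit.\<close>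
  have one: "(\<lambda>_. 1) \<in> bmeas M" for M :: "'z measure" by (rule bmeasI[where C=1]) auto
  have dX: "distr \<pi> (borel_of (paths N X)) fst = \<mu>"
  proof (rule probs_eqI[OF pX])
    show "distr \<pi> (borel_of (paths N X)) fst \<in> probs (paths N X)"
      using \<pi>.prob_space_distr[OF m(1)[OF \<pi>(2)]] by (simp add: probs_def)
    fix f assume f: "f \<in> bcont (paths N X)"
    have d: "(\<integral>x. f x \<partial>distr \<theta> (borel_of (paths N X)) fst) = (\<integral>z. f (fst z) * 1 \<partial>\<theta>)"
      if "sets \<theta> = sets (borel_of (paths N X) \<Otimes>\<^sub>M borel_of (paths N Y))" for \<theta>
      using bcont_bmeas[OF f] by (subst integral_distr[OF m(1)[OF that]]) (auto simp: bmeas_def)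
    have "((\<integral>z. f (fst z) * 1 \<partial>\<pi>s n) + (\<integral>z. f (fst z) * 1 \<partial>\<pi>s' n)) / 2 = (\<integral>x. f x \<partial>\<mu>)" for n
      using d[OF couplings_sets[OF pX pY c[of n]]] couplingsD(3)[OF c[of n]]
        d[OF couplings_sets[OF pX pY c'[of n]]] couplingsD(3)[OF c'[of n]] by simp
    then show "(\<integral>x. f x \<partial>distr \<pi> (borel_of (paths N X)) fst) = (\<integral>x. f x \<partial>\<mu>)"
      using lim[OF bcont_bmeas[OF f] one] d[OF \<pi>(2)] by (simp add: LIMSEQ_const_iff)
  qed (rule \<mu>\<nu>)
  have dY: "distr \<pi> (borel_of (paths N Y)) snd = \<nu>"
  proof (rule probs_eqI[OF pY])
    show "distr \<pi> (borel_of (paths N Y)) snd \<in> probs (paths N Y)"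
      using \<pi>.prob_space_distr[OF m(2)[OF \<pi>(2)]] by (simp add: probs_def)
    fix f assume f: "f \<in> bcont (paths N Y)"
    have d: "(\<integral>x. f x \<partial>distr \<theta> (borel_of (paths N Y)) snd) = (\<integral>z. 1 * f (snd z) \<partial>\<theta>)"
      if "sets \<theta> = sets (borel_of (paths N X) \<Otimes>\<^sub>M borel_of (paths N Y))" for \<theta>
      using bcont_bmeas[OF f] by (subst integral_distr[OF m(2)[OF that]]) (auto simp: bmeas_def)
    have "((\<integral>z. 1 * f (snd z) \<partial>\<pi>s n) + (\<integral>z. 1 * f (snd z) \<partial>\<pi>s' n)) / 2 = (\<integral>x. f x \<partial>\<nu>)" for n
      using d[OF couplings_sets[OF pX pY c[of n]]] couplingsD(4)[OF c[of n]]
        d[OF couplings_sets[OF pX pY c'[of n]]] couplingsD(4)[OF c'[of n]] by simp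
    then show "(\<integral>x. f x \<partial>distr \<pi> (borel_of (paths N Y)) snd) = (\<integral>x. f x \<partial>\<nu>)"
      using lim[OF one bcont_bmeas[OF f]] d[OF \<pi>(2)] by (simp add: LIMSEQ_const_iff)
  qed (rule \<mu>\<nu>)
  have "sets \<pi> = sets (borel_of (prod_topology (paths N X) (paths N Y)))"
    using \<pi>(2) sets_borel_of_prod[of "paths N X" "paths N Y"] pX pY by (simp add: polish_second_countable)
  then have C: "\<pi> \<in> couplings (paths N X) (paths N Y) \<mu> \<nu>"
    using \<pi>(1) dX dY by (simp add: couplings_def probs_def)
  have "(\<integral>z. a (fst z) * b (snd z) \<partial>\<pi>) = 0" if t: "version_test v N X Y \<mu> \<nu> a b" for a b
  proof -
    have "((\<integral>z. a (fst z) * b (snd z) \<partial>\<pi>s n) + (\<integral>z. a (fst z) * b (snd z) \<partial>\<pi>s' n)) / 2 = 0" for n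
      using CouplingsD(2)[OF \<pi>s[of n]] admissible_iff_version_test[OF X Y c[of n], of v] t
        CouplingsD(2)[OF \<pi>s'[of n]] admissible_iff_version_test[OF X Y c'[of n], of v] by auto
    then show ?thesis using lim[OF version_test_bmeas[OF t]] by (simp add: LIMSEQ_const_iff)
  qed
  then show ?thesis using C admissible_iff_version_test[OF X Y C, of v] by (simp add: Couplings_def)
qed

lemma Couplings_limitI:
  assumes X: "\<And>t. t \<in> {1..N} \<Longrightarrow> polish (X t)" and Y: "\<And>t. t \<in> {1..N} \<Longrightarrow> polish (Y t)"
    and \<pi>s: "\<And>n. \<pi>s n \<in> Couplings v N X Y \<mu> \<nu>"
    and \<pi>: "prob_space \<pi>" "sets \<pi> = sets (borel_of (paths N X) \<Otimes>\<^sub>M borel_of (paths N Y))"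
    and lim: "\<And>a b. a \<in> bmeas (borel_of (paths N X)) \<Longrightarrow> b \<in> bmeas (borel_of (paths N Y)) \<Longrightarrow>
      (\<lambda>n. \<integral>z. a (fst z) * b (snd z) \<partial>\<pi>s n) \<longlonglongrightarrow> (\<integral>z. a (fst z) * b (snd z) \<partial>\<pi>)"
  shows "\<pi> \<in> Couplings v N X Y \<mu> \<nu>"
  by (rule Couplings_average_limitI[where \<pi>s=\<pi>s and \<pi>s'=\<pi>s, OF X Y \<pi>s \<pi>s \<pi>]) (simp_all add: lim)

section \<open>The entropic problem\<close>

text \<open>Besides the limit in mean this delivers an almost everywhere convergent subsequence, for
  Fatou's lemma applied to the entropy, and a representative that is nonnegative at every point, as
  densities are required to be.\<close>

lemma L1_complete_nonneg:
  fixes f :: "nat \<Rightarrow> 'a \<Rightarrow> real"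
  assumes int: "\<And>n. integrable M (f n)" and nn: "\<And>n x. 0 \<le> f n x"
    and cauchy: "\<And>e. e > 0 \<Longrightarrow> \<exists>N. \<forall>i\<ge>N. \<forall>j\<ge>N. (\<integral>x. \<bar>f i x - f j x\<bar> \<partial>M) < e"
  obtains g r where "g \<in> borel_measurable M" "\<And>x. 0 \<le> g x" "integrable M g"
    "(\<lambda>n. \<integral>x. \<bar>f n x - g x\<bar> \<partial>M) \<longlonglongrightarrow> 0" "strict_mono r" "AE x in M. (\<lambda>i. f (r i) x) \<longlonglongrightarrow> g x"
proof -
  obtain r where r: "strict_mono r" "AE x in M. Cauchy (\<lambda>i. f (r i) x)"
    by (rule cauchy_L1_AE_cauchy_subseq[of M f]) (use int cauchy in auto)
  note fm [measurable] = borel_measurable_integrable[OF int]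
  define g where "g x = max 0 (lim (\<lambda>i. f (r i) x))" for x
  have gm [measurable]: "g \<in> borel_measurable M" unfolding g_def by measurable
  have gnn: "0 \<le> g x" for x by (simp add: g_def)
  have lim: "AE x in M. (\<lambda>i. f (r i) x) \<longlonglongrightarrow> g x"
    using r(2)
  proof eventually_elim
    case (elim x)
    then have 1: "(\<lambda>i. f (r i) x) \<longlonglongrightarrow> lim (\<lambda>i. f (r i) x)"
      by (simp add: Cauchy_convergent_iff convergent_LIMSEQ_iff)
    then have "0 \<le> lim (\<lambda>i. f (r i) x)" by (rule LIMSEQ_le_const) (simp add: nn)
    then show ?case using 1 by (simp add: g_def)
  qed
  \<comment> \<open>Fatou's lemma along the subsequence turns the Cauchy bound into a bound for the
    distance to the limit.\<close>
  have le: "(\<integral>\<^sup>+x. ennreal \<bar>f n x - g x\<bar> \<partial>M) \<le> ennreal e"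
    if e: "e > 0" and N: "\<forall>i\<ge>N. \<forall>j\<ge>N. (\<integral>x. \<bar>f i x - f j x\<bar> \<partial>M) < e" "n \<ge> N" for e N n
  proof -
    have "(\<integral>\<^sup>+x. ennreal \<bar>f n x - g x\<bar> \<partial>M) = (\<integral>\<^sup>+x. liminf (\<lambda>i. ennreal \<bar>f n x - f (r i) x\<bar>) \<partial>M)"
    proof (rule nn_integral_cong_AE)
      show "AE x in M. ennreal \<bar>f n x - g x\<bar> = liminf (\<lambda>i. ennreal \<bar>f n x - f (r i) x\<bar>)"
        using lim
      proof eventually_elim
        case (elim x)
        then have "(\<lambda>i. ennreal \<bar>f n x - f (r i) x\<bar>) \<longlonglongrightarrow> ennreal \<bar>f n x - g x\<bar>"
          by (intro tendsto_intros)
        from lim_imp_Liminf[OF sequentially_bot this, symmetric] show ?case .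
      qed
    qed
    also have "\<dots> \<le> liminf (\<lambda>i. \<integral>\<^sup>+x. ennreal \<bar>f n x - f (r i) x\<bar> \<partial>M)"
      by (rule nn_integral_liminf) measurable
    also have "\<dots> \<le> liminf (\<lambda>i. ennreal e)"
    proof (rule Liminf_mono)
      show "eventually (\<lambda>i. (\<integral>\<^sup>+x. ennreal \<bar>f n x - f (r i) x\<bar> \<partial>M) \<le> ennreal e) sequentially"
        using eventually_ge_at_top[of N]
      proof eventually_elim
        case (elim i)
        then have "r i \<ge> N" using seq_suble[OF r(1), of i] by linarith
        then have "(\<integral>x. \<bar>f n x - f (r i) x\<bar> \<partial>M) \<le> e" using N by (simp add: less_imp_le)
        then show ?case using int by (subst nn_integral_eq_integral) (auto intro: ennreal_leI)
      qed
    qed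
    also have "\<dots> = ennreal e" by (simp add: Liminf_const)
    finally show ?thesis .
  qed
  have gi: "integrable M g"
  proof -
    obtain N where N: "\<forall>i\<ge>N. \<forall>j\<ge>N. (\<integral>x. \<bar>f i x - f j x\<bar> \<partial>M) < 1" using cauchy[of 1] by auto
    have "(\<integral>\<^sup>+x. ennreal (norm (f N x - g x)) \<partial>M) < \<infinity>"
      using le[OF _ N order_refl] by (auto intro: le_less_trans)
    then have "integrable M (\<lambda>x. f N x - g x)" by (intro integrableI_bounded) auto
    from Bochner_Integration.integrable_diff[OF int[of N] this]
    show ?thesis by simp
  qed
  have "(\<lambda>n. \<integral>x. \<bar>f n x - g x\<bar> \<partial>M) \<longlonglongrightarrow> 0"
  proof (rule LIMSEQ_I)
    fix e :: real assume e: "e > 0"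
    then obtain N where N: "\<forall>i\<ge>N. \<forall>j\<ge>N. (\<integral>x. \<bar>f i x - f j x\<bar> \<partial>M) < e / 2" using cauchy[of "e / 2"] by auto
    show "\<exists>N. \<forall>n\<ge>N. norm ((\<integral>x. \<bar>f n x - g x\<bar> \<partial>M) - 0) < e"
    proof (intro exI[of _ N] allI impI)
      fix n assume "n \<ge> N"
      then have "(\<integral>\<^sup>+x. ennreal \<bar>f n x - g x\<bar> \<partial>M) \<le> ennreal (e / 2)" using le[OF _ N] e by simp
      then have "ennreal (\<integral>x. \<bar>f n x - g x\<bar> \<partial>M) \<le> ennreal (e / 2)"
        using int gi by (subst (asm) nn_integral_eq_integral) auto
      then have "(\<integral>x. \<bar>f n x - g x\<bar> \<partial>M) \<le> e / 2" using e by (simp add: ennreal_le_iff)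
      then show "norm ((\<integral>x. \<bar>f n x - g x\<bar> \<partial>M) - 0) < e" using e by simp
    qed
  qed
  then show thesis using that gm gnn gi r(1) lim by blast
qed

text \<open>From \<open>1 - 1 / y \<le> ln y\<close> at \<open>y = sqrt x\<close>, multiplied by
  \<open>2 * x\<close>. It is the pointwise comparison of the Hellinger distance with relative
  entropy.\<close>

lemma entropy_lower_bound: "0 \<le> x \<Longrightarrow> (sqrt x - 1)\<^sup>2 \<le> x * ln x - x + (1::real)"
proof (cases "x = 0")
  case False
  assume "0 \<le> x"
  with False have x: "0 < x" by simp
  have "sqrt x * sqrt x = x" using x by simp
  have "ln (1 / sqrt x) \<le> 1 / sqrt x - 1" using x by (intro ln_le_minus_one) auto
  then have "1 - 1 / sqrt x \<le> ln (sqrt x)" using x by (simp add: ln_div)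
  then have "2 * x * (1 - 1 / sqrt x) \<le> 2 * x * ln (sqrt x)" using x by (intro mult_left_mono) auto
  moreover have "2 * x * ln (sqrt x) = x * ln x" using x by (simp add: ln_sqrt)
  moreover have "2 * x * (1 - 1 / sqrt x) = 2 * x - 2 * sqrt x"
  proof -
    have "2 * x * (1 - 1 / sqrt x) = 2 * x - 2 * (x / sqrt x)" by (simp add: right_diff_distrib)
    then show ?thesis using real_div_sqrt[of x] x by simp
  qed
  moreover have "(sqrt x - 1)\<^sup>2 = x - 2 * sqrt x + 1" using x by (simp add: power2_diff)
  ultimately show ?thesis by linarith
qed simp

text \<open>Factor \<open>x - 1\<close> as \<open>(sqrt x - 1) * (sqrt x + 1)\<close>. The constant
  6 bounds the square of \<open>sqrt 2 + 1\<close>, which is about 5.83.\<close>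

lemma entropy_quadratic:
  assumes "0 \<le> x" "x \<le> 2"
  shows "(x - 1)\<^sup>2 \<le> 6 * (x * ln x - x + (1::real))"
proof -
  have s: "sqrt x * sqrt x = x" using assms by simp
  have "sqrt x \<le> 29 / 20" using assms by (intro real_le_lsqrt) (auto simp: power2_eq_square)
  then have "(sqrt x + 1)\<^sup>2 \<le> (29 / 20 + 1)\<^sup>2" using assms by (intro power_mono) auto
  also have "\<dots> \<le> 6 + 1 / 400" by (simp add: power2_eq_square)
  finally have "(sqrt x + 1)\<^sup>2 \<le> 6 + 1 / 400" .
  moreover have "(sqrt x + 1)\<^sup>2 = x + 2 * sqrt x + 1" using assms by (simp add: power2_sum)
  \<comment> \<open>A rational upper bound for the square root of 2, which makes
    \<open>x + 2 * sqrt x + 1\<close> at most 5.83.\<close>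
  moreover have "sqrt x \<le> 1415 / 1000" using assms by (intro real_le_lsqrt) (auto simp: power2_eq_square)
  ultimately have le: "(sqrt x + 1)\<^sup>2 \<le> 6" using assms by linarith
  have "x - 1 = (sqrt x - 1) * (sqrt x + 1)" using s by (simp add: algebra_simps)
  then have "(x - 1)\<^sup>2 = (sqrt x + 1)\<^sup>2 * (sqrt x - 1)\<^sup>2" by (simp add: power_mult_distrib)
  also have "\<dots> \<le> 6 * (x * ln x - x + 1)"
    using le entropy_lower_bound[OF assms(1)] by (intro mult_mono) auto
  finally show ?thesis .
qed

text \<open>Quantitative midpoint convexity of \<open>t * ln t\<close>. The quadratic bound is
  applied to \<open>a / s\<close> and \<open>b / s\<close>, which lie between 0 and 2; after
  multiplication by \<open>s\<close> the linear terms cancel because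
  \<open>a + b = 2 * s\<close>.\<close>

lemma entropy_midpoint:
  fixes a b :: real
  assumes a: "0 \<le> a" and b: "0 \<le> b"
  defines "s \<equiv> (a + b) / 2"
  shows "(a - b)\<^sup>2 \<le> 6 * (a + b) * (a * ln a + b * ln b - 2 * (s * ln s))"
proof (cases "s = 0")
  case True
  then have "a = 0" "b = 0" using a b by (auto simp: s_def)
  then show ?thesis by simp
next
  case False
  then have s: "s > 0" using a b by (simp add: s_def)
  have as: "0 \<le> a / s" "a / s \<le> 2" "0 \<le> b / s" "b / s \<le> 2"
    using a b s by (auto simp: s_def field_simps)
  have e: "s * (t / s * ln (t / s) - t / s + 1) = t * ln t - t * ln s - t + s" if "t \<ge> 0" for t
    using that s by (cases "t = 0") (auto simp: ln_div algebra_simps)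
  have "(a / s - 1)\<^sup>2 + (b / s - 1)\<^sup>2 \<le> 6 * (a / s * ln (a / s) - a / s + 1) + 6 * (b / s * ln (b / s) - b / s + 1)"
    using entropy_quadratic[OF as(1,2)] entropy_quadratic[OF as(3,4)] by (intro add_mono)
  then have "s * ((a / s - 1)\<^sup>2 + (b / s - 1)\<^sup>2)
      \<le> s * (6 * (a / s * ln (a / s) - a / s + 1) + 6 * (b / s * ln (b / s) - b / s + 1))"
    using s by (intro mult_left_mono) auto
  also have "\<dots> = 6 * (s * (a / s * ln (a / s) - a / s + 1)) + 6 * (s * (b / s * ln (b / s) - b / s + 1))"
    by (simp add: algebra_simps)
  also have "\<dots> = 6 * (a * ln a + b * ln b - 2 * (s * ln s))"
    unfolding e[OF a] e[OF b] by (simp add: s_def algebra_simps add_divide_distrib)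
  finally have 1: "s * ((a / s - 1)\<^sup>2 + (b / s - 1)\<^sup>2) \<le> 6 * (a * ln a + b * ln b - 2 * (s * ln s))" .
  have "a / s - 1 = (a - b) / (2 * s)" "b / s - 1 = - ((a - b) / (2 * s))"
    using s by (auto simp: s_def field_simps)
  then have "s * ((a / s - 1)\<^sup>2 + (b / s - 1)\<^sup>2) = s * (2 * ((a - b) / (2 * s))\<^sup>2)" by (simp only: power2_minus) simp
  also have "\<dots> = (a - b)\<^sup>2 / (2 * s)" using s by (simp add: power2_eq_square field_simps)
  finally have "(a - b)\<^sup>2 / (2 * s) \<le> 6 * (a * ln a + b * ln b - 2 * (s * ln s))" using 1 by simp
  then have "(a - b)\<^sup>2 \<le> 6 * (a * ln a + b * ln b - 2 * (s * ln s)) * (2 * s)"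
    using s by (simp add: pos_divide_le_eq)
  moreover have "6 * H * (2 * s) = 6 * (a + b) * H" for H by (simp add: s_def)
  ultimately show ?thesis by metis
qed

text \<open>The quadratic bound is linearized by the inequality of arithmetic and geometric means
  with weight \<open>v = \<tau> * (a + b)\<close>. In this form it can be integrated directly: the
  midpoint density has mass 1, so a small entropy defect and a small \<open>\<tau>\<close> bound the
  L1 distance.\<close>

lemma entropy_midpoint_abs:
  fixes a b \<tau> :: real
  assumes a: "0 \<le> a" and b: "0 \<le> b" and \<tau>: "\<tau> > 0"
  defines "s \<equiv> (a + b) / 2"
  shows "\<bar>a - b\<bar> \<le> 3 / \<tau> * (a * ln a + b * ln b - 2 * (s * ln s)) + \<tau> * s"
proof (cases "a + b = 0")
  case True
  then have "a = 0" "b = 0" using a b by auto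
  then show ?thesis by (simp add: s_def)
next
  case False
  then have ab: "a + b > 0" using a b by simp
  define H where "H = a * ln a + b * ln b - 2 * (s * ln s)"
  have "(a - b)\<^sup>2 \<le> 6 * (a + b) * H"
    using entropy_midpoint[OF a b] unfolding s_def H_def .
  then have "(a - b)\<^sup>2 / (a + b) \<le> 6 * H"
    using ab by (simp add: pos_divide_le_eq mult_ac)
  then have "(a - b)\<^sup>2 / (a + b) / (2 * \<tau>) \<le> 6 * H / (2 * \<tau>)" using \<tau> by (intro divide_right_mono) auto
  moreover have "\<bar>a - b\<bar> \<le> (a - b)\<^sup>2 / (a + b) / (2 * \<tau>) + \<tau> * s"
  proof -
    define u where "u = \<bar>a - b\<bar>"
    define v where "v = \<tau> * (a + b)"
    have v: "0 < 2 * v" using ab \<tau> by (simp add: v_def)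
    have "0 \<le> (u - v)\<^sup>2" by simp
    then have "u * (2 * v) \<le> u\<^sup>2 + v\<^sup>2" by (simp add: power2_diff mult_ac)
    then have "u \<le> (u\<^sup>2 + v\<^sup>2) / (2 * v)" using v by (simp only: pos_le_divide_eq)
    also have "\<dots> = (a - b)\<^sup>2 / (2 * v) + v\<^sup>2 / (2 * v)" by (simp add: add_divide_distrib u_def)
    also have "v\<^sup>2 / (2 * v) = \<tau> * s"
    proof -
      have "v\<^sup>2 / (2 * v) = v / 2" using v by (simp add: power2_eq_square)
      then show ?thesis by (simp add: v_def s_def)
    qed
    also have "(a - b)\<^sup>2 / (2 * v) = (a - b)\<^sup>2 / (a + b) / (2 * \<tau>)"
      unfolding v_def divide_divide_eq_left by (simp only: mult_ac)
    finally show ?thesis unfolding u_def .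
  qed
  moreover have "6 * H / (2 * \<tau>) = 3 / \<tau> * H" using \<tau> by (simp add: field_simps)
  ultimately have "\<bar>a - b\<bar> \<le> 3 / \<tau> * H + \<tau> * s" by linarith
  then show ?thesis by (simp only: H_def)
qed

lemma abs_mult_ln_le_sqrt: "0 \<le> x \<Longrightarrow> x \<le> 1 \<Longrightarrow> \<bar>x * ln x\<bar> \<le> 2 * sqrt (x :: real)"
proof (cases "x = 0")
  case False
  assume x: "0 \<le> x" "x \<le> 1"
  with False have x0: "0 < x" by simp
  have "- (sqrt x * ln (sqrt x)) \<le> 1" using x by (intro minus_mult_ln_le) auto
  then have "sqrt x * - (sqrt x * ln (sqrt x)) \<le> sqrt x * 1" using x by (intro mult_left_mono) auto
  moreover have "sqrt x * - (sqrt x * ln (sqrt x)) = - (x * ln (sqrt x))" using x by (simp add: mult.assoc[symmetric])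
  moreover have "x * ln x = 2 * (x * ln (sqrt x))" using x0 by (simp add: ln_sqrt)
  moreover have "x * ln x \<le> 0" using x0 x by (simp add: mult_nonneg_nonpos)
  ultimately show ?thesis by linarith
qed simp

text \<open>\<open>ln\<close> is not continuous at 0; there the domination of
  \<open>t * ln t\<close> by \<open>2 * sqrt t\<close> takes over.\<close>

lemma tendsto_mult_ln:
  fixes u :: "nat \<Rightarrow> real"
  assumes u: "u \<longlonglongrightarrow> x" and nn: "\<And>n. 0 \<le> u n"
  shows "(\<lambda>n. u n * ln (u n)) \<longlonglongrightarrow> x * ln x"
proof (cases "x = 0")
  case True
  have "(\<lambda>n. 2 * sqrt (u n)) \<longlonglongrightarrow> 2 * sqrt x" using u by (intro tendsto_intros)
  then have "(\<lambda>n. 2 * sqrt (u n)) \<longlonglongrightarrow> 0" using True by simp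
  moreover have "eventually (\<lambda>n. norm (u n * ln (u n)) \<le> 2 * sqrt (u n)) sequentially"
  proof -
    have "eventually (\<lambda>n. u n < 1) sequentially" using u True by (intro order_tendstoD(2)) auto
    then show ?thesis
    proof eventually_elim
      case (elim n)
      then show ?case using abs_mult_ln_le_sqrt[OF nn[of n]] by simp
    qed
  qed
  ultimately have "(\<lambda>n. u n * ln (u n)) \<longlonglongrightarrow> 0" by (rule Lim_null_comparison[rotated])
  then show ?thesis using True by simp
next
  case False
  then show ?thesis using u by (intro tendsto_intros)
qed

section \<open>Fixed marginals: densities, near-minimizers and the minimizer\<close>

locale transport =
  fixes N :: nat and X :: "nat \<Rightarrow> 'a topology" and Y :: "nat \<Rightarrow> 'b topology"
    and dX :: "(nat \<Rightarrow> 'a) \<Rightarrow> (nat \<Rightarrow> 'a) \<Rightarrow> real" and dY :: "(nat \<Rightarrow> 'b) \<Rightarrow> (nat \<Rightarrow> 'b) \<Rightarrow> real"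
    and p :: real and c :: "(nat \<Rightarrow> 'a) \<times> (nat \<Rightarrow> 'b) \<Rightarrow> real"
  assumes X: "\<And>t. t \<in> {1..N} \<Longrightarrow> polish (X t)" and Y: "\<And>t. t \<in> {1..N} \<Longrightarrow> polish (Y t)"
    and cost: "cost_setting (paths N X) dX (paths N Y) dY p c"
begin

sublocale cost_setting "paths N X" dX "paths N Y" dY p c by (rule cost)

abbreviation "PX \<equiv> paths N X"
abbreviation "PY \<equiv> paths N Y"
abbreviation "BX \<equiv> borel_of (paths N X)"
abbreviation "BY \<equiv> borel_of (paths N Y)"

lemma couplings_facts:
  assumes \<pi>: "\<pi> \<in> couplings PX PY \<mu> \<nu>"
  shows "prob_space \<pi>" "sets \<pi> = sets (BX \<Otimes>\<^sub>M BY)" "fst \<in> \<pi> \<rightarrow>\<^sub>M BX" "snd \<in> \<pi> \<rightarrow>\<^sub>M BY"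
    "distr \<pi> BX fst = \<mu>" "distr \<pi> BY snd = \<nu>" "space \<pi> = topspace PX \<times> topspace PY"
proof -
  show s: "sets \<pi> = sets (BX \<Otimes>\<^sub>M BY)" by (rule couplings_sets[OF S.polish T.polish \<pi>])
  show "fst \<in> \<pi> \<rightarrow>\<^sub>M BX" "snd \<in> \<pi> \<rightarrow>\<^sub>M BY" by (simp_all add: measurable_cong_sets[OF s refl])
  show "prob_space \<pi>" "distr \<pi> BX fst = \<mu>" "distr \<pi> BY snd = \<nu>" using couplingsD[OF \<pi>] by auto
  show "space \<pi> = topspace PX \<times> topspace PY"
    using sets_eq_imp_space_eq[OF s] by (simp add: space_pair_measure)
qed

text \<open>The weight \<open>g\<close> may be unbounded, yet closeness of the densities in L1
  suffices. Below the level \<open>R\<close> it contributes at most \<open>R * \<kappa>\<close>,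
  hence \<open>\<kappa> = e / (2 * R)\<close>; above it the tail is at most \<open>e / 4\<close>
  under each of the two couplings, uniformly, since only their marginals enter.\<close>

lemma density_integral_stable:
  fixes g :: "(nat \<Rightarrow> 'a) \<times> (nat \<Rightarrow> 'b) \<Rightarrow> real"
  assumes G1: "integrable \<mu> G1" and G2: "integrable \<nu> G2" and C: "C \<ge> 0"
    and g: "g \<in> borel_measurable (BX \<Otimes>\<^sub>M BY)"
    and le: "\<And>x y. x \<in> topspace PX \<Longrightarrow> y \<in> topspace PY \<Longrightarrow> \<bar>g (x, y)\<bar> \<le> C * (1 + G1 x + G2 y)"
    and e: "e > 0"
  obtains \<kappa> where "\<kappa> > 0"
    "\<And>\<rho>1 \<rho>2. \<rho>1 \<in> borel_measurable (\<mu> \<Otimes>\<^sub>M \<nu>) \<Longrightarrow> \<rho>2 \<in> borel_measurable (\<mu> \<Otimes>\<^sub>M \<nu>) \<Longrightarrow>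
      (\<And>z. 0 \<le> \<rho>1 z) \<Longrightarrow> (\<And>z. 0 \<le> \<rho>2 z) \<Longrightarrow>
      density (\<mu> \<Otimes>\<^sub>M \<nu>) (\<lambda>z. ennreal (\<rho>1 z)) \<in> couplings PX PY \<mu> \<nu> \<Longrightarrow>
      density (\<mu> \<Otimes>\<^sub>M \<nu>) (\<lambda>z. ennreal (\<rho>2 z)) \<in> couplings PX PY \<mu> \<nu> \<Longrightarrow>
      (\<integral>z. \<bar>\<rho>1 z - \<rho>2 z\<bar> \<partial>(\<mu> \<Otimes>\<^sub>M \<nu>)) \<le> \<kappa> \<Longrightarrow>
      integrable (\<mu> \<Otimes>\<^sub>M \<nu>) (\<lambda>z. g z * \<rho>1 z) \<and> integrable (\<mu> \<Otimes>\<^sub>M \<nu>) (\<lambda>z. g z * \<rho>2 z) \<and>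
      (\<integral>z. \<bar>g z\<bar> * \<bar>\<rho>1 z - \<rho>2 z\<bar> \<partial>(\<mu> \<Otimes>\<^sub>M \<nu>)) \<le> e"
proof -
  have "e / 4 > 0" using e by simp
  obtain R where R: "R > 0"
    "\<And>(M :: ((nat \<Rightarrow> 'a) \<times> (nat \<Rightarrow> 'b)) measure) x y g. prob_space M \<Longrightarrow> x \<in> M \<rightarrow>\<^sub>M BX \<Longrightarrow> y \<in> M \<rightarrow>\<^sub>M BY \<Longrightarrow>
      distr M BX x = \<mu> \<Longrightarrow> distr M BY y = \<nu> \<Longrightarrow> g \<in> borel_measurable M \<Longrightarrow>
      (\<And>w. w \<in> space M \<Longrightarrow> \<bar>g w\<bar> \<le> C * (1 + G1 (x w) + G2 (y w))) \<Longrightarrow>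
      integrable M (\<lambda>w. max 0 (\<bar>g w\<bar> - R)) \<and> (\<integral>w. max 0 (\<bar>g w\<bar> - R) \<partial>M) \<le> e / 4"
    using uniform_tail[OF G1 G2 C \<open>e / 4 > 0\<close>] by blast
  let ?m = "\<mu> \<Otimes>\<^sub>M \<nu>"
  show thesis
  proof (rule that)
    show "e / (2 * R) > 0" using e R by simp
    fix \<rho>1 \<rho>2 :: "(nat \<Rightarrow> 'a) \<times> (nat \<Rightarrow> 'b) \<Rightarrow> real"
    assume \<rho>m [measurable]: "\<rho>1 \<in> borel_measurable ?m" "\<rho>2 \<in> borel_measurable ?m"
      and nn: "\<And>z. 0 \<le> \<rho>1 z" "\<And>z. 0 \<le> \<rho>2 z"
      and c1: "density ?m (\<lambda>z. ennreal (\<rho>1 z)) \<in> couplings PX PY \<mu> \<nu>"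
      and c2: "density ?m (\<lambda>z. ennreal (\<rho>2 z)) \<in> couplings PX PY \<mu> \<nu>"
      and close: "(\<integral>z. \<bar>\<rho>1 z - \<rho>2 z\<bar> \<partial>?m) \<le> e / (2 * R)"
    have "prob_space \<mu>" "prob_space \<nu>"
      using couplings_marginals[OF S.polish T.polish c1] by (auto simp: probs_def)
    then interpret \<mu>: prob_space \<mu> + \<nu>: prob_space \<nu> by auto
    interpret m: pair_prob_space \<mu> \<nu> ..
    have sm: "sets ?m = sets (BX \<Otimes>\<^sub>M BY)" using couplings_facts(2)[OF c1] by simp
    have gm [measurable]: "g \<in> borel_measurable ?m" using g by (simp add: measurable_cong_sets[OF sm refl])
    have gb: "\<bar>g w\<bar> \<le> C * (1 + G1 (fst w) + G2 (snd w))" if "w \<in> topspace PX \<times> topspace PY" for w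
      using le[of "fst w" "snd w"] that by (auto simp: mem_Times_iff)
    have main: "integrable ?m (\<lambda>z. g z * \<rho> z) \<and> integrable ?m (\<lambda>z. \<rho> z * max 0 (\<bar>g z\<bar> - R)) \<and>
        (\<integral>z. \<rho> z * max 0 (\<bar>g z\<bar> - R) \<partial>?m) \<le> e / 4 \<and> integrable ?m \<rho>"
      if \<rho>: "\<rho> \<in> borel_measurable ?m" and nn\<rho>: "\<And>z. 0 \<le> \<rho> z"
        and cp: "density ?m (\<lambda>z. ennreal (\<rho> z)) \<in> couplings PX PY \<mu> \<nu>" for \<rho>
    proof -
      note f = couplings_facts[OF cp]
      have g\<pi>: "g \<in> borel_measurable (density ?m (\<lambda>z. ennreal (\<rho> z)))" using gm by simp
      have b: "\<bar>g w\<bar> \<le> C * (1 + G1 (fst w) + G2 (snd w))" if "w \<in> space (density ?m (\<lambda>z. ennreal (\<rho> z)))" for w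
        using that unfolding f(7) by (rule gb)
      have t: "integrable (density ?m (\<lambda>z. ennreal (\<rho> z))) (\<lambda>w. max 0 (\<bar>g w\<bar> - R)) \<and>
          (\<integral>w. max 0 (\<bar>g w\<bar> - R) \<partial>density ?m (\<lambda>z. ennreal (\<rho> z))) \<le> e / 4"
        by (rule R(2)[OF f(1,3,4,5,6) g\<pi>]) (rule b)
      have G: "integrable (distr (density ?m (\<lambda>z. ennreal (\<rho> z))) BX fst) G1"
        "integrable (distr (density ?m (\<lambda>z. ennreal (\<rho> z))) BY snd) G2"
        unfolding f(5,6) by (rule G1, rule G2)
      have gi: "integrable (density ?m (\<lambda>z. ennreal (\<rho> z))) g"
        by (rule integrable_bounded_by_marginals[OF f(1,3,4) G g\<pi>]) (rule b)
      have 1: "integrable ?m (\<lambda>z. g z * \<rho> z)"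
        using gi nn\<rho> \<rho> gm by (subst (asm) integrable_density) (auto simp: mult.commute)
      have 2: "integrable ?m (\<lambda>z. \<rho> z * max 0 (\<bar>g z\<bar> - R))"
        using t nn\<rho> \<rho> gm by (subst (asm) integrable_density) auto
      have 3: "(\<integral>z. \<rho> z * max 0 (\<bar>g z\<bar> - R) \<partial>?m) \<le> e / 4"
        using t nn\<rho> \<rho> gm by (subst (asm) integral_density) auto
      have 4: "integrable ?m \<rho>" by (rule m.integral_density_one(1)[OF \<rho> nn\<rho> f(1)])
      from 1 2 3 4 show ?thesis by blast
    qed
    note m1 = main[OF \<rho>m(1) nn(1) c1] and m2 = main[OF \<rho>m(2) nn(2) c2]
    have i: "integrable ?m (\<lambda>z. \<bar>g z\<bar> * \<bar>\<rho>1 z - \<rho>2 z\<bar>)"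
    proof -
      have "integrable ?m (\<lambda>z. \<bar>g z * \<rho>1 z - g z * \<rho>2 z\<bar>)" using m1 m2 by auto
      then show ?thesis by (simp add: abs_mult flip: right_diff_distrib)
    qed
    have "(\<integral>z. \<bar>g z\<bar> * \<bar>\<rho>1 z - \<rho>2 z\<bar> \<partial>?m) \<le>
      (\<integral>z. R * \<bar>\<rho>1 z - \<rho>2 z\<bar> + \<rho>1 z * max 0 (\<bar>g z\<bar> - R) + \<rho>2 z * max 0 (\<bar>g z\<bar> - R) \<partial>?m)"
    proof (rule integral_mono[OF i])
      show "integrable ?m (\<lambda>z. R * \<bar>\<rho>1 z - \<rho>2 z\<bar> + \<rho>1 z * max 0 (\<bar>g z\<bar> - R) + \<rho>2 z * max 0 (\<bar>g z\<bar> - R))"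
        using m1 m2 by auto
      fix z
      have "\<bar>g z\<bar> * \<bar>\<rho>1 z - \<rho>2 z\<bar> \<le> (R + max 0 (\<bar>g z\<bar> - R)) * \<bar>\<rho>1 z - \<rho>2 z\<bar>"
        by (intro mult_right_mono) auto
      also have "\<dots> = R * \<bar>\<rho>1 z - \<rho>2 z\<bar> + max 0 (\<bar>g z\<bar> - R) * \<bar>\<rho>1 z - \<rho>2 z\<bar>" by (simp add: algebra_simps)
      also have "max 0 (\<bar>g z\<bar> - R) * \<bar>\<rho>1 z - \<rho>2 z\<bar> \<le> max 0 (\<bar>g z\<bar> - R) * (\<rho>1 z + \<rho>2 z)"
        using nn[of z] by (intro mult_left_mono) auto
      finally show "\<bar>g z\<bar> * \<bar>\<rho>1 z - \<rho>2 z\<bar> \<le> R * \<bar>\<rho>1 z - \<rho>2 z\<bar> + \<rho>1 z * max 0 (\<bar>g z\<bar> - R) + \<rho>2 z * max 0 (\<bar>g z\<bar> - R)"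
        by (simp add: algebra_simps)
    qed
    also have "\<dots> = R * (\<integral>z. \<bar>\<rho>1 z - \<rho>2 z\<bar> \<partial>?m) + (\<integral>z. \<rho>1 z * max 0 (\<bar>g z\<bar> - R) \<partial>?m) + (\<integral>z. \<rho>2 z * max 0 (\<bar>g z\<bar> - R) \<partial>?m)"
      using m1 m2 by simp
    also have "\<dots> \<le> R * (e / (2 * R)) + e / 4 + e / 4"
      using m1 m2 close R by (intro add_mono mult_left_mono) auto
    also have "\<dots> = e" using R by simp
    finally show "integrable ?m (\<lambda>z. g z * \<rho>1 z) \<and> integrable ?m (\<lambda>z. g z * \<rho>2 z) \<and>
      (\<integral>z. \<bar>g z\<bar> * \<bar>\<rho>1 z - \<rho>2 z\<bar> \<partial>?m) \<le> e" using m1 m2 by blast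
  qed
qed

end

lemma Lim_transform_bound_zero:
  fixes u :: "nat \<Rightarrow> real"
  assumes "\<And>n. \<bar>u n - l\<bar> \<le> w n" "w \<longlonglongrightarrow> 0"
  shows "u \<longlonglongrightarrow> l"
proof -
  have "(\<lambda>n. u n - l) \<longlonglongrightarrow> 0"
    by (rule Lim_null_comparison[OF _ assms(2)]) (use assms(1) in auto)
  then show ?thesis by (simp add: LIM_zero_iff)
qed

context transport
begin

lemma cost_bound:
  assumes \<mu>: "\<mu> \<in> probs_p p PX dX" and \<nu>: "\<nu> \<in> probs_p p PY dY"
  obtains C a b where "C \<ge> 0" "a \<in> topspace PX" "b \<in> topspace PY"
    "integrable \<mu> (\<lambda>x. dX a x powr p)" "integrable \<nu> (\<lambda>y. dY b y powr p)"
    "\<And>x y. x \<in> topspace PX \<Longrightarrow> y \<in> topspace PY \<Longrightarrow> \<bar>c (x, y)\<bar> \<le> C * (1 + dX a x powr p + dY b y powr p)"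
proof -
  obtain a b C where ab: "a \<in> topspace PX" "b \<in> topspace PY" and C: "C \<ge> 0"
    "\<And>x y. x \<in> topspace PX \<Longrightarrow> y \<in> topspace PY \<Longrightarrow> \<bar>c (x, y)\<bar> \<le> C * (1 + dX a x powr p + dY b y powr p)"
    by (rule growth_bound) (rule that)
  then show thesis using that[OF C(1) ab S.moment_integrable[OF \<mu> ab(1)] T.moment_integrable[OF \<nu> ab(2)]] by blast
qed

text \<open>The bound \<open>K\<close> depends on the marginals only, so it bounds the infimum over
  couplings from below.\<close>

lemma coupling_cost:
  assumes \<mu>: "\<mu> \<in> probs_p p PX dX" and \<nu>: "\<nu> \<in> probs_p p PY dY"
  obtains K where "\<And>\<pi>. \<pi> \<in> couplings PX PY \<mu> \<nu> \<Longrightarrow> integrable \<pi> c \<and> \<bar>\<integral>z. c z \<partial>\<pi>\<bar> \<le> K"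
proof -
  obtain C a b where C: "C \<ge> 0" and ab: "a \<in> topspace PX" "b \<in> topspace PY"
    and G: "integrable \<mu> (\<lambda>x. dX a x powr p)" "integrable \<nu> (\<lambda>y. dY b y powr p)"
    and le: "\<And>x y. x \<in> topspace PX \<Longrightarrow> y \<in> topspace PY \<Longrightarrow> \<bar>c (x, y)\<bar> \<le> C * (1 + dX a x powr p + dY b y powr p)"
    by (rule cost_bound[OF \<mu> \<nu>]) (rule that)
  define G1 where "G1 x = dX a x powr p" for x
  define G2 where "G2 y = dY b y powr p" for y
  show thesis
  proof (rule that)
    fix \<pi> assume \<pi>: "\<pi> \<in> couplings PX PY \<mu> \<nu>"
    note f = couplings_facts[OF \<pi>]
    interpret \<pi>: prob_space \<pi> by (rule f(1))
    have cm: "c \<in> borel_measurable \<pi>" using c_measurable by (simp add: measurable_cong_sets[OF f(2) refl])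
    have b: "\<bar>c w\<bar> \<le> C * (1 + G1 (fst w) + G2 (snd w))" if "w \<in> space \<pi>" for w
      using le[of "fst w" "snd w"] that unfolding f(7) G1_def G2_def by (auto simp: mem_Times_iff)
    have Gd: "integrable (distr \<pi> BX fst) G1" "integrable (distr \<pi> BY snd) G2"
      using G unfolding f(5,6) G1_def G2_def by auto
    have ci: "integrable \<pi> c"
      by (rule integrable_bounded_by_marginals[OF f(1,3,4) Gd cm]) (rule b)
    have Gi: "integrable \<pi> (\<lambda>w. G1 (fst w))" "integrable \<pi> (\<lambda>w. G2 (snd w))"
      using integrable_distr[OF f(3) Gd(1)] integrable_distr[OF f(4) Gd(2)] by auto
    have Ge: "(\<integral>w. G1 (fst w) \<partial>\<pi>) = (\<integral>x. G1 x \<partial>\<mu>)" "(\<integral>w. G2 (snd w) \<partial>\<pi>) = (\<integral>y. G2 y \<partial>\<nu>)"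
    proof -
      have "G1 \<in> borel_measurable BX" "G2 \<in> borel_measurable BY"
        using S.dist_powr_measurable1[OF ab(1)] T.dist_powr_measurable1[OF ab(2)]
        by (simp_all add: G1_def[abs_def] G2_def[abs_def])
      from integral_distr[OF f(3) this(1)] integral_distr[OF f(4) this(2)]
      show "(\<integral>w. G1 (fst w) \<partial>\<pi>) = (\<integral>x. G1 x \<partial>\<mu>)" "(\<integral>w. G2 (snd w) \<partial>\<pi>) = (\<integral>y. G2 y \<partial>\<nu>)"
        by (simp_all only: f(5,6))
    qed
    have "\<bar>\<integral>z. c z \<partial>\<pi>\<bar> \<le> (\<integral>z. \<bar>c z\<bar> \<partial>\<pi>)" by (rule integral_abs_bound)
    also have "\<dots> \<le> (\<integral>z. C * (1 + G1 (fst z) + G2 (snd z)) \<partial>\<pi>)"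
      using ci Gi b by (intro integral_mono) auto
    also have "\<dots> = C * (1 + (\<integral>x. G1 x \<partial>\<mu>) + (\<integral>y. G2 y \<partial>\<nu>))"
      using Gi Ge \<pi>.prob_space by simp
    finally show "integrable \<pi> c \<and> \<bar>\<integral>z. c z \<partial>\<pi>\<bar> \<le> C * (1 + (\<integral>x. G1 x \<partial>\<mu>) + (\<integral>y. G2 y \<partial>\<nu>))"
      using ci by simp
  qed
qed

end

locale entropic = transport N X Y dX dY p c
  for N and X :: "nat \<Rightarrow> 'a topology" and Y :: "nat \<Rightarrow> 'b topology" and dX dY p c +
  fixes v :: version and \<epsilon> :: real and \<mu> :: "(nat \<Rightarrow> 'a) measure" and \<nu> :: "(nat \<Rightarrow> 'b) measure"
  assumes \<epsilon>: "\<epsilon> > 0" and \<mu>: "\<mu> \<in> probs_p p (paths N X) dX" and \<nu>: "\<nu> \<in> probs_p p (paths N Y) dY"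
begin

abbreviation "m \<equiv> \<mu> \<Otimes>\<^sub>M \<nu>"
abbreviation "adm \<equiv> Couplings v N X Y \<mu> \<nu>"
abbreviation "law \<rho> \<equiv> density m (\<lambda>z. ennreal (\<rho> z))"
abbreviation "E_min \<equiv> E_val v \<epsilon> N X Y \<mu> \<nu> c"

lemma probs: "\<mu> \<in> probs PX" "\<nu> \<in> probs PY"
  using \<mu> \<nu> by (auto simp: probs_p_def)

sublocale M: prob_space \<mu> using probs by (simp add: probs_def)
sublocale N: prob_space \<nu> using probs by (simp add: probs_def)
sublocale m: pair_prob_space \<mu> \<nu> ..

lemma sets_m: "sets m = sets (BX \<Otimes>\<^sub>M BY)"
  using probs by (intro sets_pair_measure_cong) (auto simp: probs_def)

lemma c_m [measurable]: "c \<in> borel_measurable m"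
  using c_measurable by (simp add: measurable_cong_sets[OF sets_m refl])

lemma product_adm: "m \<in> adm"
  by (rule product_Couplings[OF X Y probs])

definition dens :: "((nat \<Rightarrow> 'a) \<times> (nat \<Rightarrow> 'b) \<Rightarrow> real) set" where
  "dens = {\<rho>. \<rho> \<in> borel_measurable m \<and> (\<forall>z. 0 \<le> \<rho> z) \<and> law \<rho> \<in> adm \<and>
     integrable m (\<lambda>z. \<rho> z * ln (\<rho> z))}"

definition F :: "((nat \<Rightarrow> 'a) \<times> (nat \<Rightarrow> 'b) \<Rightarrow> real) \<Rightarrow> real" where
  "F \<rho> = (\<integral>z. c z * \<rho> z \<partial>m) + \<epsilon> * (\<integral>z. \<rho> z * ln (\<rho> z) \<partial>m)"

lemma densD:
  assumes "\<rho> \<in> dens"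
  shows "\<rho> \<in> borel_measurable m" "0 \<le> \<rho> z" "law \<rho> \<in> adm"
    "law \<rho> \<in> couplings PX PY \<mu> \<nu>" "prob_space (law \<rho>)"
    "integrable m (\<lambda>z. \<rho> z * ln (\<rho> z))" "integrable m \<rho>" "(\<integral>z. \<rho> z \<partial>m) = 1" "integrable m (\<lambda>z. c z * \<rho> z)"
proof -
  show a: "\<rho> \<in> borel_measurable m" "0 \<le> \<rho> z" "law \<rho> \<in> adm" "integrable m (\<lambda>z. \<rho> z * ln (\<rho> z))" for z
    using assms unfolding dens_def by blast+
  show cp: "law \<rho> \<in> couplings PX PY \<mu> \<nu>" by (rule CouplingsD(1)[OF a(3)])
  show pr: "prob_space (law \<rho>)" by (rule couplingsD(1)[OF cp])
  show "integrable m \<rho>" "(\<integral>z. \<rho> z \<partial>m) = 1" using m.integral_density_one[OF a(1,2) pr] by auto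
  obtain K where K: "\<And>\<pi>. \<pi> \<in> couplings PX PY \<mu> \<nu> \<Longrightarrow> integrable \<pi> c \<and> \<bar>\<integral>z. c z \<partial>\<pi>\<bar> \<le> K"
    by (rule coupling_cost[OF \<mu> \<nu>]) (rule that)
  have "integrable (law \<rho>) c" using K[OF cp] by simp
  then show "integrable m (\<lambda>z. c z * \<rho> z)"
    using a by (subst (asm) integrable_density) (auto simp: mult.commute)
qed

lemma integral_c_density:
  assumes "\<rho> \<in> borel_measurable m" "\<And>z. 0 \<le> \<rho> z"
  shows "(\<integral>z. c z \<partial>law \<rho>) = (\<integral>z. c z * \<rho> z \<partial>m)"
  using assms by (subst integral_density) (auto simp: mult.commute)

lemma E_cost_density:
  assumes "\<rho> \<in> dens"
  shows "E_cost \<epsilon> \<mu> \<nu> c (law \<rho>) = ereal (F \<rho>)"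
  using densD[OF assms] by (simp add: E_cost_def F_def integral_c_density m.kl_div_density)

text \<open>Couplings of infinite entropy cannot compete, so minimization over couplings becomes
  minimization of \<open>F\<close> over densities, where L1 arguments apply.\<close>

lemma dens_of_finite_cost:
  assumes \<pi>: "\<pi> \<in> adm" and fin: "E_cost \<epsilon> \<mu> \<nu> c \<pi> \<noteq> \<infinity>"
  obtains \<rho> where "\<rho> \<in> dens" "\<pi> = law \<rho>"
proof -
  note cp = CouplingsD(1)[OF \<pi>]
  note f = couplings_facts[OF cp]
  have s: "sets \<pi> = sets m" using f(2) sets_m by simp
  have "kl_div \<pi> m \<noteq> \<infinity>" using fin \<epsilon> by (auto simp: E_cost_def)
  then obtain \<rho> :: "_ \<Rightarrow> real" where \<rho>: "\<rho> \<in> borel_measurable m" "\<And>z. 0 \<le> \<rho> z" "\<pi> = law \<rho>"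
    "integrable m (\<lambda>z. \<rho> z * ln (\<rho> z))"
    by (rule m.kl_div_finite_density[OF f(1) s]) blast
  then show thesis using that[of \<rho>] \<pi> by (auto simp: dens_def)
qed

lemma one_dens: "(\<lambda>_. 1) \<in> dens"
  using product_adm by (simp add: dens_def density_1)

lemma E_min_le: "\<rho> \<in> dens \<Longrightarrow> E_min \<le> ereal (F \<rho>)"
  unfolding E_val_def E_cost_density[symmetric] by (intro INF_lower densD)

lemma E_min_finite: obtains r where "E_min = ereal r"
proof -
  obtain K where K: "\<And>\<pi>. \<pi> \<in> couplings PX PY \<mu> \<nu> \<Longrightarrow> integrable \<pi> c \<and> \<bar>\<integral>z. c z \<partial>\<pi>\<bar> \<le> K"
    by (rule coupling_cost[OF \<mu> \<nu>]) (rule that)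
  have "ereal (- K) \<le> E_min" unfolding E_val_def
  proof (rule INF_greatest)
    fix \<pi> assume \<pi>: "\<pi> \<in> adm"
    note f = couplings_facts[OF CouplingsD(1)[OF \<pi>]]
    have kl: "0 \<le> kl_div \<pi> m" using f(1,2) sets_m by (intro m.kl_div_nonneg) auto
    have "ereal (- K) \<le> ereal (\<integral>z. c z \<partial>\<pi>)" using K[OF CouplingsD(1)[OF \<pi>]] by auto
    also have "\<dots> \<le> ereal (\<integral>z. c z \<partial>\<pi>) + ereal \<epsilon> * kl_div \<pi> m"
      using kl \<epsilon> by (intro ereal_le_add_self) (auto intro!: ereal_0_le_mult)
    finally show "ereal (- K) \<le> E_cost \<epsilon> \<mu> \<nu> c \<pi>" by (simp add: E_cost_def)
  qed
  moreover have "E_min \<le> ereal (F (\<lambda>_. 1))" by (rule E_min_le[OF one_dens])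
  ultimately show thesis using that by (cases E_min) auto
qed

text \<open>The constraints are linear, so mixtures stay admissible. Integrability of the entropy of
  the midpoint follows from the lower bound -1 and from convexity.\<close>

lemma dens_midpoint:
  assumes \<rho>1: "\<rho>1 \<in> dens" and \<rho>2: "\<rho>2 \<in> dens"
  shows "(\<lambda>z. (\<rho>1 z + \<rho>2 z) / 2) \<in> dens"
proof -
  let ?s = "\<lambda>z. (\<rho>1 z + \<rho>2 z) / 2"
  note d1 = densD[OF \<rho>1] and d2 = densD[OF \<rho>2]
  note [measurable] = d1(1) d2(1)
  have nn: "0 \<le> ?s z" for z using d1(2)[of z] d2(2)[of z] by simp
  have int: "(\<integral>z. G z \<partial>law ?s)
      = ((\<integral>z. G z \<partial>law \<rho>1) + (\<integral>z. G z \<partial>law \<rho>2)) / 2"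
    if G: "G \<in> bmeas m" for G
  proof -
    note Gm [measurable] = bmeas_measurable[OF G]
    have i: "integrable m (\<lambda>z. \<rho>1 z * G z)" "integrable m (\<lambda>z. \<rho>2 z * G z)"
      by (rule integrable_mult_bmeas(1)[OF d1(7) G], rule integrable_mult_bmeas(1)[OF d2(7) G])
    have "(\<integral>z. G z \<partial>law ?s) = (\<integral>z. ?s z * G z \<partial>m)"
      using nn by (subst integral_density) auto
    also have "\<dots> = (\<integral>z. (\<rho>1 z * G z + \<rho>2 z * G z) / 2 \<partial>m)"
      by (intro Bochner_Integration.integral_cong) (auto simp: algebra_simps)
    also have "\<dots> = ((\<integral>z. \<rho>1 z * G z \<partial>m) + (\<integral>z. \<rho>2 z * G z \<partial>m)) / 2" using i by simp
    finally show ?thesis using d1(2) d2(2) by (simp add: integral_density)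
  qed
  have pr: "prob_space (law ?s)"
  proof
    have "emeasure (law ?s) (space m) = (\<integral>\<^sup>+z. ennreal (?s z) \<partial>m)"
      by (subst emeasure_density) (auto intro!: nn_integral_cong)
    also have "\<dots> = ennreal (\<integral>z. ?s z \<partial>m)" using nn d1(7) d2(7) by (intro nn_integral_eq_integral) auto
    also have "(\<integral>z. ?s z \<partial>m) = 1" using d1(7,8) d2(7,8) by simp
    finally show "emeasure (law ?s) (space (law ?s)) = 1" by simp
  qed
  have adm: "law ?s \<in> adm"
  proof (rule Couplings_average_limitI[OF X Y, where \<pi>s="\<lambda>_. law \<rho>1" and \<pi>s'="\<lambda>_. law \<rho>2"])
    fix a b assume a: "a \<in> bmeas BX" and b: "b \<in> bmeas BY"
    have "(\<lambda>z. a (fst z) * b (snd z)) \<in> bmeas m"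
      unfolding bmeas_cong_sets[OF sets_m] by (intro bmeas_mult bmeas_comp[OF a] bmeas_comp[OF b]) auto
    note eq = int[OF this]
    show "(\<lambda>n. ((\<integral>z. a (fst z) * b (snd z) \<partial>law \<rho>1)
        + (\<integral>z. a (fst z) * b (snd z) \<partial>law \<rho>2)) / 2)
        \<longlonglongrightarrow> (\<integral>z. a (fst z) * b (snd z) \<partial>law ?s)"
      unfolding eq by (rule tendsto_const)
  qed (use d1(3) d2(3) pr sets_m in auto)
  have "integrable m (\<lambda>z. ?s z * ln (?s z))"
  proof (rule Bochner_Integration.integrable_bound)
    show "integrable m (\<lambda>z. 1 + \<bar>\<rho>1 z * ln (\<rho>1 z)\<bar> + \<bar>\<rho>2 z * ln (\<rho>2 z)\<bar>)"
      using d1(6) d2(6) by auto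
    show "AE z in m. norm (?s z * ln (?s z)) \<le> norm (1 + \<bar>\<rho>1 z * ln (\<rho>1 z)\<bar> + \<bar>\<rho>2 z * ln (\<rho>2 z)\<bar>)"
    proof (rule AE_I2)
      fix z
      \<comment> \<open>Convexity of \<open>t * ln t\<close> is read off from
        \<open>entropy_midpoint\<close>, whose left side is a square; the factor
        \<open>\<rho>1 z + \<rho>2 z\<close> can be divided out where it is positive.\<close>
      have nonneg: "0 \<le> 6 * (\<rho>1 z + \<rho>2 z) * (\<rho>1 z * ln (\<rho>1 z) + \<rho>2 z * ln (\<rho>2 z) - 2 * (?s z * ln (?s z)))"
        by (rule order_trans[OF zero_le_power2 entropy_midpoint[OF d1(2) d2(2)]])
      have "2 * (?s z * ln (?s z)) \<le> \<rho>1 z * ln (\<rho>1 z) + \<rho>2 z * ln (\<rho>2 z)"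
      proof (cases "\<rho>1 z + \<rho>2 z = 0")
        case True
        then have "\<rho>1 z = 0" "\<rho>2 z = 0" using d1(2)[of z] d2(2)[of z] by linarith+
        then show ?thesis by simp
      next
        case False
        then show ?thesis using nonneg d1(2)[of z] d2(2)[of z] by (auto simp: zero_le_mult_iff)
      qed
      moreover have "- (?s z * ln (?s z)) \<le> 1" by (rule minus_mult_ln_le[OF nn])
      ultimately show "norm (?s z * ln (?s z)) \<le> norm (1 + \<bar>\<rho>1 z * ln (\<rho>1 z)\<bar> + \<bar>\<rho>2 z * ln (\<rho>2 z)\<bar>)"
        unfolding real_norm_def by linarith
    qed
  qed measurable
  then show ?thesis using adm nn by (simp add: dens_def)
qed

text \<open>The transport cost is linear in the density, so comparing \<open>F\<close> at two
  near-minimizers with \<open>F\<close> at their midpoint leaves pure entropy. As the midpoint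
  cannot fall below the infimum, the entropy defect is at most
  \<open>2 * \<delta> / \<epsilon>\<close>.\<close>

lemma near_minimizers:
  assumes r: "E_min = ereal r" and e: "e > 0"
  obtains \<delta> where "\<delta> > 0"
    "\<And>\<rho>1 \<rho>2. \<rho>1 \<in> dens \<Longrightarrow> \<rho>2 \<in> dens \<Longrightarrow> F \<rho>1 \<le> r + \<delta> \<Longrightarrow> F \<rho>2 \<le> r + \<delta> \<Longrightarrow> (\<integral>z. \<bar>\<rho>1 z - \<rho>2 z\<bar> \<partial>m) \<le> e"
proof -
  define \<tau> where "\<tau> = e / 2"
  have \<tau>: "\<tau> > 0" using e by (simp add: \<tau>_def)
  \<comment> \<open>Chosen so that the entropy term
    \<open>3 / \<tau> * (2 * \<delta> / \<epsilon>)\<close> equals \<open>\<tau>\<close>; with the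
    second summand \<open>\<tau>\<close> this adds up to \<open>e\<close>.\<close>
  define \<delta> where "\<delta> = \<epsilon> * \<tau> * \<tau> / 6"
  have \<delta>: "\<delta> > 0" using \<epsilon> \<tau> by (simp add: \<delta>_def)
  show thesis
  proof (rule that[OF \<delta>])
    fix \<rho>1 \<rho>2 assume \<rho>1: "\<rho>1 \<in> dens" and \<rho>2: "\<rho>2 \<in> dens" and F12: "F \<rho>1 \<le> r + \<delta>" "F \<rho>2 \<le> r + \<delta>"
    define s where "s z = (\<rho>1 z + \<rho>2 z) / 2" for z
    have s: "s \<in> dens" unfolding s_def by (rule dens_midpoint[OF \<rho>1 \<rho>2])
    note d1 = densD[OF \<rho>1] and d2 = densD[OF \<rho>2] and ds = densD[OF s]
    have "r \<le> F s" using E_min_le[OF s] r by simp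
    have cs: "(\<integral>z. c z * s z \<partial>m) = ((\<integral>z. c z * \<rho>1 z \<partial>m) + (\<integral>z. c z * \<rho>2 z \<partial>m)) / 2"
    proof -
      have "(\<integral>z. c z * s z \<partial>m) = (\<integral>z. (c z * \<rho>1 z + c z * \<rho>2 z) / 2 \<partial>m)"
        by (intro Bochner_Integration.integral_cong) (auto simp: s_def algebra_simps)
      then show ?thesis using d1(9) d2(9) by simp
    qed
    let ?h = "\<lambda>\<rho> :: _ \<Rightarrow> real. \<integral>z. \<rho> z * ln (\<rho> z) \<partial>m"
    have "\<epsilon> * (?h \<rho>1 + ?h \<rho>2 - 2 * ?h s) = F \<rho>1 + F \<rho>2 - 2 * F s"
      unfolding F_def cs by (simp add: algebra_simps add_divide_distrib)
    also have "\<dots> \<le> 2 * \<delta>" using F12 \<open>r \<le> F s\<close> by linarith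
    finally have h: "?h \<rho>1 + ?h \<rho>2 - 2 * ?h s \<le> 2 * \<delta> / \<epsilon>" using \<epsilon> by (simp add: pos_le_divide_eq mult.commute)
    have "(\<integral>z. \<bar>\<rho>1 z - \<rho>2 z\<bar> \<partial>m) \<le> (\<integral>z. 3 / \<tau> * (\<rho>1 z * ln (\<rho>1 z) + \<rho>2 z * ln (\<rho>2 z) - 2 * (s z * ln (s z))) + \<tau> * s z \<partial>m)"
    proof (rule integral_mono)
      show "integrable m (\<lambda>z. \<bar>\<rho>1 z - \<rho>2 z\<bar>)" using d1(7) d2(7) by auto
      show "integrable m (\<lambda>z. 3 / \<tau> * (\<rho>1 z * ln (\<rho>1 z) + \<rho>2 z * ln (\<rho>2 z) - 2 * (s z * ln (s z))) + \<tau> * s z)"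
        using d1(6) d2(6) ds(6,7) by auto
      show "\<bar>\<rho>1 z - \<rho>2 z\<bar> \<le> 3 / \<tau> * (\<rho>1 z * ln (\<rho>1 z) + \<rho>2 z * ln (\<rho>2 z) - 2 * (s z * ln (s z))) + \<tau> * s z" for z
        using entropy_midpoint_abs[OF d1(2) d2(2) \<tau>, of z z] by (simp only: s_def)
    qed
    also have "\<dots> = 3 / \<tau> * (?h \<rho>1 + ?h \<rho>2 - 2 * ?h s) + \<tau>" using d1(6) d2(6) ds(6,7,8) by simp
    also have "\<dots> \<le> 3 / \<tau> * (2 * \<delta> / \<epsilon>) + \<tau>" using h \<tau> by (intro add_right_mono mult_left_mono) auto
    also have "3 / \<tau> * (2 * \<delta> / \<epsilon>) = \<tau>" using \<tau> \<epsilon> by (simp add: \<delta>_def)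
    finally show "(\<integral>z. \<bar>\<rho>1 z - \<rho>2 z\<bar> \<partial>m) \<le> e" by (simp add: \<tau>_def)
  qed
qed

text \<open>Minimizing sequences are Cauchy in L1 by \<open>near_minimizers\<close>, so the limit is
  a strong one. Constraints and cost pass to it, and the entropy is lower semicontinuous by Fatou's
  lemma.\<close>

lemma minimizer_exists: "\<exists>\<rho>\<in>dens. ereal (F \<rho>) = E_min"
proof -
  obtain r where r: "E_min = ereal r" by (rule E_min_finite)
  have "\<exists>\<rho>\<in>dens. F \<rho> \<le> r + inverse (real (Suc n))" for n
  proof -
    have "E_min < ereal (r + inverse (real (Suc n)))" by (simp add: r)
    then obtain \<pi> where \<pi>: "\<pi> \<in> adm" "E_cost \<epsilon> \<mu> \<nu> c \<pi> < ereal (r + inverse (real (Suc n)))"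
      unfolding E_val_def INF_less_iff by blast
    then have "E_cost \<epsilon> \<mu> \<nu> c \<pi> \<noteq> \<infinity>" by auto
    then obtain \<rho> where \<rho>: "\<rho> \<in> dens" "\<pi> = law \<rho>" by (rule dens_of_finite_cost[OF \<pi>(1)])
    have "F \<rho> < r + inverse (real (Suc n))" using \<pi>(2) unfolding \<rho>(2) E_cost_density[OF \<rho>(1)] by simp
    then show ?thesis using \<rho>(1) by (intro bexI[of _ \<rho>]) auto
  qed
  then obtain \<rho>s where \<rho>s: "\<And>n. \<rho>s n \<in> dens" "\<And>n. F (\<rho>s n) \<le> r + inverse (real (Suc n))" by metis
  note ds = densD[OF \<rho>s(1)]
  have cauchy: "\<exists>n0. \<forall>i\<ge>n0. \<forall>j\<ge>n0. (\<integral>z. \<bar>\<rho>s i z - \<rho>s j z\<bar> \<partial>m) < e" if "e > 0" for e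
  proof -
    have "e / 2 > 0" using that by simp
    obtain \<delta> where \<delta>: "\<delta> > 0" "\<And>\<rho>1 \<rho>2. \<rho>1 \<in> dens \<Longrightarrow> \<rho>2 \<in> dens \<Longrightarrow> F \<rho>1 \<le> r + \<delta> \<Longrightarrow> F \<rho>2 \<le> r + \<delta> \<Longrightarrow> (\<integral>z. \<bar>\<rho>1 z - \<rho>2 z\<bar> \<partial>m) \<le> e / 2"
      using near_minimizers[OF r \<open>e / 2 > 0\<close>] by blast
    obtain n0 where n0: "inverse (real (Suc n0)) < \<delta>" using reals_Archimedean[OF \<delta>(1)] by blast
    have "F (\<rho>s i) \<le> r + \<delta>" if "i \<ge> n0" for i
    proof -
      have "inverse (real (Suc i)) \<le> inverse (real (Suc n0))" using that by (intro le_imp_inverse_le) auto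
      then show ?thesis using \<rho>s(2)[of i] n0 by linarith
    qed
    then have "(\<integral>z. \<bar>\<rho>s i z - \<rho>s j z\<bar> \<partial>m) < e" if "i \<ge> n0" "j \<ge> n0" for i j
      using \<delta>(2)[OF \<rho>s(1)[of i] \<rho>s(1)[of j]] that \<open>e > 0\<close> by fastforce
    then show ?thesis by blast
  qed
  obtain \<rho> q where \<rho>m [measurable]: "\<rho> \<in> borel_measurable m" and \<rho>nn: "\<And>z. 0 \<le> \<rho> z" and \<rho>i: "integrable m \<rho>"
    and L1: "(\<lambda>n. \<integral>z. \<bar>\<rho>s n z - \<rho> z\<bar> \<partial>m) \<longlonglongrightarrow> 0" and q: "strict_mono q" and ae: "AE z in m. (\<lambda>i. \<rho>s (q i) z) \<longlonglongrightarrow> \<rho> z"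
    by (rule L1_complete_nonneg[OF ds(7) ds(2)]) (rule cauchy, assumption, rule that)
  note [measurable] = ds(1)
  \<comment> \<open>Convergence of densities in L1 is stronger than weak convergence: it reaches all
    bounded measurable integrands, and with them the constraints.\<close>
  have int_lim: "(\<lambda>n. \<integral>z. \<rho>s n z * G z \<partial>m) \<longlonglongrightarrow> (\<integral>z. \<rho> z * G z \<partial>m)" if G: "G \<in> bmeas m" for G
  proof -
    note Gm [measurable] = bmeas_measurable[OF G]
    obtain K where K: "\<And>z. \<bar>G z\<bar> \<le> K" "K \<ge> 0" using bmeas_bound[OF G] by blast
    have i: "integrable m (\<lambda>z. \<rho>s n z * G z)" "integrable m (\<lambda>z. \<rho> z * G z)" for n
      by (rule integrable_mult_bmeas(1)[OF ds(7) G], rule integrable_mult_bmeas(1)[OF \<rho>i G])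
    show ?thesis
    proof (rule Lim_transform_bound_zero)
      show "\<bar>(\<integral>z. \<rho>s n z * G z \<partial>m) - (\<integral>z. \<rho> z * G z \<partial>m)\<bar> \<le> K * (\<integral>z. \<bar>\<rho>s n z - \<rho> z\<bar> \<partial>m)" for n
      proof -
        have "\<bar>(\<integral>z. \<rho>s n z * G z \<partial>m) - (\<integral>z. \<rho> z * G z \<partial>m)\<bar> = \<bar>\<integral>z. (\<rho>s n z - \<rho> z) * G z \<partial>m\<bar>"
          using i by (simp add: left_diff_distrib)
        also have "\<dots> \<le> (\<integral>z. \<bar>(\<rho>s n z - \<rho> z) * G z\<bar> \<partial>m)" by (rule integral_abs_bound)
        also have "\<dots> \<le> (\<integral>z. K * \<bar>\<rho>s n z - \<rho> z\<bar> \<partial>m)"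
        proof (rule integral_mono)
          show "integrable m (\<lambda>z. \<bar>(\<rho>s n z - \<rho> z) * G z\<bar>)"
            using i by (simp add: left_diff_distrib)
          show "integrable m (\<lambda>z. K * \<bar>\<rho>s n z - \<rho> z\<bar>)" using ds(7) \<rho>i by auto
          show "\<bar>(\<rho>s n z - \<rho> z) * G z\<bar> \<le> K * \<bar>\<rho>s n z - \<rho> z\<bar>" for z
            using K(1)[of z] by (subst mult.commute) (simp add: abs_mult mult_right_mono)
        qed
        finally show ?thesis by simp
      qed
      show "(\<lambda>n. K * (\<integral>z. \<bar>\<rho>s n z - \<rho> z\<bar> \<partial>m)) \<longlonglongrightarrow> 0"
        using tendsto_mult[OF tendsto_const[of K] L1] by simp
    qed
  qed
  have "(\<integral>z. \<rho> z \<partial>m) = 1"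
  proof -
    have "(\<lambda>_. 1) \<in> bmeas m" by (rule bmeasI[where C=1]) auto
    from int_lim[OF this] show ?thesis using ds(8) by (simp add: LIMSEQ_const_iff)
  qed
  then have pr: "prob_space (law \<rho>)"
    using \<rho>i \<rho>nn by (intro prob_spaceI) (auto simp: emeasure_density nn_integral_eq_integral cong: nn_integral_cong)
  have adm: "law \<rho> \<in> adm"
  proof (rule Couplings_limitI[OF X Y, where \<pi>s="\<lambda>n. density m (\<lambda>z. ennreal (\<rho>s n z))"])
    fix a b assume a: "a \<in> bmeas BX" and b: "b \<in> bmeas BY"
    have ab: "(\<lambda>z. a (fst z) * b (snd z)) \<in> bmeas m"
      unfolding bmeas_cong_sets[OF sets_m] by (intro bmeas_mult bmeas_comp[OF a] bmeas_comp[OF b]) auto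
    note [measurable] = bmeas_measurable[OF ab]
    show "(\<lambda>n. \<integral>z. a (fst z) * b (snd z) \<partial>density m (\<lambda>z. ennreal (\<rho>s n z)))
        \<longlonglongrightarrow> (\<integral>z. a (fst z) * b (snd z) \<partial>law \<rho>)"
      using int_lim[OF ab] \<rho>nn ds(2) by (simp add: integral_density)
  qed (use ds(3) pr sets_m in auto)
  have cp: "law \<rho> \<in> couplings PX PY \<mu> \<nu>" by (rule CouplingsD(1)[OF adm])
  have c_lim: "(\<lambda>n. \<integral>z. c z * \<rho>s n z \<partial>m) \<longlonglongrightarrow> (\<integral>z. c z * \<rho> z \<partial>m)"
  proof (rule LIMSEQ_I)
    fix e :: real assume "e > 0"
    then have e2: "e / 2 > 0" by simp
    obtain C a b where C: "C \<ge> 0" and G: "integrable \<mu> (\<lambda>x. dX a x powr p)" "integrable \<nu> (\<lambda>y. dY b y powr p)"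
      and le: "\<And>x y. x \<in> topspace PX \<Longrightarrow> y \<in> topspace PY \<Longrightarrow> \<bar>c (x, y)\<bar> \<le> C * (1 + dX a x powr p + dY b y powr p)"
      by (rule cost_bound[OF \<mu> \<nu>]) (rule that)
    obtain \<kappa> where \<kappa>: "\<kappa> > 0" "\<And>\<rho>1 \<rho>2. \<rho>1 \<in> borel_measurable m \<Longrightarrow> \<rho>2 \<in> borel_measurable m \<Longrightarrow>
      (\<And>z. 0 \<le> \<rho>1 z) \<Longrightarrow> (\<And>z. 0 \<le> \<rho>2 z) \<Longrightarrow>
      law \<rho>1 \<in> couplings PX PY \<mu> \<nu> \<Longrightarrow>
      law \<rho>2 \<in> couplings PX PY \<mu> \<nu> \<Longrightarrow>
      (\<integral>z. \<bar>\<rho>1 z - \<rho>2 z\<bar> \<partial>m) \<le> \<kappa> \<Longrightarrow>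
      integrable m (\<lambda>z. c z * \<rho>1 z) \<and> integrable m (\<lambda>z. c z * \<rho>2 z) \<and>
      (\<integral>z. \<bar>c z\<bar> * \<bar>\<rho>1 z - \<rho>2 z\<bar> \<partial>m) \<le> e / 2"
      using density_integral_stable[OF G C c_measurable le e2] by blast
    have "eventually (\<lambda>n. (\<integral>z. \<bar>\<rho>s n z - \<rho> z\<bar> \<partial>m) < \<kappa>) sequentially"
      using L1 \<kappa>(1) by (intro order_tendstoD(2)) auto
    then obtain n0 where n0: "\<And>n. n \<ge> n0 \<Longrightarrow> (\<integral>z. \<bar>\<rho>s n z - \<rho> z\<bar> \<partial>m) < \<kappa>"
      by (auto simp: eventually_sequentially)
    show "\<exists>n0. \<forall>n\<ge>n0. norm ((\<integral>z. c z * \<rho>s n z \<partial>m) - (\<integral>z. c z * \<rho> z \<partial>m)) < e"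
    proof (intro exI[of _ n0] allI impI)
      fix n assume "n \<ge> n0"
      then have k: "integrable m (\<lambda>z. c z * \<rho>s n z) \<and> integrable m (\<lambda>z. c z * \<rho> z) \<and>
        (\<integral>z. \<bar>c z\<bar> * \<bar>\<rho>s n z - \<rho> z\<bar> \<partial>m) \<le> e / 2"
        using n0 by (intro \<kappa>(2) ds \<rho>m \<rho>nn cp) (auto intro: less_imp_le)
      then have "\<bar>(\<integral>z. c z * \<rho>s n z \<partial>m) - (\<integral>z. c z * \<rho> z \<partial>m)\<bar> = \<bar>\<integral>z. c z * (\<rho>s n z - \<rho> z) \<partial>m\<bar>"
        by (simp add: right_diff_distrib)
      also have "\<dots> \<le> (\<integral>z. \<bar>c z * (\<rho>s n z - \<rho> z)\<bar> \<partial>m)" by (rule integral_abs_bound)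
      also have "\<dots> \<le> e / 2" using k by (simp add: abs_mult)
      finally show "norm ((\<integral>z. c z * \<rho>s n z \<partial>m) - (\<integral>z. c z * \<rho> z \<partial>m)) < e" using \<open>e > 0\<close> by simp
    qed
  qed
  \<comment> \<open>An upper bound for the integral of
    \<open>\<rho>s n z * ln (\<rho>s n z) + 1\<close>; the added 1 makes the integrand nonnegative,
    as Fatou's lemma requires.\<close>
  define u where "u n = (r + inverse (real (Suc n)) - (\<integral>z. c z * \<rho>s n z \<partial>m)) / \<epsilon> + 1" for n
  define u0 where "u0 = (r - (\<integral>z. c z * \<rho> z \<partial>m)) / \<epsilon> + 1"
  have u_lim: "u \<longlonglongrightarrow> u0"
  proof -
    have "(\<lambda>n. (r + inverse (real (Suc n)) - (\<integral>z. c z * \<rho>s n z \<partial>m)) / \<epsilon> + 1) \<longlonglongrightarrow> (r + 0 - (\<integral>z. c z * \<rho> z \<partial>m)) / \<epsilon> + 1"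
      using \<epsilon> by (intro tendsto_intros c_lim LIMSEQ_inverse_real_of_nat) auto
    then show ?thesis by (simp add: u_def[abs_def] u0_def)
  qed
  have h_le: "(\<integral>\<^sup>+z. ennreal (\<rho>s n z * ln (\<rho>s n z) + 1) \<partial>m) \<le> ennreal (u n)" for n
  proof -
    have "\<epsilon> * (\<integral>z. \<rho>s n z * ln (\<rho>s n z) \<partial>m) \<le> r + inverse (real (Suc n)) - (\<integral>z. c z * \<rho>s n z \<partial>m)"
      using \<rho>s(2)[of n] by (simp add: F_def)
    then have "(\<integral>z. \<rho>s n z * ln (\<rho>s n z) + 1 \<partial>m) \<le> u n"
      using ds(6) \<epsilon> m.prob_space by (simp add: u_def pos_le_divide_eq mult.commute)
    moreover have "0 \<le> \<rho>s n z * ln (\<rho>s n z) + 1" for z using minus_mult_ln_le[OF ds(2)[of n z]] by linarith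
    ultimately show ?thesis using ds(6) by (subst nn_integral_eq_integral) (auto intro: ennreal_leI)
  qed
  have pos: "0 \<le> \<rho> z * ln (\<rho> z) + 1" for z using minus_mult_ln_le[OF \<rho>nn[of z]] by linarith
  have fatou: "(\<integral>\<^sup>+z. ennreal (\<rho> z * ln (\<rho> z) + 1) \<partial>m) \<le> ennreal u0"
  proof -
    have "(\<integral>\<^sup>+z. ennreal (\<rho> z * ln (\<rho> z) + 1) \<partial>m)
        = (\<integral>\<^sup>+z. liminf (\<lambda>i. ennreal (\<rho>s (q i) z * ln (\<rho>s (q i) z) + 1)) \<partial>m)"
    proof (rule nn_integral_cong_AE)
      show "AE z in m. ennreal (\<rho> z * ln (\<rho> z) + 1) = liminf (\<lambda>i. ennreal (\<rho>s (q i) z * ln (\<rho>s (q i) z) + 1))"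
        using ae
      proof eventually_elim
        case (elim z)
        have "(\<lambda>i. ennreal (\<rho>s (q i) z * ln (\<rho>s (q i) z) + 1)) \<longlonglongrightarrow> ennreal (\<rho> z * ln (\<rho> z) + 1)"
          by (intro tendsto_ennrealI tendsto_add tendsto_mult_ln[OF elim ds(2)] tendsto_const)
        from lim_imp_Liminf[OF sequentially_bot this, symmetric] show ?case .
      qed
    qed
    also have "\<dots> \<le> liminf (\<lambda>i. \<integral>\<^sup>+z. ennreal (\<rho>s (q i) z * ln (\<rho>s (q i) z) + 1) \<partial>m)"
      by (rule nn_integral_liminf) measurable
    also have "\<dots> \<le> liminf (\<lambda>i. ennreal (u (q i)))"
      by (rule Liminf_mono) (simp add: h_le)
    also have "\<dots> = ennreal u0"
      using LIMSEQ_subseq_LIMSEQ[OF u_lim q] by (intro lim_imp_Liminf tendsto_ennrealI) (auto simp: o_def)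
    finally show ?thesis .
  qed
  have hi1: "integrable m (\<lambda>z. \<rho> z * ln (\<rho> z) + 1)"
    using fatou pos by (intro integrableI_nonneg) (auto intro: le_less_trans)
  then have hi: "integrable m (\<lambda>z. \<rho> z * ln (\<rho> z))"
    using Bochner_Integration.integrable_diff[OF hi1, of "\<lambda>_. 1"] by simp
  have \<rho>d: "\<rho> \<in> dens" using adm \<rho>nn hi by (simp add: dens_def)
  \<comment> \<open>\<open>ennreal\<close> truncates negative numbers to 0, so the bound can be read
    back in the reals only after this. A negative \<open>u0\<close> would make the integral 0,
    against its lower bound 1 from nonnegativity of relative entropy.\<close>
  have "0 \<le> u0"
  proof (rule ccontr)
    assume "\<not> 0 \<le> u0"
    then have "(\<integral>\<^sup>+z. ennreal (\<rho> z * ln (\<rho> z) + 1) \<partial>m) = 0" using fatou by (simp add: ennreal_neg)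
    then have "(\<integral>z. \<rho> z * ln (\<rho> z) + 1 \<partial>m) = 0" using pos hi1 by (simp add: integral_eq_nn_integral)
    moreover have "(\<integral>z. \<rho> z * ln (\<rho> z) + 1 \<partial>m) \<ge> 1"
      using m.kl_div_nonneg[OF pr] m.kl_div_density[OF \<rho>m \<rho>nn] hi m.prob_space by simp
    ultimately show False by simp
  qed
  have "ennreal (\<integral>z. \<rho> z * ln (\<rho> z) + 1 \<partial>m) \<le> ennreal u0"
    using fatou hi1 pos by (simp add: nn_integral_eq_integral)
  then have "(\<integral>z. \<rho> z * ln (\<rho> z) + 1 \<partial>m) \<le> u0" using \<open>0 \<le> u0\<close> by (simp add: ennreal_le_iff)
  then have "(\<integral>z. \<rho> z * ln (\<rho> z) \<partial>m) \<le> (r - (\<integral>z. c z * \<rho> z \<partial>m)) / \<epsilon>"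
    using hi m.prob_space by (simp add: u0_def)
  then have "F \<rho> \<le> r" using \<epsilon> by (simp add: F_def pos_le_divide_eq mult.commute)
  moreover have "r \<le> F \<rho>" using E_min_le[OF \<rho>d] r by simp
  ultimately show ?thesis using \<rho>d r by (intro bexI[of _ \<rho>]) auto
qed

lemma optimizer_dens:
  assumes "E_optimizer v \<epsilon> N X Y \<mu> \<nu> c \<pi>"
  obtains \<rho> where "\<rho> \<in> dens" "\<pi> = law \<rho>" "ereal (F \<rho>) = E_min"
proof -
  obtain r where r: "E_min = ereal r" by (rule E_min_finite)
  have \<pi>: "\<pi> \<in> adm" "E_cost \<epsilon> \<mu> \<nu> c \<pi> = E_min" using assms by (auto simp: E_optimizer_def)
  then have "E_cost \<epsilon> \<mu> \<nu> c \<pi> \<noteq> \<infinity>" using r by simp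
  then obtain \<rho> where \<rho>: "\<rho> \<in> dens" "\<pi> = law \<rho>" by (rule dens_of_finite_cost[OF \<pi>(1)])
  then show thesis using that[OF \<rho>] \<pi>(2) E_cost_density[OF \<rho>(1)] by simp
qed

lemma optimizer_unique_exists: "\<exists>!\<pi>. E_optimizer v \<epsilon> N X Y \<mu> \<nu> c \<pi>"
proof (rule ex_ex1I)
  obtain \<rho> where \<rho>: "\<rho> \<in> dens" "ereal (F \<rho>) = E_min" using minimizer_exists by blast
  then show "\<exists>\<pi>. E_optimizer v \<epsilon> N X Y \<mu> \<nu> c \<pi>"
    using densD(3)[OF \<rho>(1)] E_cost_density[OF \<rho>(1)]
    by (intro exI[of _ "law \<rho>"]) (simp add: E_optimizer_def)
next
  obtain r where r: "E_min = ereal r" by (rule E_min_finite)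
  fix \<pi>1 \<pi>2 assume o: "E_optimizer v \<epsilon> N X Y \<mu> \<nu> c \<pi>1" "E_optimizer v \<epsilon> N X Y \<mu> \<nu> c \<pi>2"
  obtain \<rho>1 where \<rho>1: "\<rho>1 \<in> dens" "\<pi>1 = law \<rho>1" "ereal (F \<rho>1) = E_min" by (rule optimizer_dens[OF o(1)])
  obtain \<rho>2 where \<rho>2: "\<rho>2 \<in> dens" "\<pi>2 = law \<rho>2" "ereal (F \<rho>2) = E_min" by (rule optimizer_dens[OF o(2)])
  note d1 = densD[OF \<rho>1(1)] and d2 = densD[OF \<rho>2(1)]
  \<comment> \<open>Exact minimizers are near-minimizers at every tolerance.\<close>
  have "(\<integral>z. \<bar>\<rho>1 z - \<rho>2 z\<bar> \<partial>m) \<le> 0"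
  proof (rule field_le_epsilon)
    fix e :: real assume "e > 0"
    obtain \<delta> where \<delta>: "\<delta> > 0" "\<And>\<rho>1 \<rho>2. \<rho>1 \<in> dens \<Longrightarrow> \<rho>2 \<in> dens \<Longrightarrow> F \<rho>1 \<le> r + \<delta> \<Longrightarrow> F \<rho>2 \<le> r + \<delta> \<Longrightarrow> (\<integral>z. \<bar>\<rho>1 z - \<rho>2 z\<bar> \<partial>m) \<le> e"
      using near_minimizers[OF r \<open>e > 0\<close>] by blast
    show "(\<integral>z. \<bar>\<rho>1 z - \<rho>2 z\<bar> \<partial>m) \<le> 0 + e"
      using \<delta>(2)[OF \<rho>1(1) \<rho>2(1)] \<delta>(1) \<rho>1(3) \<rho>2(3) r by simp
  qed
  moreover have "(\<integral>z. \<bar>\<rho>1 z - \<rho>2 z\<bar> \<partial>m) \<ge> 0" by simp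
  ultimately have "(\<integral>z. \<bar>\<rho>1 z - \<rho>2 z\<bar> \<partial>m) = 0" by linarith
  then have "AE z in m. \<bar>\<rho>1 z - \<rho>2 z\<bar> = 0"
    using d1(7) d2(7) by (subst (asm) integral_nonneg_eq_0_iff_AE) auto
  then have "AE z in m. ennreal (\<rho>1 z) = ennreal (\<rho>2 z)" by eventually_elim simp
  then show "\<pi>1 = \<pi>2" unfolding \<rho>1(2) \<rho>2(2) using d1(1) d2(1) by (intro density_cong) auto
qed

end

section \<open>Convergence of values and optimizers\<close>

lemma ennreal_root_le:
  assumes p: "p \<ge> 1" and e: "e \<ge> 0" and le: "a \<le> ennreal (e powr p)"
  shows "ennreal_root p a \<le> ennreal e"
proof -
  have fin: "a \<noteq> \<infinity>" using le by (auto simp: top_unique)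
  have "enn2real a \<le> e powr p" using enn2real_mono[OF le] by simp
  then have "enn2real a powr (1 / p) \<le> (e powr p) powr (1 / p)" using p by (intro powr_mono2) auto
  also have "\<dots> = e" using p e by (simp add: powr_powr)
  finally show ?thesis using fin by (simp add: ennreal_root_def ennreal_leI)
qed

lemma ennreal_root_less:
  assumes p: "p \<ge> 1" and \<delta>: "\<delta> > 0" and less: "ennreal_root p a < ennreal (\<delta> powr (1 / p))"
  shows "a < ennreal \<delta>"
proof -
  have fin: "a \<noteq> \<infinity>" using less by (auto simp: ennreal_root_def)
  then have "ennreal (enn2real a powr (1 / p)) < ennreal (\<delta> powr (1 / p))" using less by (simp add: ennreal_root_def)
  then have 1: "enn2real a powr (1 / p) < \<delta> powr (1 / p)" by (simp add: ennreal_less_iff)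
  have "enn2real a < \<delta>"
  proof (rule ccontr)
    assume "\<not> enn2real a < \<delta>"
    then have "\<delta> powr (1 / p) \<le> enn2real a powr (1 / p)" using p \<delta> by (intro powr_mono2) auto
    then show False using 1 by simp
  qed
  then have "ennreal (enn2real a) < ennreal \<delta>" by (simp add: ennreal_less_iff)
  then show ?thesis using fin by (simp add: ennreal_enn2real_if split: if_splits)
qed

lemma emeasure_unif_atMost: "0 \<le> w \<Longrightarrow> w \<le> 1 \<Longrightarrow> emeasure unif {..w} = ennreal w"
proof -
  assume w: "0 \<le> w" "w \<le> 1"
  then have "{0..1} \<inter> {..w} = {0..w}" by auto
  then show ?thesis using w divide_ennreal[of w 1] by (simp add: unif_def emeasure_uniform_measure)
qed

lemma emeasure_unif_greaterThan: "0 \<le> w \<Longrightarrow> w \<le> 1 \<Longrightarrow> emeasure unif {w<..} = ennreal (1 - w)"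
proof -
  assume w: "0 \<le> w" "w \<le> 1"
  then have "{0..1} \<inter> {w<..} = {w<..1}" by auto
  then show ?thesis using w divide_ennreal[of "1 - w" 1] by (simp add: unif_def emeasure_uniform_measure)
qed

text \<open>Maximal coupling: given \<open>z\<close> and \<open>z'\<close> with \<open>z' ~ \<rho>1 m\<close>, keep \<open>z'\<close> with probability
  \<open>min 1 (\<rho>2 z' / \<rho>1 z')\<close> and resample it from the normalized positive part of \<open>(\<rho>2 - \<rho>1) m\<close>
  otherwise.\<close>

lemma change_second_marginal:
  fixes \<Theta> :: "('p \<times> 'q) measure" and \<rho>1 \<rho>2 :: "'q \<Rightarrow> real"
  assumes "prob_space \<Theta>" and s: "sets \<Theta> = sets (A \<Otimes>\<^sub>M m)"
    and mg: "distr \<Theta> m snd = density m (\<lambda>z. ennreal (\<rho>1 z))"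
    and \<rho> [measurable]: "\<rho>1 \<in> borel_measurable m" "\<rho>2 \<in> borel_measurable m"
    and nn: "\<And>z. 0 \<le> \<rho>1 z" "\<And>z. 0 \<le> \<rho>2 z" and i: "integrable m \<rho>1" "integrable m \<rho>2"
    and one: "(\<integral>z. \<rho>1 z \<partial>m) = 1" "(\<integral>z. \<rho>2 z \<partial>m) = 1"
  obtains \<Theta>' where "prob_space \<Theta>'" "sets \<Theta>' = sets (A \<Otimes>\<^sub>M m)" "distr \<Theta>' A fst = distr \<Theta> A fst"
    "distr \<Theta>' m snd = density m (\<lambda>z. ennreal (\<rho>2 z))"
    "\<And>h G K. h \<in> borel_measurable (A \<Otimes>\<^sub>M m) \<Longrightarrow> G \<in> borel_measurable m \<Longrightarrow>
      (\<And>z y y'. z \<in> space A \<Longrightarrow> y \<in> space m \<Longrightarrow> y' \<in> space m \<Longrightarrow> h (z, y') \<le> K * (h (z, y) + (G y + G y'))) \<Longrightarrow>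
      (\<integral>\<^sup>+z. h z \<partial>\<Theta>') \<le> (1 + K) * (\<integral>\<^sup>+z. h z \<partial>\<Theta>) + K * (\<integral>\<^sup>+z. ennreal \<bar>\<rho>1 z - \<rho>2 z\<bar> * G z \<partial>m)"
proof -
  interpret \<Theta>: prob_space \<Theta> by fact
  note [measurable_cong] = s
  define pos where "pos z = max 0 (\<rho>2 z - \<rho>1 z)" for z
  define neg where "neg z = max 0 (\<rho>1 z - \<rho>2 z)" for z
  have [measurable]: "pos \<in> borel_measurable m" "neg \<in> borel_measurable m"
    unfolding pos_def[abs_def] neg_def[abs_def] by auto
  have ip: "integrable m pos" "integrable m neg"
    unfolding pos_def[abs_def] neg_def[abs_def] using i by auto
  have pn: "0 \<le> pos z" "0 \<le> neg z" for z by (auto simp: pos_def neg_def)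
  define \<beta> where "\<beta> = (\<integral>z. pos z \<partial>m)"
  \<comment> \<open>Both densities have mass 1, so the removed mass equals the added mass.\<close>
  have \<beta>neg: "(\<integral>z. neg z \<partial>m) = \<beta>"
  proof -
    have "(\<integral>z. neg z \<partial>m) = (\<integral>z. pos z + (\<rho>1 z - \<rho>2 z) \<partial>m)"
      by (intro Bochner_Integration.integral_cong) (auto simp: pos_def neg_def)
    then show ?thesis using i ip one by (simp add: \<beta>_def)
  qed
  have \<beta>nn: "\<beta> \<ge> 0" unfolding \<beta>_def using pn by simp
  show thesis
  proof (cases "\<beta> = 0")
    \<comment> \<open>The law for resampling is normalized by \<open>\<beta>\<close>. If
      \<open>\<beta>\<close> vanishes, the densities agree almost everywhere and
      \<open>\<Theta>\<close> itself serves.\<close>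
    case True
    have "AE z in m. pos z = 0" "AE z in m. neg z = 0"
      using integral_nonneg_eq_0_iff_AE[OF ip(1)] integral_nonneg_eq_0_iff_AE[OF ip(2)] True \<beta>neg pn
      by (simp_all add: \<beta>_def)
    then have "AE z in m. ennreal (\<rho>1 z) = ennreal (\<rho>2 z)"
      by eventually_elim (auto simp: pos_def neg_def max_def split: if_splits)
    then have eq: "density m (\<lambda>z. ennreal (\<rho>1 z)) = density m (\<lambda>z. ennreal (\<rho>2 z))"
      by (intro density_cong) auto
    show thesis
    proof (rule that[OF \<Theta>.prob_space_axioms s refl])
      show "distr \<Theta> m snd = density m (\<lambda>z. ennreal (\<rho>2 z))" using mg eq by simp
      fix h :: "_ \<Rightarrow> ennreal" and G and K :: ennreal
      have "(\<integral>\<^sup>+z. h z \<partial>\<Theta>) \<le> (1 + K) * (\<integral>\<^sup>+z. h z \<partial>\<Theta>)"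
        by (simp add: distrib_right)
      then show "(\<integral>\<^sup>+z. h z \<partial>\<Theta>) \<le> (1 + K) * (\<integral>\<^sup>+z. h z \<partial>\<Theta>) + K * (\<integral>\<^sup>+z. ennreal \<bar>\<rho>1 z - \<rho>2 z\<bar> * G z \<partial>m)"
        by (rule order_trans) simp
    qed
  next
    case False
    then have \<beta>: "\<beta> > 0" using \<beta>nn by simp
    define R where "R = density m (\<lambda>z. ennreal (pos z / \<beta>))"
    have sR [measurable_cong, simp]: "sets R = sets m" by (simp add: R_def)
    have [simp]: "space R = space m" by (simp add: R_def)
    have R: "prob_space R"
    proof
      have "emeasure R (space R) = (\<integral>\<^sup>+z. ennreal (pos z / \<beta>) \<partial>m)"
        unfolding R_def by (subst emeasure_density) (auto intro!: nn_integral_cong)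
      also have "\<dots> = ennreal (\<integral>z. pos z / \<beta> \<partial>m)" using ip pn \<beta> by (intro nn_integral_eq_integral) auto
      also have "(\<integral>z. pos z / \<beta> \<partial>m) = 1" using \<beta> by (simp add: \<beta>_def[symmetric])
      finally show "emeasure R (space R) = 1" by simp
    qed
    interpret R: prob_space R by (rule R)
    interpret U: prob_space unif by (rule prob_space_unif)
    interpret UR: pair_prob_space unif R ..
    interpret K: pair_prob_space \<Theta> "unif \<Otimes>\<^sub>M R" ..
    \<comment> \<open>Where \<open>\<rho>1\<close> vanishes the value is 1, which avoids the
      quotient 0 / 0. In every case the kept and the added mass give
      \<open>\<rho>1 z * w z + pos z = \<rho>2 z\<close>.\<close>
    define w where "w z = (if \<rho>1 z \<le> \<rho>2 z then 1 else \<rho>2 z / \<rho>1 z)" for z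
    have wm [measurable]: "w \<in> borel_measurable m" unfolding w_def[abs_def] by measurable
    have w01: "0 \<le> w z" "w z \<le> 1" for z using nn[of z] by (auto simp: w_def)
    have w\<rho>: "\<rho>1 z * w z + pos z = \<rho>2 z" "\<rho>1 z * (1 - w z) = neg z" for z
      using nn[of z] by (auto simp: w_def pos_def neg_def algebra_simps)
    define T where "T = (\<lambda>(\<zeta> :: 'p \<times> 'q, u, r). (fst \<zeta>, if u \<le> w (snd \<zeta>) then snd \<zeta> else r))"
    have T [measurable]: "T \<in> \<Theta> \<Otimes>\<^sub>M (unif \<Otimes>\<^sub>M R) \<rightarrow>\<^sub>M A \<Otimes>\<^sub>M m" unfolding T_def by measurable
    define \<Theta>' where "\<Theta>' = distr (\<Theta> \<Otimes>\<^sub>M (unif \<Otimes>\<^sub>M R)) (A \<Otimes>\<^sub>M m) T"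
    have spT: "space \<Theta> = space A \<times> space m" using sets_eq_imp_space_eq[OF s] by (simp add: space_pair_measure)
    have int: "(\<integral>\<^sup>+z. h z \<partial>\<Theta>') = (\<integral>\<^sup>+\<zeta>. ennreal (w (snd \<zeta>)) * h \<zeta> + ennreal (1 - w (snd \<zeta>)) * (\<integral>\<^sup>+r. h (fst \<zeta>, r) \<partial>R) \<partial>\<Theta>)"
      if h [measurable]: "h \<in> borel_measurable (A \<Otimes>\<^sub>M m)" for h :: "_ \<Rightarrow> ennreal"
    proof -
      have "(\<integral>\<^sup>+z. h z \<partial>\<Theta>') = (\<integral>\<^sup>+\<omega>. h (T \<omega>) \<partial>(\<Theta> \<Otimes>\<^sub>M (unif \<Otimes>\<^sub>M R)))"
        unfolding \<Theta>'_def by (rule nn_integral_distr) auto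
      also have "\<dots> = (\<integral>\<^sup>+\<zeta>. \<integral>\<^sup>+\<xi>. h (T (\<zeta>, \<xi>)) \<partial>(unif \<Otimes>\<^sub>M R) \<partial>\<Theta>)"
        by (rule UR.nn_integral_fst[symmetric]) measurable
      also have "\<dots> = (\<integral>\<^sup>+\<zeta>. ennreal (w (snd \<zeta>)) * h \<zeta> + ennreal (1 - w (snd \<zeta>)) * (\<integral>\<^sup>+r. h (fst \<zeta>, r) \<partial>R) \<partial>\<Theta>)"
      proof (rule nn_integral_cong)
        fix \<zeta> assume \<zeta>: "\<zeta> \<in> space \<Theta>"
        then have f: "fst \<zeta> \<in> space A" and sz: "snd \<zeta> \<in> space m" by (auto simp: spT)
        define I where "I = (\<integral>\<^sup>+r. h (fst \<zeta>, r) \<partial>R)"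
        have "(\<integral>\<^sup>+\<xi>. h (T (\<zeta>, \<xi>)) \<partial>(unif \<Otimes>\<^sub>M R)) = (\<integral>\<^sup>+u. \<integral>\<^sup>+r. h (T (\<zeta>, u, r)) \<partial>R \<partial>unif)"
          using \<zeta> by (intro R.nn_integral_fst[symmetric] measurable_compose[OF _ h] measurable_compose[OF measurable_Pair1' T]) auto
        also have "\<dots> = (\<integral>\<^sup>+u. h \<zeta> * indicator {..w (snd \<zeta>)} u + I * indicator {w (snd \<zeta>)<..} u \<partial>unif)"
        proof (rule nn_integral_cong)
          fix u
          show "(\<integral>\<^sup>+r. h (T (\<zeta>, u, r)) \<partial>R) = h \<zeta> * indicator {..w (snd \<zeta>)} u + I * indicator {w (snd \<zeta>)<..} u"
          proof (cases "u \<le> w (snd \<zeta>)")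
            case True
            then show ?thesis by (simp add: T_def R.emeasure_space_1[unfolded \<open>space R = space m\<close>])
          next
            case False
            then show ?thesis by (simp add: T_def I_def)
          qed
        qed
        also have "\<dots> = h \<zeta> * emeasure unif {..w (snd \<zeta>)} + I * emeasure unif {w (snd \<zeta>)<..}"
          by (simp add: nn_integral_add nn_integral_cmult)
        also have "\<dots> = ennreal (w (snd \<zeta>)) * h \<zeta> + ennreal (1 - w (snd \<zeta>)) * I"
          using w01 by (simp add: emeasure_unif_atMost emeasure_unif_greaterThan mult.commute)
        finally show "(\<integral>\<^sup>+\<xi>. h (T (\<zeta>, \<xi>)) \<partial>(unif \<Otimes>\<^sub>M R))
            = ennreal (w (snd \<zeta>)) * h \<zeta> + ennreal (1 - w (snd \<zeta>)) * (\<integral>\<^sup>+r. h (fst \<zeta>, r) \<partial>R)"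
          unfolding I_def .
      qed
      finally show ?thesis .
    qed
    have via_m: "(\<integral>\<^sup>+\<zeta>. f (snd \<zeta>) \<partial>\<Theta>) = (\<integral>\<^sup>+z. ennreal (\<rho>1 z) * f z \<partial>m)"
      if [measurable]: "f \<in> borel_measurable m" for f :: "'q \<Rightarrow> ennreal"
    proof -
      have "(\<integral>\<^sup>+\<zeta>. f (snd \<zeta>) \<partial>\<Theta>) = (\<integral>\<^sup>+z. f z \<partial>distr \<Theta> m snd)" by (rule nn_integral_distr[symmetric]) measurable
      then show ?thesis unfolding mg by (simp add: nn_integral_density)
    qed
    have neg_int: "(\<integral>\<^sup>+\<zeta>. ennreal (1 - w (snd \<zeta>)) * f (snd \<zeta>) \<partial>\<Theta>) = (\<integral>\<^sup>+z. ennreal (neg z) * f z \<partial>m)"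
      if [measurable]: "f \<in> borel_measurable m" for f :: "'q \<Rightarrow> ennreal"
    proof -
      have "(\<integral>\<^sup>+\<zeta>. ennreal (1 - w (snd \<zeta>)) * f (snd \<zeta>) \<partial>\<Theta>) = (\<integral>\<^sup>+z. ennreal (\<rho>1 z) * (ennreal (1 - w z) * f z) \<partial>m)"
        by (rule via_m) measurable
      also have "\<dots> = (\<integral>\<^sup>+z. ennreal (neg z) * f z \<partial>m)"
        using nn(1) w01 by (simp add: mult.assoc[symmetric] ennreal_mult[symmetric] w\<rho>)
      finally show ?thesis .
    qed
    have neg1: "(\<integral>\<^sup>+\<zeta>. ennreal (1 - w (snd \<zeta>)) \<partial>\<Theta>) = ennreal \<beta>"
    proof -
      have "(\<integral>\<^sup>+\<zeta>. ennreal (1 - w (snd \<zeta>)) \<partial>\<Theta>) = (\<integral>\<^sup>+z. ennreal (neg z) \<partial>m)" using neg_int[of "\<lambda>_. 1"] by simp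
      also have "\<dots> = ennreal \<beta>" using nn_integral_eq_integral[OF ip(2)] pn \<beta>neg by simp
      finally show ?thesis .
    qed
    have pos_int: "ennreal \<beta> * (\<integral>\<^sup>+r. f r \<partial>R) = (\<integral>\<^sup>+z. ennreal (pos z) * f z \<partial>m)"
      if [measurable]: "f \<in> borel_measurable m" for f :: "'q \<Rightarrow> ennreal"
    proof -
      have "ennreal \<beta> * (\<integral>\<^sup>+r. f r \<partial>R) = (\<integral>\<^sup>+z. ennreal \<beta> * (ennreal (pos z / \<beta>) * f z) \<partial>m)"
        unfolding R_def by (simp add: nn_integral_density nn_integral_cmult)
      also have "\<dots> = (\<integral>\<^sup>+z. ennreal (pos z) * f z \<partial>m)"
        using pn \<beta> by (simp add: mult.assoc[symmetric] ennreal_mult[symmetric])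
      finally show ?thesis .
    qed
    show thesis
    proof (rule that[of \<Theta>'])
      show "prob_space \<Theta>'" unfolding \<Theta>'_def by (rule K.prob_space_distr[OF T])
      show s': "sets \<Theta>' = sets (A \<Otimes>\<^sub>M m)" by (simp add: \<Theta>'_def)
      have em: "emeasure (distr \<Theta>' B f) S = (\<integral>\<^sup>+z. indicator S (f z) \<partial>\<Theta>')"
        if "f \<in> A \<Otimes>\<^sub>M m \<rightarrow>\<^sub>M B" "S \<in> sets B" for B :: "'z measure" and f S
      proof -
        have f: "f \<in> \<Theta>' \<rightarrow>\<^sub>M B" using that(1) by (simp add: measurable_cong_sets[OF s' refl])
        have "emeasure (distr \<Theta>' B f) S = (\<integral>\<^sup>+z. indicator S z \<partial>distr \<Theta>' B f)" using that(2) by simp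
        also have "\<dots> = (\<integral>\<^sup>+z. indicator S (f z) \<partial>\<Theta>')" using that(2) f by (intro nn_integral_distr) auto
        finally show ?thesis .
      qed
      show "distr \<Theta>' A fst = distr \<Theta> A fst"
      proof (rule measure_eqI)
        fix S assume "S \<in> sets (distr \<Theta>' A fst)"
        then have S [measurable]: "S \<in> sets A" by simp
        have "emeasure (distr \<Theta>' A fst) S = (\<integral>\<^sup>+z. indicator S (fst z) \<partial>\<Theta>')" by (rule em) auto
        also have "\<dots> = (\<integral>\<^sup>+\<zeta>. ennreal (w (snd \<zeta>)) * indicator S (fst \<zeta>)
            + ennreal (1 - w (snd \<zeta>)) * (\<integral>\<^sup>+r. indicator S (fst \<zeta>) \<partial>R) \<partial>\<Theta>)"
          by (subst int) auto
        also have "\<dots> = (\<integral>\<^sup>+\<zeta>. indicator S (fst \<zeta>) \<partial>\<Theta>)"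
          using w01 R.emeasure_space_1
          by (simp add: distrib_right[symmetric] ennreal_plus[symmetric] del: ennreal_plus)
        also have "\<dots> = emeasure (distr \<Theta> A fst) S"
          using nn_integral_distr[of fst \<Theta> A "indicator S"] by simp
        finally show "emeasure (distr \<Theta>' A fst) S = emeasure (distr \<Theta> A fst) S" .
      qed simp
      show "distr \<Theta>' m snd = density m (\<lambda>z. ennreal (\<rho>2 z))"
      proof (rule measure_eqI)
        fix S assume "S \<in> sets (distr \<Theta>' m snd)"
        then have S [measurable]: "S \<in> sets m" by simp
        have "emeasure (distr \<Theta>' m snd) S = (\<integral>\<^sup>+z. indicator S (snd z) \<partial>\<Theta>')" by (rule em) auto
        also have "\<dots> = (\<integral>\<^sup>+\<zeta>. ennreal (w (snd \<zeta>)) * indicator S (snd \<zeta>)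
            + ennreal (1 - w (snd \<zeta>)) * (\<integral>\<^sup>+r. indicator S r \<partial>R) \<partial>\<Theta>)"
          by (subst int) auto
        also have "\<dots> = (\<integral>\<^sup>+\<zeta>. ennreal (w (snd \<zeta>)) * indicator S (snd \<zeta>) \<partial>\<Theta>)
            + (\<integral>\<^sup>+\<zeta>. ennreal (1 - w (snd \<zeta>)) \<partial>\<Theta>) * (\<integral>\<^sup>+r. indicator S r \<partial>R)"
          by (subst nn_integral_add) (auto simp: nn_integral_multc)
        also have "\<dots> = (\<integral>\<^sup>+z. ennreal (\<rho>1 z) * (ennreal (w z) * indicator S z) \<partial>m) + (\<integral>\<^sup>+z. ennreal (pos z) * indicator S z \<partial>m)"
          unfolding neg1 by (subst pos_int, measurable) (subst via_m, measurable)
        also have "\<dots> = (\<integral>\<^sup>+z. ennreal (\<rho>1 z) * (ennreal (w z) * indicator S z) + ennreal (pos z) * indicator S z \<partial>m)"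
          by (rule nn_integral_add[symmetric]) measurable
        also have "\<dots> = (\<integral>\<^sup>+z. ennreal (\<rho>2 z) * indicator S z \<partial>m)"
          using nn(1) w01 pn
          by (intro nn_integral_cong)
            (simp add: mult.assoc[symmetric] ennreal_mult[symmetric] distrib_right[symmetric]
              ennreal_plus[symmetric] w\<rho> del: ennreal_plus)
        also have "\<dots> = emeasure (density m (\<lambda>z. ennreal (\<rho>2 z))) S" by (simp add: emeasure_density)
        finally show "emeasure (distr \<Theta>' m snd) S = emeasure (density m (\<lambda>z. ennreal (\<rho>2 z))) S" .
      qed simp
    next
      fix h :: "_ \<Rightarrow> ennreal" and G :: "_ \<Rightarrow> ennreal" and K :: ennreal
      assume h [measurable]: "h \<in> borel_measurable (A \<Otimes>\<^sub>M m)" and G [measurable]: "G \<in> borel_measurable m"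
        and le: "\<And>z y y'. z \<in> space A \<Longrightarrow> y \<in> space m \<Longrightarrow> y' \<in> space m \<Longrightarrow> h (z, y') \<le> K * (h (z, y) + (G y + G y'))"
      define g where "g = (\<integral>\<^sup>+r. G r \<partial>R)"
      have "(\<integral>\<^sup>+z. h z \<partial>\<Theta>') = (\<integral>\<^sup>+\<zeta>. ennreal (w (snd \<zeta>)) * h \<zeta> + ennreal (1 - w (snd \<zeta>)) * (\<integral>\<^sup>+r. h (fst \<zeta>, r) \<partial>R) \<partial>\<Theta>)"
        by (rule int) measurable
      \<comment> \<open>Here \<open>h\<close> stands for a cost and \<open>G\<close> for the cost of
        reaching a reference point. A kept point pays \<open>h\<close>, a resampled one pays for the
        way through the reference point, and removed and added mass together have weight
        \<open>\<bar>\<rho>1 z - \<rho>2 z\<bar>\<close>.\<close>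
      also have "\<dots> \<le> (\<integral>\<^sup>+\<zeta>. (1 + K) * h \<zeta> + K * (ennreal (1 - w (snd \<zeta>)) * G (snd \<zeta>) + ennreal (1 - w (snd \<zeta>)) * g) \<partial>\<Theta>)"
      proof (rule nn_integral_mono)
        fix \<zeta> assume "\<zeta> \<in> space \<Theta>"
        then have f: "fst \<zeta> \<in> space A" and sz: "snd \<zeta> \<in> space m" by (auto simp: spT)
        have "(\<integral>\<^sup>+r. h (fst \<zeta>, r) \<partial>R) \<le> (\<integral>\<^sup>+r. K * (h \<zeta> + (G (snd \<zeta>) + G r)) \<partial>R)"
          using le[OF f sz] by (intro nn_integral_mono) simp
        also have "\<dots> = K * (h \<zeta> + (G (snd \<zeta>) + g))"
          using R.emeasure_space_1 by (simp add: nn_integral_cmult nn_integral_add g_def)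
        finally have I: "(\<integral>\<^sup>+r. h (fst \<zeta>, r) \<partial>R) \<le> K * (h \<zeta> + (G (snd \<zeta>) + g))" .
        have 1: "ennreal (w (snd \<zeta>)) * h \<zeta> \<le> 1 * h \<zeta>" using w01 by (intro mult_right_mono) (auto simp: ennreal_le_1)
        have "ennreal (1 - w (snd \<zeta>)) * (\<integral>\<^sup>+r. h (fst \<zeta>, r) \<partial>R) \<le> ennreal (1 - w (snd \<zeta>)) * (K * (h \<zeta> + (G (snd \<zeta>) + g)))"
          by (intro mult_left_mono I) simp
        also have "\<dots> = K * (ennreal (1 - w (snd \<zeta>)) * h \<zeta>) + K * (ennreal (1 - w (snd \<zeta>)) * G (snd \<zeta>) + ennreal (1 - w (snd \<zeta>)) * g)"
          by (simp add: distrib_left mult.left_commute add.assoc)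
        also have "\<dots> \<le> K * (1 * h \<zeta>) + K * (ennreal (1 - w (snd \<zeta>)) * G (snd \<zeta>) + ennreal (1 - w (snd \<zeta>)) * g)"
          using w01 by (intro add_right_mono mult_left_mono mult_right_mono) (auto simp: ennreal_le_1)
        finally show "ennreal (w (snd \<zeta>)) * h \<zeta> + ennreal (1 - w (snd \<zeta>)) * (\<integral>\<^sup>+r. h (fst \<zeta>, r) \<partial>R)
          \<le> (1 + K) * h \<zeta> + K * (ennreal (1 - w (snd \<zeta>)) * G (snd \<zeta>) + ennreal (1 - w (snd \<zeta>)) * g)"
          using add_mono[OF 1] by (simp add: distrib_right add.assoc)
      qed
      also have "\<dots> = (1 + K) * (\<integral>\<^sup>+\<zeta>. h \<zeta> \<partial>\<Theta>) + K * ((\<integral>\<^sup>+\<zeta>. ennreal (1 - w (snd \<zeta>)) * G (snd \<zeta>) \<partial>\<Theta>) + (\<integral>\<^sup>+\<zeta>. ennreal (1 - w (snd \<zeta>)) \<partial>\<Theta>) * g)"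
        by (simp add: nn_integral_add nn_integral_cmult nn_integral_multc)
      also have "\<dots> = (1 + K) * (\<integral>\<^sup>+\<zeta>. h \<zeta> \<partial>\<Theta>) + K * (\<integral>\<^sup>+z. ennreal (neg z) * G z + ennreal (pos z) * G z \<partial>m)"
        unfolding neg1 neg_int[OF G] g_def pos_int[OF G] by (simp add: nn_integral_add)
      also have "(\<integral>\<^sup>+z. ennreal (neg z) * G z + ennreal (pos z) * G z \<partial>m) = (\<integral>\<^sup>+z. ennreal \<bar>\<rho>1 z - \<rho>2 z\<bar> * G z \<partial>m)"
      proof (rule nn_integral_cong)
        fix z
        have "ennreal (neg z) + ennreal (pos z) = ennreal \<bar>\<rho>1 z - \<rho>2 z\<bar>"
          using pn by (simp add: ennreal_plus[symmetric] del: ennreal_plus) (simp add: pos_def neg_def)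
        then show "ennreal (neg z) * G z + ennreal (pos z) * G z = ennreal \<bar>\<rho>1 z - \<rho>2 z\<bar> * G z"
          by (simp add: distrib_right[symmetric])
      qed
      finally show "(\<integral>\<^sup>+z. h z \<partial>\<Theta>') \<le> (1 + K) * (\<integral>\<^sup>+z. h z \<partial>\<Theta>) + K * (\<integral>\<^sup>+z. ennreal \<bar>\<rho>1 z - \<rho>2 z\<bar> * G z \<partial>m)" .
    qed
  qed
qed

text \<open>Reversal exchanges causality and anticausality, so the conjunction of both is preserved.
  It provides the couplings that lead from the limit back to the approximating marginals.\<close>

lemma bicausal_swap:
  fixes \<gamma> :: "((nat \<Rightarrow> 'a) \<times> (nat \<Rightarrow> 'b)) measure"
  assumes X: "\<And>t. t \<in> {1..N} \<Longrightarrow> polish (X t)" and Y: "\<And>t. t \<in> {1..N} \<Longrightarrow> polish (Y t)"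
    and \<gamma>: "\<gamma> \<in> Couplings Bicausal N X Y \<mu> \<nu>"
  shows "distr \<gamma> (borel_of (paths N Y) \<Otimes>\<^sub>M borel_of (paths N X)) (\<lambda>z. (snd z, fst z)) \<in> Couplings Bicausal N Y X \<nu> \<mu>"
    (is "?\<eta> \<in> _")
proof -
  have pX: "polish (paths N X)" and pY: "polish (paths N Y)" using X Y by (auto intro!: polish_paths)
  note cp = CouplingsD[OF \<gamma>]
  interpret prob_space \<gamma> by (rule couplingsD(1)[OF cp(1)])
  note [measurable_cong] = couplings_sets[OF pX pY cp(1)]
  have q: "(\<lambda>z. (snd z, fst z)) \<in> \<gamma> \<rightarrow>\<^sub>M borel_of (paths N Y) \<Otimes>\<^sub>M borel_of (paths N X)" by measurable
  have "prob_space ?\<eta>" by (rule prob_space_distr[OF q])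
  moreover have "sets ?\<eta> = sets (borel_of (prod_topology (paths N Y) (paths N X)))"
    using sets_borel_of_prod[of "paths N Y" "paths N X"] pX pY by (simp add: polish_second_countable)
  moreover have "distr ?\<eta> (borel_of (paths N Y)) fst = \<nu>" "distr ?\<eta> (borel_of (paths N X)) snd = \<mu>"
    using couplingsD(3,4)[OF cp(1)] q by (simp_all add: distr_distr comp_def)
  moreover have "causal_rv N Y X ?\<eta> fst snd \<longleftrightarrow> causal_rv N Y X \<gamma> (\<lambda>z. fst (snd z, fst z)) (\<lambda>z. snd (snd z, fst z))"
    by (rule causal_rv_distr[OF prob_space_axioms _ q]) (simp_all add: Y)
  moreover have "causal_rv N X Y ?\<eta> snd fst \<longleftrightarrow> causal_rv N X Y \<gamma> (\<lambda>z. snd (snd z, fst z)) (\<lambda>z. fst (snd z, fst z))"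
    by (rule causal_rv_distr[OF prob_space_axioms _ q]) (simp_all add: X)
  ultimately show ?thesis using cp(2)
    by (simp add: Couplings_def couplings_def probs_def causal_eq_causal_rv anticausal_eq_causal_rv)
qed

text \<open>Near-minimizers stand in for optimal couplings. The case of an infinite infimum is
  included, since every element then qualifies.\<close>

lemma INF_approximable:
  fixes f :: "'a \<Rightarrow> ennreal"
  assumes "A \<noteq> {}" "e > 0"
  shows "\<exists>a\<in>A. f a \<le> (INF a\<in>A. f a) + ennreal e"
proof (cases "(INF a\<in>A. f a) = \<infinity>")
  case True
  then show ?thesis using assms(1) by auto
next
  case False
  then have "(INF a\<in>A. f a) < (INF a\<in>A. f a) + ennreal e"
    using assms(2) by (cases "INF a\<in>A. f a") (auto simp: ennreal_plus[symmetric] ennreal_less_iff simp del: ennreal_plus)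
  then obtain a where "a \<in> A" "f a < (INF a\<in>A. f a) + ennreal e" by (auto simp only: INF_less_iff)
  then show ?thesis by (intro bexI[of _ a]) (auto intro: less_imp_le)
qed

lemma ennreal_root_tendsto_0:
  assumes p: "p \<ge> 1" and lim: "(\<lambda>n. ennreal_root p (a n)) \<longlonglongrightarrow> 0"
  shows "a \<longlonglongrightarrow> 0"
proof (rule order_tendstoI)
  fix e :: ennreal assume "0 < e"
  then obtain \<delta> where \<delta>: "0 < ennreal \<delta>" "ennreal \<delta> < e"
    by (metis dense ennreal_cases ennreal_less_top less_imp_neq less_trans)
  have d: "\<delta> > 0" using \<delta>(1) by simp
  then have "eventually (\<lambda>n. ennreal_root p (a n) < ennreal (\<delta> powr (1 / p))) sequentially"
    using lim by (intro order_tendstoD(2)) auto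
  then show "eventually (\<lambda>n. a n < e) sequentially"
    by eventually_elim (use ennreal_root_less[OF p d] \<delta>(2) in \<open>auto intro: less_trans\<close>)
qed simp

text \<open>The couplings are optimal up to \<open>inverse (Suc n)\<close>. This slack vanishes, so
  convergence is kept while the existence of optimal bicausal couplings is not called upon.\<close>

lemma bicausal_approximation:
  assumes X: "\<And>t. t \<in> {1..N} \<Longrightarrow> polish (X t)" and p: "p \<ge> 1"
    and \<mu>s: "\<And>n. \<mu>s n \<in> probs (paths N X)" and \<mu>: "\<mu> \<in> probs (paths N X)"
    and lim: "(\<lambda>n. W_bc p N X d (\<mu>s n) \<mu>) \<longlonglongrightarrow> 0"
  obtains \<gamma>s where "\<And>n. \<gamma>s n \<in> Couplings Bicausal N X X (\<mu>s n) \<mu>"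
    "(\<lambda>n. \<integral>\<^sup>+z. ennreal (d (fst z) (snd z) powr p) \<partial>\<gamma>s n) \<longlonglongrightarrow> 0"
proof -
  let ?I = "\<lambda>n. INF \<gamma>\<in>Couplings Bicausal N X X (\<mu>s n) \<mu>. \<integral>\<^sup>+z. ennreal (d (fst z) (snd z) powr p) \<partial>\<gamma>"
  have "\<exists>\<gamma>. \<gamma> \<in> Couplings Bicausal N X X (\<mu>s n) \<mu> \<and> (\<integral>\<^sup>+z. ennreal (d (fst z) (snd z) powr p) \<partial>\<gamma>) \<le> ?I n + ennreal (inverse (real (Suc n)))" for n
    unfolding Bex_def[symmetric]
  proof (rule INF_approximable)
    show "Couplings Bicausal N X X (\<mu>s n) \<mu> \<noteq> {}"
      using product_Couplings[where v=Bicausal, OF X X \<mu>s[of n] \<mu>] by blast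
  qed simp
  then have "\<exists>\<gamma>s. \<forall>n. \<gamma>s n \<in> Couplings Bicausal N X X (\<mu>s n) \<mu> \<and> (\<integral>\<^sup>+z. ennreal (d (fst z) (snd z) powr p) \<partial>\<gamma>s n) \<le> ?I n + ennreal (inverse (real (Suc n)))"
    by (intro choice allI)
  then obtain \<gamma>s where \<gamma>s: "\<And>n. \<gamma>s n \<in> Couplings Bicausal N X X (\<mu>s n) \<mu>"
    "\<And>n. (\<integral>\<^sup>+z. ennreal (d (fst z) (snd z) powr p) \<partial>\<gamma>s n) \<le> ?I n + ennreal (inverse (real (Suc n)))" by blast
  have "?I \<longlonglongrightarrow> 0" using lim unfolding W_bc_def by (rule ennreal_root_tendsto_0[OF p])
  then have "(\<lambda>n. ?I n + ennreal (inverse (real (Suc n)))) \<longlonglongrightarrow> 0 + ennreal 0"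
    by (intro tendsto_add tendsto_ennrealI LIMSEQ_inverse_real_of_nat)
  then have bound: "(\<lambda>n. ?I n + ennreal (inverse (real (Suc n)))) \<longlonglongrightarrow> 0" by simp
  have "(\<lambda>n. \<integral>\<^sup>+z. ennreal (d (fst z) (snd z) powr p) \<partial>\<gamma>s n) \<longlonglongrightarrow> 0"
    by (rule tendsto_sandwich[OF _ _ tendsto_const bound]) (intro always_eventually allI zero_le, intro always_eventually allI \<gamma>s(2))
  then show thesis using that \<gamma>s(1) by blast
qed

text \<open>The limit is finite while the single terms are extended reals. Additive estimates in
  both directions, as gluing delivers them, force convergence.\<close>

lemma ereal_tendstoI:
  fixes u :: "nat \<Rightarrow> ereal"
  assumes "\<And>e. e > 0 \<Longrightarrow> eventually (\<lambda>n. u n \<le> ereal r + ereal e \<and> ereal r \<le> u n + ereal e) sequentially"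
  shows "u \<longlonglongrightarrow> ereal r"
proof (rule order_tendstoI)
  fix a assume "a < ereal r"
  then obtain a' where a': "a \<le> ereal a'" "a' < r"
    by (cases a) (use lt_ex in auto)
  then have "(r - a') / 2 > 0" by simp
  from assms[OF this] show "eventually (\<lambda>n. a < u n) sequentially"
  proof eventually_elim
    case (elim n)
    then have "ereal a' < u n" using a'(2) by (cases "u n") (auto simp: field_simps)
    then show ?case using a'(1) by (rule le_less_trans[rotated])
  qed
next
  fix a assume "ereal r < a"
  then obtain a' where a': "ereal a' \<le> a" "r < a'"
    by (cases a) (use gt_ex in auto)
  then have "(a' - r) / 2 > 0" by simp
  from assms[OF this] show "eventually (\<lambda>n. u n < a) sequentially"
  proof eventually_elim
    case (elim n)
    then have "u n < ereal a'" using a'(2) by (cases "u n") (auto simp: field_simps)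
    then show ?case using a'(1) by (rule less_le_trans)
  qed
qed

section \<open>Stability of cost and of Wasserstein distance under gluing\<close>

context transport
begin

abbreviation "PP \<equiv> prod_topology PX PY"

lemma sets_PP: "sets (borel_of PP) = sets (BX \<Otimes>\<^sub>M BY)"
  by (rule sets_borel_of_prod) (simp_all add: polish_second_countable S.polish T.polish)

lemma polish_PP: "polish PP"
  by (rule polish_prod_topology[OF S.polish T.polish])

lemma coupled_facts:
  assumes \<Theta>: "\<Theta> \<in> couplings PP PP \<pi> \<pi>'"
  shows "prob_space \<Theta>" "sets \<Theta> = sets ((BX \<Otimes>\<^sub>M BY) \<Otimes>\<^sub>M (BX \<Otimes>\<^sub>M BY))"
    "sets \<pi> = sets (BX \<Otimes>\<^sub>M BY)" "sets \<pi>' = sets (BX \<Otimes>\<^sub>M BY)"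
    "distr \<Theta> (BX \<Otimes>\<^sub>M BY) fst = \<pi>" "distr \<Theta> (BX \<Otimes>\<^sub>M BY) snd = \<pi>'"
proof -
  show "prob_space \<Theta>" by (rule couplingsD(1)[OF \<Theta>])
  have "sets (borel_of PP \<Otimes>\<^sub>M borel_of PP) = sets ((BX \<Otimes>\<^sub>M BY) \<Otimes>\<^sub>M (BX \<Otimes>\<^sub>M BY))"
    by (rule sets_pair_measure_cong[OF sets_PP sets_PP])
  with couplings_sets[OF polish_PP polish_PP \<Theta>]
  show "sets \<Theta> = sets ((BX \<Otimes>\<^sub>M BY) \<Otimes>\<^sub>M (BX \<Otimes>\<^sub>M BY))" by simp
  show "distr \<Theta> (BX \<Otimes>\<^sub>M BY) fst = \<pi>" "distr \<Theta> (BX \<Otimes>\<^sub>M BY) snd = \<pi>'"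
    using couplingsD(3,4)[OF \<Theta>] distr_cong[OF refl sets_PP, of \<Theta>] by auto
  then show "sets \<pi> = sets (BX \<Otimes>\<^sub>M BY)" "sets \<pi>' = sets (BX \<Otimes>\<^sub>M BY)" by auto
qed

abbreviation "distX \<Theta> \<equiv> \<integral>\<^sup>+z. ennreal (dX (fst (fst z)) (fst (snd z)) powr p) \<partial>\<Theta>"
abbreviation "distY \<Theta> \<equiv> \<integral>\<^sup>+z. ennreal (dY (snd (fst z)) (snd (snd z)) powr p) \<partial>\<Theta>"

lemma glued_couplings:
  assumes \<gamma>: "\<gamma> \<in> Couplings Bicausal N X X \<mu> \<mu>2" and \<eta>: "\<eta> \<in> Couplings Bicausal N Y Y \<nu> \<nu>2"
    and \<pi>: "\<pi> \<in> Couplings v N X Y \<mu> \<nu>"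
  obtains \<Theta> \<pi>2 where "\<Theta> \<in> couplings PP PP \<pi> \<pi>2" "\<pi>2 \<in> Couplings v N X Y \<mu>2 \<nu>2"
    "distX \<Theta> = (\<integral>\<^sup>+z. ennreal (dX (fst z) (snd z) powr p) \<partial>\<gamma>)"
    "distY \<Theta> = (\<integral>\<^sup>+z. ennreal (dY (fst z) (snd z) powr p) \<partial>\<eta>)"
    "kl_div \<pi>2 (\<mu>2 \<Otimes>\<^sub>M \<nu>2) \<le> kl_div \<pi> (\<mu> \<Otimes>\<^sub>M \<nu>)"
proof -
  obtain \<Theta> \<pi>2 where \<Theta>: "\<Theta> \<in> couplings PP PP \<pi> \<pi>2" and \<pi>2: "\<pi>2 \<in> Couplings v N X Y \<mu>2 \<nu>2"
    and d: "distr \<Theta> (borel_of (prod_topology PX PX)) (\<lambda>z. (fst (fst z), fst (snd z))) = \<gamma>"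
      "distr \<Theta> (borel_of (prod_topology PY PY)) (\<lambda>z. (snd (fst z), snd (snd z))) = \<eta>"
    and kl: "kl_div \<pi>2 (\<mu>2 \<Otimes>\<^sub>M \<nu>2) \<le> kl_div \<pi> (\<mu> \<Otimes>\<^sub>M \<nu>)"
    by (rule glue_couplings[OF X Y \<gamma> \<eta> \<pi>]) (assumption, assumption, rule that)
  note [measurable_cong] = coupled_facts(2)[OF \<Theta>]
  have sX: "sets (borel_of (prod_topology PX PX)) = sets (BX \<Otimes>\<^sub>M BX)"
    by (rule sets_borel_of_prod) (simp_all add: polish_second_countable S.polish)
  have sY: "sets (borel_of (prod_topology PY PY)) = sets (BY \<Otimes>\<^sub>M BY)"
    by (rule sets_borel_of_prod) (simp_all add: polish_second_countable T.polish)
  note [measurable] = S.dist_powr_measurable T.dist_powr_measurable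
  have "distX \<Theta> = (\<integral>\<^sup>+z. ennreal (dX (fst z) (snd z) powr p) \<partial>distr \<Theta> (BX \<Otimes>\<^sub>M BX) (\<lambda>z. (fst (fst z), fst (snd z))))"
    by (subst nn_integral_distr) simp_all
  also have "distr \<Theta> (BX \<Otimes>\<^sub>M BX) (\<lambda>z. (fst (fst z), fst (snd z))) = \<gamma>"
    unfolding d(1)[symmetric] by (rule distr_cong[OF refl sX[symmetric] refl])
  finally have eX: "distX \<Theta> = (\<integral>\<^sup>+z. ennreal (dX (fst z) (snd z) powr p) \<partial>\<gamma>)" .
  have "distY \<Theta> = (\<integral>\<^sup>+z. ennreal (dY (fst z) (snd z) powr p) \<partial>distr \<Theta> (BY \<Otimes>\<^sub>M BY) (\<lambda>z. (snd (fst z), snd (snd z))))"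
    by (subst nn_integral_distr) simp_all
  also have "distr \<Theta> (BY \<Otimes>\<^sub>M BY) (\<lambda>z. (snd (fst z), snd (snd z))) = \<eta>"
    unfolding d(2)[symmetric] by (rule distr_cong[OF refl sY[symmetric] refl])
  finally show thesis using that[OF \<Theta> \<pi>2 eX] kl by blast
qed

text \<open>It suffices that one of the two couplings has the fixed marginals, on either side,
  because the metrics are symmetric. Thus \<open>\<delta>\<close> does not depend on the other
  coupling, whose marginals will vary with \<open>n\<close>.\<close>

lemma cost_stable:
  assumes \<mu>: "\<mu> \<in> probs_p p PX dX" and \<nu>: "\<nu> \<in> probs_p p PY dY" and e: "e > 0"
  obtains \<delta> where "\<delta> > 0"
    "\<And>\<Theta> \<pi> \<pi>'. \<Theta> \<in> couplings PP PP \<pi> \<pi>' \<Longrightarrow> \<pi> \<in> couplings PX PY \<mu> \<nu> \<or> \<pi>' \<in> couplings PX PY \<mu> \<nu> \<Longrightarrow>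
      distX \<Theta> \<le> ennreal \<delta> \<Longrightarrow> distY \<Theta> \<le> ennreal \<delta> \<Longrightarrow> \<bar>(\<integral>z. c z \<partial>\<pi>) - (\<integral>z. c z \<partial>\<pi>')\<bar> \<le> e"
proof -
  obtain \<delta> where \<delta>: "\<delta> > 0"
    "\<And>(M :: (((nat \<Rightarrow> 'a) \<times> (nat \<Rightarrow> 'b)) \<times> ((nat \<Rightarrow> 'a) \<times> (nat \<Rightarrow> 'b))) measure) x y x' y'. prob_space M \<Longrightarrow> x \<in> M \<rightarrow>\<^sub>M BX \<Longrightarrow> x' \<in> M \<rightarrow>\<^sub>M BX \<Longrightarrow>
      y \<in> M \<rightarrow>\<^sub>M BY \<Longrightarrow> y' \<in> M \<rightarrow>\<^sub>M BY \<Longrightarrow> distr M BX x = \<mu> \<Longrightarrow> distr M BY y = \<nu> \<Longrightarrow>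
      (\<integral>\<^sup>+w. ennreal (dX (x w) (x' w) powr p) \<partial>M) \<le> ennreal \<delta> \<Longrightarrow>
      (\<integral>\<^sup>+w. ennreal (dY (y w) (y' w) powr p) \<partial>M) \<le> ennreal \<delta> \<Longrightarrow>
      integrable M (\<lambda>w. c (x w, y w)) \<and> integrable M (\<lambda>w. c (x' w, y' w)) \<and>
      (\<integral>w. \<bar>c (x w, y w) - c (x' w, y' w)\<bar> \<partial>M) \<le> e"
    by (rule c_stable[OF \<mu> \<nu> e]) (rule that)
  show thesis
  proof (rule that[OF \<delta>(1)])
    fix \<Theta> \<pi> \<pi>'
    assume \<Theta>: "\<Theta> \<in> couplings PP PP \<pi> \<pi>'" and cp: "\<pi> \<in> couplings PX PY \<mu> \<nu> \<or> \<pi>' \<in> couplings PX PY \<mu> \<nu>"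
      and dist: "distX \<Theta> \<le> ennreal \<delta>" "distY \<Theta> \<le> ennreal \<delta>"
    note f = coupled_facts[OF \<Theta>]
    note [measurable_cong] = f(2)
    note [measurable] = c_measurable
    have fs: "fst \<in> \<Theta> \<rightarrow>\<^sub>M BX \<Otimes>\<^sub>M BY" "snd \<in> \<Theta> \<rightarrow>\<^sub>M BX \<Otimes>\<^sub>M BY" by measurable
    have "integrable \<Theta> (\<lambda>z. c (fst z)) \<and> integrable \<Theta> (\<lambda>z. c (snd z)) \<and> (\<integral>z. \<bar>c (fst z) - c (snd z)\<bar> \<partial>\<Theta>) \<le> e"
      using cp
    proof
      assume "\<pi> \<in> couplings PX PY \<mu> \<nu>"
      then have "distr \<pi> BX fst = \<mu>" "distr \<pi> BY snd = \<nu>" by (auto dest: couplingsD)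
      then have "distr \<Theta> BX (\<lambda>z. fst (fst z)) = \<mu>" "distr \<Theta> BY (\<lambda>z. snd (fst z)) = \<nu>"
        unfolding f(5)[symmetric] using fs by (simp_all add: distr_distr comp_def)
      from \<delta>(2)[OF f(1) _ _ _ _ this dist] show ?thesis by simp
    next
      assume "\<pi>' \<in> couplings PX PY \<mu> \<nu>"
      then have l: "distr \<pi>' BX fst = \<mu>" "distr \<pi>' BY snd = \<nu>" by (auto dest: couplingsD)
      then have l': "distr \<Theta> BX (\<lambda>z. fst (snd z)) = \<mu>" "distr \<Theta> BY (\<lambda>z. snd (snd z)) = \<nu>"
        unfolding f(6)[symmetric] using fs by (simp_all add: distr_distr comp_def)
      have "(\<integral>\<^sup>+z. ennreal (dX (fst (snd z)) (fst (fst z)) powr p) \<partial>\<Theta>) = distX \<Theta>"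
        "(\<integral>\<^sup>+z. ennreal (dY (snd (snd z)) (snd (fst z)) powr p) \<partial>\<Theta>) = distY \<Theta>"
        by (rule nn_integral_cong, subst S.commute, rule refl) (rule nn_integral_cong, subst T.commute, rule refl)
      with dist have "(\<integral>\<^sup>+z. ennreal (dX (fst (snd z)) (fst (fst z)) powr p) \<partial>\<Theta>) \<le> ennreal \<delta>"
        "(\<integral>\<^sup>+z. ennreal (dY (snd (snd z)) (snd (fst z)) powr p) \<partial>\<Theta>) \<le> ennreal \<delta>" by simp_all
      from \<delta>(2)[OF f(1) _ _ _ _ l' this] show ?thesis by (simp add: abs_minus_commute)
    qed
    then have i: "integrable \<Theta> (\<lambda>z. c (fst z))" "integrable \<Theta> (\<lambda>z. c (snd z))" and le: "(\<integral>z. \<bar>c (fst z) - c (snd z)\<bar> \<partial>\<Theta>) \<le> e"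
      by auto
    have "(\<integral>z. c z \<partial>\<pi>) = (\<integral>z. c (fst z) \<partial>\<Theta>)" "(\<integral>z. c z \<partial>\<pi>') = (\<integral>z. c (snd z) \<partial>\<Theta>)"
      unfolding f(5,6)[symmetric] by (rule integral_distr[OF fs(1) c_measurable], rule integral_distr[OF fs(2) c_measurable])
    then have "\<bar>(\<integral>z. c z \<partial>\<pi>) - (\<integral>z. c z \<partial>\<pi>')\<bar> = \<bar>\<integral>z. c (fst z) - c (snd z) \<partial>\<Theta>\<bar>" using i by simp
    also have "\<dots> \<le> (\<integral>z. \<bar>c (fst z) - c (snd z)\<bar> \<partial>\<Theta>)" by (rule integral_abs_bound)
    finally show "\<bar>(\<integral>z. c z \<partial>\<pi>) - (\<integral>z. c z \<partial>\<pi>')\<bar> \<le> e" using le by simp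
  qed
qed

end

context entropic
begin

text \<open>The passage from \<open>\<pi>\<close> to the law of \<open>\<rho>\<close> has two legs:
  \<open>\<Theta>\<close> moves points a little in the mean on the way to \<open>\<rho>'\<close>,
  and the maximal coupling moves a small mass, possibly far, on to \<open>\<rho>\<close>. The second
  leg is priced by the moment weight \<open>g\<close>, for which closeness of the densities in L1 is
  enough.\<close>

lemma W_prod_stable:
  assumes \<rho>: "\<rho> \<in> dens" and e: "e > 0"
  obtains \<delta> \<kappa> where "\<delta> > 0" "\<kappa> > 0"
    "\<And>\<Theta> \<pi> \<rho>'. \<rho>' \<in> dens \<Longrightarrow> \<Theta> \<in> couplings PP PP \<pi> (law \<rho>') \<Longrightarrow>
      distX \<Theta> \<le> ennreal \<delta> \<Longrightarrow> distY \<Theta> \<le> ennreal \<delta> \<Longrightarrow> (\<integral>z. \<bar>\<rho>' z - \<rho> z\<bar> \<partial>m) \<le> \<kappa> \<Longrightarrow>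
      W_prod p PX dX PY dY \<pi> (law \<rho>) \<le> ennreal e"
proof -
  obtain C a b where ab: "a \<in> topspace PX" "b \<in> topspace PY"
    and G: "integrable \<mu> (\<lambda>x. dX a x powr p)" "integrable \<nu> (\<lambda>y. dY b y powr p)"
    by (rule cost_bound[OF \<mu> \<nu>]) (rule that)
  \<comment> \<open>One factor \<open>2 powr p\<close> for each of two triangle inequalities:
    through the old second point and through the reference point \<open>(a, b)\<close>.\<close>
  define k where "k = (2 :: real) powr p * 2 powr p"
  have k: "k > 0" by (simp add: k_def)
  define t where "t = e powr p"
  have t: "t > 0" using e by (simp add: t_def)
  \<comment> \<open>Together with \<open>e1\<close> below this makes
    \<open>(1 + k) * (\<delta> + \<delta>) + k * e1\<close> equal to \<open>t\<close>, each summand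
    being \<open>t / 2\<close>.\<close>
  define \<delta> where "\<delta> = t / (4 * (1 + k))"
  have \<delta>: "\<delta> > 0" using t k by (simp add: \<delta>_def)
  define e1 where "e1 = t / (2 * k)"
  have e1: "e1 > 0" using t k by (simp add: e1_def)
  define g where "g z = dX a (fst z) powr p + dY b (snd z) powr p" for z :: "(nat \<Rightarrow> 'a) \<times> (nat \<Rightarrow> 'b)"
  have gnn: "g z \<ge> 0" for z by (simp add: g_def)
  have g: "g \<in> borel_measurable (BX \<Otimes>\<^sub>M BY)"
    unfolding g_def[abs_def] using S.dist_powr_measurable1[OF ab(1)] T.dist_powr_measurable1[OF ab(2)] by measurable
  have gm [measurable]: "g \<in> borel_measurable m" using g by (simp add: measurable_cong_sets[OF sets_m refl])
  have gle: "\<bar>g (x, y)\<bar> \<le> 1 * (1 + dX a x powr p + dY b y powr p)" for x y by (simp add: g_def)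
  obtain \<kappa> where \<kappa>: "\<kappa> > 0" "\<And>\<rho>1 \<rho>2. \<rho>1 \<in> borel_measurable m \<Longrightarrow> \<rho>2 \<in> borel_measurable m \<Longrightarrow>
    (\<And>z. 0 \<le> \<rho>1 z) \<Longrightarrow> (\<And>z. 0 \<le> \<rho>2 z) \<Longrightarrow>
    law \<rho>1 \<in> couplings PX PY \<mu> \<nu> \<Longrightarrow>
    law \<rho>2 \<in> couplings PX PY \<mu> \<nu> \<Longrightarrow>
    (\<integral>z. \<bar>\<rho>1 z - \<rho>2 z\<bar> \<partial>m) \<le> \<kappa> \<Longrightarrow>
    integrable m (\<lambda>z. g z * \<rho>1 z) \<and> integrable m (\<lambda>z. g z * \<rho>2 z) \<and>
    (\<integral>z. \<bar>g z\<bar> * \<bar>\<rho>1 z - \<rho>2 z\<bar> \<partial>m) \<le> e1"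
    using density_integral_stable[OF G zero_le_one g gle e1] by blast
  note d = densD[OF \<rho>]
  show thesis
  proof (rule that[OF \<delta> \<kappa>(1)])
    fix \<Theta> \<pi> \<rho>'
    assume \<rho>': "\<rho>' \<in> dens" and \<Theta>: "\<Theta> \<in> couplings PP PP \<pi> (law \<rho>')"
      and dist: "distX \<Theta> \<le> ennreal \<delta>" "distY \<Theta> \<le> ennreal \<delta>" and close: "(\<integral>z. \<bar>\<rho>' z - \<rho> z\<bar> \<partial>m) \<le> \<kappa>"
    note d' = densD[OF \<rho>']
    note f = coupled_facts[OF \<Theta>]
    note [measurable] = d(1) d'(1)
    have s: "sets ((BX \<Otimes>\<^sub>M BY) \<Otimes>\<^sub>M m) = sets ((BX \<Otimes>\<^sub>M BY) \<Otimes>\<^sub>M (BX \<Otimes>\<^sub>M BY))"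
      by (rule sets_pair_measure_cong[OF refl sets_m])
    have s\<Theta>: "sets \<Theta> = sets ((BX \<Otimes>\<^sub>M BY) \<Otimes>\<^sub>M m)" using f(2) s by simp
    have mg: "distr \<Theta> m snd = law \<rho>'"
      using f(6) distr_cong[OF refl sets_m, of \<Theta> snd snd] by simp
    obtain \<Theta>' where \<Theta>': "prob_space \<Theta>'" "sets \<Theta>' = sets ((BX \<Otimes>\<^sub>M BY) \<Otimes>\<^sub>M m)"
      "distr \<Theta>' (BX \<Otimes>\<^sub>M BY) fst = distr \<Theta> (BX \<Otimes>\<^sub>M BY) fst" "distr \<Theta>' m snd = law \<rho>"
      and cost': "\<And>h G K. h \<in> borel_measurable ((BX \<Otimes>\<^sub>M BY) \<Otimes>\<^sub>M m) \<Longrightarrow> G \<in> borel_measurable m \<Longrightarrow>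
        (\<And>z y y'. z \<in> space (BX \<Otimes>\<^sub>M BY) \<Longrightarrow> y \<in> space m \<Longrightarrow> y' \<in> space m \<Longrightarrow> h (z, y') \<le> K * (h (z, y) + (G y + G y'))) \<Longrightarrow>
        (\<integral>\<^sup>+z. h z \<partial>\<Theta>') \<le> (1 + K) * (\<integral>\<^sup>+z. h z \<partial>\<Theta>) + K * (\<integral>\<^sup>+z. ennreal \<bar>\<rho>' z - \<rho> z\<bar> * G z \<partial>m)"
      apply (rule change_second_marginal[OF f(1) s\<Theta> mg d'(1) d(1) d'(2) d(2) d'(7) d(7) d'(8) d(8)])
      subgoal premises prems for \<Theta>'
        by (rule prems(1)[OF prems(2-5)]) (rule prems(6))
      done
    define h where "h = (\<lambda>((x, y), (x', y')). ennreal (dX x x' powr p + dY y y' powr p))"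
    have h_eq: "h z = ennreal (dX (fst (fst z)) (fst (snd z)) powr p) + ennreal (dY (snd (fst z)) (snd (snd z)) powr p)" for z
      by (cases z) (auto simp: h_def ennreal_plus split: prod.splits)
    have dm [measurable]:
      "(\<lambda>z. dX (fst (fst z)) (fst (snd z)) powr p) \<in> borel_measurable ((BX \<Otimes>\<^sub>M BY) \<Otimes>\<^sub>M (BX \<Otimes>\<^sub>M BY))"
      "(\<lambda>z. dY (snd (fst z)) (snd (snd z)) powr p) \<in> borel_measurable ((BX \<Otimes>\<^sub>M BY) \<Otimes>\<^sub>M (BX \<Otimes>\<^sub>M BY))"
      using measurable_compose[OF _ S.dist_powr_measurable, of "\<lambda>z. (fst (fst z), fst (snd z))" "(BX \<Otimes>\<^sub>M BY) \<Otimes>\<^sub>M (BX \<Otimes>\<^sub>M BY)"]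
        measurable_compose[OF _ T.dist_powr_measurable, of "\<lambda>z. (snd (fst z), snd (snd z))" "(BX \<Otimes>\<^sub>M BY) \<Otimes>\<^sub>M (BX \<Otimes>\<^sub>M BY)"]
      by simp_all
    have hm0: "h \<in> borel_measurable ((BX \<Otimes>\<^sub>M BY) \<Otimes>\<^sub>M (BX \<Otimes>\<^sub>M BY))"
      unfolding h_eq[abs_def] by measurable
    have hm: "h \<in> borel_measurable ((BX \<Otimes>\<^sub>M BY) \<Otimes>\<^sub>M m)" using hm0 by (simp add: measurable_cong_sets[OF s refl])
    have h\<Theta>: "(\<integral>\<^sup>+z. h z \<partial>\<Theta>) \<le> ennreal (\<delta> + \<delta>)"
    proof -
      have "(\<integral>\<^sup>+z. h z \<partial>\<Theta>) = distX \<Theta> + distY \<Theta>" unfolding h_eq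
        using dm by (intro nn_integral_add) (simp_all add: measurable_cong_sets[OF f(2) refl])
      also have "\<dots> \<le> ennreal \<delta> + ennreal \<delta>" by (intro add_mono dist)
      finally show ?thesis using \<delta> by (subst ennreal_plus) auto
    qed
    have sp: "space (BX \<Otimes>\<^sub>M BY) = topspace PX \<times> topspace PY" "space m = topspace PX \<times> topspace PY"
      using sets_eq_imp_space_eq[OF sets_m] by (simp_all add: space_pair_measure)
    have tri: "h (z, y') \<le> ennreal k * (h (z, y) + (ennreal (g y) + ennreal (g y')))"
      if "z \<in> space (BX \<Otimes>\<^sub>M BY)" "y \<in> space m" "y' \<in> space m" for z y y'
    proof -
      have in_sp: "fst z \<in> topspace PX" "fst y \<in> topspace PX" "fst y' \<in> topspace PX"
        "snd z \<in> topspace PY" "snd y \<in> topspace PY" "snd y' \<in> topspace PY"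
        using that unfolding sp by auto
      define q where "q = (2 :: real) powr p"
      have q: "q \<ge> 1" unfolding q_def using S.p by (simp add: ge_one_powr_ge_zero)
      have chain: "D \<le> q * q * (A + (B + C))" if "D \<le> q * (A + E')" "E' \<le> q * (B + C)" "A \<ge> 0" for A B C D E' :: real
      proof -
        have "D \<le> q * (A + q * (B + C))" using that q by (intro order_trans[OF that(1)] mult_left_mono) auto
        also have "\<dots> \<le> q * (q * A + q * (B + C))"
          using that q by (intro mult_left_mono add_right_mono) (auto simp: mult_le_cancel_right1)
        finally show ?thesis by (simp add: algebra_simps)
      qed
      have 1: "dX (fst z) (fst y') powr p \<le> q * q * (dX (fst z) (fst y) powr p + (dX a (fst y) powr p + dX a (fst y') powr p))"
        by (rule chain[OF S.dist_powr_triangle[OF in_sp(1,2,3), folded q_def]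
              S.dist_powr_triangle[OF in_sp(2) ab(1) in_sp(3), folded q_def, unfolded S.commute[of "fst y" a]]]) simp
      have 2: "dY (snd z) (snd y') powr p \<le> q * q * (dY (snd z) (snd y) powr p + (dY b (snd y) powr p + dY b (snd y') powr p))"
        by (rule chain[OF T.dist_powr_triangle[OF in_sp(4,5,6), folded q_def]
              T.dist_powr_triangle[OF in_sp(5) ab(2) in_sp(6), folded q_def, unfolded T.commute[of "snd y" b]]]) simp
      define u where "u = dX (fst z) (fst y) powr p + dY (snd z) (snd y) powr p"
      have hu: "h (z, y) = ennreal u" by (simp add: h_eq u_def ennreal_plus)
      have un: "u \<ge> 0" by (simp add: u_def)
      have "dX (fst z) (fst y') powr p + dY (snd z) (snd y') powr p \<le> k * (u + (g y + g y'))"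
        using add_mono[OF 1 2] by (simp add: k_def q_def u_def g_def algebra_simps)
      then have "h (z, y') \<le> ennreal (k * (u + (g y + g y')))"
        unfolding h_eq by (simp add: ennreal_plus[symmetric] ennreal_leI del: ennreal_plus)
      also have "\<dots> = ennreal k * (h (z, y) + (ennreal (g y) + ennreal (g y')))"
        unfolding hu using k gnn un by (simp add: ennreal_mult ennreal_plus)
      finally show ?thesis .
    qed
    have Gsmall: "(\<integral>\<^sup>+z. ennreal \<bar>\<rho>' z - \<rho> z\<bar> * ennreal (g z) \<partial>m) \<le> ennreal e1"
    proof -
      have K: "integrable m (\<lambda>z. g z * \<rho>' z) \<and> integrable m (\<lambda>z. g z * \<rho> z) \<and> (\<integral>z. \<bar>g z\<bar> * \<bar>\<rho>' z - \<rho> z\<bar> \<partial>m) \<le> e1"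
        by (intro \<kappa>(2) d d' close)
      then have i: "integrable m (\<lambda>z. \<bar>g z * \<rho>' z - g z * \<rho> z\<bar>)" by auto
      have "(\<integral>\<^sup>+z. ennreal \<bar>\<rho>' z - \<rho> z\<bar> * ennreal (g z) \<partial>m) = (\<integral>\<^sup>+z. ennreal (\<bar>g z * \<rho>' z - g z * \<rho> z\<bar>) \<partial>m)"
      proof (rule nn_integral_cong)
        fix z
        have "\<bar>g z * \<rho>' z - g z * \<rho> z\<bar> = g z * \<bar>\<rho>' z - \<rho> z\<bar>"
          using gnn[of z] by (simp add: right_diff_distrib[symmetric] abs_mult)
        also have "\<dots> = \<bar>\<rho>' z - \<rho> z\<bar> * g z" by (rule mult.commute)
        finally show "ennreal \<bar>\<rho>' z - \<rho> z\<bar> * ennreal (g z) = ennreal \<bar>g z * \<rho>' z - g z * \<rho> z\<bar>"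
          using gnn[of z] by (simp add: ennreal_mult)
      qed
      also have "\<dots> = ennreal (\<integral>z. \<bar>g z * \<rho>' z - g z * \<rho> z\<bar> \<partial>m)" using i by (intro nn_integral_eq_integral) auto
      also have "(\<integral>z. \<bar>g z * \<rho>' z - g z * \<rho> z\<bar> \<partial>m) = (\<integral>z. \<bar>g z\<bar> * \<bar>\<rho>' z - \<rho> z\<bar> \<partial>m)"
        by (simp add: right_diff_distrib[symmetric] abs_mult)
      finally show ?thesis using K by (simp add: ennreal_leI)
    qed
    have gm': "(\<lambda>z. ennreal (g z)) \<in> borel_measurable m" by measurable
    have "(\<integral>\<^sup>+z. h z \<partial>\<Theta>') \<le> (1 + ennreal k) * (\<integral>\<^sup>+z. h z \<partial>\<Theta>) + ennreal k * (\<integral>\<^sup>+z. ennreal \<bar>\<rho>' z - \<rho> z\<bar> * ennreal (g z) \<partial>m)"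
      by (rule cost'[OF hm gm']) (rule tri)
    also have "\<dots> \<le> (1 + ennreal k) * ennreal (\<delta> + \<delta>) + ennreal k * ennreal e1"
      by (intro add_mono mult_left_mono h\<Theta> Gsmall) auto
    also have "\<dots> = ennreal ((1 + k) * (\<delta> + \<delta>) + k * e1)"
      using k \<delta> e1 by (simp add: ennreal_mult ennreal_plus)
    also have "(1 + k) * (\<delta> + \<delta>) + k * e1 = t"
    proof -
      have "j * (t / (4 * j) + t / (4 * j)) = t / 2" if "j > 0" for j using that by simp
      from this[of "1 + k"] show ?thesis using k by (simp add: \<delta>_def e1_def)
    qed
    finally have small: "(\<integral>\<^sup>+z. h z \<partial>\<Theta>') \<le> ennreal (e powr p)" by (simp add: t_def)
    have "\<Theta>' \<in> couplings PP PP \<pi> (law \<rho>)"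
    proof -
      have "sets (borel_of (prod_topology PP PP)) = sets (borel_of PP \<Otimes>\<^sub>M borel_of PP)"
        by (rule sets_borel_of_prod) (simp_all add: polish_second_countable polish_PP)
      also have "\<dots> = sets \<Theta>'" using sets_pair_measure_cong[OF sets_PP sets_PP] \<Theta>'(2) s by simp
      finally have "sets \<Theta>' = sets (borel_of (prod_topology PP PP))" by simp
      moreover have "distr \<Theta>' (borel_of PP) fst = \<pi>"
        using \<Theta>'(3) f(5) distr_cong[OF refl sets_PP, of \<Theta>' fst fst] by simp
      moreover have "distr \<Theta>' (borel_of PP) snd = law \<rho>"
        using \<Theta>'(4) distr_cong[OF refl sets_PP[folded sets_m], of \<Theta>' snd snd] by simp
      ultimately show ?thesis using \<Theta>'(1) by (simp add: couplings_def probs_def)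
    qed
    then have "(INF \<theta>\<in>couplings PP PP \<pi> (law \<rho>). \<integral>\<^sup>+z. h z \<partial>\<theta>) \<le> ennreal (e powr p)"
      using small by (rule INF_lower2)
    then show "W_prod p PX dX PY dY \<pi> (law \<rho>) \<le> ennreal e"
      unfolding W_prod_def h_def using e by (intro ennreal_root_le S.p) auto
  qed
qed

end

lemma INF_le_INF_plus:
  fixes f :: "'a \<Rightarrow> ereal" and g :: "'b \<Rightarrow> ereal"
  assumes "\<And>a. a \<in> A \<Longrightarrow> \<exists>b\<in>B. g b \<le> f a + ereal e"
  shows "(INF b\<in>B. g b) \<le> (INF a\<in>A. f a) + ereal e"
proof -
  have "(INF b\<in>B. g b) - ereal e \<le> (INF a\<in>A. f a)"
  proof (rule INF_greatest)
    fix a assume "a \<in> A"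
    then obtain b where "b \<in> B" "g b \<le> f a + ereal e" using assms by blast
    then have "(INF b\<in>B. g b) \<le> f a + ereal e" by (rule INF_lower2)
    then show "(INF b\<in>B. g b) - ereal e \<le> f a" by (simp add: ereal_minus_le)
  qed
  then show ?thesis by (simp add: ereal_minus_le)
qed

lemma E_cost_le:
  assumes "\<epsilon> > 0" "(\<integral>z. c z \<partial>\<pi>') \<le> (\<integral>z. c z \<partial>\<pi>) + e"
    "kl_div \<pi>' (\<mu>' \<Otimes>\<^sub>M \<nu>') \<le> kl_div \<pi> (\<mu> \<Otimes>\<^sub>M \<nu>)"
  shows "E_cost \<epsilon> \<mu>' \<nu>' c \<pi>' \<le> E_cost \<epsilon> \<mu> \<nu> c \<pi> + ereal e"
proof -
  have "ereal (\<integral>z. c z \<partial>\<pi>') + ereal \<epsilon> * kl_div \<pi>' (\<mu>' \<Otimes>\<^sub>M \<nu>')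
      \<le> ereal ((\<integral>z. c z \<partial>\<pi>) + e) + ereal \<epsilon> * kl_div \<pi> (\<mu> \<Otimes>\<^sub>M \<nu>)"
    using assms by (intro add_mono ereal_mult_left_mono) auto
  also have "\<dots> = ereal (\<integral>z. c z \<partial>\<pi>) + ereal \<epsilon> * kl_div \<pi> (\<mu> \<Otimes>\<^sub>M \<nu>) + ereal e"
    by (simp add: plus_ereal.simps(1)[symmetric] add.assoc add.commute del: plus_ereal.simps)
  finally show ?thesis by (simp add: E_cost_def)
qed

context transport
begin

text \<open>Bounded continuous functions are costs of the permitted growth, so the stability of
  costs under gluing also applies to the test functions of weak convergence.\<close>

lemma transport_bcont:
  assumes f: "f \<in> bcont PP"
  shows "transport N X Y dX dY p f"
proof
  show "continuous_map PP euclideanreal f" using f by (simp add: bcont_def)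
  obtain a b where ab: "a \<in> topspace PX" "b \<in> topspace PY" by (rule growth_bound) (rule that)
  obtain C where C: "\<And>x. \<bar>f x\<bar> \<le> C" using f by (auto simp: bcont_def)
  have "\<bar>f (x, y) / (1 + dX a x powr p + dY b y powr p)\<bar> \<le> C" for x y
  proof -
    have "\<bar>f (x, y) / (1 + dX a x powr p + dY b y powr p)\<bar> = \<bar>f (x, y)\<bar> / (1 + dX a x powr p + dY b y powr p)"
      by (simp add: abs_divide add_nonneg_nonneg)
    also have "\<dots> \<le> \<bar>f (x, y)\<bar> / 1" by (intro divide_left_mono) (auto simp: add_nonneg_nonneg add_pos_nonneg)
    finally show ?thesis using C[of "(x, y)"] by simp
  qed
  then show "growth_at_most p PX dX PY dY f"
    unfolding growth_at_most_def bounded_iff using ab by (intro bexI[of _ a] bexI[of _ b] exI[of _ C]) auto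
qed (auto intro: X Y)

text \<open>Weak convergence handles bounded integrands only. Clipping the cost at a level given by
  uniform integrability changes its integral by at most \<open>e\<close> for all couplings at
  once.\<close>

lemma truncated_cost:
  assumes \<mu>: "\<mu> \<in> probs_p p PX dX" and \<nu>: "\<nu> \<in> probs_p p PY dY" and e: "e > 0"
  obtains f where "f \<in> bcont PP"
    "\<And>\<pi>. \<pi> \<in> couplings PX PY \<mu> \<nu> \<Longrightarrow> \<bar>(\<integral>z. c z \<partial>\<pi>) - (\<integral>z. f z \<partial>\<pi>)\<bar> \<le> e"
proof -
  obtain C a b where C: "C \<ge> 0" and ab: "a \<in> topspace PX" "b \<in> topspace PY"
    and G: "integrable \<mu> (\<lambda>x. dX a x powr p)" "integrable \<nu> (\<lambda>y. dY b y powr p)"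
    and le: "\<And>x y. x \<in> topspace PX \<Longrightarrow> y \<in> topspace PY \<Longrightarrow> \<bar>c (x, y)\<bar> \<le> C * (1 + dX a x powr p + dY b y powr p)"
    by (rule cost_bound[OF \<mu> \<nu>]) (rule that)
  obtain R where R: "R > 0"
    "\<And>(M :: ((nat \<Rightarrow> 'a) \<times> (nat \<Rightarrow> 'b)) measure) x y g. prob_space M \<Longrightarrow> x \<in> M \<rightarrow>\<^sub>M BX \<Longrightarrow> y \<in> M \<rightarrow>\<^sub>M BY \<Longrightarrow>
      distr M BX x = \<mu> \<Longrightarrow> distr M BY y = \<nu> \<Longrightarrow> g \<in> borel_measurable M \<Longrightarrow>
      (\<And>w. w \<in> space M \<Longrightarrow> \<bar>g w\<bar> \<le> C * (1 + dX a (x w) powr p + dY b (y w) powr p)) \<Longrightarrow>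
      integrable M (\<lambda>w. max 0 (\<bar>g w\<bar> - R)) \<and> (\<integral>w. max 0 (\<bar>g w\<bar> - R) \<partial>M) \<le> e"
    using uniform_tail[OF G C e] by blast
  define f where "f z = max (- R) (min R (c z))" for z
  obtain K where K: "\<And>\<pi>. \<pi> \<in> couplings PX PY \<mu> \<nu> \<Longrightarrow> integrable \<pi> c \<and> \<bar>\<integral>z. c z \<partial>\<pi>\<bar> \<le> K"
    by (rule coupling_cost[OF \<mu> \<nu>]) (rule that)
  show thesis
  proof (rule that)
    show "f \<in> bcont PP" unfolding bcont_def f_def[abs_def]
      using R(1) by (auto intro!: continuous_map_real_max continuous_map_real_min c_cont exI[of _ R])
    fix \<pi> assume \<pi>: "\<pi> \<in> couplings PX PY \<mu> \<nu>"
    note F = couplings_facts[OF \<pi>]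
    have ci: "integrable \<pi> c" using K[OF \<pi>] by simp
    interpret \<pi>: prob_space \<pi> by (rule F(1))
    have fi: "integrable \<pi> f" unfolding f_def[abs_def] using ci by auto
    have t: "integrable \<pi> (\<lambda>w. max 0 (\<bar>c w\<bar> - R)) \<and> (\<integral>w. max 0 (\<bar>c w\<bar> - R) \<partial>\<pi>) \<le> e"
    proof (rule R(2)[OF F(1,3,4,5,6)])
      fix w assume "w \<in> space \<pi>"
      then show "\<bar>c w\<bar> \<le> C * (1 + dX a (fst w) powr p + dY b (snd w) powr p)"
        using le[of "fst w" "snd w"] unfolding F(7) by (auto simp: mem_Times_iff)
    qed (use ci in auto)
    have "\<bar>(\<integral>z. c z \<partial>\<pi>) - (\<integral>z. f z \<partial>\<pi>)\<bar> = \<bar>\<integral>z. c z - f z \<partial>\<pi>\<bar>" using ci fi by simp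
    also have "\<dots> \<le> (\<integral>z. \<bar>c z - f z\<bar> \<partial>\<pi>)" by (rule integral_abs_bound)
    also have "\<dots> \<le> (\<integral>w. max 0 (\<bar>c w\<bar> - R) \<partial>\<pi>)"
      using ci fi t R(1) by (intro integral_mono) (auto simp: f_def)
    finally show "\<bar>(\<integral>z. c z \<partial>\<pi>) - (\<integral>z. f z \<partial>\<pi>)\<bar> \<le> e" using t by simp
  qed
qed

end

section \<open>Convergent marginals with bicausal couplings of vanishing cost\<close>

locale approximation = transport N X Y dX dY p c
  for N and X :: "nat \<Rightarrow> 'a topology" and Y :: "nat \<Rightarrow> 'b topology" and dX dY p c +
  fixes \<mu>s :: "nat \<Rightarrow> (nat \<Rightarrow> 'a) measure" and \<mu> and \<nu>s :: "nat \<Rightarrow> (nat \<Rightarrow> 'b) measure" and \<nu> and \<gamma>s \<eta>s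
  assumes \<mu>s: "\<And>n. \<mu>s n \<in> probs_p p (paths N X) dX" and \<mu>: "\<mu> \<in> probs_p p (paths N X) dX"
    and \<nu>s: "\<And>n. \<nu>s n \<in> probs_p p (paths N Y) dY" and \<nu>: "\<nu> \<in> probs_p p (paths N Y) dY"
    and \<gamma>s: "\<And>n. \<gamma>s n \<in> Couplings Bicausal N X X (\<mu>s n) \<mu>" and \<eta>s: "\<And>n. \<eta>s n \<in> Couplings Bicausal N Y Y (\<nu>s n) \<nu>"
    and \<gamma>0: "(\<lambda>n. \<integral>\<^sup>+z. ennreal (dX (fst z) (snd z) powr p) \<partial>\<gamma>s n) \<longlonglongrightarrow> 0"
    and \<eta>0: "(\<lambda>n. \<integral>\<^sup>+z. ennreal (dY (fst z) (snd z) powr p) \<partial>\<eta>s n) \<longlonglongrightarrow> 0"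
begin

definition costX where "costX n = (\<integral>\<^sup>+z. ennreal (dX (fst z) (snd z) powr p) \<partial>\<gamma>s n)"
definition costY where "costY n = (\<integral>\<^sup>+z. ennreal (dY (fst z) (snd z) powr p) \<partial>\<eta>s n)"

lemma cost_small: "\<delta> > 0 \<Longrightarrow> eventually (\<lambda>n. costX n \<le> ennreal \<delta> \<and> costY n \<le> ennreal \<delta>) sequentially"
  using order_tendstoD(2)[OF \<gamma>0, of "ennreal \<delta>"] order_tendstoD(2)[OF \<eta>0, of "ennreal \<delta>"]
  unfolding costX_def costY_def by (simp add: eventually_conj_iff less_imp_le eventually_mono)

lemma to_limit:
  assumes "\<pi> \<in> Couplings v N X Y (\<mu>s n) (\<nu>s n)"
  shows "\<exists>\<Theta> \<pi>'. \<Theta> \<in> couplings PP PP \<pi> \<pi>' \<and> \<pi>' \<in> Couplings v N X Y \<mu> \<nu> \<and> distX \<Theta> = costX n \<and> distY \<Theta> = costY n \<and>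
    kl_div \<pi>' (\<mu> \<Otimes>\<^sub>M \<nu>) \<le> kl_div \<pi> (\<mu>s n \<Otimes>\<^sub>M \<nu>s n)"
  unfolding costX_def costY_def by (rule glued_couplings[OF \<gamma>s[of n] \<eta>s[of n] assms]) blast

text \<open>Gluing along the reversed couplings; by symmetry of the metrics the reversal leaves the
  mean displacement unchanged.\<close>

lemma from_limit:
  assumes "\<pi> \<in> Couplings v N X Y \<mu> \<nu>"
  shows "\<exists>\<Theta> \<pi>'. \<Theta> \<in> couplings PP PP \<pi> \<pi>' \<and> \<pi>' \<in> Couplings v N X Y (\<mu>s n) (\<nu>s n) \<and> distX \<Theta> = costX n \<and> distY \<Theta> = costY n \<and>
    kl_div \<pi>' (\<mu>s n \<Otimes>\<^sub>M \<nu>s n) \<le> kl_div \<pi> (\<mu> \<Otimes>\<^sub>M \<nu>)"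
proof -
  have swap: "(\<integral>\<^sup>+z. ennreal (d (fst z) (snd z) powr p) \<partial>distr \<gamma> (borel_of (paths N Z) \<Otimes>\<^sub>M borel_of (paths N Z)) (\<lambda>z. (snd z, fst z)))
      = (\<integral>\<^sup>+z. ennreal (d (fst z) (snd z) powr p) \<partial>\<gamma>)"
    if "metric_polish (paths N Z) d p" "\<gamma> \<in> Couplings Bicausal N Z Z \<xi> \<zeta>"
    for d :: "(nat \<Rightarrow> 'c) \<Rightarrow> (nat \<Rightarrow> 'c) \<Rightarrow> real" and Z \<gamma> \<xi> \<zeta>
  proof -
    interpret Z: metric_polish "paths N Z" d p by fact
    have s: "sets \<gamma> = sets (borel_of (paths N Z) \<Otimes>\<^sub>M borel_of (paths N Z))"
      by (rule couplings_sets[OF Z.polish Z.polish CouplingsD(1)[OF that(2)]])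
    note [measurable_cong] = s
    note [measurable] = Z.dist_powr_measurable
    have "(\<integral>\<^sup>+z. ennreal (d (fst z) (snd z) powr p) \<partial>distr \<gamma> (borel_of (paths N Z) \<Otimes>\<^sub>M borel_of (paths N Z)) (\<lambda>z. (snd z, fst z)))
      = (\<integral>\<^sup>+z. ennreal (d (snd z) (fst z) powr p) \<partial>\<gamma>)"
      by (subst nn_integral_distr) simp_all
    also have "\<dots> = (\<integral>\<^sup>+z. ennreal (d (fst z) (snd z) powr p) \<partial>\<gamma>)"
      by (rule nn_integral_cong, subst Z.commute, rule refl)
    finally show ?thesis .
  qed
  have "metric_polish PX dX p" "metric_polish PY dY p" by unfold_locales
  note sw = swap[OF this(1) \<gamma>s[of n]] swap[OF this(2) \<eta>s[of n]]
  show ?thesis unfolding costX_def costY_def sw[symmetric]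
    by (rule glued_couplings[OF bicausal_swap[OF X X \<gamma>s[of n]] bicausal_swap[OF Y Y \<eta>s[of n]] assms]) (assumption+, blast)
qed

text \<open>The threshold for \<open>n\<close> depends on \<open>e\<close> and the given marginal
  sequences, not on the coupling or the version. This uniformity is what allows the infima to be
  compared.\<close>

lemma near:
  assumes "e > 0"
  shows "eventually (\<lambda>n. (\<forall>v. \<forall>\<pi>\<in>Couplings v N X Y (\<mu>s n) (\<nu>s n). \<exists>\<pi>'\<in>Couplings v N X Y \<mu> \<nu>.
      (\<integral>z. c z \<partial>\<pi>') \<le> (\<integral>z. c z \<partial>\<pi>) + e \<and> kl_div \<pi>' (\<mu> \<Otimes>\<^sub>M \<nu>) \<le> kl_div \<pi> (\<mu>s n \<Otimes>\<^sub>M \<nu>s n)) \<and>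
    (\<forall>v. \<forall>\<pi>\<in>Couplings v N X Y \<mu> \<nu>. \<exists>\<pi>'\<in>Couplings v N X Y (\<mu>s n) (\<nu>s n).
      (\<integral>z. c z \<partial>\<pi>') \<le> (\<integral>z. c z \<partial>\<pi>) + e \<and> kl_div \<pi>' (\<mu>s n \<Otimes>\<^sub>M \<nu>s n) \<le> kl_div \<pi> (\<mu> \<Otimes>\<^sub>M \<nu>))) sequentially"
proof -
  obtain \<delta> where \<delta>: "\<delta> > 0"
    "\<And>\<Theta> \<pi> \<pi>'. \<Theta> \<in> couplings PP PP \<pi> \<pi>' \<Longrightarrow> \<pi> \<in> couplings PX PY \<mu> \<nu> \<or> \<pi>' \<in> couplings PX PY \<mu> \<nu> \<Longrightarrow>
      distX \<Theta> \<le> ennreal \<delta> \<Longrightarrow> distY \<Theta> \<le> ennreal \<delta> \<Longrightarrow> \<bar>(\<integral>z. c z \<partial>\<pi>) - (\<integral>z. c z \<partial>\<pi>')\<bar> \<le> e"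
    by (rule cost_stable[OF \<mu> \<nu> assms]) (rule that)
  from cost_small[OF \<delta>(1)] show ?thesis
  proof eventually_elim
    case (elim n)
    show ?case
    proof (intro conjI allI ballI)
      fix v \<pi> assume "\<pi> \<in> Couplings v N X Y (\<mu>s n) (\<nu>s n)"
      from to_limit[OF this] obtain \<Theta> \<pi>' where t: "\<Theta> \<in> couplings PP PP \<pi> \<pi>'" "\<pi>' \<in> Couplings v N X Y \<mu> \<nu>"
        "distX \<Theta> = costX n" "distY \<Theta> = costY n" "kl_div \<pi>' (\<mu> \<Otimes>\<^sub>M \<nu>) \<le> kl_div \<pi> (\<mu>s n \<Otimes>\<^sub>M \<nu>s n)" by blast
      have "\<bar>(\<integral>z. c z \<partial>\<pi>) - (\<integral>z. c z \<partial>\<pi>')\<bar> \<le> e"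
        by (rule \<delta>(2)[OF t(1)]) (use CouplingsD(1)[OF t(2)] t(3,4) elim in auto)
      then show "\<exists>\<pi>'\<in>Couplings v N X Y \<mu> \<nu>. (\<integral>z. c z \<partial>\<pi>') \<le> (\<integral>z. c z \<partial>\<pi>) + e \<and> kl_div \<pi>' (\<mu> \<Otimes>\<^sub>M \<nu>) \<le> kl_div \<pi> (\<mu>s n \<Otimes>\<^sub>M \<nu>s n)"
        using t(2,5) by (intro bexI[of _ \<pi>']) auto
    next
      fix v \<pi> assume \<pi>: "\<pi> \<in> Couplings v N X Y \<mu> \<nu>"
      from from_limit[OF this, of n] obtain \<Theta> \<pi>' where t: "\<Theta> \<in> couplings PP PP \<pi> \<pi>'" "\<pi>' \<in> Couplings v N X Y (\<mu>s n) (\<nu>s n)"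
        "distX \<Theta> = costX n" "distY \<Theta> = costY n" "kl_div \<pi>' (\<mu>s n \<Otimes>\<^sub>M \<nu>s n) \<le> kl_div \<pi> (\<mu> \<Otimes>\<^sub>M \<nu>)" by blast
      have "\<bar>(\<integral>z. c z \<partial>\<pi>) - (\<integral>z. c z \<partial>\<pi>')\<bar> \<le> e"
        by (rule \<delta>(2)[OF t(1)]) (use CouplingsD(1)[OF \<pi>] t(3,4) elim in auto)
      then show "\<exists>\<pi>'\<in>Couplings v N X Y (\<mu>s n) (\<nu>s n). (\<integral>z. c z \<partial>\<pi>') \<le> (\<integral>z. c z \<partial>\<pi>) + e \<and> kl_div \<pi>' (\<mu>s n \<Otimes>\<^sub>M \<nu>s n) \<le> kl_div \<pi> (\<mu> \<Otimes>\<^sub>M \<nu>)"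
        using t(2,5) by (intro bexI[of _ \<pi>']) auto
    qed
  qed
qed

lemma V_finite: obtains r where "V_val v N X Y \<mu> \<nu> c = ereal r"
proof -
  obtain K where K: "\<And>\<pi>. \<pi> \<in> couplings PX PY \<mu> \<nu> \<Longrightarrow> integrable \<pi> c \<and> \<bar>\<integral>z. c z \<partial>\<pi>\<bar> \<le> K"
    by (rule coupling_cost[OF \<mu> \<nu>]) (rule that)
  have "\<mu> \<Otimes>\<^sub>M \<nu> \<in> Couplings v N X Y \<mu> \<nu>"
    using \<mu> \<nu> by (intro product_Couplings X Y) (auto simp: probs_p_def)
  then have "V_val v N X Y \<mu> \<nu> c \<le> ereal (\<integral>z. c z \<partial>(\<mu> \<Otimes>\<^sub>M \<nu>))" unfolding V_val_def by (rule INF_lower)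
  moreover have "ereal (- K) \<le> V_val v N X Y \<mu> \<nu> c"
    unfolding V_val_def using K CouplingsD(1) by (intro INF_greatest) (fastforce simp: abs_le_iff)
  ultimately show thesis using that by (cases "V_val v N X Y \<mu> \<nu> c") auto
qed

lemma V_limit: "(\<lambda>n. V_val v N X Y (\<mu>s n) (\<nu>s n) c) \<longlonglongrightarrow> V_val v N X Y \<mu> \<nu> c"
proof -
  obtain r where r: "V_val v N X Y \<mu> \<nu> c = ereal r" by (rule V_finite)
  show ?thesis unfolding r
  proof (rule ereal_tendstoI)
    fix e :: real assume "e > 0"
    from near[OF this] show "eventually (\<lambda>n. V_val v N X Y (\<mu>s n) (\<nu>s n) c \<le> ereal r + ereal e \<and>
        ereal r \<le> V_val v N X Y (\<mu>s n) (\<nu>s n) c + ereal e) sequentially"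
    proof eventually_elim
      case (elim n)
      have "V_val v N X Y (\<mu>s n) (\<nu>s n) c \<le> V_val v N X Y \<mu> \<nu> c + ereal e"
        unfolding V_val_def using elim by (intro INF_le_INF_plus) (simp, blast)
      moreover have "V_val v N X Y \<mu> \<nu> c \<le> V_val v N X Y (\<mu>s n) (\<nu>s n) c + ereal e"
        unfolding V_val_def using elim by (intro INF_le_INF_plus) (simp, blast)
      ultimately show ?case unfolding r by blast
    qed
  qed
qed

lemma E_near:
  assumes \<epsilon>: "\<epsilon> > 0" and "e > 0"
  shows "eventually (\<lambda>n. E_val v \<epsilon> N X Y (\<mu>s n) (\<nu>s n) c \<le> E_val v \<epsilon> N X Y \<mu> \<nu> c + ereal e \<and>
    E_val v \<epsilon> N X Y \<mu> \<nu> c \<le> E_val v \<epsilon> N X Y (\<mu>s n) (\<nu>s n) c + ereal e) sequentially"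
  using near[OF assms(2)]
proof eventually_elim
  case (elim n)
  show ?case unfolding E_val_def
  proof (intro conjI INF_le_INF_plus)
    fix \<pi> assume "\<pi> \<in> Couplings v N X Y \<mu> \<nu>"
    then obtain \<pi>' where "\<pi>' \<in> Couplings v N X Y (\<mu>s n) (\<nu>s n)" "(\<integral>z. c z \<partial>\<pi>') \<le> (\<integral>z. c z \<partial>\<pi>) + e"
      "kl_div \<pi>' (\<mu>s n \<Otimes>\<^sub>M \<nu>s n) \<le> kl_div \<pi> (\<mu> \<Otimes>\<^sub>M \<nu>)" using elim by blast
    then show "\<exists>\<pi>'\<in>Couplings v N X Y (\<mu>s n) (\<nu>s n). E_cost \<epsilon> (\<mu>s n) (\<nu>s n) c \<pi>' \<le> E_cost \<epsilon> \<mu> \<nu> c \<pi> + ereal e"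
      using E_cost_le[OF \<epsilon>] by blast
  next
    fix \<pi> assume "\<pi> \<in> Couplings v N X Y (\<mu>s n) (\<nu>s n)"
    then obtain \<pi>' where "\<pi>' \<in> Couplings v N X Y \<mu> \<nu>" "(\<integral>z. c z \<partial>\<pi>') \<le> (\<integral>z. c z \<partial>\<pi>) + e"
      "kl_div \<pi>' (\<mu> \<Otimes>\<^sub>M \<nu>) \<le> kl_div \<pi> (\<mu>s n \<Otimes>\<^sub>M \<nu>s n)" using elim by blast
    then show "\<exists>\<pi>'\<in>Couplings v N X Y \<mu> \<nu>. E_cost \<epsilon> \<mu> \<nu> c \<pi>' \<le> E_cost \<epsilon> (\<mu>s n) (\<nu>s n) c \<pi> + ereal e"
      using E_cost_le[OF \<epsilon>] by blast
  qed
qed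

lemma entropic_limit: "\<epsilon> > 0 \<Longrightarrow> entropic N X Y dX dY p c \<epsilon> \<mu> \<nu>"
  by unfold_locales (use \<mu> \<nu> in auto)

lemma entropic_n: "\<epsilon> > 0 \<Longrightarrow> entropic N X Y dX dY p c \<epsilon> (\<mu>s n) (\<nu>s n)"
  by unfold_locales (use \<mu>s \<nu>s in auto)

lemma E_limit:
  assumes \<epsilon>: "\<epsilon> > 0"
  shows "(\<lambda>n. E_val v \<epsilon> N X Y (\<mu>s n) (\<nu>s n) c) \<longlonglongrightarrow> E_val v \<epsilon> N X Y \<mu> \<nu> c"
proof -
  obtain r where r: "E_val v \<epsilon> N X Y \<mu> \<nu> c = ereal r" by (rule entropic.E_min_finite[OF entropic_limit[OF \<epsilon>]])
  show ?thesis unfolding r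
    by (rule ereal_tendstoI) (rule E_near[OF \<epsilon>, of _ v, unfolded r])
qed

text \<open>Integrals along \<open>\<pi>s n\<close> may be replaced by integrals along glued
  partners with the fixed marginals, where the closedness results apply.\<close>

lemma vanishing_difference:
  assumes f: "transport N X Y dX dY p f"
    and \<Theta>s: "\<And>n. \<Theta>s n \<in> couplings PP PP (\<pi>s n) (\<rho>s n)" "\<And>n. distX (\<Theta>s n) = costX n" "\<And>n. distY (\<Theta>s n) = costY n"
    and \<rho>s: "\<And>n. \<rho>s n \<in> couplings PX PY \<mu> \<nu>"
  shows "(\<lambda>n. (\<integral>z. f z \<partial>\<pi>s n) - (\<integral>z. f z \<partial>\<rho>s n)) \<longlonglongrightarrow> 0"
proof (rule tendstoI)
  fix e :: real assume "e > 0"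
  then have e2: "e / 2 > 0" by simp
  obtain \<delta> where \<delta>: "\<delta> > 0"
    "\<And>\<Theta> \<pi> \<pi>'. \<Theta> \<in> couplings PP PP \<pi> \<pi>' \<Longrightarrow> \<pi> \<in> couplings PX PY \<mu> \<nu> \<or> \<pi>' \<in> couplings PX PY \<mu> \<nu> \<Longrightarrow>
      distX \<Theta> \<le> ennreal \<delta> \<Longrightarrow> distY \<Theta> \<le> ennreal \<delta> \<Longrightarrow> \<bar>(\<integral>z. f z \<partial>\<pi>) - (\<integral>z. f z \<partial>\<pi>')\<bar> \<le> e / 2"
    by (rule transport.cost_stable[OF f \<mu> \<nu> e2]) (rule that)
  from cost_small[OF \<delta>(1)] show "eventually (\<lambda>n. dist ((\<integral>z. f z \<partial>\<pi>s n) - (\<integral>z. f z \<partial>\<rho>s n)) 0 < e) sequentially"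
  proof eventually_elim
    case (elim n)
    have "\<bar>(\<integral>z. f z \<partial>\<pi>s n) - (\<integral>z. f z \<partial>\<rho>s n)\<bar> \<le> e / 2"
      by (rule \<delta>(2)[OF \<Theta>s(1)]) (use \<rho>s \<Theta>s(2,3) elim in auto)
    then show ?case using \<open>e > 0\<close> by (simp add: dist_real_def)
  qed
qed

end

context approximation
begin

text \<open>The marginals of the optimizers vary, so closedness of the admissible set does not apply
  to them. Their glued partners have marginals \<open>\<mu>\<close> and \<open>\<nu>\<close>, the
  same weak limit along the subsequence, and asymptotically the same cost.\<close>

lemma V_optimizer_limit:
  assumes opt: "\<And>n. V_optimizer v N X Y (\<mu>s n) (\<nu>s n) c (\<pi>s n)" and acc: "weak_accumulation_point PP \<pi>s \<pi>"
  shows "V_optimizer v N X Y \<mu> \<nu> c \<pi>"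
proof -
  obtain r where r: "strict_mono r" and weak: "weakly_converges PP (\<pi>s \<circ> r) \<pi>"
    using acc by (auto simp: weak_accumulation_point_def)
  have \<pi>p: "\<pi> \<in> probs PP" using weak by (simp add: weakly_converges_def)
  then have \<pi>: "prob_space \<pi>" "sets \<pi> = sets (BX \<Otimes>\<^sub>M BY)" using sets_PP by (auto simp: probs_def)
  have conv: "(\<lambda>k. \<integral>z. f z \<partial>\<pi>s (r k)) \<longlonglongrightarrow> (\<integral>z. f z \<partial>\<pi>)" if "f \<in> bcont PP" for f
  proof -
    have "continuous_map PP euclideanreal f" "bounded (f ` topspace PP)"
      using that by (auto simp: bcont_def bounded_iff)
    then show ?thesis using weak unfolding weakly_converges_def o_def by blast
  qed
  let ?Q = "\<lambda>n \<Theta> \<pi>'. \<Theta> \<in> couplings PP PP (\<pi>s n) \<pi>' \<and> \<pi>' \<in> Couplings v N X Y \<mu> \<nu> \<and> distX \<Theta> = costX n \<and> distY \<Theta> = costY n"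
  have "\<forall>n. \<exists>\<Theta> \<pi>'. ?Q n \<Theta> \<pi>'"
    using to_limit opt unfolding V_optimizer_def by blast
  then have "\<exists>\<Theta>s. \<forall>n. \<exists>\<pi>'. ?Q n (\<Theta>s n) \<pi>'" by (rule choice)
  then obtain \<Theta>s where "\<forall>n. \<exists>\<pi>'. ?Q n (\<Theta>s n) \<pi>'" by blast
  then have "\<exists>\<rho>s. \<forall>n. ?Q n (\<Theta>s n) (\<rho>s n)" by (rule choice)
  then obtain \<rho>s where \<Theta>s: "\<And>n. \<Theta>s n \<in> couplings PP PP (\<pi>s n) (\<rho>s n)" "\<And>n. distX (\<Theta>s n) = costX n" "\<And>n. distY (\<Theta>s n) = costY n"
    and \<rho>s: "\<And>n. \<rho>s n \<in> Couplings v N X Y \<mu> \<nu>" by blast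
  note cp = CouplingsD(1)[OF \<rho>s]
  have conv': "(\<lambda>k. \<integral>z. f z \<partial>\<rho>s (r k)) \<longlonglongrightarrow> (\<integral>z. f z \<partial>\<pi>)" if "f \<in> bcont PP" for f
  proof -
    have "(\<lambda>n. (\<integral>z. f z \<partial>\<pi>s n) - (\<integral>z. f z \<partial>\<rho>s n)) \<longlonglongrightarrow> 0"
      by (rule vanishing_difference[OF transport_bcont[OF that] \<Theta>s cp])
    from tendsto_diff[OF conv[OF that] LIMSEQ_subseq_LIMSEQ[OF this r]] show ?thesis by (simp add: o_def)
  qed
  note F = couplings_facts[OF cp]
  have fs: "fst \<in> \<pi> \<rightarrow>\<^sub>M BX" "snd \<in> \<pi> \<rightarrow>\<^sub>M BY" by (simp_all add: measurable_cong_sets[OF \<pi>(2) refl])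
  interpret \<pi>: prob_space \<pi> by (rule \<pi>(1))
  have pX: "\<mu> \<in> probs PX" and pY: "\<nu> \<in> probs PY" using \<mu> \<nu> by (auto simp: probs_p_def)
  have "distr \<pi> BX fst = \<mu>"
  proof (rule probs_eqI[OF S.polish _ pX])
    show "distr \<pi> BX fst \<in> probs PX" using \<pi>.prob_space_distr[OF fs(1)] by (simp add: probs_def)
    fix f assume f: "f \<in> bcont PX"
    have fm: "f \<in> borel_measurable BX" by (rule bmeas_measurable[OF bcont_bmeas[OF f]])
    have "(\<integral>z. f (fst z) \<partial>\<rho>s n) = (\<integral>x. f x \<partial>\<mu>)" for n
      using integral_distr[OF F(3) fm, of n] F(5)[of n] by simp
    then have "(\<lambda>k. \<integral>x. f x \<partial>\<mu>) \<longlonglongrightarrow> (\<integral>z. f (fst z) \<partial>\<pi>)"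
      using conv'[OF bcont_compose[OF f continuous_map_fst]] by simp
    then show "(\<integral>x. f x \<partial>distr \<pi> BX fst) = (\<integral>x. f x \<partial>\<mu>)"
      by (simp add: integral_distr[OF fs(1) fm] LIMSEQ_const_iff)
  qed
  moreover have "distr \<pi> BY snd = \<nu>"
  proof (rule probs_eqI[OF T.polish _ pY])
    show "distr \<pi> BY snd \<in> probs PY" using \<pi>.prob_space_distr[OF fs(2)] by (simp add: probs_def)
    fix f assume f: "f \<in> bcont PY"
    have fm: "f \<in> borel_measurable BY" by (rule bmeas_measurable[OF bcont_bmeas[OF f]])
    have "(\<integral>z. f (snd z) \<partial>\<rho>s n) = (\<integral>x. f x \<partial>\<nu>)" for n
      using integral_distr[OF F(4) fm, of n] F(6)[of n] by simp
    then have "(\<lambda>k. \<integral>x. f x \<partial>\<nu>) \<longlonglongrightarrow> (\<integral>z. f (snd z) \<partial>\<pi>)"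
      using conv'[OF bcont_compose[OF f continuous_map_snd]] by simp
    then show "(\<integral>x. f x \<partial>distr \<pi> BY snd) = (\<integral>x. f x \<partial>\<nu>)"
      by (simp add: integral_distr[OF fs(2) fm] LIMSEQ_const_iff)
  qed
  ultimately have \<pi>c: "\<pi> \<in> couplings PX PY \<mu> \<nu>" using \<pi>p by (simp add: couplings_def)
  have adm: "\<pi> \<in> Couplings v N X Y \<mu> \<nu>"
  proof (rule Couplings_limitI[OF X Y, where \<pi>s="\<lambda>k. \<rho>s (r k)"])
    fix a b assume ab: "a \<in> bmeas BX" "b \<in> bmeas BY"
    show "(\<lambda>k. \<integral>z. a (fst z) * b (snd z) \<partial>\<rho>s (r k)) \<longlonglongrightarrow> (\<integral>z. a (fst z) * b (snd z) \<partial>\<pi>)"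
      by (rule couplings_product_convergence[where \<pi>s="\<lambda>k. \<rho>s (r k)", OF S.polish T.polish cp \<pi>c conv' ab])
  qed (use \<rho>s \<pi> in auto)
  obtain q where q: "V_val v N X Y \<mu> \<nu> c = ereal q" by (rule V_finite)
  have "(\<lambda>n. ereal (\<integral>z. c z \<partial>\<pi>s n)) \<longlonglongrightarrow> ereal q"
    using V_limit[of v] opt unfolding q V_optimizer_def by simp
  then have cq: "(\<lambda>n. \<integral>z. c z \<partial>\<pi>s n) \<longlonglongrightarrow> q" by simp
  have "(\<lambda>n. (\<integral>z. c z \<partial>\<pi>s n) - (\<integral>z. c z \<partial>\<rho>s n)) \<longlonglongrightarrow> 0"
    by (rule vanishing_difference[OF transport_axioms \<Theta>s cp])
  from tendsto_diff[OF cq this] have "(\<lambda>n. \<integral>z. c z \<partial>\<rho>s n) \<longlonglongrightarrow> q" by simp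
  from LIMSEQ_subseq_LIMSEQ[OF this r] have cq': "(\<lambda>k. \<integral>z. c z \<partial>\<rho>s (r k)) \<longlonglongrightarrow> q" by (simp add: o_def)
  \<comment> \<open>The cost may be unbounded, so it is replaced by its truncation, with error
    \<open>e / 2\<close> along the sequence and again at the limit.\<close>
  have "\<bar>q - (\<integral>z. c z \<partial>\<pi>)\<bar> \<le> 0"
  proof (rule field_le_epsilon)
    fix e :: real assume "e > 0"
    then have e2: "e / 2 > 0" by simp
    obtain f where f: "f \<in> bcont PP"
      "\<And>\<pi>. \<pi> \<in> couplings PX PY \<mu> \<nu> \<Longrightarrow> \<bar>(\<integral>z. c z \<partial>\<pi>) - (\<integral>z. f z \<partial>\<pi>)\<bar> \<le> e / 2"
      by (rule truncated_cost[OF \<mu> \<nu> e2]) (rule that)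
    have "(\<lambda>k. \<bar>(\<integral>z. c z \<partial>\<rho>s (r k)) - (\<integral>z. f z \<partial>\<rho>s (r k))\<bar>) \<longlonglongrightarrow> \<bar>q - (\<integral>z. f z \<partial>\<pi>)\<bar>"
      by (intro tendsto_intros cq' conv'[OF f(1)])
    then have "\<bar>q - (\<integral>z. f z \<partial>\<pi>)\<bar> \<le> e / 2"
      by (rule LIMSEQ_le_const2) (use f(2)[OF cp] in blast)
    then show "\<bar>q - (\<integral>z. c z \<partial>\<pi>)\<bar> \<le> 0 + e" using f(2)[OF \<pi>c] by linarith
  qed
  then have "(\<integral>z. c z \<partial>\<pi>) = q" by simp
  then show ?thesis using adm q by (simp add: V_optimizer_def)
qed

text \<open>Glued to the fixed marginals, an optimizer becomes a near-minimizer of the limit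
  problem, for gluing does not raise the entropy and hardly changes the cost. Its density is then
  close in L1 to the minimizing one, and \<open>W_prod_stable\<close> converts this into the
  distance.\<close>

lemma E_optimizer_limit:
  assumes \<epsilon>: "\<epsilon> > 0" and opts: "\<And>n. E_optimizer v \<epsilon> N X Y (\<mu>s n) (\<nu>s n) c (\<pi>s n)"
    and opt: "E_optimizer v \<epsilon> N X Y \<mu> \<nu> c \<pi>"
  shows "(\<lambda>n. W_prod p PX dX PY dY (\<pi>s n) \<pi>) \<longlonglongrightarrow> 0"
proof -
  interpret L: entropic N X Y dX dY p c v \<epsilon> \<mu> \<nu> by (rule entropic_limit[OF \<epsilon>])
  obtain \<rho> where \<rho>: "\<rho> \<in> L.dens" "\<pi> = L.law \<rho>" "ereal (L.F \<rho>) = L.E_min"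
    by (rule L.optimizer_dens[OF opt])
  have le: "eventually (\<lambda>n. W_prod p PX dX PY dY (\<pi>s n) \<pi> \<le> ennreal e) sequentially" if e: "e > 0" for e
  proof -
    obtain \<delta> \<kappa> where \<delta>: "\<delta> > 0" and \<kappa>: "\<kappa> > 0"
      and W: "\<And>\<Theta> \<pi> \<rho>'. \<rho>' \<in> L.dens \<Longrightarrow> \<Theta> \<in> couplings PP PP \<pi> (L.law \<rho>') \<Longrightarrow>
      distX \<Theta> \<le> ennreal \<delta> \<Longrightarrow> distY \<Theta> \<le> ennreal \<delta> \<Longrightarrow> (\<integral>z. \<bar>\<rho>' z - \<rho> z\<bar> \<partial>L.m) \<le> \<kappa> \<Longrightarrow>
      W_prod p PX dX PY dY \<pi> (L.law \<rho>) \<le> ennreal e"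
      by (rule L.W_prod_stable[OF \<rho>(1) e]) (rule that)
    have r: "L.E_min = ereal (L.F \<rho>)" using \<rho>(3) by simp
    obtain \<tau> where \<tau>: "\<tau> > 0"
      "\<And>\<rho>1 \<rho>2. \<rho>1 \<in> L.dens \<Longrightarrow> \<rho>2 \<in> L.dens \<Longrightarrow> L.F \<rho>1 \<le> L.F \<rho> + \<tau> \<Longrightarrow> L.F \<rho>2 \<le> L.F \<rho> + \<tau> \<Longrightarrow> (\<integral>z. \<bar>\<rho>1 z - \<rho>2 z\<bar> \<partial>L.m) \<le> \<kappa>"
      by (rule L.near_minimizers[OF r \<kappa>]) (rule that)
    \<comment> \<open>Half of \<open>\<tau>\<close> pays for the change of cost under gluing, the
      other half for the difference of the two optimal values.\<close>
    have \<tau>2: "\<tau> / 2 > 0" using \<tau> by simp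
    obtain \<delta>2 where \<delta>2: "\<delta>2 > 0"
      "\<And>\<Theta> \<pi> \<pi>'. \<Theta> \<in> couplings PP PP \<pi> \<pi>' \<Longrightarrow> \<pi> \<in> couplings PX PY \<mu> \<nu> \<or> \<pi>' \<in> couplings PX PY \<mu> \<nu> \<Longrightarrow>
        distX \<Theta> \<le> ennreal \<delta>2 \<Longrightarrow> distY \<Theta> \<le> ennreal \<delta>2 \<Longrightarrow> \<bar>(\<integral>z. c z \<partial>\<pi>) - (\<integral>z. c z \<partial>\<pi>')\<bar> \<le> \<tau> / 2"
      by (rule cost_stable[OF \<mu> \<nu> \<tau>2]) (rule that)
    from cost_small[OF \<delta>] cost_small[OF \<delta>2(1)] E_near[OF \<epsilon> \<tau>2, of v]
    show ?thesis
    proof eventually_elim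
      case (elim n)
      have \<pi>n: "\<pi>s n \<in> Couplings v N X Y (\<mu>s n) (\<nu>s n)" "E_cost \<epsilon> (\<mu>s n) (\<nu>s n) c (\<pi>s n) = E_val v \<epsilon> N X Y (\<mu>s n) (\<nu>s n) c"
        using opts[of n] by (auto simp: E_optimizer_def)
      obtain \<Theta> \<pi>' where t: "\<Theta> \<in> couplings PP PP (\<pi>s n) \<pi>'" "\<pi>' \<in> L.adm"
        "distX \<Theta> = costX n" "distY \<Theta> = costY n" "kl_div \<pi>' L.m \<le> kl_div (\<pi>s n) (\<mu>s n \<Otimes>\<^sub>M \<nu>s n)"
        using to_limit[OF \<pi>n(1)] by blast
      have "\<bar>(\<integral>z. c z \<partial>\<pi>s n) - (\<integral>z. c z \<partial>\<pi>')\<bar> \<le> \<tau> / 2"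
        by (rule \<delta>2(2)[OF t(1)]) (use CouplingsD(1)[OF t(2)] t(3,4) elim in auto)
      then have "(\<integral>z. c z \<partial>\<pi>') \<le> (\<integral>z. c z \<partial>\<pi>s n) + \<tau> / 2" by linarith
      from E_cost_le[OF \<epsilon> this t(5)]
      have "E_cost \<epsilon> \<mu> \<nu> c \<pi>' \<le> E_val v \<epsilon> N X Y (\<mu>s n) (\<nu>s n) c + ereal (\<tau> / 2)" by (simp only: \<pi>n(2))
      also have "\<dots> \<le> (L.E_min + ereal (\<tau> / 2)) + ereal (\<tau> / 2)" using elim by (intro add_right_mono) blast
      also have "\<dots> = ereal (L.F \<rho> + \<tau>)" unfolding r by simp
      finally have E: "E_cost \<epsilon> \<mu> \<nu> c \<pi>' \<le> ereal (L.F \<rho> + \<tau>)" .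
      then have "E_cost \<epsilon> \<mu> \<nu> c \<pi>' \<noteq> \<infinity>" by auto
      then obtain \<rho>' where \<rho>': "\<rho>' \<in> L.dens" "\<pi>' = L.law \<rho>'" by (rule L.dens_of_finite_cost[OF t(2)])
      have "L.F \<rho>' \<le> L.F \<rho> + \<tau>" using E unfolding \<rho>'(2) L.E_cost_density[OF \<rho>'(1)] by simp
      then have close: "(\<integral>z. \<bar>\<rho>' z - \<rho> z\<bar> \<partial>L.m) \<le> \<kappa>" using \<tau> by (intro \<tau>(2) \<rho>'(1) \<rho>(1)) auto
      show ?case unfolding \<rho>(2)
        by (rule W[OF \<rho>'(1) t(1)[unfolded \<rho>'(2)] _ _ close]) (use t(3,4) elim in auto)
    qed
  qed
  show ?thesis
  proof (rule order_tendstoI)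
    fix e :: ennreal assume "0 < e"
    then obtain \<delta> where \<delta>: "0 < ennreal \<delta>" "ennreal \<delta> < e"
      by (metis dense ennreal_cases ennreal_less_top less_imp_neq less_trans)
    then have "\<delta> > 0" by simp
    from le[OF this] show "eventually (\<lambda>n. W_prod p PX dX PY dY (\<pi>s n) \<pi> < e) sequentially"
      by eventually_elim (use \<delta>(2) in \<open>auto intro: le_less_trans\<close>)
  qed simp
qed

end

theorem theorem3p6:
  fixes N :: nat
    and X :: "nat \<Rightarrow> 'a topology" and Y :: "nat \<Rightarrow> 'b topology"
    and dX :: "(nat \<Rightarrow> 'a) \<Rightarrow> (nat \<Rightarrow> 'a) \<Rightarrow> real"
    and dY :: "(nat \<Rightarrow> 'b) \<Rightarrow> (nat \<Rightarrow> 'b) \<Rightarrow> real"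
    and v :: version and \<epsilon> p :: real
    and c :: "(nat \<Rightarrow> 'a) \<times> (nat \<Rightarrow> 'b) \<Rightarrow> real"
    and \<mu>s :: "nat \<Rightarrow> (nat \<Rightarrow> 'a) measure" and \<mu> :: "(nat \<Rightarrow> 'a) measure"
    and \<nu>s :: "nat \<Rightarrow> (nat \<Rightarrow> 'b) measure" and \<nu> :: "(nat \<Rightarrow> 'b) measure"
  assumes "N \<ge> 1"
    and "\<And>t. t \<in> {1..N} \<Longrightarrow> polish_top (X t)"
    and "\<And>t. t \<in> {1..N} \<Longrightarrow> polish_top (Y t)"
    and "metric_inducing (paths N X) dX"
    and "metric_inducing (paths N Y) dY"
    and "\<epsilon> > 0"
    and "p \<ge> 1"
    and "continuous_map (prod_topology (paths N X) (paths N Y)) euclideanreal c"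
    and "growth_at_most p (paths N X) dX (paths N Y) dY c"
    and "\<And>n. \<mu>s n \<in> probs_p p (paths N X) dX"
    and "\<And>n. \<nu>s n \<in> probs_p p (paths N Y) dY"
    and "\<mu> \<in> probs_p p (paths N X) dX"
    and "\<nu> \<in> probs_p p (paths N Y) dY"
    and "(\<lambda>n. W_bc p N X dX (\<mu>s n) \<mu>) \<longlonglongrightarrow> 0"
    and "(\<lambda>n. W_bc p N Y dY (\<nu>s n) \<nu>) \<longlonglongrightarrow> 0"
  shows "((\<lambda>n. V_val v N X Y (\<mu>s n) (\<nu>s n) c) \<longlonglongrightarrow> V_val v N X Y \<mu> \<nu> c)
    \<and> (\<forall>\<pi>s \<pi>. (\<forall>n. V_optimizer v N X Y (\<mu>s n) (\<nu>s n) c (\<pi>s n)) \<and>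
          weak_accumulation_point (prod_topology (paths N X) (paths N Y)) \<pi>s \<pi>
          \<longrightarrow> V_optimizer v N X Y \<mu> \<nu> c \<pi>)
    \<and> ((\<lambda>n. E_val v \<epsilon> N X Y (\<mu>s n) (\<nu>s n) c) \<longlonglongrightarrow> E_val v \<epsilon> N X Y \<mu> \<nu> c)
    \<and> (\<forall>n. \<exists>!\<pi>. E_optimizer v \<epsilon> N X Y (\<mu>s n) (\<nu>s n) c \<pi>)
    \<and> (\<exists>!\<pi>. E_optimizer v \<epsilon> N X Y \<mu> \<nu> c \<pi>)
    \<and> (\<forall>\<pi>s \<pi>. (\<forall>n. E_optimizer v \<epsilon> N X Y (\<mu>s n) (\<nu>s n) c (\<pi>s n)) \<and>
          E_optimizer v \<epsilon> N X Y \<mu> \<nu> c \<pi>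
          \<longrightarrow> (\<lambda>n. W_prod p (paths N X) dX (paths N Y) dY (\<pi>s n) \<pi>) \<longlonglongrightarrow> 0)"
proof -
  have X: "polish (X t)" and Y: "polish (Y t)" if "t \<in> {1..N}" for t
    using assms(2,3)[OF that] by (auto intro: polish_top_imp_polish)
  have pX: "polish (paths N X)" and pY: "polish (paths N Y)" using X Y by (auto intro!: polish_paths)
  have probs: "\<mu>s n \<in> probs (paths N X)" "\<nu>s n \<in> probs (paths N Y)" "\<mu> \<in> probs (paths N X)" "\<nu> \<in> probs (paths N Y)" for n
    using assms(10-13) by (auto simp: probs_p_def)
  \<comment> \<open>The choice involves neither the version nor the cost, so one pair of sequences
    serves both problems.\<close>
  obtain \<gamma>s where \<gamma>s: "\<And>n. \<gamma>s n \<in> Couplings Bicausal N X X (\<mu>s n) \<mu>"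
    "(\<lambda>n. \<integral>\<^sup>+z. ennreal (dX (fst z) (snd z) powr p) \<partial>\<gamma>s n) \<longlonglongrightarrow> 0"
    by (rule bicausal_approximation[OF X assms(7) probs(1,3) assms(14)]) (assumption, rule that)
  obtain \<eta>s where \<eta>s: "\<And>n. \<eta>s n \<in> Couplings Bicausal N Y Y (\<nu>s n) \<nu>"
    "(\<lambda>n. \<integral>\<^sup>+z. ennreal (dY (fst z) (snd z) powr p) \<partial>\<eta>s n) \<longlonglongrightarrow> 0"
    by (rule bicausal_approximation[OF Y assms(7) probs(2,4) assms(15)]) (assumption, rule that)
  interpret approximation N X Y dX dY p c \<mu>s \<mu> \<nu>s \<nu> \<gamma>s \<eta>s
    by unfold_locales (use assms X Y pX pY \<gamma>s \<eta>s in auto)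
  show ?thesis
    using V_limit V_optimizer_limit E_limit[OF assms(6)] E_optimizer_limit[OF assms(6)]
      entropic.optimizer_unique_exists[OF entropic_limit[OF assms(6)]]
      entropic.optimizer_unique_exists[OF entropic_n[OF assms(6)]]
    by blast
qed

end
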